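(* Assume that the stabilisation parameter satisfies $\varepsilon>0$. Then there exists at least one sequence $(\underline\ell_{\mathcal D}^n)_{n\ge1}$ in $\underline V_{\mathcal D}^k$ which solves the nonlinear scheme, i.e. such that, for all $n\in\mathbb N$ (including $n=0$), $$\sum_{K\in\mathcal M}\int_K\frac{\mathfrak u_K^{n+1}-\mathfrak u_K^n}{\Delta t}\,v_K+\mathcal T_{\mathcal D}(\underline\ell_{\mathcal D}^{n+1};\underline\ell_{\mathcal D}^{n+1}+\underline\phi_{\mathcal D},\underline v_{\mathcal D})=0\qquad\forall\,\underline v_{\mathcal D}\in\underline V_{\mathcal D}^k,$$ where $\mathfrak u_K^{n+1}=e^{\ell_K^{n+1}}$ and $\mathfrak u_K^0=u^0_{|K}$ for all $K\in\mathcal M$. The corresponding discrete densities $(\underline{\mathfrak u}^n_{\mathcal D})_{n\ge1}$, defined by $\mathfrak u_K^n=e^{\ell_K^n}$ for all $K\in\mathcal M$ and $\mathfrak u_\sigma^n=e^{\ell_\sigma^n}$ for all $\sigma\in\mathcal E$, are positive.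
   Context: **Data.** $\Omega\subset\mathbb R^d$, $d\in\{2,3\}$, is an open, bounded, connected polytopal set with Lipschitz boundary. $\Lambda\in L^\infty(\Omega)^{d\times d}$ is uniformly elliptic: there is $\lambda_\flat>0$ with $\Lambda(x)\xi\cdot\xi\ge\lambda_\flat|\xi|^2$ for a.e. $x\in\Omega$ and all $\xi\in\mathbb R^d$. $\phi\in W^{1,\infty}(\Omega)$. $u^0\in L^1(\Omega)$ is non-negative with $\int_\Omega u^0\log(u^0)<\infty$ and $M=\int_\Omega u^0>0$. $\Delta t>0$ is the time step, $k\ge 0$ is an integer. **Mesh.** A discretisation is a couple $\mathcal D=(\mathcal M,\mathcal E)$. $\mathcal M$ is a finite collection of disjoint, open, Lipschitz polytopes $K\subset\Omega$ (cells) of positive measure with $\overline\Omega=\bigcup_{K\in\mathcal M}\overline K$. $\mathcal E$ is a finite collection of disjoint, connected, relatively open subsets $\sigma$ of $\overline\Omega$ (faces), with positive $(d-1)$-dimensional measure, each a Lipschitz polytopal subset of an affine hyperplane, with $\partial\mathcal M:=\bigcup_{K\in\mathcal M}\partial K=\bigcup_{\sigma\in\mathcal E}\overline\sigma$; for each $K$ there is $\mathcal E_K\subset\mathcal E$ with $\partial K=\bigcup_{\sigma\in\mathcal E_K}\overline\sigma$. $n_{K,\sigma}$ is the unit normal to $\sigma\in\mathcal E_K$ pointing out of $K$; $h_X$ is the diameter of $X$. It is assumed that $\Lambda_{|K}\in W^{1,\infty}(K)^{d\times d}$ for all $K\in\mathcal M$. **Discrete space and operators.** $\mathbb P^q(X)$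 denotes polynomial functions on $X$ of total degree at most $q$, and $\Pi_X^q$ the $L^2(X)$-orthogonal projector onto it. $\underline V_{\mathcal D}^k$ is the space of $\underline v_{\mathcal D}=((v_K)_{K\in\mathcal M},(v_\sigma)_{\sigma\in\mathcal E})$ with $v_K\in\mathbb P^{k+1}(K)$ and $v_\sigma\in\mathbb P^k(\sigma)$; the restriction of $\underline v_{\mathcal D}$ to $K$ is $\underline v_K=(v_K,(v_\sigma)_{\sigma\in\mathcal E_K})$. The discrete potential is $\underline\phi_{\mathcal D}=\big((\Pi_K^{k+1}(\phi_{|K}))_{K\in\mathcal M},(\Pi_\sigma^k(\phi_{|\sigma}))_{\sigma\in\mathcal E}\big)\in\underline V^k_{\mathcal D}$. The discrete gradient $G_K(\underline v_K)\in\mathbb P^k(K)^d$ is defined by $$\int_K G_K(\underline v_K)\cdot\tau=-\int_K v_K\,\nabla\cdot\tau+\sum_{\sigma\in\mathcal E_K}\int_\sigma v_\sigma\,\tau\cdot n_{K,\sigma}\qquad\forall\tau\in\mathbb P^k(K)^d,$$ and the jump by $J_{K,\sigma}(\underline v_K)=\Pi_\sigma^k(v_{K|\sigma})-v_\sigma$. Let $\Lambda_{K,\sigma}=\|\Lambda_{|K}n_{K,\sigma}\cdot n_{K,\sigma}\|_{L^\infty(\sigma)}$ and $$a_K(\underline z_K,\underline v_K)=\int_K\Lambda G_K(\underline z_K)\cdot G_K(\underline v_K)+\sum_{\sigma\in\mathcal E_K}\frac{\Lambda_{K,\sigma}}{h_\sigma}\int_\sigma J_{K,\sigma}(\underline z_K)J_{K,\sigma}(\underline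 v_K).$$ **The map $\mathcal T_{\mathcal D}$.** For a parameter $\varepsilon\ge0$ and $\underline\ell_{\mathcal D},\underline w_{\mathcal D},\underline v_{\mathcal D}\in\underline V_{\mathcal D}^k$, $\mathcal T_{\mathcal D}(\underline\ell_{\mathcal D};\underline w_{\mathcal D},\underline v_{\mathcal D})$ is the sum over $K\in\mathcal M$ of $$\int_K e^{\ell_K}\Lambda G_K(\underline w_K)\cdot G_K(\underline v_K)+\sum_{\sigma\in\mathcal E_K}\frac{\Lambda_{K,\sigma}}{h_\sigma}\int_\sigma\frac{e^{\Pi_\sigma^k(\ell_{K|\sigma})}+e^{\ell_\sigma}}{2}J_{K,\sigma}(\underline w_K)J_{K,\sigma}(\underline v_K)+\varepsilon\,h_K^{k+2}a_K(\underline w_K,\underline v_K).$$ *)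

theory Defs
  imports "HOL-Analysis.Analysis"
begin

section \<open>Polytopal and Lipschitz sets\<close>

text \<open>
  All topological notions are relative to an affine set \<open>H\<close>: cells and the domain use \<open>H = UNIV\<close>,
  faces use the hyperplane containing them.
\<close>

definition polytopal_in :: "'a::euclidean_space set \<Rightarrow> 'a set \<Rightarrow> bool" where
  "polytopal_in H S \<longleftrightarrow>
     (\<exists>F. finite F \<and> (\<forall>P\<in>F. polytope P \<and> P \<subseteq> H) \<and> S = top_of_set H interior_of (\<Union>F))"

text \<open>
  Near each relative boundary point, \<open>S\<close> is the strict epigraph, in some unit direction \<open>e\<close> of \<open>H\<close>,
  of a Lipschitz function \<open>g\<close> of the component orthogonal to \<open>e\<close>.
\<close>

definition lipschitz_boundary_in :: "'a::euclidean_space set \<Rightarrow> 'a set \<Rightarrow> bool" where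
  "lipschitz_boundary_in H S \<longleftrightarrow>
     (\<forall>x \<in> top_of_set H frontier_of S.
        \<exists>e g L r. norm e = 1 \<and> x + e \<in> H \<and> L-lipschitz_on (UNIV :: 'a set) g \<and> (0::real) < r \<and>
          (\<forall>y \<in> H \<inter> ball x r. y \<in> S \<longleftrightarrow> g (y - (y \<bullet> e) *\<^sub>R e) < y \<bullet> e))"


section \<open>Lower-dimensional Lebesgue measure\<close>

text \<open>
  Lebesgue measure on an affine set \<open>H\<close>: the image of the product Lebesgue measure under the
  isometric parametrisation given by a point of \<open>H\<close> and an orthonormal basis of the direction
  of \<open>H\<close>. The measure does not depend on these choices, by rotation and translation invariance.
\<close>

definition direction_basis :: "'a::euclidean_space set \<Rightarrow> 'a set" where
  "direction_basis H =
     (SOME B. pairwise orthogonal B \<and> (\<forall>b\<in>B. norm b = 1) \<and> span B = {x - y |x y. x \<in> H \<and> y \<in> H})"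

definition affine_lborel :: "'a::euclidean_space set \<Rightarrow> 'a measure" where
  "affine_lborel H =
     distr (\<Pi>\<^sub>M b\<in>direction_basis H. (lborel :: real measure)) borel
       (\<lambda>c. (SOME p. p \<in> H) + (\<Sum>b\<in>direction_basis H. c b *\<^sub>R b))"

definition face_measure :: "'a::euclidean_space set \<Rightarrow> 'a measure" where
  "face_measure \<sigma> = affine_lborel (affine hull \<sigma>)"


section \<open>Sobolev functions and traces\<close>

definition L_infty :: "'a::euclidean_space set \<Rightarrow> ('a \<Rightarrow> 'b::euclidean_space) \<Rightarrow> bool" where
  "L_infty U f \<longleftrightarrow>
     set_borel_measurable lebesgue U f \<and> (\<exists>C. AE x in lebesgue. x \<in> U \<longrightarrow> norm (f x) \<le> C)"

definition Linf_norm :: "'a measure \<Rightarrow> 'a set \<Rightarrow> ('a \<Rightarrow> real) \<Rightarrow> real" where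
  "Linf_norm \<mu> X f = Inf {C. 0 \<le> C \<and> (AE x in \<mu>. x \<in> X \<longrightarrow> \<bar>f x\<bar> \<le> C)}"

text \<open>
  First-order weak derivatives are tested against compactly supported functions of class
  \<open>C\<^sup>1\<close>, as in Gilbarg and Trudinger; \<open>d\<close> is the gradient of the test function.
\<close>

definition C1_test :: "'a::euclidean_space set \<Rightarrow> ('a \<Rightarrow> real) \<Rightarrow> ('a \<Rightarrow> 'a) \<Rightarrow> bool" where
  "C1_test U \<psi> d \<longleftrightarrow>
     continuous_on UNIV d \<and> (\<forall>x. (\<psi> has_derivative (\<lambda>h. d x \<bullet> h)) (at x)) \<and>
     (\<exists>C. compact C \<and> C \<subseteq> U \<and> (\<forall>x. x \<notin> C \<longrightarrow> \<psi> x = 0))"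

definition weak_gradient ::
  "'a::euclidean_space set \<Rightarrow> ('a \<Rightarrow> real) \<Rightarrow> ('a \<Rightarrow> 'a) \<Rightarrow> bool" where
  "weak_gradient U f g \<longleftrightarrow>
     (\<forall>\<psi> d. C1_test U \<psi> d \<longrightarrow>
        (LINT x:U|lebesgue. f x *\<^sub>R d x) = - (LINT x:U|lebesgue. \<psi> x *\<^sub>R g x))"

definition W1_infty :: "'a::euclidean_space set \<Rightarrow> ('a \<Rightarrow> real) \<Rightarrow> bool" where
  "W1_infty U f \<longleftrightarrow> L_infty U f \<and> (\<exists>g. L_infty U g \<and> weak_gradient U f g)"

text \<open>
  On a bounded Lipschitz set, a \<open>W\<^sup>1\<^sup>,\<^sup>\<infinity>\<close> function has a representative continuous up to the
  boundary, unique on the closure. Its values are the traces on the faces.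
\<close>

definition boundary_trace ::
  "'a::euclidean_space set \<Rightarrow> ('a \<Rightarrow> 'b::real_normed_vector) \<Rightarrow> 'a \<Rightarrow> 'b" where
  "boundary_trace U f =
     (SOME g. continuous_on (closure U) g \<and> (AE x in lebesgue. x \<in> U \<longrightarrow> g x = f x))"


section \<open>Meshes\<close>

text \<open>
  Faces are relatively open in the hyperplane that contains them. \<open>EK K\<close> is the set of faces of
  the cell \<open>K\<close>.
\<close>

definition discretisation ::
  "(real^'n) set \<Rightarrow> (real^'n) set set \<Rightarrow> (real^'n) set set \<Rightarrow>
   ((real^'n) set \<Rightarrow> (real^'n) set set) \<Rightarrow> bool" where
  "discretisation \<Omega> M E EK \<longleftrightarrow>
     finite M \<and> pairwise disjnt M \<and>
     (\<forall>K\<in>M. open K \<and> K \<subseteq> \<Omega> \<and> polytopal_in UNIV K \<and> lipschitz_boundary_in UNIV K \<and>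
        0 < emeasure lebesgue K) \<and>
     closure \<Omega> = (\<Union>K\<in>M. closure K) \<and>
     finite E \<and> pairwise disjnt E \<and>
     (\<forall>\<sigma>\<in>E. connected \<sigma> \<and> \<sigma> \<subseteq> closure \<Omega> \<and> 0 < emeasure (face_measure \<sigma>) \<sigma> \<and>
        (\<exists>a b. a \<noteq> 0 \<and>
          (let H = {x. a \<bullet> x = b} in
             \<sigma> \<subseteq> H \<and> openin (top_of_set H) \<sigma> \<and> polytopal_in H \<sigma> \<and> lipschitz_boundary_in H \<sigma>))) \<and>
     (\<Union>K\<in>M. frontier K) = (\<Union>\<sigma>\<in>E. closure \<sigma>) \<and>
     (\<forall>K\<in>M. EK K \<subseteq> E \<and> frontier K = (\<Union>\<sigma>\<in>EK K. closure \<sigma>))"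

definition outer_normal :: "'a::euclidean_space set \<Rightarrow> 'a set \<Rightarrow> 'a" where
  "outer_normal K \<sigma> =
     (THE n. norm n = 1 \<and> (\<forall>x\<in>\<sigma>. \<forall>y\<in>\<sigma>. n \<bullet> (x - y) = 0) \<and>
        (\<forall>x\<in>\<sigma>. \<forall>\<^sub>F t in at_right (0::real). x - t *\<^sub>R n \<in> K \<and> x + t *\<^sub>R n \<notin> K))"


section \<open>Polynomials and projectors\<close>

text \<open>
  Elements of \<open>\<P>\<^sup>q(X)\<close> are represented by polynomial functions on the whole space, of which only
  the values on \<open>X\<close> matter. For a cell the representative is unique, and it also provides
  the trace on the boundary. For a face it is not unique, but all integrals below depend
  only on the values on the face.
\<close>

definition poly_fun :: "nat \<Rightarrow> (real^'n \<Rightarrow> real) set" where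
  "poly_fun q =
     {p. \<exists>c. \<forall>x. p x = (\<Sum>\<alpha> | (\<Sum>i\<in>UNIV. \<alpha> i) \<le> q. c \<alpha> * (\<Prod>i\<in>UNIV. (x $ i) ^ \<alpha> i))}"

definition poly_vec :: "nat \<Rightarrow> (real^'n \<Rightarrow> real^'n) set" where
  "poly_vec q = {\<tau>. \<forall>i. (\<lambda>x. \<tau> x $ i) \<in> poly_fun q}"

definition L2_proj ::
  "(real^'n) measure \<Rightarrow> nat \<Rightarrow> (real^'n) set \<Rightarrow> (real^'n \<Rightarrow> real) \<Rightarrow> real^'n \<Rightarrow> real" where
  "L2_proj \<mu> q X f =
     (SOME p. p \<in> poly_fun q \<and>
        (\<forall>r\<in>poly_fun q. (LINT x:X|\<mu>. p x * r x) = (LINT x:X|\<mu>. f x * r x)))"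

abbreviation cell_proj ::
  "nat \<Rightarrow> (real^'n) set \<Rightarrow> (real^'n \<Rightarrow> real) \<Rightarrow> real^'n \<Rightarrow> real" where
  "cell_proj q K \<equiv> L2_proj lebesgue q K"

abbreviation face_proj ::
  "nat \<Rightarrow> (real^'n) set \<Rightarrow> (real^'n \<Rightarrow> real) \<Rightarrow> real^'n \<Rightarrow> real" where
  "face_proj q \<sigma> \<equiv> L2_proj (face_measure \<sigma>) q \<sigma>"

definition divergence :: "(real^'n \<Rightarrow> real^'n) \<Rightarrow> real^'n \<Rightarrow> real" where
  "divergence \<tau> x = (\<Sum>i\<in>UNIV. frechet_derivative \<tau> (at x) (axis i 1) $ i)"


section \<open>The discrete space and its operators\<close>

text \<open>
  A pair \<open>v\<close> consists of the family \<open>fst v\<close> indexed by cells and the family \<open>snd v\<close> indexed by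
  faces. The set of cells and the set of faces restrict which indices matter.
\<close>

type_synonym 'n hybrid =
  "((real^'n) set \<Rightarrow> real^'n \<Rightarrow> real) \<times> ((real^'n) set \<Rightarrow> real^'n \<Rightarrow> real)"

definition hybrid_space ::
  "nat \<Rightarrow> (real^'n) set set \<Rightarrow> (real^'n) set set \<Rightarrow> 'n::finite hybrid set" where
  "hybrid_space k M E =
     {v. (\<forall>K\<in>M. fst v K \<in> poly_fun (k + 1)) \<and> (\<forall>\<sigma>\<in>E. snd v \<sigma> \<in> poly_fun k)}"

definition hybrid_add :: "'n::finite hybrid \<Rightarrow> 'n hybrid \<Rightarrow> 'n hybrid" where
  "hybrid_add v w = (\<lambda>K x. fst v K x + fst w K x, \<lambda>\<sigma> x. snd v \<sigma> x + snd w \<sigma> x)"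

definition hybrid_potential ::
  "nat \<Rightarrow> (real^'n) set \<Rightarrow> (real^'n \<Rightarrow> real) \<Rightarrow> 'n::finite hybrid" where
  "hybrid_potential k \<Omega> \<phi> =
     (\<lambda>K. cell_proj (k + 1) K \<phi>, \<lambda>\<sigma>. face_proj k \<sigma> (boundary_trace \<Omega> \<phi>))"

definition grad_K ::
  "nat \<Rightarrow> ((real^'n) set \<Rightarrow> (real^'n) set set) \<Rightarrow> (real^'n) set \<Rightarrow> 'n::finite hybrid \<Rightarrow>
   real^'n \<Rightarrow> real^'n" where
  "grad_K k EK K v =
     (THE G. G \<in> poly_vec k \<and>
        (\<forall>\<tau>\<in>poly_vec k.
           (LINT x:K|lebesgue. G x \<bullet> \<tau> x) =
             - (LINT x:K|lebesgue. fst v K x * divergence \<tau> x) +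
             (\<Sum>\<sigma>\<in>EK K. LINT x:\<sigma>|face_measure \<sigma>. snd v \<sigma> x * (\<tau> x \<bullet> outer_normal K \<sigma>))))"

definition jump ::
  "nat \<Rightarrow> (real^'n) set \<Rightarrow> (real^'n) set \<Rightarrow> 'n::finite hybrid \<Rightarrow> real^'n \<Rightarrow> real" where
  "jump k K \<sigma> v x = face_proj k \<sigma> (fst v K) x - snd v \<sigma> x"

definition Lambda_face ::
  "(real^'n \<Rightarrow> real^'n^'n) \<Rightarrow> (real^'n) set \<Rightarrow> (real^'n) set \<Rightarrow> real" where
  "Lambda_face \<Lambda> K \<sigma> =
     Linf_norm (face_measure \<sigma>) \<sigma>
       (\<lambda>x. (boundary_trace K \<Lambda> x *v outer_normal K \<sigma>) \<bullet> outer_normal K \<sigma>)"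

definition a_K ::
  "nat \<Rightarrow> (real^'n \<Rightarrow> real^'n^'n) \<Rightarrow> ((real^'n) set \<Rightarrow> (real^'n) set set) \<Rightarrow> (real^'n) set \<Rightarrow>
   'n::finite hybrid \<Rightarrow> 'n hybrid \<Rightarrow> real" where
  "a_K k \<Lambda> EK K z v =
     (LINT x:K|lebesgue. (\<Lambda> x *v grad_K k EK K z x) \<bullet> grad_K k EK K v x) +
     (\<Sum>\<sigma>\<in>EK K. Lambda_face \<Lambda> K \<sigma> / diameter \<sigma> *
        (LINT x:\<sigma>|face_measure \<sigma>. jump k K \<sigma> z x * jump k K \<sigma> v x))"

definition T_D ::
  "nat \<Rightarrow> real \<Rightarrow> (real^'n \<Rightarrow> real^'n^'n) \<Rightarrow> (real^'n) set set \<Rightarrow>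
   ((real^'n) set \<Rightarrow> (real^'n) set set) \<Rightarrow>
   'n::finite hybrid \<Rightarrow> 'n hybrid \<Rightarrow> 'n hybrid \<Rightarrow> real" where
  "T_D k \<epsilon> \<Lambda> M EK l w v =
     (\<Sum>K\<in>M.
        (LINT x:K|lebesgue.
           exp (fst l K x) * ((\<Lambda> x *v grad_K k EK K w x) \<bullet> grad_K k EK K v x)) +
        (\<Sum>\<sigma>\<in>EK K. Lambda_face \<Lambda> K \<sigma> / diameter \<sigma> *
           (LINT x:\<sigma>|face_measure \<sigma>.
              (exp (face_proj k \<sigma> (fst l K) x) + exp (snd l \<sigma> x)) / 2 *
              (jump k K \<sigma> w x * jump k K \<sigma> v x))) +
        \<epsilon> * diameter K ^ (k + 2) * a_K k \<Lambda> EK K w v)"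


section \<open>The nonlinear scheme\<close>

definition discrete_density :: "'n::finite hybrid \<Rightarrow> 'n hybrid" where
  "discrete_density l = (\<lambda>K x. exp (fst l K x), \<lambda>\<sigma> x. exp (snd l \<sigma> x))"

definition cell_density ::
  "(real^'n \<Rightarrow> real) \<Rightarrow> (nat \<Rightarrow> 'n::finite hybrid) \<Rightarrow> nat \<Rightarrow> (real^'n) set \<Rightarrow> real^'n \<Rightarrow> real" where
  "cell_density u0 l n K = (if n = 0 then u0 else fst (discrete_density (l n)) K)"

text \<open>The term \<open>l 0\<close> plays no role: the sequence of unknowns starts at index 1.\<close>

definition solves_scheme ::
  "nat \<Rightarrow> real \<Rightarrow> real \<Rightarrow> (real^'n) set \<Rightarrow> (real^'n \<Rightarrow> real^'n^'n) \<Rightarrow> (real^'n \<Rightarrow> real) \<Rightarrow>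
   (real^'n \<Rightarrow> real) \<Rightarrow> (real^'n) set set \<Rightarrow> (real^'n) set set \<Rightarrow>
   ((real^'n) set \<Rightarrow> (real^'n) set set) \<Rightarrow> (nat \<Rightarrow> 'n::finite hybrid) \<Rightarrow> bool" where
  "solves_scheme k \<epsilon> \<Delta>t \<Omega> \<Lambda> \<phi> u0 M E EK l \<longleftrightarrow>
     (\<forall>n\<ge>1. l n \<in> hybrid_space k M E) \<and>
     (\<forall>n. \<forall>v\<in>hybrid_space k M E.
        (\<Sum>K\<in>M. LINT x:K|lebesgue.
           (cell_density u0 l (n + 1) K x - cell_density u0 l n K x) / \<Delta>t * fst v K x) +
        T_D k \<epsilon> \<Lambda> M EK (l (n + 1)) (hybrid_add (l (n + 1)) (hybrid_potential k \<Omega> \<phi>)) v = 0)"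

end

theory Submission
  imports Defs "HOL-Real_Asymp.Real_Asymp"
begin

text \<open>
  One time step is a finite system \<open>P(c) = 0\<close> for the coefficients of the logarithmic unknown
  \<open>\<ell>\<close>, and \<open>P\<close> is continuous. Testing with \<open>w = \<ell> + \<phi>\<close> gives
  \<open>\<Sum>\<^sub>K \<integral>\<^sub>K (e\<^bsup>w - \<phi>\<^esup> - u) w / \<Delta>t + \<epsilon> Q(w)\<close> as a lower bound, where \<open>Q\<close> is the
  stabilising quadratic form. Suppose this is nonpositive along an unbounded sequence and pass to
  the limit of the normalised \<open>w\<close>. The first term is bounded below by a linear function of the
  size of \<open>w\<close>, so the limit lies in the kernel of \<open>Q\<close>. Integration by parts on each cell and the
  connectedness of \<open>\<Omega>\<close> show that this kernel consists of the constants. A positive limit is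
  excluded by the exponential growth of \<open>e\<^bsup>w\<^esup>\<close>, a negative one by \<open>\<integral> u > 0\<close>. Hence there is
  an a priori bound, and a solution of a variational inequality on a large cube, which exists by
  Brouwer's fixed point theorem, is interior and therefore a zero of \<open>P\<close>.

  The divergence theorem on a cell is proved by slicing the cell by parallel lines. For the traces,
  a function with bounded weak gradient is Lipschitz along segments, by mollification, and the
  epigraph charts of the boundary turn this into a local Lipschitz bound up to the boundary.
\<close>

section \<open>Lebesgue measure on affine hyperplanes\<close>

text \<open>The exponential weights degenerate where the unknown tends to minus infinity, so the
  weighted part of the form gives no uniform control; only its sign is used. The part with factor
  \<open>\<epsilon>\<close> has coefficients independent of the unknown, and so its kernel is a
  fixed space. Testing with the sum of unknown and potential makes both arguments of the form equal,
  which is what gives it a sign. Uniqueness fails on faces: distinct polynomials may agree on a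
  hyperplane, and projections are choices. Linearity and equality there hold modulo null sets
  (\<open>null_on\<close>, \<open>eqv\<close>), and coordinates refer to orthonormal families
  instead of monomials. The face measure is built on an unspecified orthonormal basis, so the
  slicing behind the divergence theorem rests on a Fubini formula in directions oblique to the face.
  Rims of faces are controlled by their affine dimension: almost every line misses them, and
  removing their affine hulls does not disconnect the domain. Each time step hands on an integrable
  nonnegative density with positive integral, and this is the invariant of the sequence.\<close>

text \<open>
  The library states the change of variables for linear maps only for well-ordered index types.
\<close>

typedef (overloaded) ('n::finite) findex = "{..<CARD('n)}"
  by (rule exI[of _ 0]) simp

setup_lifting type_definition_findex

instantiation findex :: (finite) linorder
begin
lift_definition less_eq_findex :: "'a findex \<Rightarrow> 'a findex \<Rightarrow> bool" is "(\<le>)" .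
lift_definition less_findex :: "'a findex \<Rightarrow> 'a findex \<Rightarrow> bool" is "(<)" .
instance by (standard; transfer; auto)
end

instance findex :: (finite) finite
  by standard (metis finite_imageI finite_lessThan type_definition.Abs_image[OF type_definition_findex])

instance findex :: (finite) wellorder
proof
  fix P :: "'a findex \<Rightarrow> bool" and x
  assume *: "\<And>x. (\<And>y. y < x \<Longrightarrow> P y) \<Longrightarrow> P x"
  show "P x"
    by (induction x rule: measure_induct_rule[of Rep_findex]) (rule *, simp add: less_findex.rep_eq)
qed

lemma findex_bij: "\<exists>f :: 'n::finite findex \<Rightarrow> 'n. bij f"
proof -
  have "CARD('n findex) = CARD('n)"
    using type_definition.card[OF type_definition_findex[where 'n='n]] by simp
  then show ?thesis by (metis finite finite_same_card_bij)
qed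

text \<open>The preimage of a box under \<open>T\<close> is its image under the inverse
  \<open>S\<close>, and \<open>det (matrix S)\<close> is the reciprocal of
  \<open>det (matrix T)\<close>. Agreement on boxes determines \<open>lborel\<close>.\<close>

lemma lborel_linear_image:
  fixes T :: "real^'n::{finite,wellorder} \<Rightarrow> real^'n::_"
  assumes T: "linear T" and det: "det (matrix T) \<noteq> 0"
  shows "lborel = density (distr lborel borel T) (\<lambda>_. ennreal \<bar>det (matrix T)\<bar>)"
proof (rule lborel_eqI)
  have [measurable]: "T \<in> borel \<rightarrow>\<^sub>M borel"
    using T by (intro borel_measurable_continuous_onI linear_continuous_on) (simp add: linear_linear)
  obtain S where S: "linear S" "\<And>x. S (T x) = x" "\<And>x. T (S x) = x"
    using linear_injective_isomorphism[OF T] det det_nz_iff_inj[OF T] by (metis o_def id_apply)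
  have "matrix T ** matrix S = mat 1"
    using matrix_compose[OF S(1) T] S(3) by (simp add: o_def matrix_id_mat_1[unfolded id_def])
  then have dd: "det (matrix T) * det (matrix S) = 1" by (metis det_I det_mul)
  fix l u :: "real^'n::_" assume le: "\<And>b. b \<in> Basis \<Longrightarrow> l \<bullet> b \<le> u \<bullet> b"
  have eq: "T -` box l u = S ` box l u"
  proof (intro set_eqI iffI)
    fix x assume "x \<in> T -` box l u"
    then show "x \<in> S ` box l u" using S(2)[of x] by (intro image_eqI[of x S "T x"]) auto
  qed (use S(3) in auto)
  have Sm: "S ` box l u \<in> lmeasurable"
    by (rule measurable_linear_image[OF S(1)]) auto
  have borel: "S ` box l u \<in> sets borel"
    unfolding eq[symmetric] using measurable_sets[of T borel borel "box l u"] by simp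
  have "emeasure lebesgue (S ` box l u) = ennreal (measure lebesgue (S ` box l u))"
    using fmeasurableD2[OF Sm] by (intro emeasure_eq_ennreal_measure) auto
  then have "emeasure lborel (T -` box l u) = ennreal (measure lebesgue (S ` box l u))"
    unfolding eq using borel by simp
  also have "\<dots> = ennreal (\<bar>det (matrix S)\<bar> * measure lborel (box l u))"
    using S(1) by (subst measure_linear_image) auto
  finally have *: "emeasure lborel (T -` box l u) = ennreal (\<bar>det (matrix S)\<bar> * measure lborel (box l u))" .
  show "emeasure (density (distr lborel borel T) (\<lambda>_. ennreal \<bar>det (matrix T)\<bar>)) (box l u)
      = ennreal (\<Prod>b\<in>Basis. (u - l) \<bullet> b)"
  proof -
    have "0 \<le> (\<Prod>b\<in>Basis. (u - l) \<bullet> b)" using le by (intro prod_nonneg) (simp add: inner_diff_left)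
    then have "ennreal \<bar>det (matrix T)\<bar> * ennreal (\<bar>det (matrix S)\<bar> * (\<Prod>b\<in>Basis. (u - l) \<bullet> b))
        = ennreal (\<bar>det (matrix T) * det (matrix S)\<bar> * (\<Prod>b\<in>Basis. (u - l) \<bullet> b))"
      by (simp add: ennreal_mult[symmetric] abs_mult mult.assoc)
    with * dd le show ?thesis
      by (simp add: emeasure_density nn_integral_cmult emeasure_distr measure_lborel_box_eq)
  qed
qed simp

text \<open>Connects three index sets for coordinates: the vectors of
  \<open>direction_basis\<close>, those of \<open>Basis\<close>, and the coordinate type. Product
  boxes correspond under \<open>h\<close>, and they determine the product measure.\<close>

lemma PiM_lborel_reindex:
  fixes h :: "'i \<Rightarrow> 'j"
  assumes h: "bij_betw h I J" and I: "finite I"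
  shows "distr (\<Pi>\<^sub>M j\<in>J. (lborel :: real measure)) (\<Pi>\<^sub>M i\<in>I. lborel) (\<lambda>c. \<lambda>i\<in>I. c (h i)) = (\<Pi>\<^sub>M i\<in>I. lborel)"
proof -
  interpret p: product_sigma_finite "\<lambda>_::'i. lborel :: real measure" ..
  interpret q: product_sigma_finite "\<lambda>_::'j. lborel :: real measure" ..
  have J: "finite J" using h I bij_betw_finite by blast
  have hI: "\<And>i. i \<in> I \<Longrightarrow> h i \<in> J" using h bij_betwE by blast
  have [measurable]: "(\<lambda>c. \<lambda>i\<in>I. c (h i)) \<in> (\<Pi>\<^sub>M j\<in>J. (lborel :: real measure)) \<rightarrow>\<^sub>M (\<Pi>\<^sub>M i\<in>I. lborel)"
    using hI by (intro measurable_restrict measurable_component_singleton) auto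
  show ?thesis
  proof (rule p.PiM_eqI[OF I])
    fix A assume A: "\<And>i. i \<in> I \<Longrightarrow> A i \<in> sets (lborel :: real measure)"
    define B where "B j = A (inv_into I h j)" for j
    have Bh: "B (h i) = A i" if "i \<in> I" for i
      using h that by (simp add: B_def bij_betw_def inv_into_f_f)
    have hJ: "\<And>j. j \<in> J \<Longrightarrow> \<exists>i\<in>I. j = h i" using h by (auto simp: bij_betw_def)
    have "(\<lambda>c. \<lambda>i\<in>I. c (h i)) -` (Pi\<^sub>E I A) \<inter> space (\<Pi>\<^sub>M j\<in>J. (lborel :: real measure)) = Pi\<^sub>E J B"
    proof (intro set_eqI iffI)
      fix c assume c: "c \<in> (\<lambda>c. \<lambda>i\<in>I. c (h i)) -` (Pi\<^sub>E I A) \<inter> space (\<Pi>\<^sub>M j\<in>J. (lborel :: real measure))"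
      then have *: "\<And>i. i \<in> I \<Longrightarrow> c (h i) \<in> A i" "c \<in> extensional J"
        by (auto simp: space_PiM PiE_def Pi_def)
      have "c j \<in> B j" if "j \<in> J" for j using hJ[OF that] *(1) Bh by auto
      then show "c \<in> Pi\<^sub>E J B" using * by (auto simp: PiE_def)
    next
      fix c assume "c \<in> Pi\<^sub>E J B"
      then have "\<And>i. i \<in> I \<Longrightarrow> c (h i) \<in> A i" "c \<in> extensional J" using hI Bh by (auto simp: PiE_def Pi_def)
      then show "c \<in> (\<lambda>c. \<lambda>i\<in>I. c (h i)) -` (Pi\<^sub>E I A) \<inter> space (\<Pi>\<^sub>M j\<in>J. (lborel :: real measure))"
        by (auto simp: space_PiM PiE_def)
    qed
    moreover have BJ: "B j \<in> sets lborel" if "j \<in> J" for j using hJ[OF that] Bh A by auto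
    moreover have "Pi\<^sub>E I A \<in> sets (\<Pi>\<^sub>M i\<in>I. (lborel :: real measure))" using A I by (intro sets_PiM_I_finite) auto
    ultimately have "emeasure (distr (\<Pi>\<^sub>M j\<in>J. (lborel :: real measure)) (\<Pi>\<^sub>M i\<in>I. lborel) (\<lambda>c. \<lambda>i\<in>I. c (h i))) (Pi\<^sub>E I A)
       = (\<Prod>j\<in>J. emeasure lborel (B j))"
      using J by (simp add: emeasure_distr q.emeasure_PiM)
    also have "\<dots> = (\<Prod>i\<in>I. emeasure lborel (B (h i)))" using h by (rule prod.reindex_bij_betw[symmetric])
    also have "\<dots> = (\<Prod>i\<in>I. emeasure lborel (A i))" using Bh by (intro prod.cong) auto
    finally show "emeasure (distr (\<Pi>\<^sub>M j\<in>J. (lborel :: real measure)) (\<Pi>\<^sub>M i\<in>I. lborel) (\<lambda>c. \<lambda>i\<in>I. c (h i))) (Pi\<^sub>E I A)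
       = (\<Prod>i\<in>I. emeasure lborel (A i))" .
  qed simp
qed

text \<open>The choice in \<open>direction_basis\<close> is inhabited, because the differences of
  points of the hyperplane form exactly the linear hyperplane orthogonal to \<open>n\<close>, which
  has an orthonormal basis.\<close>

lemma direction_basis_hyperplane:
  fixes n :: "'a::euclidean_space" and b :: real
  assumes n: "norm n = 1"
  defines "B \<equiv> direction_basis {x. n \<bullet> x = b}"
  shows "pairwise orthogonal B" "\<And>u. u \<in> B \<Longrightarrow> norm u = 1" "span B = {x. n \<bullet> x = 0}"
    "finite B" "card B = DIM('a) - 1"
proof -
  have nn: "n \<bullet> n = 1" using n by (simp add: norm_eq_1)
  have eq: "{x - y |x y. x \<in> {x. n \<bullet> x = b} \<and> y \<in> {x. n \<bullet> x = b}} = {x. n \<bullet> x = 0}"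
  proof (intro set_eqI iffI)
    fix v assume "v \<in> {x. n \<bullet> x = 0}"
    then have "v = (b *\<^sub>R n + v) - b *\<^sub>R n" "b *\<^sub>R n + v \<in> {x. n \<bullet> x = b}" "b *\<^sub>R n \<in> {x. n \<bullet> x = b}"
      using nn by (auto simp: inner_right_distrib)
    then show "v \<in> {x - y |x y. x \<in> {x. n \<bullet> x = b} \<and> y \<in> {x. n \<bullet> x = b}}" by blast
  qed (auto simp: inner_diff_right)
  have "\<exists>B. pairwise orthogonal B \<and> (\<forall>u\<in>B. norm u = 1) \<and> span B = {x. n \<bullet> x = 0}"
    using orthonormal_basis_subspace[OF subspace_hyperplane[of n]] by metis
  then have *: "pairwise orthogonal B \<and> (\<forall>u\<in>B. norm u = 1) \<and> span B = {x. n \<bullet> x = 0}"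
    unfolding B_def direction_basis_def eq by (rule someI_ex)
  then show 1: "pairwise orthogonal B" "span B = {x. n \<bullet> x = 0}"
    and 2: "\<And>u. u \<in> B \<Longrightarrow> norm u = 1" by auto
  have "0 \<notin> B" using 2 by force
  then have ind: "independent B" using 1 by (intro pairwise_orthogonal_independent) auto
  then show "finite B" by (rule independent_imp_finite)
  have "card B = dim (span B)" using ind by (simp add: dim_eq_card_independent)
  also have "\<dots> = DIM('a) - 1" using n unfolding 1(2) by (intro dim_hyperplane) auto
  finally show "card B = DIM('a) - 1" .
qed

text \<open>Up to transposition, the matrix of the coordinate change has the rows \<open>e\<close>
  and \<open>h i\<close>. Its determinant is unchanged when \<open>e\<close> is replaced by its
  normal part \<open>(e \<bullet> n) *\<^sub>R n\<close>, since the difference lies in the span of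
  the other rows. Pulling out \<open>e \<bullet> n\<close> leaves an orthogonal matrix.\<close>

lemma nn_integral_adapted_wellorder:
  fixes n e :: "real^'n::{finite,wellorder}" and h :: "'n::_ \<Rightarrow> real^'n::_" and i0 :: "'n::_"
  defines "I \<equiv> UNIV - {i0}"
  assumes n: "norm n = 1" and en: "e \<bullet> n \<noteq> 0"
    and ort: "\<And>i j. i \<in> I \<Longrightarrow> j \<in> I \<Longrightarrow> h i \<bullet> h j = (if i = j then 1 else 0)"
    and ortn: "\<And>i. i \<in> I \<Longrightarrow> n \<bullet> h i = 0" and sp: "span (h ` I) = {x. n \<bullet> x = 0}"
    and [measurable]: "F \<in> borel_measurable borel"
  shows "(\<integral>\<^sup>+x. F x \<partial>lborel) =
    ennreal \<bar>e \<bullet> n\<bar> * (\<integral>\<^sup>+x. F ((x $ i0) *\<^sub>R e + (\<Sum>i\<in>I. (x $ i) *\<^sub>R h i)) \<partial>lborel)"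
proof -
  have nn: "n \<bullet> n = 1" using n by (simp add: norm_eq_1)
  have norm_h: "norm (h i) = 1" if "i \<in> I" for i using ort[OF that that] by (simp add: norm_eq_1)
  define T where "T x = (x $ i0) *\<^sub>R e + (\<Sum>i\<in>I. (x $ i) *\<^sub>R h i)" for x
  have linT: "linear T"
    unfolding T_def by (intro linearI) (auto simp: algebra_simps sum.distrib scaleR_sum_right)
  define A where "A = (\<chi> i. if i = i0 then e else h i)"
  have TA: "matrix T = transpose A"
  proof -
    have "T (axis j 1) = A $ j" for j
    proof (cases "j = i0")
      case True
      have "(\<Sum>i\<in>I. ((axis j (1::real) :: real^'n::_) $ i) *\<^sub>R h i) = 0"
        using True by (intro sum.neutral) (auto simp: I_def axis_def)
      then show ?thesis using True by (simp add: T_def A_def)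
    next
      case False
      then have jI: "j \<in> I" by (simp add: I_def)
      have "(\<Sum>i\<in>I. ((axis j (1::real) :: real^'n::_) $ i) *\<^sub>R h i) = (\<Sum>i\<in>I. if i = j then h i else 0)"
        by (intro sum.cong) (auto simp: axis_def)
      also have "\<dots> = h j" using jI by (simp add: sum.delta I_def)
      finally show ?thesis using False by (simp add: T_def A_def axis_def)
    qed
    then show ?thesis by (simp add: matrix_def transpose_def vec_eq_iff)
  qed
  define C where "C = (\<chi> i. if i = i0 then n else h i)"
  have "orthogonal_matrix C"
    unfolding orthogonal_matrix_orthonormal_rows
  proof (intro conjI allI impI)
    fix i show "norm (row i C) = 1"
      using n norm_h[of i] by (auto simp: row_def C_def I_def)
  next
    fix i j :: 'n assume "i \<noteq> j"
    then show "orthogonal (row i C) (row j C)"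
      using ort ortn by (auto simp: row_def C_def I_def orthogonal_def inner_commute)
  qed
  then have detC: "\<bar>det C\<bar> = 1" using det_orthogonal_matrix by fastforce
  define D where "D = (\<chi> i. if i = i0 then (e \<bullet> n) *\<^sub>R n else h i)"
  have detD: "det D = (e \<bullet> n) * det C"
    unfolding D_def C_def scalar_mult_eq_scaleR[symmetric]
    using det_row_mul[of i0 "e \<bullet> n" "\<lambda>_. n" h] by simp
  have "e - (e \<bullet> n) *\<^sub>R n \<in> span (h ` I)" using nn
    unfolding sp by (simp add: inner_diff_right inner_commute)
  moreover have "h ` I \<subseteq> {row j D |j. j \<noteq> i0}"
  proof
    fix v assume "v \<in> h ` I"
    then obtain i where "i \<in> I" "v = h i" by auto
    then have "v = row i D" "i \<noteq> i0" by (auto simp: row_def D_def I_def)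
    then show "v \<in> {row j D |j. j \<noteq> i0}" by blast
  qed
  ultimately have "e - (e \<bullet> n) *\<^sub>R n \<in> vec.span {row j D |j. j \<noteq> i0}"
    unfolding span_vec_eq using span_mono by blast
  from det_row_span[OF this]
  have "det (\<chi> k. if k = i0 then row i0 D + (e - (e \<bullet> n) *\<^sub>R n) else row k D) = det D" .
  moreover have "(\<chi> k. if k = i0 then row i0 D + (e - (e \<bullet> n) *\<^sub>R n) else row k D) = A"
    by (auto simp: A_def D_def row_def vec_eq_iff)
  ultimately have "det A = det D" by simp
  then have detT: "\<bar>det (matrix T)\<bar> = \<bar>e \<bullet> n\<bar>" unfolding TA det_transpose by (simp add: detD abs_mult detC)
  have [measurable]: "T \<in> borel \<rightarrow>\<^sub>M borel"
    using linT by (intro borel_measurable_continuous_onI linear_continuous_on) (simp add: linear_linear)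
  have "(\<integral>\<^sup>+x. F x \<partial>lborel) = ennreal \<bar>e \<bullet> n\<bar> * (\<integral>\<^sup>+x. F (T x) \<partial>lborel)"
    by (subst lborel_linear_image[OF linT])
       (use detT en in \<open>auto simp: nn_integral_density nn_integral_distr nn_integral_cmult\<close>)
  then show ?thesis by (simp add: T_def)
qed

lemma lborel_permute_coordinates:
  fixes f :: "'m::finite \<Rightarrow> 'n::finite"
  assumes f: "bij f"
  shows "(lborel :: (real^'n) measure) = distr (lborel :: (real^'m) measure) borel (\<lambda>x. \<chi> i. x $ inv f i)"
proof (rule lborel_eqI)
  have cont: "continuous_on UNIV (\<lambda>x :: real^'m. (\<chi> i. x $ inv f i) :: real^'n)"
    by (intro continuous_intros)
  then have [measurable]: "(\<lambda>x :: real^'m. (\<chi> i. x $ inv f i) :: real^'n) \<in> borel \<rightarrow>\<^sub>M borel"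
    by (rule borel_measurable_continuous_onI)
  have invf: "inv f (f i) = i" "f (inv f j) = j" for i j
    using f by (auto simp: bij_is_inj bij_is_surj surj_f_inv_f)
  fix l u :: "real^'n" assume le: "\<And>b. b \<in> Basis \<Longrightarrow> l \<bullet> b \<le> u \<bullet> b"
  then have lu: "l $ i \<le> u $ i" for i using le[of "axis i 1"] by (simp add: inner_axis axis_in_Basis_iff)
  have pr: "(\<Prod>b\<in>Basis. (u' - l') \<bullet> b) = (\<Prod>i\<in>UNIV. u' $ i - l' $ i)" for u' l' :: "real^'k"
    by (simp add: Basis_vec_def UNION_singleton_eq_range prod.reindex inj_on_def axis_eq_axis inner_axis)
  have inner_Basis_vec: "(\<chi> i. l $ f i) \<bullet> b \<le> (\<chi> i. u $ f i) \<bullet> b" if "b \<in> Basis" for b :: "real^'m"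
    using that lu by (auto simp: Basis_vec_def inner_axis)
  have all_inv: "(\<forall>i. R (inv f i) i) \<longleftrightarrow> (\<forall>j. R j (f j))" for R :: "'m \<Rightarrow> 'n \<Rightarrow> bool"
    using invf by metis
  have "(\<lambda>x :: real^'m. (\<chi> i. x $ inv f i)) -` box l u = box (\<chi> i. l $ f i) (\<chi> i. u $ f i)"
    unfolding vimage_def mem_box_cart set_eq_iff
    by (simp add: all_inv[of "\<lambda>j i. l $ i < _ $ j \<and> _ $ j < u $ i"])
  then have "emeasure (distr (lborel :: (real^'m) measure) borel (\<lambda>x. \<chi> i. x $ inv f i)) (box l u)
     = ennreal (\<Prod>i\<in>UNIV. u $ f i - l $ f i)"
    using inner_Basis_vec by (subst emeasure_distr) (auto simp add: pr simp flip: inner_diff_left)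
  also have "(\<Prod>i\<in>UNIV. u $ f i - l $ f i) = (\<Prod>i\<in>UNIV. u $ i - l $ i)"
    using prod.reindex_bij_betw[of f UNIV UNIV "\<lambda>i. u $ i - l $ i"] f by simp
  finally show "emeasure (distr (lborel :: (real^'m) measure) borel (\<lambda>x. \<chi> i. x $ inv f i)) (box l u)
     = ennreal (\<Prod>b\<in>Basis. (u - l) \<bullet> b)" by (simp add: pr)
qed simp

text \<open>A bijection between the coordinate type and \<open>findex\<close> induces a linear
  isometry that preserves \<open>lborel\<close>, and this carries over the well-ordered
  case.\<close>

lemma nn_integral_adapted:
  fixes n e :: "real^'n" and h :: "'n::_ \<Rightarrow> real^'n::_" and i0 :: "'n::_"
  defines "I \<equiv> UNIV - {i0}"
  assumes n: "norm n = 1" and en: "e \<bullet> n \<noteq> 0"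
    and ort: "\<And>i j. i \<in> I \<Longrightarrow> j \<in> I \<Longrightarrow> h i \<bullet> h j = (if i = j then 1 else 0)"
    and ortn: "\<And>i. i \<in> I \<Longrightarrow> n \<bullet> h i = 0" and sp: "span (h ` I) = {x. n \<bullet> x = 0}"
    and [measurable]: "F \<in> borel_measurable borel"
  shows "(\<integral>\<^sup>+x. F x \<partial>lborel) =
    ennreal \<bar>e \<bullet> n\<bar> * (\<integral>\<^sup>+x. F ((x $ i0) *\<^sub>R e + (\<Sum>i\<in>I. (x $ i) *\<^sub>R h i)) \<partial>lborel)"
proof -
  obtain f :: "'n findex \<Rightarrow> 'n" where f: "bij f" using findex_bij by blast
  have invf: "inv f (f i) = i" "f (inv f j) = j" for i j
    using f by (auto simp: bij_is_inj bij_is_surj surj_f_inv_f)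
  define P :: "real^'n findex \<Rightarrow> real^'n" where "P x = (\<chi> i. x $ inv f i)" for x
  define Q :: "real^'n \<Rightarrow> real^'n findex" where "Q x = (\<chi> i. x $ f i)" for x
  have PQ: "P (Q x) = x" "Q (P y) = y" for x y by (auto simp: P_def Q_def vec_eq_iff invf)
  have linP: "linear P" and linQ: "linear Q" by (auto intro!: linearI simp: P_def Q_def vec_eq_iff)
  have Qi: "Q x \<bullet> Q y = x \<bullet> y" for x y
    using sum.reindex_bij_betw[of f UNIV UNIV "\<lambda>i. x $ i * y $ i"] f
    by (simp add: inner_vec_def Q_def)
  have Qn: "norm (Q x) = norm x" for x by (simp add: norm_eq_sqrt_inner Qi)
  have [measurable]: "P \<in> borel \<rightarrow>\<^sub>M borel"
    unfolding P_def by (intro borel_measurable_continuous_onI continuous_intros)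
  have PL: "(lborel :: (real^'n) measure) = distr lborel borel P"
    using lborel_permute_coordinates[OF f] by (simp add: P_def[abs_def])
  define I' where "I' = UNIV - {inv f i0}"
  have inj: "inj f" using f by (rule bij_is_inj)
  have "f ` I' = f ` UNIV - f ` {inv f i0}"
    unfolding I'_def by (rule image_set_diff[OF inj])
  also have "\<dots> = I" by (simp add: I_def invf bij_is_surj[OF f])
  finally have bI: "bij_betw f I' I" using inj by (auto simp: bij_betw_def inj_on_def)
  have fI: "f i \<in> I" if "i \<in> I'" for i using bI that bij_betwE by blast
  have "(\<integral>\<^sup>+x. F x \<partial>lborel) = (\<integral>\<^sup>+x. F (P x) \<partial>lborel)"
    by (subst PL) (simp add: nn_integral_distr)
  also have "\<dots> = ennreal \<bar>Q e \<bullet> Q n\<bar> *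
      (\<integral>\<^sup>+x. F (P ((x $ inv f i0) *\<^sub>R Q e + (\<Sum>i\<in>I'. (x $ i) *\<^sub>R Q (h (f i))))) \<partial>lborel)"
    unfolding I'_def
  proof (rule nn_integral_adapted_wellorder, unfold I'_def[symmetric])
    show "norm (Q n) = 1" "Q e \<bullet> Q n \<noteq> 0" using n en by (auto simp: Qn Qi)
    show "Q (h (f i)) \<bullet> Q (h (f j)) = (if i = j then 1 else 0)" if "i \<in> I'" "j \<in> I'" for i j
      using ort[OF fI[OF that(1)] fI[OF that(2)]] by (simp add: Qi invf) (metis invf)
    show "Q n \<bullet> Q (h (f i)) = 0" if "i \<in> I'" for i using ortn fI that by (simp add: Qi)
    have "(\<lambda>i. Q (h (f i))) ` I' = Q ` (h ` I)"
      using bI by (auto simp: bij_betw_def image_image)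
    then have "span ((\<lambda>i. Q (h (f i))) ` I') = Q ` {x. n \<bullet> x = 0}"
      using linear_span_image[OF linQ] sp by simp
    also have "\<dots> = {x. Q n \<bullet> x = 0}"
    proof (intro set_eqI iffI)
      fix x assume "x \<in> {x. Q n \<bullet> x = 0}"
      then have "n \<bullet> P x = 0" using Qi[of n "P x"] PQ by simp
      then show "x \<in> Q ` {x. n \<bullet> x = 0}" using PQ(2)[of x, symmetric] by blast
    qed (auto simp: Qi)
    finally show "span ((\<lambda>i. Q (h (f i))) ` I') = {x. Q n \<bullet> x = 0}" .
  qed measurable
  also have "\<dots> = ennreal \<bar>e \<bullet> n\<bar> *
      (\<integral>\<^sup>+x. F ((x $ inv f i0) *\<^sub>R e + (\<Sum>i\<in>I'. (x $ i) *\<^sub>R h (f i))) \<partial>lborel)"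
    by (simp add: Qi linear_add[OF linP] linear_cmul[OF linP] linear_sum[OF linP] PQ)
  also have "(\<integral>\<^sup>+x. F ((x $ inv f i0) *\<^sub>R e + (\<Sum>i\<in>I'. (x $ i) *\<^sub>R h (f i))) \<partial>lborel)
     = (\<integral>\<^sup>+x. F ((x $ i0) *\<^sub>R e + (\<Sum>i\<in>I. (x $ i) *\<^sub>R h i)) \<partial>lborel)"
  proof -
    have "(\<Sum>i\<in>I. (P x $ i) *\<^sub>R h i) = (\<Sum>i\<in>I'. (x $ i) *\<^sub>R h (f i))" for x
      using sum.reindex_bij_betw[OF bI, of "\<lambda>i. (P x $ i) *\<^sub>R h i"] by (simp add: P_def invf)
    moreover have "P x $ i0 = x $ inv f i0" for x by (simp add: P_def)
    moreover have "(\<integral>\<^sup>+x. G x \<partial>(lborel :: (real^'n) measure)) = (\<integral>\<^sup>+x. G (P x) \<partial>lborel)"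
      if [measurable]: "G \<in> borel_measurable borel" for G
      by (subst PL) (simp add: nn_integral_distr)
    ultimately show ?thesis by simp
  qed
  finally show ?thesis .
qed

text \<open>The direction \<open>e\<close> may be oblique to the hyperplane; the factor
  \<open>\<bar>e \<bullet> n\<bar>\<close> is the height gained per unit of the parameter
  \<open>t\<close>.\<close>

lemma affine_lborel_fubini:
  fixes n e :: "real^'n" and b :: real
  assumes n: "norm n = 1" and en: "e \<bullet> n \<noteq> 0" and [measurable]: "F \<in> borel_measurable borel"
  shows "(\<integral>\<^sup>+x. F x \<partial>lborel) =
    ennreal \<bar>e \<bullet> n\<bar> * (\<integral>\<^sup>+y. (\<integral>\<^sup>+t. F (y + t *\<^sub>R e) \<partial>lborel) \<partial>affine_lborel {x. n \<bullet> x = b})"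
proof -
  define H where "H = {x. n \<bullet> x = b}"
  \<comment> \<open>The basis here and the point \<open>p\<close> below are the very choices made
    inside \<open>affine_lborel\<close>, so the last step is a change of variables under its own
    parametrisation.\<close>
  define B where "B = direction_basis H"
  define p where "p = (SOME p. p \<in> H)"
  note B = direction_basis_hyperplane[OF n, where b=b, folded H_def B_def]
  have nn: "n \<bullet> n = 1" using n by (simp add: norm_eq_1)
  \<comment> \<open>Any coordinate may be the transversal one; the others are as many as the basis
    vectors of the hyperplane.\<close>
  define i0 where "i0 = (undefined :: 'n)"
  define I where "I = UNIV - {i0}"
  have "card I = card B" using B(5) by (simp add: I_def)
  then obtain h where h: "bij_betw h I B" using B(4) by (metis finite_same_card_bij finite_class.finite)
  have hB: "\<And>i. i \<in> I \<Longrightarrow> h i \<in> B" using h bij_betwE by blast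
  have ort: "h i \<bullet> h j = (if i = j then 1 else 0)" if "i \<in> I" "j \<in> I" for i j
  proof (cases "i = j")
    case True
    then show ?thesis using B(2)[OF hB[OF that(1)]] by (simp add: norm_eq_1)
  next
    case False
    then have "h i \<noteq> h j" using that h by (auto simp: bij_betw_def inj_on_def)
    then show ?thesis using B(1) hB that False by (auto simp: pairwise_def orthogonal_def)
  qed
  have ortn: "n \<bullet> h i = 0" if "i \<in> I" for i
    using B(3) hB[OF that] span_base by fastforce
  have sp: "span (h ` I) = {x. n \<bullet> x = 0}" using h B(3) by (simp add: bij_betw_def)
  define T where "T x = (x $ i0) *\<^sub>R e + (\<Sum>i\<in>I. (x $ i) *\<^sub>R h i)" for x
  have linT: "linear T"
    unfolding T_def by (intro linearI) (auto simp: algebra_simps sum.distrib scaleR_sum_right)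
  have [measurable]: "T \<in> borel \<rightarrow>\<^sub>M borel"
    using linT by (intro borel_measurable_continuous_onI linear_continuous_on) (simp add: linear_linear)
  define L where "L = (lborel :: real measure)"
  have [measurable_cong]: "sets L = sets borel" by (simp add: L_def)
  interpret ps: product_sigma_finite "\<lambda>_::'n. L" by (simp add: product_sigma_finite_def L_def lborel.sigma_finite_measure_axioms)
  have bij: "bij_betw (\<lambda>i. axis i (1::real) :: real^'n) UNIV Basis"
    by (auto simp: bij_betw_def inj_on_def axis_eq_axis Basis_vec_def)
  have axis: "(\<Sum>b\<in>(Basis :: (real^'n) set). f b *\<^sub>R b) = (\<chi> i. f (axis i 1))" for f
  proof -
    have "(\<Sum>b\<in>(Basis :: (real^'n) set). f b *\<^sub>R b) $ i = f (axis i 1)" for i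
    proof -
      have "(\<Sum>b\<in>(Basis :: (real^'n) set). f b *\<^sub>R b) = (\<Sum>j\<in>UNIV. f (axis j 1) *\<^sub>R axis j 1)"
        by (rule sum.reindex_bij_betw[OF bij, symmetric])
      then show ?thesis by (simp add: axis_def if_distrib sum.delta cong: if_cong)
    qed
    then show ?thesis by (simp add: vec_eq_iff)
  qed
  have vm [measurable]: "(\<lambda>c. \<chi> i. c i) \<in> (\<Pi>\<^sub>M i\<in>(UNIV :: 'n set). L) \<rightarrow>\<^sub>M borel"
  proof -
    have "(\<chi> i. c i) = (\<Sum>i\<in>UNIV. c i *\<^sub>R (axis i 1 :: real^'n))" for c :: "'n \<Rightarrow> real"
      by (simp add: vec_eq_iff axis_def if_distrib sum.delta cong: if_cong)
    moreover have "(\<lambda>c. \<Sum>i\<in>UNIV. c i *\<^sub>R (axis i 1 :: real^'n)) \<in> (\<Pi>\<^sub>M i\<in>(UNIV :: 'n set). L) \<rightarrow>\<^sub>M borel"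
      by measurable
    ultimately show ?thesis by simp
  qed
  have lb: "(lborel :: (real^'n) measure) = distr (\<Pi>\<^sub>M i\<in>(UNIV :: 'n set). L) borel (\<lambda>c. \<chi> i. c i)"
  proof -
    have [measurable]: "(\<lambda>c. \<lambda>i\<in>UNIV. c (axis i 1)) \<in>
        (\<Pi>\<^sub>M b\<in>(Basis :: (real^'n) set). L) \<rightarrow>\<^sub>M (\<Pi>\<^sub>M i\<in>(UNIV :: 'n set). L)"
      by (intro measurable_restrict measurable_component_singleton) auto
    have r: "distr (\<Pi>\<^sub>M b\<in>(Basis :: (real^'n) set). L) (\<Pi>\<^sub>M i\<in>(UNIV :: 'n set). L) (\<lambda>c. \<lambda>i\<in>UNIV. c (axis i 1))
       = (\<Pi>\<^sub>M i\<in>(UNIV :: 'n set). L)"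
      unfolding L_def by (rule PiM_lborel_reindex[OF bij finite])
    have "distr (\<Pi>\<^sub>M i\<in>(UNIV :: 'n set). L) borel (\<lambda>c. \<chi> i. c i) =
       distr (\<Pi>\<^sub>M b\<in>(Basis :: (real^'n) set). L) borel ((\<lambda>c. \<chi> i. c i) \<circ> (\<lambda>c. \<lambda>i\<in>UNIV. c (axis i 1)))"
      by (subst (1) r[symmetric], rule distr_distr) measurable
    also have "\<dots> = distr (\<Pi>\<^sub>M b\<in>(Basis :: (real^'n) set). lborel) borel (\<lambda>f. \<Sum>b\<in>Basis. f b *\<^sub>R b)"
      unfolding L_def axis by (simp add: o_def restrict_def)
    also have "\<dots> = lborel" by (rule lborel_eq[symmetric])
    finally show ?thesis by simp
  qed
  have UI: "UNIV = insert i0 I" by (auto simp: I_def)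
  have "(\<integral>\<^sup>+x. F x \<partial>lborel) = (\<integral>\<^sup>+x. F (p + x) \<partial>lborel)"
    by (subst lborel_distr_plus[of p, symmetric]) (simp add: nn_integral_distr)
  also have "\<dots> = ennreal \<bar>e \<bullet> n\<bar> * (\<integral>\<^sup>+x. F (p + T x) \<partial>lborel)"
    unfolding T_def using ort ortn sp unfolding I_def
    by (intro nn_integral_adapted[OF n en]) auto
  also have "(\<integral>\<^sup>+x. F (p + T x) \<partial>lborel) = (\<integral>\<^sup>+c. F (p + T (\<chi> i. c i)) \<partial>(\<Pi>\<^sub>M i\<in>(UNIV :: 'n set). L))"
    by (subst lb) (simp add: nn_integral_distr)
  also have "\<dots> = (\<integral>\<^sup>+c. \<integral>\<^sup>+t. F (p + T (\<chi> i. (c(i0 := t)) i)) \<partial>L \<partial>(\<Pi>\<^sub>M i\<in>I. L))"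
    unfolding UI by (subst ps.product_nn_integral_insert) (auto simp: I_def UI[unfolded I_def, symmetric])
  also have "\<dots> = (\<integral>\<^sup>+c. \<integral>\<^sup>+t. F (p + (\<Sum>i\<in>I. c i *\<^sub>R h i) + t *\<^sub>R e) \<partial>L \<partial>(\<Pi>\<^sub>M i\<in>I. L))"
  proof -
    have "(\<Sum>i\<in>I. (c(i0 := t)) i *\<^sub>R h i) = (\<Sum>i\<in>I. c i *\<^sub>R h i)" for c :: "'n \<Rightarrow> real" and t
      by (intro sum.cong) (auto simp: I_def)
    then show ?thesis by (simp add: T_def add_ac del: fun_upd_apply) (simp add: add_ac)
  qed
  also have "\<dots> = (\<integral>\<^sup>+c. \<integral>\<^sup>+t. F (p + (\<Sum>u\<in>B. c u *\<^sub>R u) + t *\<^sub>R e) \<partial>L \<partial>(\<Pi>\<^sub>M u\<in>B. L))"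
  proof -
    have m [measurable]: "(\<lambda>c. \<lambda>i\<in>I. c (h i)) \<in> (\<Pi>\<^sub>M u\<in>B. L) \<rightarrow>\<^sub>M (\<Pi>\<^sub>M i\<in>I. L)"
      using hB by (intro measurable_restrict measurable_component_singleton) auto
    have r: "distr (\<Pi>\<^sub>M u\<in>B. L) (\<Pi>\<^sub>M i\<in>I. L) (\<lambda>c. \<lambda>i\<in>I. c (h i)) = (\<Pi>\<^sub>M i\<in>I. L)"
      unfolding L_def by (rule PiM_lborel_reindex[OF h finite])
    have "(\<Sum>i\<in>I. (\<lambda>i\<in>I. c (h i)) i *\<^sub>R h i) = (\<Sum>i\<in>I. c (h i) *\<^sub>R h i)" for c :: "real^'n \<Rightarrow> real"
      by (intro sum.cong) auto
    also have "(\<Sum>i\<in>I. c (h i) *\<^sub>R h i) = (\<Sum>u\<in>B. c u *\<^sub>R u)" for c :: "real^'n \<Rightarrow> real"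
      by (rule sum.reindex_bij_betw[OF h, of "\<lambda>u. c u *\<^sub>R u"])
    finally have s: "(\<Sum>i\<in>I. (\<lambda>i\<in>I. c (h i)) i *\<^sub>R h i) = (\<Sum>u\<in>B. c u *\<^sub>R u)" for c :: "real^'n \<Rightarrow> real" .
    have "(\<integral>\<^sup>+c. \<integral>\<^sup>+t. F (p + (\<Sum>i\<in>I. c i *\<^sub>R h i) + t *\<^sub>R e) \<partial>L \<partial>distr (\<Pi>\<^sub>M u\<in>B. L) (\<Pi>\<^sub>M i\<in>I. L) (\<lambda>c. \<lambda>i\<in>I. c (h i)))
      = (\<integral>\<^sup>+c. \<integral>\<^sup>+t. F (p + (\<Sum>i\<in>I. (\<lambda>i\<in>I. c (h i)) i *\<^sub>R h i) + t *\<^sub>R e) \<partial>L \<partial>(\<Pi>\<^sub>M u\<in>B. L))"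
      unfolding L_def by (intro nn_integral_distr) (use m in \<open>simp_all add: L_def\<close>)
    then show ?thesis unfolding r s .
  qed
  also have "\<dots> = (\<integral>\<^sup>+y. (\<integral>\<^sup>+t. F (y + t *\<^sub>R e) \<partial>L) \<partial>affine_lborel H)"
    unfolding affine_lborel_def B_def[symmetric] p_def[symmetric] L_def by (subst nn_integral_distr) auto
  finally show ?thesis by (simp add: L_def H_def)
qed

lemma sets_affine_lborel [simp, measurable_cong]: "sets (affine_lborel H) = sets borel"
  by (simp add: affine_lborel_def)

lemma space_affine_lborel [simp]: "space (affine_lborel H) = UNIV"
  by (simp add: affine_lborel_def)

text \<open>The measure is declared on the whole space, but its parametrisation takes values only in
  the hyperplane.\<close>

lemma AE_affine_lborel_mem:
  assumes n: "norm n = 1"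
  shows "AE y in affine_lborel {x. n \<bullet> x = b}. n \<bullet> y = b"
proof -
  define H where "H = {x. n \<bullet> x = b}"
  define p where "p = (SOME p. p \<in> H)"
  have "b *\<^sub>R n \<in> H" using n by (simp add: H_def norm_eq_1)
  then have p: "p \<in> H" unfolding p_def by (rule someI)
  have "n \<bullet> (\<Sum>u\<in>direction_basis H. c u *\<^sub>R u) = 0" for c
    unfolding inner_sum_right using direction_basis_hyperplane(3)[OF n, of b] span_base
    by (intro sum.neutral) (fastforce simp: H_def)
  then have "n \<bullet> (p + (\<Sum>u\<in>direction_basis H. c u *\<^sub>R u)) = b" for c
    using p by (simp add: H_def inner_right_distrib)
  then show ?thesis
    unfolding affine_lborel_def H_def[symmetric] p_def[symmetric] by (subst AE_distr_iff) auto
qed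

text \<open>The flat ball is thickened by a segment of unit length along \<open>n\<close>. The
  result fits into the ball of radius \<open>R + 1\<close>, and slicing bounds the area by that
  volume.\<close>

lemma emeasure_affine_lborel_cball:
  fixes n :: "real^'n"
  assumes n: "norm n = 1"
  shows "emeasure (affine_lborel {x. n \<bullet> x = b}) (cball 0 R) < \<infinity>"
proof -
  let ?\<mu> = "affine_lborel {x. n \<bullet> x = b}"
  have nn: "n \<bullet> n = 1" using n by (simp add: norm_eq_1)
  have "emeasure ?\<mu> (cball 0 R) = (\<integral>\<^sup>+y. indicator (cball 0 R) y * (\<integral>\<^sup>+t. indicator {0..1::real} t \<partial>lborel) \<partial>?\<mu>)"
    by simp
  also have "\<dots> \<le> (\<integral>\<^sup>+y. \<integral>\<^sup>+t. indicator (cball 0 (R + 1)) (y + t *\<^sub>R n) \<partial>lborel \<partial>?\<mu>)"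
  proof (rule nn_integral_mono)
    fix y
    have in_ball: "y + t *\<^sub>R n \<in> cball 0 (R + 1)" if "y \<in> cball 0 R" "t \<in> {0..1}" for t
      using that norm_triangle_ineq[of y "t *\<^sub>R n"] n by auto
    have "indicator (cball 0 R) y * (\<integral>\<^sup>+t. indicator {0..1::real} t \<partial>lborel)
      = (\<integral>\<^sup>+t. indicator (cball 0 R) y * indicator {0..1::real} t \<partial>lborel)"
      by (subst nn_integral_cmult) simp_all
    also have "\<dots> \<le> (\<integral>\<^sup>+t. indicator (cball 0 (R + 1)) (y + t *\<^sub>R n) \<partial>lborel)"
      by (intro nn_integral_mono) (use in_ball in \<open>auto simp: indicator_def\<close>)
    finally show "indicator (cball 0 R) y * (\<integral>\<^sup>+t. indicator {0..1::real} t \<partial>lborel)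
       \<le> (\<integral>\<^sup>+t. indicator (cball 0 (R + 1)) (y + t *\<^sub>R n) \<partial>lborel)" .
  qed
  also have "\<dots> = (\<integral>\<^sup>+x. indicator (cball (0::real^'n) (R + 1)) x \<partial>lborel)"
    by (subst affine_lborel_fubini[OF n, of n _ b]) (simp add: nn, measurable, simp_all add: nn)
  also have "\<dots> = emeasure lborel (cball (0::real^'n) (R + 1))" by (rule nn_integral_indicator) simp
  also have "\<dots> < \<infinity>" by (rule emeasure_bounded_finite) simp
  finally show ?thesis .
qed

lemma emeasure_affine_lborel_bounded:
  fixes n :: "real^'n"
  assumes n: "norm n = 1" and S: "bounded S"
  shows "emeasure (affine_lborel {x. n \<bullet> x = b}) S < \<infinity>"
proof -
  obtain R where "S \<subseteq> cball 0 R" using bounded_subset_ballD[OF S, of 0] ball_subset_cball by (meson order_trans)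
  then have "emeasure (affine_lborel {x. n \<bullet> x = b}) S \<le> emeasure (affine_lborel {x. n \<bullet> x = b}) (cball 0 R)"
    by (intro emeasure_mono) auto
  then show ?thesis using emeasure_affine_lborel_cball[OF n, of b R] by (rule le_less_trans)
qed

lemma sigma_finite_affine_lborel:
  fixes n :: "real^'n"
  assumes n: "norm n = 1"
  shows "sigma_finite_measure (affine_lborel {x. n \<bullet> x = b})"
proof
  show "\<exists>A. countable A \<and> A \<subseteq> sets (affine_lborel {x. n \<bullet> x = b}) \<and> \<Union>A = space (affine_lborel {x. n \<bullet> x = b}) \<and>
      (\<forall>a\<in>A. emeasure (affine_lborel {x. n \<bullet> x = b}) a \<noteq> \<infinity>)"
  proof (intro exI conjI ballI)
    show "countable (range (\<lambda>i::nat. cball (0::real^'n) (real i)))" by simp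
    show "\<Union> (range (\<lambda>i::nat. cball (0::real^'n) (real i))) = space (affine_lborel {x. n \<bullet> x = b})"
      using real_arch_simple by auto
  qed (use emeasure_affine_lborel_cball[OF n] in \<open>auto simp: less_top\<close>)
qed

text \<open>Slicing as an identity of measures also serves Bochner integrals of signed
  functions.\<close>

lemma lborel_eq_density_affine:
  fixes n e :: "real^'n"
  assumes n: "norm n = 1" and en: "e \<bullet> n \<noteq> 0"
  shows "lborel = density (distr (affine_lborel {x. n \<bullet> x = b} \<Otimes>\<^sub>M lborel) borel (\<lambda>(y, t). y + t *\<^sub>R e))
     (\<lambda>_. ennreal \<bar>e \<bullet> n\<bar>)"
proof (rule measure_eqI)
  fix A :: "(real^'n) set" assume "A \<in> sets lborel"
  then have [measurable]: "A \<in> sets borel" by simp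
  have "emeasure lborel A = (\<integral>\<^sup>+x. indicator A x \<partial>lborel)" by simp
  also have "\<dots> = ennreal \<bar>e \<bullet> n\<bar> * (\<integral>\<^sup>+y. (\<integral>\<^sup>+t. indicator A (y + t *\<^sub>R e) \<partial>lborel) \<partial>affine_lborel {x. n \<bullet> x = b})"
    by (rule affine_lborel_fubini[OF n en]) measurable
  also have "(\<integral>\<^sup>+y. (\<integral>\<^sup>+t. indicator A (y + t *\<^sub>R e) \<partial>lborel) \<partial>affine_lborel {x. n \<bullet> x = b})
     = (\<integral>\<^sup>+z. indicator A (case z of (y, t) \<Rightarrow> y + t *\<^sub>R e) \<partial>(affine_lborel {x. n \<bullet> x = b} \<Otimes>\<^sub>M lborel))"
    by (subst lborel.nn_integral_fst[symmetric]) auto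
  also have "ennreal \<bar>e \<bullet> n\<bar> * \<dots> = emeasure (density (distr (affine_lborel {x. n \<bullet> x = b} \<Otimes>\<^sub>M lborel) borel (\<lambda>(y, t). y + t *\<^sub>R e))
     (\<lambda>_. ennreal \<bar>e \<bullet> n\<bar>)) A"
    by (subst emeasure_density)
       (auto simp: nn_integral_cmult nn_integral_distr simp flip: nn_integral_indicator)
  finally show "emeasure lborel A = emeasure (density (distr (affine_lborel {x. n \<bullet> x = b} \<Otimes>\<^sub>M lborel) borel (\<lambda>(y, t). y + t *\<^sub>R e))
     (\<lambda>_. ennreal \<bar>e \<bullet> n\<bar>)) A" .
qed simp

text \<open>Every line in the unit direction \<open>e\<close> spends length one in the slab where
  \<open>x \<bullet> e\<close> lies between 0 and 1, and \<open>pr x\<close> is constant along it.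
  Hence the space integral of \<open>G\<close> is the integral over the face, up to the slicing
  factor.\<close>

lemma face_integral_along_lines:
  fixes n e :: "real^'n" and f :: "real^'n \<Rightarrow> real" and b :: real
  assumes n: "norm n = 1" and en: "e \<bullet> n \<noteq> 0" and e: "norm e = 1"
    and S [measurable]: "S \<in> sets borel" and Sb: "bounded S"
    and f [measurable]: "f \<in> borel_measurable borel" and C: "\<And>y. y \<in> S \<Longrightarrow> \<bar>f y\<bar> \<le> C"
  defines "pr \<equiv> \<lambda>x. x + ((b - n \<bullet> x) / (e \<bullet> n)) *\<^sub>R e"
  defines "G \<equiv> \<lambda>x. indicator {0..1} (x \<bullet> e) * (indicator S (pr x) * f (pr x))"
  shows "integrable lborel G" (is ?int)
    and "(\<integral>x. G x \<partial>lborel) = \<bar>e \<bullet> n\<bar> * (LINT y:S|affine_lborel {x. n \<bullet> x = b}. f y)" (is ?eq)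
proof -
  let ?\<mu> = "affine_lborel {x. n \<bullet> x = b}"
  let ?\<Psi> = "\<lambda>(y, t). y + t *\<^sub>R e"
  interpret \<mu>: sigma_finite_measure ?\<mu> by (rule sigma_finite_affine_lborel[OF n])
  interpret pair_sigma_finite ?\<mu> "lborel :: real measure" ..
  have ee: "e \<bullet> e = 1" using e by (simp add: norm_eq_1)
  have [measurable]: "pr \<in> borel \<rightarrow>\<^sub>M borel" unfolding pr_def by measurable
  have [measurable]: "G \<in> borel_measurable borel" unfolding G_def by measurable
  have [measurable]: "?\<Psi> \<in> ?\<mu> \<Otimes>\<^sub>M lborel \<rightarrow>\<^sub>M borel" by measurable
  have prH: "pr (y + t *\<^sub>R e) = y" if "n \<bullet> y = b" for y t
    using that en by (simp add: pr_def inner_right_distrib inner_commute algebra_simps add_divide_distrib)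
  have GH: "G (y + t *\<^sub>R e) = indicator {- (y \<bullet> e)..1 - y \<bullet> e} t * (indicator S y * f y)" if "n \<bullet> y = b" for y t
    using that ee by (auto simp: G_def prH inner_left_distrib indicator_def)
  note AEH = AE_affine_lborel_mem[OF n, of b]
  have G2: "(\<lambda>z. G (?\<Psi> z)) = (\<lambda>(y, t). G (y + t *\<^sub>R e))" by (auto simp: fun_eq_iff)
  have finS: "emeasure ?\<mu> S < \<infinity>" by (rule emeasure_affine_lborel_bounded[OF n Sb])
  have intS: "integrable ?\<mu> (\<lambda>y. indicator S y * f y)"
  proof (rule Bochner_Integration.integrable_bound[where f="\<lambda>y. \<bar>C\<bar> * indicator S y"])
    show "integrable ?\<mu> (\<lambda>y. \<bar>C\<bar> * indicator S y)"
      using finS by (intro integrable_mult_right integrable_real_indicator) auto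
    show "AE y in ?\<mu>. norm (indicator S y * f y) \<le> norm (\<bar>C\<bar> * indicator S y)"
      using C by (intro AE_I2) (force simp: indicator_def)
  qed measurable
  have intp: "integrable (?\<mu> \<Otimes>\<^sub>M lborel) (\<lambda>z. G (?\<Psi> z))"
    unfolding G2
  proof (rule Fubini_integrable)
    show "(\<lambda>(y, t). G (y + t *\<^sub>R e)) \<in> borel_measurable (?\<mu> \<Otimes>\<^sub>M lborel)" by measurable
    have *: "AE y in ?\<mu>. (\<integral>t. norm (G (y + t *\<^sub>R e)) \<partial>lborel) = \<bar>indicator S y * f y\<bar>"
      using AEH by eventually_elim (simp add: GH abs_mult)
    show "integrable ?\<mu> (\<lambda>y. \<integral>t. norm (case (y, t) of (y, t) \<Rightarrow> G (y + t *\<^sub>R e)) \<partial>lborel)"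
      by (subst integrable_cong_AE[where g="\<lambda>y. \<bar>indicator S y * f y\<bar>"])
         (use * intS in \<open>auto intro!: integrable_abs\<close>)
    show "AE y in ?\<mu>. integrable lborel (\<lambda>t. case (y, t) of (y, t) \<Rightarrow> G (y + t *\<^sub>R e))"
      using AEH by eventually_elim (simp add: GH)
  qed
  have intd: "integrable (distr (?\<mu> \<Otimes>\<^sub>M lborel) borel ?\<Psi>) G"
    using intp by (subst integrable_distr_eq) auto
  note L = lborel_eq_density_affine[OF n en, of b]
  show ?int
    by (subst L, subst integrable_density) (use intd in \<open>auto intro!: integrable_mult_right\<close>)
  have "(\<integral>x. G x \<partial>lborel) = (\<integral>x. \<bar>e \<bullet> n\<bar> * G x \<partial>distr (?\<mu> \<Otimes>\<^sub>M lborel) borel ?\<Psi>)"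
    by (subst L, subst integral_density) auto
  also have "\<dots> = \<bar>e \<bullet> n\<bar> * (\<integral>z. G (?\<Psi> z) \<partial>(?\<mu> \<Otimes>\<^sub>M lborel))"
    by (subst integral_distr) auto
  also have "(\<integral>z. G (?\<Psi> z) \<partial>(?\<mu> \<Otimes>\<^sub>M lborel)) = (\<integral>y. \<integral>t. G (y + t *\<^sub>R e) \<partial>lborel \<partial>?\<mu>)"
    using integral_fst'[OF intp] by simp
  also have "\<dots> = (\<integral>y. indicator S y * f y \<partial>?\<mu>)"
  proof (rule integral_cong_AE)
    show "AE y in ?\<mu>. (\<integral>t. G (y + t *\<^sub>R e) \<partial>lborel) = indicator S y * f y"
      using AEH by eventually_elim (simp add: GH)
  qed auto
  finally show ?eq by (simp add: set_lebesgue_integral_def)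
qed

text \<open>After the shift by \<open>t *\<^sub>R e\<close>, the slab weight becomes the indicator
  of an interval of length one in \<open>t\<close>, so it integrates to one. With the same weight on
  cells and on faces, the two kinds of integral can be compared on almost every line without a
  measure on the set of lines.\<close>

lemma cell_integral_along_lines:
  fixes e :: "'a::euclidean_space" and F :: "'a \<Rightarrow> real"
  assumes e: "norm e = 1" and F: "integrable lborel F"
  shows "integrable lborel (\<lambda>x. indicator {0..1} (x \<bullet> e) * (\<integral>t. F (x + t *\<^sub>R e) \<partial>lborel))" (is ?int)
    and "(\<integral>x. indicator {0..1} (x \<bullet> e) * (\<integral>t. F (x + t *\<^sub>R e) \<partial>lborel) \<partial>lborel) = (\<integral>x. F x \<partial>lborel)" (is ?eq)
    and "AE x in lborel. x \<bullet> e \<in> {0..1} \<longrightarrow> integrable lborel (\<lambda>t. F (x + t *\<^sub>R e))" (is ?ae)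
proof -
  have [measurable]: "F \<in> borel_measurable borel" using F by simp
  have ee: "e \<bullet> e = 1" using e by (simp add: norm_eq_1)
  define P where "P = (\<lambda>(t::real, x). indicator {0..1} (x \<bullet> e) * F (x + t *\<^sub>R e))"
  define Q where "Q = (\<lambda>(t::real, x). indicator {0..1} (x \<bullet> e - t) * F x)"
  have [measurable]: "P \<in> borel_measurable (lborel \<Otimes>\<^sub>M lborel)" "Q \<in> borel_measurable (lborel \<Otimes>\<^sub>M lborel)"
    unfolding P_def Q_def by measurable
  have PQ: "P (t, x) = Q (t, t *\<^sub>R e + x)" for t x
    using ee by (simp add: P_def Q_def inner_left_distrib add.commute)
  have tr: "(\<integral>x. G (c + x) \<partial>lborel) = (\<integral>x. G x \<partial>lborel)" if [measurable]: "G \<in> borel_measurable borel" for c :: 'a and G :: "'a \<Rightarrow> real"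
    by (subst (2) lborel_distr_plus[of c, symmetric]) (simp add: integral_distr)
  have tri: "integrable lborel (\<lambda>x. G (c + x))" if "integrable lborel G" for c :: 'a and G :: "'a \<Rightarrow> real"
  proof -
    have "integrable (distr lborel borel ((+) c)) G" using that by (simp add: lborel_distr_plus)
    then show ?thesis by (subst (asm) integrable_distr_eq) (use that in auto)
  qed
  have Q1: "integrable (lborel \<Otimes>\<^sub>M lborel) (\<lambda>(x, t). Q (t, x))"
  proof (rule lborel_pair.Fubini_integrable)
    have "(\<integral>t. norm (Q (t, x)) \<partial>lborel) = \<bar>F x\<bar>" for x
    proof -
      have "indicator {0..1} (x \<bullet> e - t) = (indicator {x \<bullet> e - 1 .. x \<bullet> e} t :: real)" for t by (auto simp: indicator_def)
      then show ?thesis by (simp add: Q_def abs_mult)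
    qed
    then show "integrable lborel (\<lambda>x. \<integral>t. norm (case (x, t) of (x, t) \<Rightarrow> Q (t, x)) \<partial>lborel)" using F by simp
    have "integrable lborel (\<lambda>t. Q (t, x))" for x
    proof -
      have "indicator {0..1} (x \<bullet> e - t) = (indicator {x \<bullet> e - 1 .. x \<bullet> e} t :: real)" for t by (auto simp: indicator_def)
      then show ?thesis by (simp add: Q_def)
    qed
    then show "AE x in lborel. integrable lborel (\<lambda>t. case (x, t) of (x, t) \<Rightarrow> Q (t, x))" by simp
  qed measurable
  have Q2: "integrable (lborel \<Otimes>\<^sub>M lborel) Q"
    using lborel_pair.integrable_product_swap[OF Q1] by (simp add: split_def)
  have P2: "integrable (lborel \<Otimes>\<^sub>M lborel) P"
  proof -
    have "AE t in lborel. integrable lborel (\<lambda>x. Q (t, x))"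
      using lborel_pair.AE_integrable_fst'[OF Q2] .
    then have 1: "AE t in lborel. integrable lborel (\<lambda>x. P (t, x))"
      unfolding PQ by eventually_elim (rule tri)
    have "(\<integral>x. norm (P (t, x)) \<partial>lborel) = (\<integral>x. norm (Q (t, x)) \<partial>lborel)" for t
      unfolding PQ by (rule tr) measurable
    then have 2: "integrable lborel (\<lambda>t. \<integral>x. norm (P (t, x)) \<partial>lborel)"
      using lborel_pair.integrable_fst'[OF integrable_norm[OF Q2]] by simp
    show ?thesis by (rule lborel_pair.Fubini_integrable) (use 1 2 in auto)
  qed
  have P1: "integrable (lborel \<Otimes>\<^sub>M lborel) (\<lambda>(x, t). P (t, x))"
    using lborel_pair.integrable_product_swap[OF P2] by (simp add: split_def)
  show ?int using lborel_pair.integrable_fst'[OF P1] by (simp add: P_def)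
  have "(\<integral>x. indicator {0..1} (x \<bullet> e) * (\<integral>t. F (x + t *\<^sub>R e) \<partial>lborel) \<partial>lborel) = (\<integral>x. \<integral>t. P (t, x) \<partial>lborel \<partial>lborel)"
    by (simp add: P_def)
  also have "\<dots> = (\<integral>t. \<integral>x. P (t, x) \<partial>lborel \<partial>lborel)"
    using lborel_pair.Fubini_integral[of "\<lambda>t x. P (t, x)"] P2 by simp
  also have "\<dots> = (\<integral>t. \<integral>x. Q (t, x) \<partial>lborel \<partial>lborel)"
    unfolding PQ by (intro Bochner_Integration.integral_cong refl tr) measurable
  also have "\<dots> = (\<integral>x. \<integral>t. Q (t, x) \<partial>lborel \<partial>lborel)"
    using lborel_pair.Fubini_integral[of "\<lambda>t x. Q (t, x)"] Q2 by simp
  also have "\<dots> = (\<integral>x. F x \<partial>lborel)"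
  proof -
    have "indicator {0..1} (x \<bullet> e - t) = (indicator {x \<bullet> e - 1 .. x \<bullet> e} t :: real)" for t x by (auto simp: indicator_def)
    then show ?thesis by (simp add: Q_def)
  qed
  finally show ?eq .
  have "AE x in lborel. integrable lborel (\<lambda>t. P (t, x))"
    using lborel_pair.AE_integrable_fst'[OF P1] by simp
  then show ?ae by eventually_elim (auto simp: P_def)
qed

section \<open>Outer normals\<close>

text \<open>Records the orientation together with one-sidedness: a cell lying on both sides of a
  face would have no outer normal.\<close>

definition cell_face :: "'a::euclidean_space set \<Rightarrow> 'a set \<Rightarrow> 'a \<Rightarrow> real \<Rightarrow> bool" where
  "cell_face K \<sigma> n b \<longleftrightarrow>
     norm n = 1 \<and> openin (top_of_set {x. n \<bullet> x = b}) \<sigma> \<and>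
     (\<forall>x\<in>\<sigma>. \<exists>\<rho>>0. \<forall>y\<in>ball x \<rho>. y \<in> K \<longleftrightarrow> n \<bullet> (y - x) < 0)"

text \<open>In a boundary chart the frontier is the graph of \<open>g\<close>, and the flat face
  must be part of it. If the chart direction \<open>e\<close> were tangent to the face, moving along
  \<open>e\<close> would stay in the face and leave the graph. So \<open>e\<close> is transversal,
  the graph is the hyperplane near \<open>x\<close>, and the epigraph is one of the two
  half-spaces.\<close>

lemma local_halfspace:
  fixes K :: "'a::euclidean_space set"
  assumes K: "open K" "lipschitz_boundary_in UNIV K"
    and a: "norm a = 1" and op: "openin (top_of_set {x. a \<bullet> x = b}) \<sigma>"
    and fr: "\<sigma> \<subseteq> frontier K" and x: "x \<in> \<sigma>"
  shows "\<exists>c\<in>{1,-1}. \<exists>\<rho>>0. \<forall>y\<in>ball x \<rho>. y \<in> K \<longleftrightarrow> c * (a \<bullet> (y - x)) < (0::real)"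
proof -
  have "x \<in> top_of_set UNIV frontier_of K" using fr x by (auto simp: euclidean_frontier_of)
  then obtain e g L r where e: "norm e = 1" and g: "L-lipschitz_on (UNIV :: 'a set) g" and r: "r > 0"
    and epi: "\<And>y. y \<in> ball x r \<Longrightarrow> y \<in> K \<longleftrightarrow> g (y - (y \<bullet> e) *\<^sub>R e) < y \<bullet> e"
    using K(2) unfolding lipschitz_boundary_in_def by (metis IntI UNIV_I)
  have ee: "e \<bullet> e = 1" using e by (simp add: norm_eq_1)
  have contg: "continuous_on UNIV g" using g lipschitz_on_continuous_on by blast
  have ax: "a \<bullet> x = b" and "\<sigma> \<subseteq> {x. a \<bullet> x = b}" using x openin_imp_subset[OF op] by auto
  obtain r1 where r1: "r1 > 0" "ball x r1 \<inter> {x. a \<bullet> x = b} \<subseteq> \<sigma>"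
    using op x unfolding openin_contains_ball by blast
  define r' where "r' = min r r1"
  have r': "r' > 0" "r' \<le> r" "r' \<le> r1" using r r1 by (auto simp: r'_def)
  have graph: "g (z - (z \<bullet> e) *\<^sub>R e) = z \<bullet> e" if z: "z \<in> ball x r'" "a \<bullet> z = b" for z
  proof -
    have "z \<in> ball x r1 \<inter> {x. a \<bullet> x = b}" using z r' by auto
    then have zfr: "z \<in> frontier K" using r1 fr by blast
    then have "z \<notin> K" using K(1) by (auto simp: frontier_def interior_open)
    then have "g (z - (z \<bullet> e) *\<^sub>R e) \<ge> z \<bullet> e" using epi[of z] z r' by auto
    moreover have False if "g (z - (z \<bullet> e) *\<^sub>R e) > z \<bullet> e"
    proof -
      define U where "U = {y. y \<bullet> e < g (y - (y \<bullet> e) *\<^sub>R e)} \<inter> ball x r"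
      have "open {y. y \<bullet> e < g (y - (y \<bullet> e) *\<^sub>R e)}"
        by (intro open_Collect_less continuous_on_compose2[OF contg] continuous_intros) auto
      then have "open U" by (auto simp: U_def)
      moreover have "z \<in> U" using that z r' by (auto simp: U_def)
      moreover have "z \<in> closure K" using zfr by (auto simp: frontier_def)
      ultimately have "U \<inter> K \<noteq> {}" by (meson disjoint_iff open_Int_closure_eq_empty)
      then show False using epi by (force simp: U_def)
    qed
    ultimately show ?thesis by (meson antisym not_less)
  qed
  have ae: "a \<bullet> e \<noteq> 0"
  proof
    assume "a \<bullet> e = 0"
    define z where "z = x + (r' / 2) *\<^sub>R e"
    have "z \<in> ball x r'" "a \<bullet> z = b" using r' e ax \<open>a \<bullet> e = 0\<close>
      by (auto simp: z_def dist_norm inner_right_distrib)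
    from graph[OF this] graph[of x] have "z \<bullet> e = x \<bullet> e"
      using r' ax ee by (simp add: z_def algebra_simps inner_right_distrib)
    then show False using ee r' by (simp add: z_def inner_left_distrib)
  qed
  \<comment> \<open>Sliding a point of \<open>ball x \<rho>\<close> along \<open>e\<close> onto the
    hyperplane moves it by at most \<open>\<rho> / \<bar>a \<bullet> e\<bar>\<close>, and so keeps
    it inside \<open>ball x r'\<close>.\<close>
  define \<rho> where "\<rho> = r' / (1 + 1 / \<bar>a \<bullet> e\<bar>)"
  have pos: "1 + 1 / \<bar>a \<bullet> e\<bar> > 0" by (simp add: add_pos_nonneg)
  have \<rho>: "\<rho> > 0" using r' pos by (simp add: \<rho>_def)
  have "\<rho> * (1 + 1 / \<bar>a \<bullet> e\<bar>) = r'" using pos by (simp add: \<rho>_def)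
  then have \<rho>r: "\<rho> + \<rho> / \<bar>a \<bullet> e\<bar> = r'" by (simp add: algebra_simps)
  have key: "y \<in> K \<longleftrightarrow> - sgn (a \<bullet> e) * (a \<bullet> (y - x)) < 0" if y: "y \<in> ball x \<rho>" for y
  proof -
    define s where "s = (b - a \<bullet> y) / (a \<bullet> e)"
    define z where "z = y + s *\<^sub>R e"
    have nyx: "norm (y - x) < \<rho>" using y by (simp add: dist_norm norm_minus_commute)
    have bay: "b - a \<bullet> y = - (a \<bullet> (y - x))" using ax by (simp add: inner_diff_right)
    have "\<bar>a \<bullet> (y - x)\<bar> \<le> norm (y - x)" using Cauchy_Schwarz_ineq2[of a "y - x"] a by simp
    then have "\<bar>s\<bar> \<le> \<rho> / \<bar>a \<bullet> e\<bar>" using nyx unfolding s_def bay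
      by (simp add: abs_divide divide_right_mono)
    moreover have "norm (z - x) \<le> norm (y - x) + \<bar>s\<bar>"
      using norm_triangle_ineq[of "y - x" "s *\<^sub>R e"] e by (simp add: z_def algebra_simps)
    ultimately have zb: "z \<in> ball x r'" using nyx \<rho>r by (simp add: dist_norm norm_minus_commute)
    have "a \<bullet> z = b" using ae by (simp add: z_def s_def inner_right_distrib)
    from graph[OF zb this] have "g (y - (y \<bullet> e) *\<^sub>R e) = y \<bullet> e + s"
      using ee by (simp add: z_def inner_left_distrib algebra_simps)
    moreover have "y \<in> ball x r" using nyx \<rho>r r' pos
      by (smt (verit) \<rho> abs_ge_zero divide_nonneg_nonneg dist_norm mem_ball norm_minus_commute)
    ultimately have "y \<in> K \<longleftrightarrow> s < 0" using epi by simp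
    also have "\<dots> \<longleftrightarrow> - sgn (a \<bullet> e) * (a \<bullet> (y - x)) < 0"
      unfolding s_def bay using ae by (cases "a \<bullet> e > 0") (auto simp: sgn_if zero_less_divide_iff)
    finally show ?thesis .
  qed
  have "- sgn (a \<bullet> e) \<in> {1, -1}" using ae by (auto simp: sgn_if)
  then show ?thesis using key \<rho> by blast
qed

text \<open>The side on which the cell lies is locally constant along the face, and the face is
  connected.\<close>

lemma cell_face_exists:
  fixes K :: "'a::euclidean_space set"
  assumes K: "open K" "lipschitz_boundary_in UNIV K"
    and a: "norm a = 1" and op: "openin (top_of_set {x. a \<bullet> x = b}) \<sigma>"
    and fr: "\<sigma> \<subseteq> frontier K" and con: "connected \<sigma>"
  shows "\<exists>c\<in>{1,-1}. cell_face K \<sigma> (c *\<^sub>R a) (c * b)"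
proof -
  define N where "N c = {x\<in>\<sigma>. \<exists>\<rho>>0. \<forall>y\<in>ball x \<rho>. y \<in> K \<longleftrightarrow> c * (a \<bullet> (y - x)) < 0}" for c :: real
  have sub: "\<sigma> \<subseteq> {x. a \<bullet> x = b}" using openin_imp_subset[OF op] by auto
  have opN: "openin (top_of_set \<sigma>) (N c)" for c
    unfolding openin_contains_ball
  proof (intro conjI ballI)
    fix x assume "x \<in> N c"
    then obtain \<rho> where \<rho>: "\<rho> > 0" "\<And>y. y\<in>ball x \<rho> \<Longrightarrow> y \<in> K \<longleftrightarrow> c * (a \<bullet> (y - x)) < 0" and x: "x \<in> \<sigma>"
      by (auto simp: N_def)
    have "z \<in> N c" if z: "z \<in> ball x \<rho>" "z \<in> \<sigma>" for z
    proof -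
      have "a \<bullet> z = a \<bullet> x" using z x sub by auto
      then have "\<forall>y\<in>ball z (\<rho> - dist x z). y \<in> K \<longleftrightarrow> c * (a \<bullet> (y - z)) < 0"
        using \<rho>(2) by (smt (verit) dist_triangle inner_diff_right mem_ball)
      moreover have "\<rho> - dist x z > 0" using z by auto
      ultimately show ?thesis using z unfolding N_def by blast
    qed
    then show "\<exists>e>0. ball x e \<inter> \<sigma> \<subseteq> N c" using \<rho>(1) by blast
  qed (auto simp: N_def)
  have cover: "\<sigma> \<subseteq> N 1 \<union> N (-1)"
    using local_halfspace[OF K a op fr] by (auto simp: N_def)
  have disj: "N 1 \<inter> N (-1) = {}"
  proof (rule ccontr)
    assume "\<not> ?thesis"
    then obtain x where "x \<in> N 1" "x \<in> N (-1)" by blast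
    then obtain \<rho>1 \<rho>2 where x: "\<rho>1 > 0" "\<And>y. y\<in>ball x \<rho>1 \<Longrightarrow> y \<in> K \<longleftrightarrow> a \<bullet> (y - x) < 0"
       "\<rho>2 > 0" "\<And>y. y\<in>ball x \<rho>2 \<Longrightarrow> y \<in> K \<longleftrightarrow> - (a \<bullet> (y - x)) < 0" unfolding N_def by (auto simp del: mem_ball)
    define y where "y = x + (min \<rho>1 \<rho>2 / 2) *\<^sub>R a"
    have "y \<in> ball x \<rho>1" "y \<in> ball x \<rho>2" using x a by (auto simp: y_def dist_norm)
    moreover have "a \<bullet> (y - x) > 0" using x a by (simp add: y_def norm_eq_1)
    ultimately show False using x by force
  qed
  have "N 1 = {} \<or> N (-1) = {}"
    using con opN cover disj unfolding connected_openin by blast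
  moreover have "N c \<subseteq> \<sigma>" for c by (auto simp: N_def)
  ultimately have "\<sigma> = N 1 \<or> \<sigma> = N (-1)" using cover by blast
  then obtain c where c: "c \<in> {1,-1}" "\<sigma> = N c" by blast
  have "{x. (c *\<^sub>R a) \<bullet> x = c * b} = {x. a \<bullet> x = b}" using c by auto
  then have "cell_face K \<sigma> (c *\<^sub>R a) (c * b)"
    using c a op unfolding cell_face_def N_def by auto
  then show ?thesis using c by blast
qed

text \<open>A competing normal \<open>m\<close> has no component \<open>v\<close> tangent to the
  hyperplane, because the relatively open face contains a small step along \<open>v\<close>. This
  leaves \<open>n\<close> and \<open>- n\<close>, and the latter points into the cell.\<close>

lemma outer_normal_eq:
  fixes K :: "'a::euclidean_space set"
  assumes "cell_face K \<sigma> n b" and ne: "\<sigma> \<noteq> {}"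
  shows "outer_normal K \<sigma> = n"
proof -
  have n: "norm n = 1" and op: "openin (top_of_set {x. n \<bullet> x = b}) \<sigma>"
    and loc: "\<And>x. x \<in> \<sigma> \<Longrightarrow> \<exists>\<rho>>0. \<forall>y\<in>ball x \<rho>. y \<in> K \<longleftrightarrow> n \<bullet> (y - x) < 0"
    using assms by (auto simp: cell_face_def)
  have nn: "n \<bullet> n = 1" using n by (simp add: norm_eq_1)
  have sub: "\<And>x. x \<in> \<sigma> \<Longrightarrow> n \<bullet> x = b" using openin_imp_subset[OF op] by auto
  have ev: "\<forall>\<^sub>F t in at_right (0::real). x - t *\<^sub>R n \<in> K \<and> x + t *\<^sub>R n \<notin> K" if "x \<in> \<sigma>" for x
  proof -
    obtain \<rho> where \<rho>: "\<rho>>0" "\<And>y. y\<in>ball x \<rho> \<Longrightarrow> y \<in> K \<longleftrightarrow> n \<bullet> (y - x) < 0" using loc \<open>x \<in> \<sigma>\<close> by blast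
    have "x - t *\<^sub>R n \<in> K \<and> x + t *\<^sub>R n \<notin> K" if "t > 0" "t < \<rho>" for t
      using \<rho>(2)[of "x - t *\<^sub>R n"] \<rho>(2)[of "x + t *\<^sub>R n"] that n nn by (auto simp: dist_norm)
    then show ?thesis using \<rho>(1) unfolding eventually_at_right_field by blast
  qed
  obtain x where x: "x \<in> \<sigma>" using ne by auto
  show ?thesis
    unfolding outer_normal_def
  proof (rule the_equality)
    show "norm n = 1 \<and> (\<forall>x\<in>\<sigma>. \<forall>y\<in>\<sigma>. n \<bullet> (x - y) = 0) \<and>
        (\<forall>x\<in>\<sigma>. \<forall>\<^sub>F t in at_right (0::real). x - t *\<^sub>R n \<in> K \<and> x + t *\<^sub>R n \<notin> K)"
      using n sub ev by (auto simp: inner_diff_right)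
  next
    fix m assume m: "norm m = 1 \<and> (\<forall>x\<in>\<sigma>. \<forall>y\<in>\<sigma>. m \<bullet> (x - y) = 0) \<and>
        (\<forall>x\<in>\<sigma>. \<forall>\<^sub>F t in at_right (0::real). x - t *\<^sub>R m \<in> K \<and> x + t *\<^sub>R m \<notin> K)"
    obtain r where r: "r > 0" "ball x r \<inter> {x. n \<bullet> x = b} \<subseteq> \<sigma>"
      using op x unfolding openin_contains_ball by blast
    define v where "v = m - (m \<bullet> n) *\<^sub>R n"
    have nv: "n \<bullet> v = 0" using nn by (simp add: v_def inner_diff_right inner_commute)
    have "m \<bullet> v = 0"
    proof (cases "v = 0")
      case False
      define s where "s = r / (2 * norm v)"
      have s: "s > 0" using r False by (simp add: s_def)
      have "x + s *\<^sub>R v \<in> ball x r" using r False by (simp add: s_def dist_norm)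
      then have "x + s *\<^sub>R v \<in> \<sigma>" using r nv sub[OF x] by (auto simp: inner_right_distrib)
      then have "m \<bullet> (s *\<^sub>R v) = 0" using m x by (metis add_diff_cancel_left')
      then show ?thesis using s by simp
    qed simp
    then have "v \<bullet> v = 0" using nv unfolding v_def by (simp add: inner_diff_left inner_diff_right inner_commute)
    then have mv: "m = (m \<bullet> n) *\<^sub>R n" by (simp add: v_def)
    then have "\<bar>m \<bullet> n\<bar> = 1" using m n by (metis norm_scaleR mult.right_neutral)
    then consider "m = n" | "m = - n" using mv by (metis abs_eq_iff abs_one scaleR_minus1_left scaleR_one)
    then show "m = n"
    proof cases
      case 2
      have "\<forall>\<^sub>F t in at_right (0::real). x + t *\<^sub>R n \<in> K" using m x 2 by (force elim: eventually_mono)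
      with ev[OF x] have "\<forall>\<^sub>F t in at_right (0::real). False" by eventually_elim auto
      then show ?thesis by simp
    qed
  qed
qed

section \<open>The divergence theorem on a cell\<close>

text \<open>A bounded open set of the line is absent before its first crossing, so the first two
  crossings enclose an interval of it. The fundamental theorem handles this interval, and induction
  on the number of crossings handles the part beyond it. The crossing condition excludes two
  components with a common endpoint.\<close>

lemma integral_derivative_open_set:
  fixes S T :: "real set" and F f s :: "real \<Rightarrow> real"
  assumes "open S" "bounded S" "finite T" "frontier S \<subseteq> T"
    and F: "\<And>t. (F has_real_derivative f t) (at t)" and f: "continuous_on UNIV f"
    and cross: "\<And>t. t \<in> T \<Longrightarrow> \<exists>\<delta>>0. (s t = 1 \<and> {t-\<delta><..<t} \<subseteq> S \<and> {t<..<t+\<delta>} \<inter> S = {}) \<or>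
       (s t = -1 \<and> {t-\<delta><..<t} \<inter> S = {} \<and> {t<..<t+\<delta>} \<subseteq> S)"
  shows "(\<integral>t. indicator S t * f t \<partial>lborel) = (\<Sum>t\<in>T. s t * F t)"
  using assms(1-4) cross
proof (induction "card T" arbitrary: S T rule: less_induct)
  case less
  have conn: "C \<subseteq> S \<or> C \<inter> S = {}" if "connected C" "C \<inter> T = {}" for C
    using connected_Int_frontier[OF that(1), of S] less.prems(4) that(2) by blast
  show ?case
  proof (cases "T = {}")
    case True
    then have "S = {}" using less.prems frontier_eq_empty[of S] not_bounded_UNIV by auto
    then show ?thesis using True by simp
  next
    case False
    define t0 where "t0 = Min T"
    have t0: "t0 \<in> T" "\<And>t. t \<in> T \<Longrightarrow> t0 \<le> t" using False less.prems(3) by (auto simp: t0_def)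
    have unb: "\<not> {..<a} \<subseteq> S" "\<not> {a<..} \<subseteq> S" for a
    proof -
      obtain B where B: "\<And>x. x \<in> S \<Longrightarrow> \<bar>x\<bar> \<le> B" using less.prems(2) by (auto simp: bounded_iff)
      show "\<not> {..<a} \<subseteq> S"
        using B[of "min (a - 1) (- B - 1)"] by (force simp: min_def split: if_splits)
      show "\<not> {a<..} \<subseteq> S"
        using B[of "max (a + 1) (B + 1)"] by (force simp: max_def split: if_splits)
    qed
    have "{..<t0} \<inter> S = {}" using conn[of "{..<t0}"] t0 unb by force
    obtain \<delta> where \<delta>: "\<delta> > 0" "(s t0 = 1 \<and> {t0-\<delta><..<t0} \<subseteq> S \<and> {t0<..<t0+\<delta>} \<inter> S = {}) \<or>
       (s t0 = -1 \<and> {t0-\<delta><..<t0} \<inter> S = {} \<and> {t0<..<t0+\<delta>} \<subseteq> S)" using less.prems(5)[OF t0(1)] by blast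
    have mid: "t0 - \<delta> / 2 \<in> {t0-\<delta><..<t0}" "t0 + \<delta> / 2 \<in> {t0<..<t0+\<delta>}" using \<delta>(1) by auto
    have "t0 - \<delta> / 2 \<in> {..<t0}" using \<delta>(1) by simp
    then have "t0 - \<delta> / 2 \<notin> S" using \<open>{..<t0} \<inter> S = {}\<close> by blast
    then have \<delta>2: "s t0 = -1" "{t0<..<t0+\<delta>} \<subseteq> S" using \<delta>(2) mid by blast+
    have t0S: "t0 \<notin> S"
    proof
      assume "t0 \<in> S"
      then obtain e where "e > 0" "ball t0 e \<subseteq> S" using less.prems(1) open_contains_ball by blast
      then have "t0 - e / 2 \<in> S" by (auto simp: dist_real_def)
      moreover have "t0 - e / 2 \<in> {..<t0}" using \<open>e > 0\<close> by simp
      ultimately show False using \<open>{..<t0} \<inter> S = {}\<close> by blast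
    qed
    define T' where "T' = T - {t0}"
    \<comment> \<open>With a single crossing the set would contain a half-line.\<close>
    have "T' \<noteq> {}"
    proof
      assume "T' = {}"
      then have "{t0<..} \<inter> T = {}" by (auto simp: T'_def)
      moreover have "t0 + \<delta> / 2 \<in> {t0<..} \<inter> S" using mid \<delta>2 by auto
      ultimately have "{t0<..} \<subseteq> S" using conn[OF connected_Ioi] by blast
      then show False using unb by blast
    qed
    define t1 where "t1 = Min T'"
    have t1: "t1 \<in> T'" "\<And>t. t \<in> T' \<Longrightarrow> t1 \<le> t"
      using \<open>T' \<noteq> {}\<close> less.prems(3) Min_in[of T'] Min_le[of T'] unfolding t1_def by (simp_all add: T'_def)
    have t01: "t0 < t1" using t1(1) t0(2)[of t1] by (auto simp: T'_def)
    have "{t0<..<t1} \<inter> T = {}" using t1(2) by (force simp: T'_def)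
    moreover have "t0 + min (\<delta> / 2) ((t1 - t0) / 2) \<in> {t0<..<t1} \<inter> S"
    proof -
      have "t0 + min (\<delta> / 2) ((t1 - t0) / 2) \<in> {t0<..<t0+\<delta>}" using \<delta>(1) t01 by auto
      moreover have "t0 + min (\<delta> / 2) ((t1 - t0) / 2) \<in> {t0<..<t1}" using \<delta>(1) t01 by (auto simp: min_def field_simps)
      ultimately show ?thesis using \<delta>2 by blast
    qed
    ultimately have sub01: "{t0<..<t1} \<subseteq> S" using conn[OF connected_Ioo] by blast
    obtain \<eta> where \<eta>: "\<eta> > 0" "(s t1 = 1 \<and> {t1-\<eta><..<t1} \<subseteq> S \<and> {t1<..<t1+\<eta>} \<inter> S = {}) \<or>
       (s t1 = -1 \<and> {t1-\<eta><..<t1} \<inter> S = {} \<and> {t1<..<t1+\<eta>} \<subseteq> S)"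
      using less.prems(5)[of t1] t1(1) by (auto simp: T'_def)
    have "t1 - min (\<eta> / 2) ((t1 - t0) / 2) \<in> {t1-\<eta><..<t1} \<inter> S"
    proof -
      have "t1 - min (\<eta> / 2) ((t1 - t0) / 2) \<in> {t0<..<t1}" using \<eta>(1) t01 by (auto simp: min_def field_simps)
      moreover have "t1 - min (\<eta> / 2) ((t1 - t0) / 2) \<in> {t1-\<eta><..<t1}" using \<eta>(1) t01 by (auto simp: min_def field_simps)
      ultimately show ?thesis using sub01 by blast
    qed
    then have \<eta>2: "s t1 = 1" "{t1<..<t1+\<eta>} \<inter> S = {}" using \<eta>(2) by blast+
    have t1S: "t1 \<notin> S"
    proof
      assume "t1 \<in> S"
      then obtain e where e: "e > 0" "ball t1 e \<subseteq> S" using less.prems(1) open_contains_ball by blast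
      then have "t1 + min e \<eta> / 2 \<in> ball t1 e" using \<eta>(1) by (auto simp: dist_real_def)
      moreover have "t1 + min e \<eta> / 2 \<in> {t1<..<t1+\<eta>}" using e \<eta>(1) by auto
      ultimately show False using e \<eta>2 by blast
    qed
    define S' where "S' = S \<inter> {t1<..}"
    define T'' where "T'' = T' - {t1}"
    have split: "S = {t0<..<t1} \<union> S'" "{t0<..<t1} \<inter> S' = {}"
    proof -
      have "x \<in> {t0<..<t1} \<union> S'" if "x \<in> S" for x
      proof -
        have "\<not> x < t0" using that \<open>{..<t0} \<inter> S = {}\<close> by auto
        moreover have "x \<noteq> t0" "x \<noteq> t1" using that t0S t1S by auto
        ultimately show ?thesis using that by (auto simp: S'_def)
      qed
      moreover have "S' \<subseteq> S" by (simp add: S'_def)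
      ultimately show "S = {t0<..<t1} \<union> S'" using sub01 by blast
    qed (auto simp: S'_def)
    have openS': "open S'" using less.prems(1) by (auto simp: S'_def)
    have bS': "bounded S'" using less.prems(2) by (auto simp: S'_def intro: bounded_subset)
    have "frontier S' \<subseteq> T''"
    proof
      fix x assume "x \<in> frontier S'"
      then have x: "x \<in> closure S'" "x \<notin> S'" using openS' by (auto simp: frontier_def interior_open)
      have "S' \<subseteq> S" "S' \<subseteq> {t1<..}" by (auto simp: S'_def)
      then have "x \<in> closure S" "x \<in> closure {t1<..}" using x(1) closure_mono by blast+
      then have "x \<ge> t1" by simp
      moreover have "x \<noteq> t1"
      proof
        assume "x = t1"
        moreover have "{t1 - \<eta><..<t1 + \<eta>} \<inter> S' = {}" using \<eta>2 by (fastforce simp: S'_def)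
        moreover have "t1 \<in> {t1 - \<eta><..<t1 + \<eta>}" using \<eta>(1) by simp
        ultimately show False using x(1) by (metis IntI empty_iff open_Int_closure_eq_empty open_greaterThanLessThan)
      qed
      ultimately have "x > t1" by simp
      then have "x \<notin> S" using x(2) by (auto simp: S'_def)
      then have "x \<in> T" using \<open>x \<in> closure S\<close> less.prems(1,4) by (auto simp: frontier_def interior_open)
      then show "x \<in> T''" using \<open>x > t1\<close> t01 by (auto simp: T''_def T'_def)
    qed
    have cross'': "\<exists>\<delta>>0. (s t = 1 \<and> {t-\<delta><..<t} \<subseteq> S' \<and> {t<..<t+\<delta>} \<inter> S' = {}) \<or>
       (s t = -1 \<and> {t-\<delta><..<t} \<inter> S' = {} \<and> {t<..<t+\<delta>} \<subseteq> S')" if t: "t \<in> T''" for t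
    proof -
      have tt: "t > t1" "t \<in> T" using t t1(2)[of t] by (auto simp: T''_def T'_def)
      obtain d where d: "d > 0" "(s t = 1 \<and> {t-d<..<t} \<subseteq> S \<and> {t<..<t+d} \<inter> S = {}) \<or>
       (s t = -1 \<and> {t-d<..<t} \<inter> S = {} \<and> {t<..<t+d} \<subseteq> S)" using less.prems(5)[OF tt(2)] by blast
      define d' where "d' = min d (t - t1)"
      have "d' > 0" "{t-d'<..<t} \<subseteq> {t-d<..<t} \<inter> {t1<..}" "{t<..<t+d'} \<subseteq> {t<..<t+d} \<inter> {t1<..}"
        using d(1) tt by (auto simp: d'_def)
      then show ?thesis using d(2) unfolding S'_def by blast
    qed
    have "card T'' < card T"
      using less.prems(3) t0(1) by (intro psubset_card_mono) (auto simp: T''_def T'_def)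
    from less.hyps[OF this openS' bS' _ \<open>frontier S' \<subseteq> T''\<close> cross'']
    have IH: "(\<integral>t. indicator S' t * f t \<partial>lborel) = (\<Sum>t\<in>T''. s t * F t)"
      using less.prems(3) by (auto simp: T''_def T'_def)
    have int: "integrable lborel (\<lambda>t. indicator U t * f t)" if "bounded U" "open U" for U
    proof -
      obtain a b where "U \<subseteq> {a..b}" using \<open>bounded U\<close> by (metis bounded_subset_cbox_symmetric box_real(2))
      moreover have "set_integrable lborel {a..b} f"
        using f continuous_on_subset by (intro borel_integrable_atLeastAtMost') blast
      moreover have "U \<in> sets lborel" using \<open>open U\<close> by simp
      ultimately have "set_integrable lborel U f" using set_integrable_subset by blast
      then show ?thesis by (simp add: set_integrable_def)
    qed
    have "(\<integral>t. indicator {t0<..<t1} t * f t \<partial>lborel) = (\<integral>t. indicator {t0..t1} t *\<^sub>R f t \<partial>lborel)"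
    proof (rule integral_cong_AE)
      have [measurable]: "f \<in> borel_measurable borel" using f by (rule borel_measurable_continuous_onI)
      show "(\<lambda>t. indicator {t0<..<t1} t * f t) \<in> borel_measurable lborel"
        "(\<lambda>t. indicator {t0..t1} t *\<^sub>R f t) \<in> borel_measurable lborel" by measurable
      show "AE t in lborel. indicator {t0<..<t1} t * f t = indicator {t0..t1} t *\<^sub>R f t"
        using AE_lborel_singleton[of t0] AE_lborel_singleton[of t1] by eventually_elim (auto simp: indicator_def)
    qed
    also have "\<dots> = F t1 - F t0"
      using t01 F f by (intro integral_FTC_atLeastAtMost)
        (auto intro: continuous_on_subset simp: has_real_derivative_iff_has_vector_derivative has_vector_derivative_at_within)
    finally have I01: "(\<integral>t. indicator {t0<..<t1} t * f t \<partial>lborel) = F t1 - F t0" .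
    have "(\<integral>t. indicator S t * f t \<partial>lborel)
       = (\<integral>t. indicator {t0<..<t1} t * f t + indicator S' t * f t \<partial>lborel)"
      by (rule Bochner_Integration.integral_cong) (use split in \<open>auto simp: indicator_def\<close>)
    also have "\<dots> = F t1 - F t0 + (\<Sum>t\<in>T''. s t * F t)"
      using int[OF bS' openS'] int[of "{t0<..<t1}"] by (simp add: I01 IH)
    also have "\<dots> = (\<Sum>t\<in>T. s t * F t)"
    proof -
      have "T = insert t0 (insert t1 T'')" "t0 \<notin> insert t1 T''" "t1 \<notin> T''" "finite T''"
        using t0(1) t1(1) less.prems(3) t01 by (auto simp: T''_def T'_def)
      then show ?thesis using \<delta>2 \<eta>2 by simp
    qed
    finally show ?thesis .
  qed
qed

text \<open>The exceptional sets of the proof, mainly the rims of faces. Almost every line in a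
  given direction misses such a set, and it fits into a closed null set whose removal keeps a
  connected open set connected.\<close>

definition codim2 :: "'a::euclidean_space set \<Rightarrow> bool" where
  "codim2 S \<longleftrightarrow> (\<exists>F. finite F \<and> S \<subseteq> \<Union>F \<and> (\<forall>L\<in>F. aff_dim L + 2 \<le> int DIM('a)))"

lemma AE_hyperplane:
  fixes a :: "'a::euclidean_space"
  assumes "a \<noteq> 0"
  shows "AE x in lborel. a \<bullet> x \<noteq> b"
proof -
  have "{x. a \<bullet> x = b} \<in> null_sets lebesgue"
    using negligible_hyperplane[of a b] assms by (simp add: negligible_iff_null_sets)
  moreover have "{x. a \<bullet> x = b} \<in> sets borel" by (intro borel_closed closed_hyperplane)
  ultimately have "{x. a \<bullet> x = b} \<in> null_sets lborel" by (auto simp: null_sets_def)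
  then show ?thesis by (rule AE_I') auto
qed

text \<open>A piece \<open>L\<close> of affine dimension at most \<open>DIM('a) - 2\<close> can be
  enlarged by one point \<open>p + e\<close> and still fits into a hyperplane. That hyperplane is
  parallel to \<open>e\<close>, so it contains every line in direction \<open>e\<close> that meets
  \<open>L\<close>, and it is null.\<close>

lemma AE_line_avoids:
  fixes e :: "'a::euclidean_space"
  assumes "codim2 S"
  shows "AE x in lborel. \<forall>t. x + t *\<^sub>R e \<notin> S"
proof -
  obtain F where F: "finite F" "S \<subseteq> \<Union>F" "\<And>L. L \<in> F \<Longrightarrow> aff_dim L + 2 \<le> int DIM('a)"
    using assms by (auto simp: codim2_def)
  have "AE x in lborel. \<forall>t. x + t *\<^sub>R e \<notin> L" if L: "L \<in> F" for L
  proof (cases "L = {}")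
    case False
    then obtain p where p: "p \<in> L" by auto
    have "aff_dim (insert (p + e) L) < DIM('a)" using F(3)[OF L] by (simp add: aff_dim_insert)
    then obtain a b where ab: "a \<noteq> 0" "insert (p + e) L \<subseteq> {x. a \<bullet> x = b}"
      by (rule aff_lowdim_subset_hyperplane)
    then have ae: "a \<bullet> e = 0" using p by (auto simp: inner_right_distrib)
    have "a \<bullet> x = b" if "x + t *\<^sub>R e \<in> L" for x t
    proof -
      have "a \<bullet> (x + t *\<^sub>R e) = b" using that ab by auto
      then show ?thesis using ae by (simp add: inner_right_distrib)
    qed
    then show ?thesis using AE_hyperplane[OF ab(1), of b] by (rule_tac eventually_mono) auto
  qed simp
  then have "AE x in lborel. \<forall>L\<in>F. \<forall>t. x + t *\<^sub>R e \<notin> L" using F(1) by (simp add: AE_ball_countable countable_finite)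
  then show ?thesis by eventually_elim (use F(2) in blast)
qed

lemma cell_face_subset: "cell_face K \<sigma> n b \<Longrightarrow> \<sigma> \<subseteq> {x. n \<bullet> x = b}"
  by (auto simp: cell_face_def dest: openin_imp_subset)

lemma cell_face_borel:
  fixes \<sigma> :: "'a::euclidean_space set"
  assumes "cell_face K \<sigma> n b"
  shows "\<sigma> \<in> sets borel"
proof -
  obtain U where "open U" "\<sigma> = {x. n \<bullet> x = b} \<inter> U" using assms by (auto simp: cell_face_def openin_open)
  then show ?thesis using borel_closed[OF closed_hyperplane[of n b]] by auto
qed

lemma face_measure_hyperplane:
  assumes "cell_face K \<sigma> n b" "\<sigma> \<noteq> {}"
  shows "face_measure \<sigma> = affine_lborel {x. n \<bullet> x = b}"
proof -
  obtain U where U: "open U" "\<sigma> = {x. n \<bullet> x = b} \<inter> U" using assms by (auto simp: cell_face_def openin_open)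
  then have "affine hull \<sigma> = affine hull {x. n \<bullet> x = b}"
    using affine_hull_affine_Int_open[of "{x. n \<bullet> x = b}" U] assms(2) affine_hyperplane by metis
  also have "\<dots> = {x. n \<bullet> x = b}" by (intro affine_hull_eq[THEN iffD2] affine_hyperplane)
  finally show ?thesis by (simp add: face_measure_def)
qed

text \<open>On a line that misses all rims and lies in no face hyperplane, every frontier point is a
  transversal crossing of exactly one face: outward where \<open>e \<bullet> n \<sigma>\<close> is
  positive, inward where it is negative.\<close>

lemma line_integral_cell:
  fixes K :: "'a::euclidean_space set" and f :: "'a \<Rightarrow> real" and g :: "'a \<Rightarrow> 'a"
  assumes K: "open K" "bounded K" and Fs: "finite Fs" "pairwise disjnt Fs"
    and fr: "frontier K = (\<Union>\<sigma>\<in>Fs. closure \<sigma>)"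
    and cf: "\<And>\<sigma>. \<sigma> \<in> Fs \<Longrightarrow> cell_face K \<sigma> (n \<sigma>) (b \<sigma>)"
    and f: "\<And>x. (f has_derivative (\<lambda>h. g x \<bullet> h)) (at x)" and g: "continuous_on UNIV g"
    and e: "norm e = 1"
    and avoid: "\<And>\<sigma> t. \<sigma> \<in> Fs \<Longrightarrow> x + t *\<^sub>R e \<notin> closure \<sigma> - \<sigma>"
    and par: "\<And>\<sigma>. \<sigma> \<in> Fs \<Longrightarrow> e \<bullet> n \<sigma> = 0 \<Longrightarrow> n \<sigma> \<bullet> x \<noteq> b \<sigma>"
  defines "pr \<equiv> \<lambda>\<sigma>. x + ((b \<sigma> - n \<sigma> \<bullet> x) / (e \<bullet> n \<sigma>)) *\<^sub>R e"
  shows "(\<integral>t. indicator K (x + t *\<^sub>R e) * (g (x + t *\<^sub>R e) \<bullet> e) \<partial>lborel)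
    = (\<Sum>\<sigma>\<in>Fs. sgn (e \<bullet> n \<sigma>) * (indicator \<sigma> (pr \<sigma>) * f (pr \<sigma>)))"
proof -
  define S where "S = {t. x + t *\<^sub>R e \<in> K}"
  define \<tau> where "\<tau> \<sigma> = (b \<sigma> - n \<sigma> \<bullet> x) / (e \<bullet> n \<sigma>)" for \<sigma>
  define Z where "Z = {\<sigma>\<in>Fs. e \<bullet> n \<sigma> \<noteq> 0 \<and> pr \<sigma> \<in> \<sigma>}"
  have pr: "pr \<sigma> = x + \<tau> \<sigma> *\<^sub>R e" for \<sigma> by (simp add: pr_def \<tau>_def)
  have finZ: "finite Z" using Fs by (simp add: Z_def)
  \<comment> \<open>Disjoint faces are not met at the same parameter, so the sign of a crossing can
    be read off from the parameter alone.\<close>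
  have inj: "inj_on \<tau> Z"
  proof (rule inj_onI)
    fix \<sigma> \<sigma>' assume "\<sigma> \<in> Z" "\<sigma>' \<in> Z" "\<tau> \<sigma> = \<tau> \<sigma>'"
    then have "x + \<tau> \<sigma> *\<^sub>R e \<in> \<sigma> \<inter> \<sigma>'" "\<sigma> \<in> Fs" "\<sigma>' \<in> Fs" by (auto simp: Z_def pr)
    then show "\<sigma> = \<sigma>'" using Fs(2) by (auto simp: pairwise_def disjnt_def)
  qed
  define s where "s t = sgn (e \<bullet> n (the_inv_into Z \<tau> t))" for t
  have s: "s (\<tau> \<sigma>) = sgn (e \<bullet> n \<sigma>)" if "\<sigma> \<in> Z" for \<sigma>
    using that by (simp add: s_def the_inv_into_f_f[OF inj])
  have contl: "continuous_on UNIV (\<lambda>t. x + t *\<^sub>R e)" by (intro continuous_intros)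
  have "S = (\<lambda>t. x + t *\<^sub>R e) -` K" by (auto simp: S_def)
  then have opS: "open S" using open_vimage[OF K(1) contl] by simp
  have bS: "bounded S"
  proof -
    obtain R where R: "\<And>y. y \<in> K \<Longrightarrow> norm y \<le> R" using K(2) by (auto simp: bounded_iff)
    have "\<bar>t\<bar> \<le> R + norm x" if "t \<in> S" for t
    proof -
      have "norm (t *\<^sub>R e) \<le> norm (x + t *\<^sub>R e) + norm x" by (metis add_diff_cancel_left' norm_triangle_ineq4)
      then show ?thesis using R[of "x + t *\<^sub>R e"] that e by (simp add: S_def)
    qed
    then show ?thesis by (auto simp: bounded_iff)
  qed
  have frS: "frontier S \<subseteq> \<tau> ` Z"
  proof
    fix t assume "t \<in> frontier S"
    then have t: "t \<in> closure S" "t \<notin> S" using opS by (auto simp: frontier_def interior_open)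
    have "(\<lambda>t. x + t *\<^sub>R e) ` closure S \<subseteq> closure K"
      using contl by (intro image_closure_subset[where T="closure K"]) (auto simp: S_def intro: continuous_on_subset closure_subset[THEN subsetD])
    then have "x + t *\<^sub>R e \<in> frontier K" using t K(1) by (auto simp: frontier_def interior_open S_def)
    then obtain \<sigma> where \<sigma>: "\<sigma> \<in> Fs" "x + t *\<^sub>R e \<in> closure \<sigma>" using fr by auto
    then have mem: "x + t *\<^sub>R e \<in> \<sigma>" using avoid by blast
    then have nb: "n \<sigma> \<bullet> (x + t *\<^sub>R e) = b \<sigma>" using cell_face_subset[OF cf[OF \<sigma>(1)]] by auto
    then have ne: "e \<bullet> n \<sigma> \<noteq> 0" using par[OF \<sigma>(1)] by (auto simp: inner_right_distrib inner_commute)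
    then have "t = \<tau> \<sigma>" using nb by (simp add: \<tau>_def inner_right_distrib inner_commute field_simps)
    then show "t \<in> \<tau> ` Z" using \<sigma> mem ne by (auto simp: Z_def pr)
  qed
  have cross: "\<exists>\<delta>>0. (s t = 1 \<and> {t-\<delta><..<t} \<subseteq> S \<and> {t<..<t+\<delta>} \<inter> S = {}) \<or>
       (s t = -1 \<and> {t-\<delta><..<t} \<inter> S = {} \<and> {t<..<t+\<delta>} \<subseteq> S)" if tZ: "t \<in> \<tau> ` Z" for t
  proof -
    obtain \<sigma> where \<sigma>: "\<sigma> \<in> Z" "t = \<tau> \<sigma>" using tZ by auto
    then have "x + t *\<^sub>R e \<in> \<sigma>" "\<sigma> \<in> Fs" and ne: "e \<bullet> n \<sigma> \<noteq> 0" by (auto simp: Z_def pr)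
    then obtain \<rho> where \<rho>: "\<rho> > 0" "\<And>y. y \<in> ball (x + t *\<^sub>R e) \<rho> \<Longrightarrow> y \<in> K \<longleftrightarrow> n \<sigma> \<bullet> (y - (x + t *\<^sub>R e)) < 0"
      using cf[of \<sigma>] unfolding cell_face_def by blast
    have mem: "u \<in> S \<longleftrightarrow> (u - t) * (e \<bullet> n \<sigma>) < 0" if "\<bar>u - t\<bar> < \<rho>" for u
    proof -
      have eq: "(x + u *\<^sub>R e) - (x + t *\<^sub>R e) = (u - t) *\<^sub>R e" by (simp add: algebra_simps)
      have "dist (x + u *\<^sub>R e) (x + t *\<^sub>R e) < \<rho>" unfolding dist_norm eq using that e by simp
      then have "x + u *\<^sub>R e \<in> ball (x + t *\<^sub>R e) \<rho>" by (metis dist_commute mem_ball)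
      from \<rho>(2)[OF this] show ?thesis unfolding eq by (simp add: S_def inner_commute)
    qed
    show ?thesis
    proof (cases "e \<bullet> n \<sigma> > 0")
      case True
      then have "s t = 1" using s \<sigma> by simp
      moreover have "{t-\<rho><..<t} \<subseteq> S" "{t<..<t+\<rho>} \<inter> S = {}" using mem True
        by (auto simp: mult_less_0_iff abs_less_iff)
      ultimately show ?thesis using \<rho>(1) by blast
    next
      case False
      then have neg: "e \<bullet> n \<sigma> < 0" using ne by simp
      then have "s t = -1" using s \<sigma> by simp
      moreover have "{t-\<rho><..<t} \<inter> S = {}" "{t<..<t+\<rho>} \<subseteq> S" using mem neg
        by (auto simp: mult_less_0_iff abs_less_iff)
      ultimately show ?thesis using \<rho>(1) by blast
    qed
  qed
  have der: "((\<lambda>t. f (x + t *\<^sub>R e)) has_real_derivative g (x + t *\<^sub>R e) \<bullet> e) (at t)" for t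
  proof -
    have "((\<lambda>t. x + t *\<^sub>R e) has_derivative (\<lambda>h. h *\<^sub>R e)) (at t)" by (auto intro!: derivative_eq_intros)
    from has_derivative_compose[OF this f] show ?thesis
      by (simp add: has_field_derivative_def mult_commute_abs)
  qed
  have "(\<integral>t. indicator K (x + t *\<^sub>R e) * (g (x + t *\<^sub>R e) \<bullet> e) \<partial>lborel)
     = (\<integral>t. indicator S t * (g (x + t *\<^sub>R e) \<bullet> e) \<partial>lborel)"
    by (rule Bochner_Integration.integral_cong) (auto simp: S_def indicator_def)
  also have "\<dots> = (\<Sum>t\<in>\<tau> ` Z. s t * f (x + t *\<^sub>R e))"
    by (rule integral_derivative_open_set[OF opS bS _ frS der _ cross])
       (use finZ in \<open>auto intro!: continuous_on_inner continuous_on_compose2[OF g] continuous_intros\<close>)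
  also have "\<dots> = (\<Sum>\<sigma>\<in>Z. sgn (e \<bullet> n \<sigma>) * f (pr \<sigma>))"
    by (subst sum.reindex[OF inj]) (auto simp: s pr intro!: sum.cong)
  also have "\<dots> = (\<Sum>\<sigma>\<in>Fs. sgn (e \<bullet> n \<sigma>) * (indicator \<sigma> (pr \<sigma>) * f (pr \<sigma>)))"
    using Fs(1) by (intro sum.mono_neutral_cong_left) (auto simp: Z_def indicator_def)
  finally show ?thesis .
qed

lemma set_integral_lebesgue_borel:
  fixes f :: "'a::euclidean_space \<Rightarrow> 'b::{banach, second_countable_topology}"
  assumes [measurable]: "S \<in> sets borel" "f \<in> borel_measurable borel"
  shows "(LINT x:S|lebesgue. f x) = (\<integral>x. indicator S x *\<^sub>R f x \<partial>lborel)"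
  unfolding set_lebesgue_integral_def by (rule integral_completion) measurable

text \<open>The identity on lines is averaged with the slab weight. The sign
  \<open>sgn (e \<bullet> n \<sigma>)\<close> of a crossing and the slicing factor
  \<open>\<bar>e \<bullet> n \<sigma>\<bar>\<close> multiply to
  \<open>e \<bullet> n \<sigma>\<close>; faces parallel to \<open>e\<close> contribute nothing on
  either side.\<close>

lemma divergence_directional:
  fixes K :: "(real^'n) set" and f :: "real^'n \<Rightarrow> real" and g :: "real^'n \<Rightarrow> real^'n"
  assumes K: "open K" "bounded K" and Fs: "finite Fs" "pairwise disjnt Fs"
    and fr: "frontier K = (\<Union>\<sigma>\<in>Fs. closure \<sigma>)"
    and cf: "\<And>\<sigma>. \<sigma> \<in> Fs \<Longrightarrow> cell_face K \<sigma> (n \<sigma>) (b \<sigma>)" and ne: "\<And>\<sigma>. \<sigma> \<in> Fs \<Longrightarrow> \<sigma> \<noteq> {}"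
    and rim: "\<And>\<sigma>. \<sigma> \<in> Fs \<Longrightarrow> codim2 (closure \<sigma> - \<sigma>)"
    and f: "\<And>x. (f has_derivative (\<lambda>h. g x \<bullet> h)) (at x)" and g: "continuous_on UNIV g"
  shows "(LINT x:K|lebesgue. g x \<bullet> e) = (\<Sum>\<sigma>\<in>Fs. (e \<bullet> n \<sigma>) * (LINT y:\<sigma>|face_measure \<sigma>. f y))"
proof -
  have unit: "(LINT x:K|lebesgue. g x \<bullet> e) = (\<Sum>\<sigma>\<in>Fs. (e \<bullet> n \<sigma>) * (LINT y:\<sigma>|face_measure \<sigma>. f y))"
    if e: "norm e = 1" for e
  proof -
    have contf: "continuous_on UNIV f" using f by (meson continuous_at_imp_continuous_on has_derivative_continuous)
    have [measurable]: "f \<in> borel_measurable borel" "g \<in> borel_measurable borel"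
      using contf g by (auto intro: borel_measurable_continuous_onI)
    have [measurable]: "K \<in> sets borel" using K by auto
    define F where "F x = indicator K x * (g x \<bullet> e)" for x
    have compK: "compact (closure K)" using K(2) by simp
    have intF: "integrable lborel F"
    proof -
      have "integrable lborel (\<lambda>x. indicator (closure K) x *\<^sub>R (g x \<bullet> e))"
        using g by (intro borel_integrable_compact compK continuous_on_inner) (auto intro: continuous_on_subset)
      then have "set_integrable lborel (closure K) (\<lambda>x. g x \<bullet> e)" by (simp add: set_integrable_def)
      then have "set_integrable lborel K (\<lambda>x. g x \<bullet> e)"
        by (rule set_integrable_subset) (auto simp: closure_subset)
      then show ?thesis by (simp add: set_integrable_def F_def[abs_def])
    qed
    have "bounded (f ` closure K)" using compK contf
      by (intro compact_imp_bounded compact_continuous_image) (auto intro: continuous_on_subset)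
    then obtain C where C: "\<And>y. y \<in> closure K \<Longrightarrow> \<bar>f y\<bar> \<le> C" by (auto simp: bounded_iff)
    have subK: "\<sigma> \<subseteq> closure K" if "\<sigma> \<in> Fs" for \<sigma>
      using that fr closure_subset[of \<sigma>] by (auto simp: frontier_def)
    define pr where "pr \<sigma> x = x + ((b \<sigma> - n \<sigma> \<bullet> x) / (e \<bullet> n \<sigma>)) *\<^sub>R e" for \<sigma> x
    define G where "G \<sigma> x = indicator {0..1} (x \<bullet> e) * (indicator \<sigma> (pr \<sigma> x) * f (pr \<sigma> x))" for \<sigma> x
    have G: "integrable lborel (\<lambda>x. sgn (e \<bullet> n \<sigma>) * G \<sigma> x)"
       "(\<integral>x. sgn (e \<bullet> n \<sigma>) * G \<sigma> x \<partial>lborel) = (e \<bullet> n \<sigma>) * (LINT y:\<sigma>|face_measure \<sigma>. f y)" if \<sigma>: "\<sigma> \<in> Fs" for \<sigma>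
    proof -
      have "integrable lborel (\<lambda>x. sgn (e \<bullet> n \<sigma>) * G \<sigma> x) \<and>
        (\<integral>x. sgn (e \<bullet> n \<sigma>) * G \<sigma> x \<partial>lborel) = (e \<bullet> n \<sigma>) * (LINT y:\<sigma>|face_measure \<sigma>. f y)"
      proof (cases "e \<bullet> n \<sigma> = 0")
        case False
        have nrm: "norm (n \<sigma>) = 1" using cf[OF \<sigma>] by (simp add: cell_face_def)
        have bd: "bounded \<sigma>" using subK[OF \<sigma>] compK by (meson bounded_subset compact_imp_bounded)
        note E = face_integral_along_lines[OF nrm False e cell_face_borel[OF cf[OF \<sigma>]] bd, of f C "b \<sigma>"]
        have "integrable lborel (G \<sigma>)" "(\<integral>x. G \<sigma> x \<partial>lborel) = \<bar>e \<bullet> n \<sigma>\<bar> * (LINT y:\<sigma>|face_measure \<sigma>. f y)"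
          using E C subK[OF \<sigma>] by (auto simp: G_def[abs_def] pr_def face_measure_hyperplane[OF cf[OF \<sigma>] ne[OF \<sigma>]])
        then show ?thesis by (simp add: mult.assoc[symmetric] sgn_mult_abs)
      qed simp
      then show "integrable lborel (\<lambda>x. sgn (e \<bullet> n \<sigma>) * G \<sigma> x)"
       "(\<integral>x. sgn (e \<bullet> n \<sigma>) * G \<sigma> x \<partial>lborel) = (e \<bullet> n \<sigma>) * (LINT y:\<sigma>|face_measure \<sigma>. f y)" by auto
    qed
    have 1: "AE x in lborel. \<forall>\<sigma>\<in>Fs. \<forall>t. x + t *\<^sub>R e \<notin> closure \<sigma> - \<sigma>"
      using AE_line_avoids[OF rim] Fs(1) by (simp add: AE_ball_countable countable_finite)
    have "AE x in lborel. n \<sigma> \<bullet> x \<noteq> b \<sigma>" if "\<sigma> \<in> Fs" for \<sigma>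
      using cf[OF that] by (intro AE_hyperplane) (auto simp: cell_face_def)
    then have 2: "AE x in lborel. \<forall>\<sigma>\<in>Fs. n \<sigma> \<bullet> x \<noteq> b \<sigma>"
      using Fs(1) by (simp add: AE_ball_countable countable_finite)
    have "(LINT x:K|lebesgue. g x \<bullet> e) = (\<integral>x. F x \<partial>lborel)"
      by (subst set_integral_lebesgue_borel) (auto simp: F_def[abs_def])
    also have "\<dots> = (\<integral>x. indicator {0..1} (x \<bullet> e) * (\<integral>t. F (x + t *\<^sub>R e) \<partial>lborel) \<partial>lborel)"
      by (rule cell_integral_along_lines(2)[OF e intF, symmetric])
    also have "\<dots> = (\<integral>x. (\<Sum>\<sigma>\<in>Fs. sgn (e \<bullet> n \<sigma>) * G \<sigma> x) \<partial>lborel)"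
    proof (rule integral_cong_AE)
      show "(\<lambda>x. indicator {0..1} (x \<bullet> e) * (\<integral>t. F (x + t *\<^sub>R e) \<partial>lborel)) \<in> borel_measurable lborel"
        using cell_integral_along_lines(1)[OF e intF] by simp
      show "(\<lambda>x. \<Sum>\<sigma>\<in>Fs. sgn (e \<bullet> n \<sigma>) * G \<sigma> x) \<in> borel_measurable lborel"
        by (intro borel_measurable_sum borel_measurable_integrable G(1))
      show "AE x in lborel. indicator {0..1} (x \<bullet> e) * (\<integral>t. F (x + t *\<^sub>R e) \<partial>lborel) = (\<Sum>\<sigma>\<in>Fs. sgn (e \<bullet> n \<sigma>) * G \<sigma> x)"
        using 1 2
      proof eventually_elim
        case (elim x)
        have "(\<integral>t. F (x + t *\<^sub>R e) \<partial>lborel) = (\<Sum>\<sigma>\<in>Fs. sgn (e \<bullet> n \<sigma>) * (indicator \<sigma> (pr \<sigma> x) * f (pr \<sigma> x)))"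
          unfolding F_def pr_def
          by (rule line_integral_cell[OF K Fs fr cf f g e]) (use elim in auto)
        then show ?case by (simp add: G_def sum_distrib_left mult_ac)
      qed
    qed
    also have "\<dots> = (\<Sum>\<sigma>\<in>Fs. (e \<bullet> n \<sigma>) * (LINT y:\<sigma>|face_measure \<sigma>. f y))"
      using G by (subst Bochner_Integration.integral_sum) auto
    finally show ?thesis .
  qed
  show ?thesis
  proof (cases "e = 0")
    case False
    define u where "u = e /\<^sub>R norm e"
    have u: "norm u = 1" "e = norm e *\<^sub>R u" using False by (auto simp: u_def)
    have "(LINT x:K|lebesgue. g x \<bullet> e) = norm e * (LINT x:K|lebesgue. g x \<bullet> u)"
      by (subst u(2)) (simp add: set_lebesgue_integral_def mult.left_commute)
    also have "\<dots> = (\<Sum>\<sigma>\<in>Fs. (e \<bullet> n \<sigma>) * (LINT y:\<sigma>|face_measure \<sigma>. f y))"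
      unfolding unit[OF u(1)] sum_distrib_left by (subst (2) u(2)) (simp add: mult_ac)
    finally show ?thesis .
  qed (simp add: set_lebesgue_integral_def)
qed

section \<open>Connectivity of the mesh\<close>

text \<open>A rim point lies in one of finitely many polytopes. If that polytope is of full
  dimension in the hyperplane, its relative interior belongs to the face, so the point is on one of
  its facets. Otherwise the polytope itself is of low dimension.\<close>

lemma codim2_rim:
  fixes \<sigma> :: "'a::euclidean_space set"
  assumes a: "a \<noteq> 0" and poly: "polytopal_in {x. a \<bullet> x = b} \<sigma>"
  shows "codim2 (closure \<sigma> - \<sigma>)"
proof -
  define H where "H = {x. a \<bullet> x = b}"
  obtain F where F: "finite F" "\<And>P. P \<in> F \<Longrightarrow> polytope P" "\<And>P. P \<in> F \<Longrightarrow> P \<subseteq> H"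
    and \<sigma>: "\<sigma> = top_of_set H interior_of (\<Union>F)"
    using poly unfolding polytopal_in_def H_def by auto
  have affH: "affine H" and dimH: "aff_dim H = int DIM('a) - 1"
    using a by (auto simp: H_def affine_hyperplane aff_dim_hyperplane)
  have "closed (\<Union>F)" using F(1,2) polytope_imp_closed by (intro closed_Union) auto
  moreover have "\<sigma> \<subseteq> \<Union>F" unfolding \<sigma> by (rule interior_of_subset)
  ultimately have cl: "closure \<sigma> \<subseteq> \<Union>F" by (rule closure_minimal[rotated])
  define Q where "Q = {P\<in>F. aff_dim P + 2 \<le> int DIM('a)} \<union> (\<Union>P\<in>F. {G. G facet_of P \<and> aff_dim G + 2 \<le> int DIM('a)})"
  have "x \<in> \<Union>Q" if x: "x \<in> closure \<sigma>" "x \<notin> \<sigma>" for x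
  proof -
    obtain P where P: "P \<in> F" "x \<in> P" using x(1) cl by auto
    have le: "aff_dim P \<le> aff_dim H" using F(3)[OF P(1)] by (rule aff_dim_subset)
    show ?thesis
    proof (cases "aff_dim P = aff_dim H")
      case True
      have "affine hull P = affine hull H" using F(3)[OF P(1)] True by (rule aff_dim_eq_full_gen[THEN iffD1])
      then have hull: "affine hull P = H" using affH by simp
      have "openin (top_of_set H) (rel_interior P)" using openin_rel_interior[of P] hull by simp
      moreover have "rel_interior P \<subseteq> \<Union>F" using rel_interior_subset P by blast
      ultimately have "rel_interior P \<subseteq> \<sigma>" unfolding \<sigma> by (rule interior_of_maximal[rotated])
      then have "x \<in> rel_frontier P"
        using x P closure_subset by (auto simp: rel_frontier_def)
      then obtain G where G: "G facet_of P" "x \<in> G"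
        using rel_frontier_of_polyhedron[OF polytope_imp_polyhedron[OF F(2)[OF P(1)]]] by auto
      then have "aff_dim G + 2 \<le> int DIM('a)" using True dimH by (auto simp: facet_of_def)
      then show ?thesis using G P by (auto simp: Q_def)
    next
      case False
      then have "aff_dim P + 2 \<le> int DIM('a)" using le dimH by linarith
      then show ?thesis using P by (auto simp: Q_def)
    qed
  qed
  moreover have "finite Q"
  proof -
    have "finite {G. G facet_of P \<and> aff_dim G + 2 \<le> int DIM('a)}" if "P \<in> F" for P
      by (rule finite_subset[OF _ finite_polyhedron_facets[OF polytope_imp_polyhedron[OF F(2)[OF that]]]]) auto
    then show ?thesis unfolding Q_def using F(1) by auto
  qed
  moreover have "\<forall>L\<in>Q. aff_dim L + 2 \<le> int DIM('a)" by (auto simp: Q_def)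
  ultimately show ?thesis unfolding codim2_def by blast
qed

text \<open>Two points \<open>p\<close> and \<open>q\<close> are joined through a third point
  \<open>z\<close> outside the affine hulls of \<open>L\<close> with \<open>p\<close> and of
  \<open>L\<close> with \<open>q\<close>: a segment from \<open>p\<close> to \<open>z\<close> that
  met \<open>L\<close> would put \<open>z\<close> into the first hull. Such a \<open>z\<close>
  exists because both hulls are null.\<close>

lemma connected_ball_diff_codim2:
  fixes L :: "'a::euclidean_space set"
  assumes L: "aff_dim L + 2 \<le> int DIM('a)"
  shows "connected (ball x r - L)"
proof (cases "r > 0")
  case True
  have avoid: "closed_segment p z \<inter> L = {}" if "p \<notin> L" "z \<notin> affine hull (insert p L)" for p z
  proof (rule ccontr)
    assume "\<not> ?thesis"
    then obtain y u where y: "y \<in> L" "y = (1 - u) *\<^sub>R p + u *\<^sub>R z" by (auto simp: closed_segment_def)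
    then have "u \<noteq> 0" using that(1) by auto
    then have "(1 - 1 / u) *\<^sub>R p + (1 / u) *\<^sub>R y = z"
      unfolding y(2) by (simp add: algebra_simps diff_divide_distrib)
    moreover have "(1 - 1 / u) *\<^sub>R p + (1 / u) *\<^sub>R y \<in> affine hull (insert p L)"
      by (rule mem_affine[OF affine_affine_hull]) (use y(1) in \<open>auto intro: hull_inc\<close>)
    ultimately show False using that(2) by simp
  qed
  have hyp: "negligible (affine hull (insert p L))" for p
  proof -
    have "aff_dim (affine hull (insert p L)) < DIM('a)" using L by (simp add: aff_dim_insert)
    then obtain a b where "a \<noteq> 0" "affine hull (insert p L) \<subseteq> {x. a \<bullet> x = b}" by (rule aff_lowdim_subset_hyperplane)
    then show ?thesis using negligible_hyperplane negligible_subset by blast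
  qed
  have "\<exists>T. connected T \<and> T \<subseteq> ball x r - L \<and> p \<in> T \<and> q \<in> T" if pq: "p \<in> ball x r - L" "q \<in> ball x r - L" for p q
  proof -
    have "\<not> ball x r \<subseteq> affine hull (insert p L) \<union> affine hull (insert q L)"
      using hyp[of p] hyp[of q] True open_not_negligible[of "ball x r"]
      by (metis negligible_Un negligible_subset open_ball centre_in_ball empty_iff)
    then obtain z where z: "z \<in> ball x r" "z \<notin> affine hull (insert p L)" "z \<notin> affine hull (insert q L)" by blast
    let ?T = "closed_segment p z \<union> closed_segment q z"
    have "connected ?T" by (rule connected_Un) auto
    moreover have "?T \<subseteq> ball x r - L"
      using avoid[of p z] avoid[of q z] pq z convex_contains_segment[of "ball x r"] convex_ball[of x r] by blast
    ultimately show ?thesis by (intro exI[of _ ?T]) auto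
  qed
  then have "connected_component (ball x r - L) p q" if "p \<in> ball x r - L" "q \<in> ball x r - L" for p q
    using that by (simp only: connected_component_def)
  then show ?thesis by (subst connected_iff_connected_component) blast
next
  case False
  then have "ball x r = {}" by simp
  then show ?thesis by (metis connected_empty empty_Diff)
qed

text \<open>A separation of \<open>S - L\<close> extends to one of \<open>S\<close>. Each small ball
  minus \<open>L\<close> is connected and so lies on one side, and \<open>A\<close> assigns the
  centre to that side. The two sides stay disjoint because \<open>L\<close> contains no
  ball.\<close>

lemma connected_open_diff_codim2:
  fixes S L :: "'a::euclidean_space set"
  assumes S: "open S" "connected S" and L: "closed L" "aff_dim L + 2 \<le> int DIM('a)"
  shows "connected (S - L)"
  unfolding connected_def
proof
  assume "\<exists>e1 e2. open e1 \<and> open e2 \<and> S - L \<subseteq> e1 \<union> e2 \<and> e1 \<inter> e2 \<inter> (S - L) = {} \<and> e1 \<inter> (S - L) \<noteq> {} \<and> e2 \<inter> (S - L) \<noteq> {}"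
  then obtain e1 e2 where e: "open e1" "open e2" "S - L \<subseteq> e1 \<union> e2" "e1 \<inter> e2 \<inter> (S - L) = {}"
     "e1 \<inter> (S - L) \<noteq> {}" "e2 \<inter> (S - L) \<noteq> {}" by blast
  define A where "A U = {x. \<exists>r>0. ball x r \<subseteq> S \<and> ball x r - L \<subseteq> U}" for U
  have opA: "open (A U)" for U
    unfolding open_contains_ball
  proof
    fix x assume "x \<in> A U"
    then obtain r where r: "r > 0" "ball x r \<subseteq> S" "ball x r - L \<subseteq> U" by (auto simp: A_def)
    have "ball x (r/2) \<subseteq> A U"
    proof
      fix y assume "y \<in> ball x (r/2)"
      then have "ball y (r/2) \<subseteq> ball x r" by (metis ball_subset_ball_iff dist_commute mem_ball field_sum_of_halves add_strict_right_mono less_eq_real_def)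
      then show "y \<in> A U" using r unfolding A_def by (intro CollectI exI[of _ "r/2"]) auto
    qed
    then show "\<exists>e>0. ball x e \<subseteq> A U" using r(1) half_gt_zero by blast
  qed
  have "negligible L"
  proof -
    have "aff_dim L < DIM('a)" using L by simp
    then obtain a b where "a \<noteq> 0" "L \<subseteq> {x. a \<bullet> x = b}" by (rule aff_lowdim_subset_hyperplane)
    then show ?thesis using negligible_hyperplane negligible_subset by blast
  qed
  have cover: "S \<subseteq> A e1 \<union> A e2"
  proof
    fix x assume "x \<in> S"
    then obtain r where r: "r > 0" "ball x r \<subseteq> S" using S(1) open_contains_ball by blast
    have "connected (ball x r - L)" by (rule connected_ball_diff_codim2[OF L(2)])
    moreover have "ball x r - L \<subseteq> e1 \<union> e2" "e1 \<inter> e2 \<inter> (ball x r - L) = {}" using e r by auto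
    ultimately have "e1 \<inter> (ball x r - L) = {} \<or> e2 \<inter> (ball x r - L) = {}"
      using connectedD[of "ball x r - L" e1 e2] e(1,2) by blast
    then have "ball x r - L \<subseteq> e1 \<or> ball x r - L \<subseteq> e2" using \<open>ball x r - L \<subseteq> e1 \<union> e2\<close> by blast
    then show "x \<in> A e1 \<union> A e2" using r by (auto simp: A_def)
  qed
  have disj: "A e1 \<inter> A e2 = {}"
  proof (rule ccontr)
    assume "\<not> ?thesis"
    then obtain x r1 r2 where r: "r1 > 0" "ball x r1 \<subseteq> S" "ball x r1 - L \<subseteq> e1" "r2 > 0" "ball x r2 - L \<subseteq> e2"
      by (auto simp: A_def)
    have "ball x (min r1 r2) = ball x r1 \<inter> ball x r2" by auto
    then have "ball x (min r1 r2) \<subseteq> L" using r e(4) by blast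
    then show False using \<open>negligible L\<close> r open_not_negligible[of "ball x (min r1 r2)"] negligible_subset
      by (metis centre_in_ball empty_iff min_less_iff_conj open_ball)
  qed
  have sub: "A U \<inter> (S - L) \<subseteq> U" for U by (auto simp: A_def subset_iff)
  have "A e1 \<inter> S \<noteq> {}" using e(4,5) sub[of e2] cover by blast
  moreover have "A e2 \<inter> S \<noteq> {}" using e(4,6) sub[of e1] cover by blast
  ultimately show False using connectedD[OF S(2) opA opA] cover disj by blast
qed

text \<open>The exceptional set is enlarged to a finite union of affine hulls, which is closed and
  null and can be removed one hull at a time.\<close>

lemma connected_diff_codim2:
  fixes S :: "'a::euclidean_space set"
  assumes S: "open S" "connected S" and N: "codim2 N"
  shows "\<exists>N'. N \<subseteq> N' \<and> closed N' \<and> negligible N' \<and> connected (S - N')"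
proof -
  obtain F where F: "finite F" "N \<subseteq> \<Union>F" "\<forall>L\<in>F. aff_dim L + 2 \<le> int DIM('a)"
    using N by (auto simp: codim2_def)
  from F(1,3) have "open (S - (\<Union>L\<in>F. affine hull L)) \<and> connected (S - (\<Union>L\<in>F. affine hull L))"
  proof (induction F rule: finite_induct)
    case (insert L F)
    have eq: "S - (\<Union>L\<in>insert L F. affine hull L) = (S - (\<Union>L\<in>F. affine hull L)) - affine hull L" by auto
    show ?case unfolding eq using insert
      by (auto intro!: connected_open_diff_codim2 open_Diff closed_affine_hull)
  qed (use S in auto)
  moreover have "negligible (\<Union>L\<in>F. affine hull L)"
  proof (rule negligible_Union)
    show "finite ((\<lambda>L. affine hull L) ` F)" using F(1) by simp
    fix A assume "A \<in> (\<lambda>L. affine hull L) ` F"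
    then obtain L where A: "A = affine hull L" and "L \<in> F" by auto
    then have "aff_dim (affine hull L) < DIM('a)" using F(3) by force
    then obtain a b where "a \<noteq> 0" "affine hull L \<subseteq> {x. a \<bullet> x = b}" by (rule aff_lowdim_subset_hyperplane)
    then show "negligible A" unfolding A using negligible_hyperplane negligible_subset by blast
  qed
  moreover have "closed (\<Union>L\<in>F. affine hull L)" using F(1) by (intro closed_UN) auto
  moreover have "N \<subseteq> (\<Union>L\<in>F. affine hull L)"
  proof
    fix x assume "x \<in> N"
    then obtain L where "L \<in> F" "x \<in> L" using F(2) by blast
    then show "x \<in> (\<Union>L\<in>F. affine hull L)" by (intro UN_I hull_inc)
  qed
  ultimately show ?thesis by blast
qed

lemma codim2_UN: "finite I \<Longrightarrow> (\<And>i. i \<in> I \<Longrightarrow> codim2 (S i)) \<Longrightarrow> codim2 (\<Union>i\<in>I. S i)"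
proof (induction I rule: finite_induct)
  case empty
  then show ?case by (auto simp: codim2_def intro: exI[of _ "{}"])
next
  case (insert i I)
  then have "codim2 (S i)" "codim2 (\<Union>i\<in>I. S i)" by auto
  then obtain F G where F: "finite F" "S i \<subseteq> \<Union>F" "\<forall>L\<in>F. aff_dim L + 2 \<le> int DIM('b)"
     and G: "finite G" "(\<Union>i\<in>I. S i) \<subseteq> \<Union>G" "\<forall>L\<in>G. aff_dim L + 2 \<le> int DIM('b)"
    unfolding codim2_def by (elim exE conjE)
  from F G show ?case unfolding codim2_def by (intro exI[of _ "F \<union> G"]) auto
qed

lemma discretisationD:
  assumes "discretisation \<Omega> M E EK"
  shows "finite M" "pairwise disjnt M" "closure \<Omega> = (\<Union>K\<in>M. closure K)" "finite E" "pairwise disjnt E"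
    and "\<And>K. K \<in> M \<Longrightarrow> open K" "\<And>K. K \<in> M \<Longrightarrow> K \<subseteq> \<Omega>" "\<And>K. K \<in> M \<Longrightarrow> lipschitz_boundary_in UNIV K"
    and "\<And>K. K \<in> M \<Longrightarrow> K \<noteq> {}"
    and "\<And>K. K \<in> M \<Longrightarrow> EK K \<subseteq> E" "\<And>K. K \<in> M \<Longrightarrow> frontier K = (\<Union>\<sigma>\<in>EK K. closure \<sigma>)"
    and "\<And>\<sigma>. \<sigma> \<in> E \<Longrightarrow> 0 < emeasure (face_measure \<sigma>) \<sigma>" "\<And>\<sigma>. \<sigma> \<in> E \<Longrightarrow> \<sigma> \<noteq> {}"
    and "\<And>\<sigma>. \<sigma> \<in> E \<Longrightarrow> \<sigma> \<subseteq> closure \<Omega>" "\<And>\<sigma>. \<sigma> \<in> E \<Longrightarrow> codim2 (closure \<sigma> - \<sigma>)"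
    and "\<And>\<sigma>. \<sigma> \<in> E \<Longrightarrow> connected \<sigma>"
    and "\<And>\<sigma>. \<sigma> \<in> E \<Longrightarrow> \<exists>a b. norm a = 1 \<and> openin (top_of_set {x. a \<bullet> x = b}) \<sigma>"
proof -
  note D = assms[unfolded discretisation_def Let_def]
  have DM: "\<forall>K\<in>M. open K \<and> K \<subseteq> \<Omega> \<and> polytopal_in UNIV K \<and> lipschitz_boundary_in UNIV K \<and> 0 < emeasure lebesgue K"
    and DE: "\<forall>\<sigma>\<in>E. connected \<sigma> \<and> \<sigma> \<subseteq> closure \<Omega> \<and> 0 < emeasure (face_measure \<sigma>) \<sigma> \<and>
        (\<exists>a b. a \<noteq> 0 \<and> \<sigma> \<subseteq> {x. a \<bullet> x = b} \<and> openin (top_of_set {x. a \<bullet> x = b}) \<sigma> \<and>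
          polytopal_in {x. a \<bullet> x = b} \<sigma> \<and> lipschitz_boundary_in {x. a \<bullet> x = b} \<sigma>)"
    and DK: "\<forall>K\<in>M. EK K \<subseteq> E \<and> frontier K = (\<Union>\<sigma>\<in>EK K. closure \<sigma>)"
    by (insert D, elim conjE, assumption)+
  show "finite M" "pairwise disjnt M" "closure \<Omega> = (\<Union>K\<in>M. closure K)" "finite E" "pairwise disjnt E"
    by (insert D, elim conjE, assumption)+
  show "\<And>K. K \<in> M \<Longrightarrow> open K" "\<And>K. K \<in> M \<Longrightarrow> K \<subseteq> \<Omega>" "\<And>K. K \<in> M \<Longrightarrow> lipschitz_boundary_in UNIV K"
    using DM by auto
  show "\<And>K. K \<in> M \<Longrightarrow> K \<noteq> {}" using DM by (metis emeasure_empty less_irrefl)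
  show "\<And>K. K \<in> M \<Longrightarrow> EK K \<subseteq> E" "\<And>K. K \<in> M \<Longrightarrow> frontier K = (\<Union>\<sigma>\<in>EK K. closure \<sigma>)"
    using DK by auto
  show "\<And>\<sigma>. \<sigma> \<in> E \<Longrightarrow> 0 < emeasure (face_measure \<sigma>) \<sigma>" "\<And>\<sigma>. \<sigma> \<in> E \<Longrightarrow> \<sigma> \<subseteq> closure \<Omega>"
    "\<And>\<sigma>. \<sigma> \<in> E \<Longrightarrow> connected \<sigma>" using DE by auto
  show "\<And>\<sigma>. \<sigma> \<in> E \<Longrightarrow> \<sigma> \<noteq> {}" using DE by (metis emeasure_empty less_irrefl)
  fix \<sigma> assume "\<sigma> \<in> E"
  then obtain a b where a: "a \<noteq> 0" and ab: "openin (top_of_set {x. a \<bullet> x = b}) \<sigma>" "polytopal_in {x. a \<bullet> x = b} \<sigma>"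
    using DE by blast
  show "codim2 (closure \<sigma> - \<sigma>)" by (rule codim2_rim[OF a ab(2)])
  have "{x. (a /\<^sub>R norm a) \<bullet> x = b / norm a} = {x. a \<bullet> x = b}" using a by (auto simp: field_simps)
  then show "\<exists>a b. norm a = 1 \<and> openin (top_of_set {x. a \<bullet> x = b}) \<sigma>"
    using a ab(1) by (intro exI[of _ "a /\<^sub>R norm a"] exI[of _ "b / norm a"]) auto
qed

lemma discretisation_cell_face:
  assumes D: "discretisation \<Omega> M E EK" and K: "K \<in> M" and \<sigma>: "\<sigma> \<in> EK K"
  shows "\<exists>b. cell_face K \<sigma> (outer_normal K \<sigma>) b"
proof -
  note D' = discretisationD[OF D]
  have E: "\<sigma> \<in> E" using D'(10) K \<sigma> by auto
  obtain a b where a: "norm a = 1" "openin (top_of_set {x. a \<bullet> x = b}) \<sigma>" using D'(17)[OF E] by auto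
  have "\<sigma> \<subseteq> frontier K" using D'(11)[OF K] \<sigma> closure_subset by blast
  from cell_face_exists[OF D'(6)[OF K] D'(8)[OF K] a this D'(16)[OF E]]
  obtain c where "cell_face K \<sigma> (c *\<^sub>R a) (c * b)" by blast
  then show ?thesis using outer_normal_eq D'(13)[OF E] by metis
qed

text \<open>Away from the rims, a point in the closures of two cells lies on a face of each, and
  these faces coincide because faces are disjoint. So the cells with the value \<open>c K0\<close>
  and the remaining ones have closures that are disjoint in \<open>\<Omega> - N\<close>, which is
  connected.\<close>

lemma mesh_connected:
  fixes c :: "(real^'n) set \<Rightarrow> 'b"
  assumes D: "discretisation \<Omega> M E EK" and \<Omega>: "open \<Omega>" "connected \<Omega>"
    and c: "\<And>K K' \<sigma>. K \<in> M \<Longrightarrow> K' \<in> M \<Longrightarrow> \<sigma> \<in> EK K \<Longrightarrow> \<sigma> \<in> EK K' \<Longrightarrow> c K = c K'"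
    and K: "K0 \<in> M" "K1 \<in> M"
  shows "c K0 = c K1"
proof (rule ccontr)
  assume neq: "c K0 \<noteq> c K1"
  note D' = discretisationD[OF D]
  have "codim2 (\<Union>\<sigma>\<in>E. closure \<sigma> - \<sigma>)" using D'(4,15) by (rule codim2_UN)
  then obtain N where N: "(\<Union>\<sigma>\<in>E. closure \<sigma> - \<sigma>) \<subseteq> N" "closed N" "negligible N" "connected (\<Omega> - N)"
    using connected_diff_codim2[OF \<Omega>] by blast
  define M1 where "M1 = {K\<in>M. c K = c K0}"
  define A where "A = (\<Union>K\<in>M1. closure K)"
  define B where "B = (\<Union>K\<in>M - M1. closure K)"
  have cl: "closed A" "closed B" using D'(1) by (auto simp: A_def B_def M1_def intro!: closed_UN)
  have cov: "\<Omega> - N \<subseteq> A \<union> B"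
  proof
    fix x assume "x \<in> \<Omega> - N"
    then obtain K where "K \<in> M" "x \<in> closure K" using D'(3) closure_subset[of \<Omega>] by auto
    then show "x \<in> A \<union> B" unfolding A_def B_def by (cases "K \<in> M1") auto
  qed
  have dis: "A \<inter> B \<inter> (\<Omega> - N) = {}"
  proof (rule ccontr)
    assume "\<not> ?thesis"
    then obtain x K K' where x: "x \<notin> N" "K \<in> M1" "x \<in> closure K" "K' \<in> M" "K' \<notin> M1" "x \<in> closure K'"
      by (auto simp: A_def B_def)
    have KM: "K \<in> M" using x by (simp add: M1_def)
    have "disjnt K K'" using D'(2) KM x by (metis pairwise_def)
    then have "x \<notin> K" "x \<notin> K'" using x D'(6)[OF KM] D'(6)[OF x(4)]
      by (metis disjnt_def IntI empty_iff inf_commute open_Int_closure_eq_empty)+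
    then have "x \<in> frontier K" "x \<in> frontier K'"
      using x D'(6)[OF KM] D'(6)[OF x(4)] by (auto simp: frontier_def interior_open)
    then obtain \<sigma> \<sigma>' where s: "\<sigma> \<in> EK K" "x \<in> closure \<sigma>" "\<sigma>' \<in> EK K'" "x \<in> closure \<sigma>'"
      using D'(11)[OF KM] D'(11)[OF x(4)] by auto
    have sE: "\<sigma> \<in> E" "\<sigma>' \<in> E" using s D'(10) KM x by auto
    then have "x \<in> \<sigma>" "x \<in> \<sigma>'" using s x(1) N(1) by auto
    then have "\<sigma> = \<sigma>'" using D'(5) sE by (metis disjnt_iff pairwise_def)
    then show False using c[OF KM x(4) s(1)] s(3) x by (auto simp: M1_def)
  qed
  have ne: "C \<inter> (\<Omega> - N) \<noteq> {}" if "K \<in> M" "K \<subseteq> C" for K C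
  proof
    assume "C \<inter> (\<Omega> - N) = {}"
    then have "K \<subseteq> N" using that D'(7)[OF that(1)] by blast
    then show False using N(3) open_not_negligible[OF D'(6)[OF that(1)] D'(9)[OF that(1)]] negligible_subset by blast
  qed
  have "K0 \<subseteq> A" "K1 \<subseteq> B" using K neq closure_subset by (fastforce simp: A_def B_def M1_def)+
  then have "A \<inter> (\<Omega> - N) \<noteq> {}" "B \<inter> (\<Omega> - N) \<noteq> {}" using ne K by blast+
  then show False using connected_closedD[OF N(4) dis cov cl] by blast
qed

text \<open>A point of the domain outside all cells lies in the closure of a face, hence in one of
  finitely many hyperplanes.\<close>

lemma AE_mesh_covers:
  fixes \<Omega> :: "(real^'n) set"
  assumes D: "discretisation \<Omega> M E EK"
  shows "AE x in lebesgue. x \<in> \<Omega> \<longrightarrow> x \<in> \<Union>M"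
proof -
  note D' = discretisationD[OF D]
  have "negligible (closure \<sigma>)" if \<sigma>: "\<sigma> \<in> E" for \<sigma>
  proof -
    obtain a b where a: "norm a = 1" "openin (top_of_set {x. a \<bullet> x = b}) \<sigma>" using D'(17)[OF \<sigma>] by auto
    then have "closure \<sigma> \<subseteq> {x. a \<bullet> x = b}" using openin_imp_subset by (intro closure_minimal closed_hyperplane) blast
    moreover have "negligible {x. a \<bullet> x = b}" using a by (intro negligible_hyperplane) auto
    ultimately show ?thesis by (rule negligible_subset[rotated])
  qed
  then have "negligible (\<Union>\<sigma>\<in>E. closure \<sigma>)" using D'(4) by (intro negligible_Union) auto
  then have "(\<Union>\<sigma>\<in>E. closure \<sigma>) \<in> null_sets lebesgue" by (simp add: negligible_iff_null_sets)
  moreover have "{x \<in> space lebesgue. \<not> (x \<in> \<Omega> \<longrightarrow> x \<in> \<Union>M)} \<subseteq> (\<Union>\<sigma>\<in>E. closure \<sigma>)"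
  proof
    fix x assume "x \<in> {x \<in> space lebesgue. \<not> (x \<in> \<Omega> \<longrightarrow> x \<in> \<Union>M)}"
    then have x: "x \<in> \<Omega>" "\<And>K. K \<in> M \<Longrightarrow> x \<notin> K" by auto
    then obtain K where K: "K \<in> M" "x \<in> closure K" using D'(3) closure_subset by blast
    then have "x \<in> frontier K" using x D'(6) by (auto simp: frontier_def interior_open)
    then show "x \<in> (\<Union>\<sigma>\<in>E. closure \<sigma>)" using D'(10,11)[OF K(1)] by auto
  qed
  ultimately show ?thesis by (rule AE_I'[rotated 0])
qed

section \<open>Polynomials and orthonormal families\<close>

definition monomial_fun :: "('n::finite \<Rightarrow> nat) \<Rightarrow> real^'n \<Rightarrow> real" where
  "monomial_fun \<alpha> x = (\<Prod>i\<in>UNIV. (x $ i) ^ \<alpha> i)"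

text \<open>Stated for an arbitrary family, possibly dependent, so that orthonormalisation can
  proceed by induction on the index set.\<close>

definition lin_span :: "('i \<Rightarrow> 'a \<Rightarrow> real) \<Rightarrow> 'i set \<Rightarrow> ('a \<Rightarrow> real) set" where
  "lin_span m A = {p. \<exists>c. \<forall>x. p x = (\<Sum>\<alpha>\<in>A. c \<alpha> * m \<alpha> x)}"

lemma finite_multi_indices: "finite {\<alpha> :: 'n::finite \<Rightarrow> nat. (\<Sum>i\<in>UNIV. \<alpha> i) \<le> q}"
proof (rule finite_subset)
  show "{\<alpha> :: 'n \<Rightarrow> nat. (\<Sum>i\<in>UNIV. \<alpha> i) \<le> q} \<subseteq> PiE UNIV (\<lambda>_. {..q})"
  proof
    fix \<alpha> :: "'n \<Rightarrow> nat" assume \<alpha>: "\<alpha> \<in> {\<alpha>. (\<Sum>i\<in>UNIV. \<alpha> i) \<le> q}"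
    have "\<alpha> i \<le> q" for i using member_le_sum[of i UNIV \<alpha>] \<alpha> by simp
    then show "\<alpha> \<in> PiE UNIV (\<lambda>_. {..q})" by auto
  qed
qed (intro finite_PiE; simp)

lemma poly_fun_lin_span: "poly_fun q = lin_span monomial_fun {\<alpha> :: 'n::finite \<Rightarrow> nat. (\<Sum>i\<in>UNIV. \<alpha> i) \<le> q}"
  by (simp add: poly_fun_def lin_span_def monomial_fun_def)

lemma lin_span_add: "p \<in> lin_span m A \<Longrightarrow> r \<in> lin_span m A \<Longrightarrow> (\<lambda>x. p x + r x) \<in> lin_span m A"
proof -
  assume "p \<in> lin_span m A" "r \<in> lin_span m A"
  then obtain c d where "\<And>x. p x = (\<Sum>\<alpha>\<in>A. c \<alpha> * m \<alpha> x)" "\<And>x. r x = (\<Sum>\<alpha>\<in>A. d \<alpha> * m \<alpha> x)"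
    by (auto simp: lin_span_def)
  then show ?thesis unfolding lin_span_def
    by (intro CollectI exI[of _ "\<lambda>\<alpha>. c \<alpha> + d \<alpha>"]) (simp add: distrib_right sum.distrib)
qed

lemma lin_span_cmul: "p \<in> lin_span m A \<Longrightarrow> (\<lambda>x. a * p x) \<in> lin_span m A"
proof -
  assume "p \<in> lin_span m A"
  then obtain c where "\<And>x. p x = (\<Sum>\<alpha>\<in>A. c \<alpha> * m \<alpha> x)" by (auto simp: lin_span_def)
  then show ?thesis unfolding lin_span_def
    by (intro CollectI exI[of _ "\<lambda>\<alpha>. a * c \<alpha>"]) (simp add: sum_distrib_left mult.assoc)
qed

lemma lin_span_zero: "(\<lambda>x. 0) \<in> lin_span m A"
  unfolding lin_span_def by (intro CollectI exI[of _ "\<lambda>_. 0"]) simp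

lemma lin_span_sum: "(\<And>i. i \<in> I \<Longrightarrow> p i \<in> lin_span m A) \<Longrightarrow> (\<lambda>x. \<Sum>i\<in>I. p i x) \<in> lin_span m A"
  by (induction I rule: infinite_finite_induct) (auto simp: lin_span_zero intro: lin_span_add)

lemma lin_span_member: "finite A \<Longrightarrow> \<alpha> \<in> A \<Longrightarrow> m \<alpha> \<in> lin_span m A"
  unfolding lin_span_def
  by (intro CollectI exI[of _ "\<lambda>\<beta>. if \<beta> = \<alpha> then 1 else 0"]) (simp add: if_distrib[where f="\<lambda>z. z * _"] sum.delta cong: if_cong)

lemma poly_fun_add: "p \<in> poly_fun q \<Longrightarrow> r \<in> poly_fun q \<Longrightarrow> (\<lambda>x. p x + r x) \<in> poly_fun q"
  and poly_fun_cmul: "p \<in> poly_fun q \<Longrightarrow> (\<lambda>x. a * p x) \<in> poly_fun q"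
  and poly_fun_zero: "(\<lambda>x. 0) \<in> poly_fun q"
  and poly_fun_sum: "(\<And>i. i \<in> I \<Longrightarrow> f i \<in> poly_fun q) \<Longrightarrow> (\<lambda>x. \<Sum>i\<in>I. f i x) \<in> poly_fun q"
  unfolding poly_fun_lin_span by (rule lin_span_add lin_span_cmul lin_span_zero lin_span_sum; assumption)+

lemma poly_fun_diff: "p \<in> poly_fun q \<Longrightarrow> r \<in> poly_fun q \<Longrightarrow> (\<lambda>x. p x - r x) \<in> poly_fun q"
  using poly_fun_add[OF _ poly_fun_cmul[of r q "-1"], of p] by simp

lemma monomial_fun_poly_fun: "(\<Sum>i\<in>UNIV. \<alpha> i) \<le> q \<Longrightarrow> monomial_fun \<alpha> \<in> poly_fun q"
  unfolding poly_fun_lin_span by (intro lin_span_member finite_multi_indices) simp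

lemma poly_fun_const: "(\<lambda>x. c) \<in> poly_fun q"
proof -
  have "monomial_fun (\<lambda>_. 0) \<in> poly_fun q" by (rule monomial_fun_poly_fun) simp
  from poly_fun_cmul[OF this, of c] show ?thesis by (simp add: monomial_fun_def)
qed

text \<open>Where \<open>\<alpha> i = 0\<close>, the truncated exponent
  \<open>\<alpha> i - 1\<close> yields a meaningless monomial, but its coefficient
  \<open>real (\<alpha> i)\<close> is zero.\<close>

lemma monomial_fun_has_derivative:
  "(monomial_fun \<alpha> has_derivative
     (\<lambda>h. (\<chi> i. real (\<alpha> i) * monomial_fun (\<alpha>(i := \<alpha> i - 1)) x) \<bullet> h)) (at x)"
proof -
  have "((\<lambda>x. \<Prod>i\<in>UNIV. (x $ i) ^ \<alpha> i) has_derivative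
     (\<lambda>h. \<Sum>i\<in>UNIV. (real (\<alpha> i) * (h $ i * (x $ i) ^ (\<alpha> i - 1))) * (\<Prod>j\<in>UNIV - {i}. (x $ j) ^ \<alpha> j))) (at x)"
    by (rule has_derivative_prod) (auto intro!: derivative_eq_intros bounded_linear_imp_has_derivative bounded_linear_vec_nth simp: mult_ac)
  moreover have "(x $ i) ^ (\<alpha> i - 1) * (\<Prod>j\<in>UNIV - {i}. (x $ j) ^ \<alpha> j) = monomial_fun (\<alpha>(i := \<alpha> i - 1)) x" for i
    unfolding monomial_fun_def by (subst prod.remove[of UNIV i]) (auto intro!: prod.cong)
  ultimately show ?thesis
    by (simp add: monomial_fun_def[abs_def] inner_vec_def mult_ac)
qed

lemma poly_fun_gradient:
  assumes "p \<in> poly_fun (q + 1)"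
  shows "\<exists>g\<in>poly_vec q. \<forall>x. (p has_derivative (\<lambda>h. g x \<bullet> h)) (at x)"
proof -
  define A where "A = {\<alpha> :: 'a \<Rightarrow> nat. (\<Sum>i\<in>UNIV. \<alpha> i) \<le> q + 1}"
  obtain c where c: "\<And>x. p x = (\<Sum>\<alpha>\<in>A. c \<alpha> * monomial_fun \<alpha> x)"
    using assms unfolding poly_fun_lin_span lin_span_def A_def by blast
  define g where "g x = (\<chi> i. \<Sum>\<alpha>\<in>A. c \<alpha> * (real (\<alpha> i) * monomial_fun (\<alpha>(i := \<alpha> i - 1)) x))" for x
  have mem: "(\<lambda>x. real (\<alpha> i) * monomial_fun (\<alpha>(i := \<alpha> i - 1)) x) \<in> poly_fun q" if "\<alpha> \<in> A" for \<alpha> i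
  proof (cases "\<alpha> i = 0")
    case False
    have "(\<Sum>j\<in>UNIV. \<alpha> j) = \<alpha> i + (\<Sum>j\<in>UNIV - {i}. \<alpha> j)" by (rule sum.remove) auto
    moreover have "(\<Sum>j\<in>UNIV. (\<alpha>(i := \<alpha> i - 1)) j) = (\<alpha> i - 1) + (\<Sum>j\<in>UNIV - {i}. \<alpha> j)"
      by (subst sum.remove[of UNIV i]) auto
    ultimately have "(\<Sum>j\<in>UNIV. (\<alpha>(i := \<alpha> i - 1)) j) \<le> q" using that False by (simp add: A_def)
    then show ?thesis by (intro poly_fun_cmul monomial_fun_poly_fun)
  qed (simp add: poly_fun_zero)
  have "g \<in> poly_vec q"
    unfolding poly_vec_def g_def by (simp only: vec_lambda_beta mem_Collect_eq, intro allI poly_fun_sum poly_fun_cmul mem)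
  moreover have "(p has_derivative (\<lambda>h. g x \<bullet> h)) (at x)" for x
  proof -
    have "((\<lambda>x. \<Sum>\<alpha>\<in>A. c \<alpha> * monomial_fun \<alpha> x) has_derivative
       (\<lambda>h. \<Sum>\<alpha>\<in>A. c \<alpha> * ((\<chi> i. real (\<alpha> i) * monomial_fun (\<alpha>(i := \<alpha> i - 1)) x) \<bullet> h))) (at x)"
      by (intro has_derivative_sum has_derivative_mult_right monomial_fun_has_derivative)
    moreover have "(\<lambda>x. \<Sum>\<alpha>\<in>A. c \<alpha> * monomial_fun \<alpha> x) = p" using c by auto
    moreover have "(\<Sum>\<alpha>\<in>A. c \<alpha> * ((\<chi> i. real (\<alpha> i) * monomial_fun (\<alpha>(i := \<alpha> i - 1)) x) \<bullet> h)) = g x \<bullet> h" for h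
      unfolding g_def inner_vec_def by (simp add: sum_distrib_left sum_distrib_right mult_ac, subst sum.swap, rule refl)
    ultimately show ?thesis by simp
  qed
  ultimately show ?thesis by blast
qed

lemma poly_fun_Suc: "p \<in> poly_fun q \<Longrightarrow> p \<in> poly_fun (q + 1)"
proof -
  assume "p \<in> poly_fun q"
  then obtain c where c: "\<And>x. p x = (\<Sum>\<alpha> | (\<Sum>i\<in>UNIV. \<alpha> i) \<le> q. c \<alpha> * monomial_fun \<alpha> x)"
    unfolding poly_fun_lin_span lin_span_def by blast
  have "(\<lambda>x. \<Sum>\<alpha> | (\<Sum>i\<in>UNIV. \<alpha> i) \<le> q. c \<alpha> * monomial_fun \<alpha> x) \<in> poly_fun (q + 1)"
    by (intro poly_fun_sum poly_fun_cmul monomial_fun_poly_fun) auto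
  moreover have "(\<lambda>x. \<Sum>\<alpha> | (\<Sum>i\<in>UNIV. \<alpha> i) \<le> q. c \<alpha> * monomial_fun \<alpha> x) = p" using c by auto
  ultimately show ?thesis by simp
qed

lemma poly_fun_continuous: "p \<in> poly_fun q \<Longrightarrow> continuous_on UNIV p"
proof -
  assume "p \<in> poly_fun q"
  then obtain g where "\<forall>x. (p has_derivative (\<lambda>h. g x \<bullet> h)) (at x)"
    using poly_fun_gradient[OF poly_fun_Suc] by blast
  then show ?thesis by (meson continuous_at_imp_continuous_on has_derivative_continuous)
qed

lemma poly_vec_continuous: "\<tau> \<in> poly_vec q \<Longrightarrow> continuous_on UNIV \<tau>"
  using poly_fun_continuous unfolding poly_vec_def
  by (subst continuous_on_componentwise) (auto simp: Basis_vec_def inner_axis)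

lemma poly_vec_inner: "\<tau> \<in> poly_vec q \<Longrightarrow> (\<lambda>x. \<tau> x \<bullet> n) \<in> poly_fun q"
proof -
  assume "\<tau> \<in> poly_vec q"
  then have "(\<lambda>x. \<Sum>i\<in>UNIV. n $ i * \<tau> x $ i) \<in> poly_fun q"
    by (intro poly_fun_sum poly_fun_cmul) (simp add: poly_vec_def)
  then show ?thesis by (simp add: inner_vec_def mult.commute)
qed

lemma poly_vec_scaleR: "\<tau> \<in> poly_vec q \<Longrightarrow> (\<lambda>x. a *\<^sub>R \<tau> x) \<in> poly_vec q"
  by (auto simp: poly_vec_def intro: poly_fun_add poly_fun_cmul)

lemma poly_vec_axis: "p \<in> poly_fun q \<Longrightarrow> (\<lambda>x. p x *\<^sub>R axis i 1) \<in> poly_vec q"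
  by (auto simp: poly_vec_def axis_def poly_fun_zero)

lemma poly_fun_real_polynomial: "p \<in> poly_fun q \<Longrightarrow> real_polynomial_function p"
proof -
  assume "p \<in> poly_fun q"
  then obtain c where c: "\<And>x. p x = (\<Sum>\<alpha> | (\<Sum>i\<in>UNIV. \<alpha> i) \<le> q. c \<alpha> * (\<Prod>i\<in>UNIV. (x $ i) ^ \<alpha> i))"
    by (auto simp: poly_fun_def)
  have "real_polynomial_function (\<lambda>x :: real^'a. \<Sum>\<alpha> | (\<Sum>i\<in>UNIV. \<alpha> i) \<le> q. c \<alpha> * (\<Prod>i\<in>UNIV. (x $ i) ^ \<alpha> i))"
    by (intro real_polynomial_function_sum real_polynomial_function.intros(4) real_polynomial_function_prod
        real_polynomial_function_power finite_multi_indices)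
       (auto intro: real_polynomial_function.intros bounded_linear_vec_nth)
  moreover have "(\<lambda>x :: real^'a. \<Sum>\<alpha> | (\<Sum>i\<in>UNIV. \<alpha> i) \<le> q. c \<alpha> * (\<Prod>i\<in>UNIV. (x $ i) ^ \<alpha> i)) = p"
    using c by auto
  ultimately show ?thesis by simp
qed

text \<open>The line from a point of \<open>K\<close> to \<open>y\<close> starts inside
  \<open>K\<close>, and a polynomial in one variable with infinitely many roots is zero.\<close>

lemma poly_fun_zero_on_open:
  fixes p :: "real^'n \<Rightarrow> real"
  assumes p: "p \<in> poly_fun q" and K: "open K" "K \<noteq> {}" and z: "\<And>x. x \<in> K \<Longrightarrow> p x = 0"
  shows "p y = 0"
proof -
  obtain x r where r: "r > 0" "ball x r \<subseteq> K" using K open_contains_ball by blast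
  define f where "f t = p (x + t *\<^sub>R (y - x))" for t :: real
  have "polynomial_function (\<lambda>t :: real. x + t *\<^sub>R (y - x))"
    by (intro polynomial_function_add polynomial_function_const polynomial_function_bounded_linear bounded_linear_scaleR_left)
  then have "real_polynomial_function (p \<circ> (\<lambda>t :: real. x + t *\<^sub>R (y - x)))"
    by (rule real_polynomial_function_compose[OF _ poly_fun_real_polynomial[OF p]])
  then have "real_polynomial_function f" by (simp add: f_def[abs_def] o_def)
  then obtain a n where a: "f = (\<lambda>t. \<Sum>i\<le>n. a i * t ^ i)" using real_polynomial_function_imp_sum by blast
  define d where "d = r / (norm (y - x) + 1)"
  have d: "d > 0" using r(1) by (simp add: d_def add_nonneg_pos)
  have "f t = 0" if "t \<in> {0<..<d}" for t
  proof -
    have "norm (t *\<^sub>R (y - x)) \<le> t * (norm (y - x) + 1)" using that by (simp add: mult_left_mono)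
    also have "\<dots> < d * (norm (y - x) + 1)" using that by (intro mult_strict_right_mono) (auto simp: add_nonneg_pos)
    also have "\<dots> = r" unfolding d_def using norm_ge_zero[of "y - x"] by (simp add: add_nonneg_eq_0_iff)
    finally have "x + t *\<^sub>R (y - x) \<in> ball x r" by (simp add: dist_norm)
    then show ?thesis using r(2) z unfolding f_def by blast
  qed
  then have "{0<..<d} \<subseteq> {t. (\<Sum>i\<le>n. a i * t ^ i) = 0}" by (auto simp: a)
  then have inf: "infinite {t. (\<Sum>i\<le>n. a i * t ^ i) = 0}" using infinite_Ioo[OF d] finite_subset by blast
  have "a i = 0" if "i \<le> n" for i
    using polyfun_roots_finite[of a i n] inf that by blast
  then have "f 1 = 0" by (simp add: a)
  then show ?thesis by (simp add: f_def)
qed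

section \<open>Inner products modulo null sets, orthonormalisation and the projector\<close>

definition cont_integrable :: "'a::euclidean_space measure \<Rightarrow> 'a set \<Rightarrow> bool" where
  "cont_integrable \<mu> X \<longleftrightarrow> (\<forall>f :: 'a \<Rightarrow> real. continuous_on UNIV f \<longrightarrow> set_integrable \<mu> X f)"

definition null_on :: "'a measure \<Rightarrow> 'a set \<Rightarrow> ('a \<Rightarrow> real) \<Rightarrow> bool" where
  "null_on \<mu> X f \<longleftrightarrow> (AE x in \<mu>. x \<in> X \<longrightarrow> f x = 0)"

definition ip :: "'a measure \<Rightarrow> 'a set \<Rightarrow> ('a \<Rightarrow> real) \<Rightarrow> ('a \<Rightarrow> real) \<Rightarrow> real" where
  "ip \<mu> X f g = (LINT x:X|\<mu>. f x * g x)"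

lemma ip_commute: "ip \<mu> X f g = ip \<mu> X g f"
  by (simp add: ip_def mult.commute)

lemma ip_cong_null:
  assumes "null_on \<mu> X (\<lambda>x. f x - f' x)"
    and "set_integrable \<mu> X (\<lambda>x. f x * g x)" "set_integrable \<mu> X (\<lambda>x. f' x * g x)"
  shows "ip \<mu> X f g = ip \<mu> X f' g"
  unfolding ip_def set_lebesgue_integral_def
proof (rule integral_cong_AE)
  show "AE x in \<mu>. indicator X x *\<^sub>R (f x * g x) = indicator X x *\<^sub>R (f' x * g x)"
    using assms(1) unfolding null_on_def by eventually_elim (auto simp: indicator_def)
qed (use assms(2,3) in \<open>auto simp: set_integrable_def\<close>)

context
  fixes \<mu> :: "'a::euclidean_space measure" and X :: "'a set"
  assumes ci: "cont_integrable \<mu> X"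
begin

lemma cont_set_integrable: "continuous_on UNIV f \<Longrightarrow> set_integrable \<mu> X (f :: 'a \<Rightarrow> real)"
  using ci by (auto simp: cont_integrable_def)

lemma ip_add_left:
  assumes "set_integrable \<mu> X (\<lambda>x. f x * h x)" "set_integrable \<mu> X (\<lambda>x. g x * h x)"
  shows "ip \<mu> X (\<lambda>x. f x + g x) h = ip \<mu> X f h + ip \<mu> X g h"
  unfolding ip_def using assms by (simp add: distrib_right)

lemma ip_cmul_left: "ip \<mu> X (\<lambda>x. c * f x) h = c * ip \<mu> X f h"
  unfolding ip_def by (simp add: mult.assoc)

lemma ip_sum_left:
  assumes "\<And>i. i \<in> I \<Longrightarrow> set_integrable \<mu> X (\<lambda>x. f i x * h x)"
  shows "ip \<mu> X (\<lambda>x. \<Sum>i\<in>I. f i x) h = (\<Sum>i\<in>I. ip \<mu> X (f i) h)"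
  unfolding ip_def sum_distrib_right set_lebesgue_integral_def scaleR_sum_right
  using assms by (intro Bochner_Integration.integral_sum) (simp add: set_integrable_def)

lemma ip_self_zero:
  assumes "continuous_on UNIV f" "ip \<mu> X f f = 0"
  shows "null_on \<mu> X f"
proof -
  have "set_integrable \<mu> X (\<lambda>x. f x * f x)" using assms by (intro cont_set_integrable continuous_intros)
  then have "integrable \<mu> (\<lambda>x. indicator X x * (f x * f x))" by (simp add: set_integrable_def)
  moreover have "(\<integral>x. indicator X x * (f x * f x) \<partial>\<mu>) = 0" using assms(2) by (simp add: ip_def set_lebesgue_integral_def)
  ultimately have "AE x in \<mu>. indicator X x * (f x * f x) = 0"
    by (subst (asm) integral_nonneg_eq_0_iff_AE) auto
  then show ?thesis unfolding null_on_def by eventually_elim (auto simp: indicator_def split: if_splits)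
qed

lemma ip_self_nonneg: "ip \<mu> X f f \<ge> 0"
  unfolding ip_def set_lebesgue_integral_def by (intro integral_nonneg_AE AE_I2) (simp add: indicator_def)

lemma lin_span_continuous:
  "(\<And>\<alpha>. \<alpha> \<in> A \<Longrightarrow> continuous_on UNIV (m \<alpha>)) \<Longrightarrow> p \<in> lin_span m A \<Longrightarrow> continuous_on UNIV p"
proof -
  assume m: "\<And>\<alpha>. \<alpha> \<in> A \<Longrightarrow> continuous_on UNIV (m \<alpha>)" and "p \<in> lin_span m A"
  then obtain c where "\<And>x. p x = (\<Sum>\<alpha>\<in>A. c \<alpha> * m \<alpha> x)" by (auto simp: lin_span_def)
  then have "p = (\<lambda>x. \<Sum>\<alpha>\<in>A. c \<alpha> * m \<alpha> x)" by auto
  then show ?thesis using m by (simp add: continuous_on_sum continuous_on_mult_left)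
qed

text \<open>Gram-Schmidt modulo null sets. Monomials are dependent on a face, so the residue
  \<open>r\<close> of a new function may be null; the family then stays as it is. Integrability of
  products is drawn from continuity alone, which treats cells and faces at once.\<close>

lemma orthonormal_family:
  assumes "finite A" "\<forall>\<alpha>\<in>A. continuous_on UNIV (m \<alpha>)"
  shows "\<exists>B. finite B \<and> B \<subseteq> lin_span m A \<and> (\<forall>e\<in>B. \<forall>e'\<in>B. ip \<mu> X e e' = (if e = e' then 1 else 0)) \<and>
    (\<forall>p\<in>lin_span m A. null_on \<mu> X (\<lambda>x. p x - (\<Sum>e\<in>B. ip \<mu> X p e * e x)))"
  using assms
proof (induction A rule: finite_induct)
  case empty
  then show ?case by (intro exI[of _ "{}"]) (auto simp: lin_span_def null_on_def)
next
  case (insert a A)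
  have "\<forall>\<alpha>\<in>A. continuous_on UNIV (m \<alpha>)" using insert.prems by simp
  from insert.IH[OF this] obtain B where B: "finite B" "B \<subseteq> lin_span m A"
    and B3: "\<forall>e\<in>B. \<forall>e'\<in>B. ip \<mu> X e e' = (if e = e' then 1 else 0)"
    and span': "\<forall>p\<in>lin_span m A. null_on \<mu> X (\<lambda>x. p x - (\<Sum>e\<in>B. ip \<mu> X p e * e x))" by (elim exE conjE)
  note B = B B3[rule_format] and span = span'[rule_format]
  have cm: "continuous_on UNIV (m a)" using insert.prems by auto
  have cA: "continuous_on UNIV p" if p: "p \<in> lin_span m A" for p
    by (rule lin_span_continuous[OF _ p]) (use insert.prems in simp)
  have cB: "continuous_on UNIV e" if "e \<in> B" for e using that B(2) cA by auto
  have sub: "p \<in> lin_span m (insert a A)" if p: "p \<in> lin_span m A" for p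
  proof -
    obtain c where c: "\<And>x. p x = (\<Sum>\<alpha>\<in>A. c \<alpha> * m \<alpha> x)" using p by (auto simp: lin_span_def)
    have "(\<lambda>x. \<Sum>\<alpha>\<in>A. c \<alpha> * m \<alpha> x) \<in> lin_span m (insert a A)"
      using insert.hyps by (intro lin_span_sum lin_span_cmul lin_span_member) auto
    moreover have "(\<lambda>x. \<Sum>\<alpha>\<in>A. c \<alpha> * m \<alpha> x) = p" using c by (rule ext[symmetric])
    ultimately show ?thesis by simp
  qed
  have decomp: "\<exists>c p'. p' \<in> lin_span m A \<and> (\<forall>x. p x = c * m a x + p' x)" if p: "p \<in> lin_span m (insert a A)" for p
  proof -
    obtain c where c: "\<And>x. p x = (\<Sum>\<alpha>\<in>insert a A. c \<alpha> * m \<alpha> x)" using p by (auto simp: lin_span_def)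
    have "\<forall>x. p x = c a * m a x + (\<Sum>\<alpha>\<in>A. c \<alpha> * m \<alpha> x)" unfolding c using insert.hyps by simp
    moreover have "(\<lambda>x. \<Sum>\<alpha>\<in>A. c \<alpha> * m \<alpha> x) \<in> lin_span m A"
      unfolding lin_span_def by (intro CollectI exI[of _ c]) simp
    ultimately show ?thesis by (intro exI[of _ "c a"] exI[of _ "\<lambda>x. \<Sum>\<alpha>\<in>A. c \<alpha> * m \<alpha> x"] conjI)
  qed
  have int: "set_integrable \<mu> X (\<lambda>x. f x * g x)" if "continuous_on UNIV f" "continuous_on UNIV g" for f g :: "'a \<Rightarrow> real"
    by (rule cont_set_integrable[OF continuous_on_mult[OF that]])
  have ip_split: "ip \<mu> X p e = c * ip \<mu> X (m a) e + ip \<mu> X p' e"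
    if p': "p' \<in> lin_span m A" and pc: "\<And>x. p x = c * m a x + p' x" and e: "continuous_on UNIV e" for p p' c e
  proof -
    have "ip \<mu> X (\<lambda>x. c * m a x + p' x) e = ip \<mu> X (\<lambda>x. c * m a x) e + ip \<mu> X p' e"
      by (rule ip_add_left) (rule int[OF _ e], intro continuous_intros cm cA p')+
    moreover have "p = (\<lambda>x. c * m a x + p' x)" using pc by (rule ext)
    ultimately show ?thesis by (simp add: ip_cmul_left)
  qed
  define r where "r x = m a x - (\<Sum>e\<in>B. ip \<mu> X (m a) e * e x)" for x
  have cr: "continuous_on UNIV r" unfolding r_def using cm cB by (intro continuous_intros) auto
  have ma: "m a x = r x + (\<Sum>e\<in>B. ip \<mu> X (m a) e * e x)" for x by (simp add: r_def)
  have rin: "r \<in> lin_span m (insert a A)"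
  proof -
    have "m a \<in> lin_span m (insert a A)" using insert.hyps by (intro lin_span_member) auto
    moreover have "(\<lambda>x. \<Sum>e\<in>B. ip \<mu> X (m a) e * e x) \<in> lin_span m (insert a A)"
      using B(2) sub by (intro lin_span_sum lin_span_cmul) auto
    ultimately have "(\<lambda>x. m a x + (- 1) * (\<Sum>e\<in>B. ip \<mu> X (m a) e * e x)) \<in> lin_span m (insert a A)"
      by (intro lin_span_add lin_span_cmul)
    then show ?thesis by (simp add: r_def[abs_def])
  qed
  have sumB: "ip \<mu> X (\<lambda>x. \<Sum>e\<in>B. k e * e x) e' = k e'" if e': "e' \<in> B" for k e'
  proof -
    have "ip \<mu> X (\<lambda>x. \<Sum>e\<in>B. k e * e x) e' = (\<Sum>e\<in>B. k e * ip \<mu> X e e')"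
      using cB e' by (subst ip_sum_left) (auto simp: ip_cmul_left intro!: int continuous_intros)
    also have "\<dots> = (\<Sum>e\<in>B. if e = e' then k e else 0)" using B(3) e' by (intro sum.cong) auto
    also have "\<dots> = k e'" using B(1) e' by simp
    finally show ?thesis .
  qed
  have csum: "continuous_on UNIV (\<lambda>x. \<Sum>e\<in>B. k e * e x)" for k :: "('a \<Rightarrow> real) \<Rightarrow> real"
    using cB by (intro continuous_intros) auto
  have rB: "ip \<mu> X r e = 0" if "e \<in> B" for e
  proof -
    have "ip \<mu> X (m a) e = ip \<mu> X r e + ip \<mu> X (\<lambda>x. \<Sum>e\<in>B. ip \<mu> X (m a) e * e x) e"
      using cr csum cB[OF that] by (subst ip_add_left[symmetric]) (auto simp flip: ma intro!: int)
    then show ?thesis using sumB[OF that, of "\<lambda>e. ip \<mu> X (m a) e"] by simp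
  qed
  show ?case
  proof (cases "ip \<mu> X r r = 0")
    case True
    then have nr: "null_on \<mu> X r" by (rule ip_self_zero[OF cr])
    have "null_on \<mu> X (\<lambda>x. p x - (\<Sum>e\<in>B. ip \<mu> X p e * e x))" if p: "p \<in> lin_span m (insert a A)" for p
    proof -
      obtain c p' where p': "p' \<in> lin_span m A" "\<And>x. p x = c * m a x + p' x" using decomp[OF p] by blast
      have "ip \<mu> X p e = c * ip \<mu> X (m a) e + ip \<mu> X p' e" if "e \<in> B" for e
        by (rule ip_split[OF p'(1) p'(2) cB[OF that]])
      then have "(\<Sum>e\<in>B. ip \<mu> X p e * e x) = c * (\<Sum>e\<in>B. ip \<mu> X (m a) e * e x) + (\<Sum>e\<in>B. ip \<mu> X p' e * e x)" for x
        by (simp add: sum.distrib[symmetric] sum_distrib_left distrib_right mult.assoc)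
      then have eq: "p x - (\<Sum>e\<in>B. ip \<mu> X p e * e x) = c * r x + (p' x - (\<Sum>e\<in>B. ip \<mu> X p' e * e x))" for x
        by (simp add: p'(2) r_def algebra_simps)
      show ?thesis using nr span[OF p'(1)] unfolding null_on_def eq by eventually_elim simp
    qed
    then show ?thesis using B sub by (intro exI[of _ B]) auto
  next
    case False
    define s where "s = sqrt (ip \<mu> X r r)"
    have s: "s > 0" "s * s = ip \<mu> X r r" using False ip_self_nonneg[of r] by (auto simp: s_def)
    define e0 where "e0 x = (1 / s) * r x" for x
    have ce0: "continuous_on UNIV e0" unfolding e0_def using cr by (intro continuous_intros)
    have e0B: "ip \<mu> X e0 e = 0" if "e \<in> B" for e unfolding e0_def[abs_def] ip_cmul_left rB[OF that] by simp
    have re0: "ip \<mu> X r e0 = s"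
    proof -
      have "ip \<mu> X r e0 = ip \<mu> X e0 r" by (rule ip_commute)
      also have "\<dots> = (1 / s) * (s * s)" unfolding e0_def[abs_def] ip_cmul_left s(2) ..
      finally show ?thesis using s(1) by simp
    qed
    have e00: "ip \<mu> X e0 e0 = 1"
    proof -
      have "ip \<mu> X e0 e0 = (1 / s) * ip \<mu> X r e0" by (subst e0_def[abs_def]) (rule ip_cmul_left)
      then show ?thesis using re0 s(1) by simp
    qed
    have e0n: "e0 \<notin> B" using e0B[of e0] e00 by auto
    have "null_on \<mu> X (\<lambda>x. p x - (\<Sum>e\<in>insert e0 B. ip \<mu> X p e * e x))" if p: "p \<in> lin_span m (insert a A)" for p
    proof -
      obtain c p' where p': "p' \<in> lin_span m A" "\<And>x. p x = c * m a x + p' x" using decomp[OF p] by blast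
      have ipp: "ip \<mu> X p e = c * ip \<mu> X (m a) e + ip \<mu> X p' e" if "continuous_on UNIV e" for e
        by (rule ip_split[OF p'(1) p'(2) that])
      have sum0: "ip \<mu> X (\<lambda>x. \<Sum>e\<in>B. k e * e x) e0 = 0" for k
      proof -
        have "ip \<mu> X (\<lambda>x. \<Sum>e\<in>B. k e * e x) e0 = (\<Sum>e\<in>B. k e * ip \<mu> X e e0)"
          using cB ce0 by (subst ip_sum_left) (auto simp: ip_cmul_left intro!: int continuous_intros)
        also have "\<dots> = 0" using e0B by (intro sum.neutral) (auto simp: ip_commute[of \<mu> X _ e0])
        finally show ?thesis .
      qed
      have "ip \<mu> X p' e0 = ip \<mu> X (\<lambda>x. \<Sum>e\<in>B. ip \<mu> X p' e * e x) e0"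
        by (rule ip_cong_null[OF span[OF p'(1)]]) (intro int cA p'(1) ce0 csum)+
      then have "ip \<mu> X p' e0 = 0" using sum0 by simp
      moreover have "ip \<mu> X (m a) e0 = ip \<mu> X r e0 + ip \<mu> X (\<lambda>x. \<Sum>e\<in>B. ip \<mu> X (m a) e * e x) e0"
        using cr csum ce0 by (subst ip_add_left[symmetric]) (auto simp flip: ma intro!: int)
      ultimately have "ip \<mu> X p e0 = c * s" using ipp[OF ce0] sum0 re0 by simp
      moreover have "(\<Sum>e\<in>B. ip \<mu> X p e * e x) = c * (\<Sum>e\<in>B. ip \<mu> X (m a) e * e x) + (\<Sum>e\<in>B. ip \<mu> X p' e * e x)" for x
        using ipp cB by (simp add: sum.distrib[symmetric] sum_distrib_left distrib_right mult.assoc)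
      ultimately have "p x - (\<Sum>e\<in>insert e0 B. ip \<mu> X p e * e x) = p' x - (\<Sum>e\<in>B. ip \<mu> X p' e * e x)" for x
        using B(1) e0n s(1) by (simp add: p'(2) r_def e0_def algebra_simps)
      then show ?thesis using span[OF p'(1)] by simp
    qed
    moreover have "insert e0 B \<subseteq> lin_span m (insert a A)"
      using lin_span_cmul[OF rin, of "1 / s"] B(2) sub by (auto simp: e0_def[abs_def])
    moreover have "ip \<mu> X e e' = (if e = e' then 1 else 0)" if "e \<in> insert e0 B" "e' \<in> insert e0 B" for e e'
    proof (cases "e = e0")
      case True
      then show ?thesis using that(2) e0B e00 e0n by auto
    next
      case False
      then have "e \<in> B" using that(1) by simp
      then show ?thesis using that(2) B(3)[of e e'] e0B[of e] e0n False by (auto simp: ip_commute[of \<mu> X e e0])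
    qed
    moreover have "finite (insert e0 B)" using B(1) by simp
    ultimately show ?thesis by (intro exI[of _ "insert e0 B"] conjI ballI)
  qed
qed

end

definition onb :: "(real^'n) measure \<Rightarrow> nat \<Rightarrow> (real^'n) set \<Rightarrow> (real^'n \<Rightarrow> real) set \<Rightarrow> bool" where
  "onb \<mu> q X B \<longleftrightarrow> finite B \<and> B \<subseteq> poly_fun q \<and> (\<forall>e\<in>B. \<forall>e'\<in>B. ip \<mu> X e e' = (if e = e' then 1 else 0)) \<and>
    (\<forall>p\<in>poly_fun q. null_on \<mu> X (\<lambda>x. p x - (\<Sum>e\<in>B. ip \<mu> X p e * e x)))"

lemma onb_exists:
  fixes \<mu> :: "(real^'n) measure"
  assumes "cont_integrable \<mu> X"
  shows "\<exists>B. onb \<mu> q X B"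
  unfolding onb_def poly_fun_lin_span
  by (intro orthonormal_family[OF assms] finite_multi_indices)
     (auto intro!: poly_fun_continuous[OF monomial_fun_poly_fun[OF order_refl]])

lemma set_integrable_cong_null:
  assumes "null_on \<mu> X (\<lambda>x. p x - p' x)" "set_integrable \<mu> X (\<lambda>x. f x * p x)"
    "set_borel_measurable \<mu> X (\<lambda>x. f x * p' x)"
  shows "set_integrable \<mu> X (\<lambda>x. f x * p' x)" "(LINT x:X|\<mu>. f x * p x) = (LINT x:X|\<mu>. f x * p' x)"
proof -
  have ae: "AE x in \<mu>. indicator X x *\<^sub>R (f x * p x) = indicator X x *\<^sub>R (f x * p' x)"
    using assms(1) unfolding null_on_def by eventually_elim (auto simp: indicator_def)
  show "set_integrable \<mu> X (\<lambda>x. f x * p' x)"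
    using assms(2,3) ae unfolding set_integrable_def set_borel_measurable_def
    by (subst integrable_cong_AE[symmetric]) auto
  show "(LINT x:X|\<mu>. f x * p x) = (LINT x:X|\<mu>. f x * p' x)"
    unfolding set_lebesgue_integral_def using assms(2,3) ae
    by (intro integral_cong_AE) (auto simp: set_integrable_def set_borel_measurable_def)
qed

text \<open>The choice in \<open>L2_proj\<close> is inhabited by the Fourier sum \<open>p\<close> in
  an orthonormal family. To compare \<open>p\<close> and \<open>f\<close> against a polynomial
  \<open>r\<close>, that polynomial is replaced by its own expansion \<open>r'\<close>, from which
  it differs only on a null set.\<close>

lemma L2_proj_poly_fun:
  fixes \<mu> :: "(real^'n) measure"
  assumes ci: "cont_integrable \<mu> X" and f: "\<And>r. r \<in> poly_fun q \<Longrightarrow> set_integrable \<mu> X (\<lambda>x. f x * r x)"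
  shows "L2_proj \<mu> q X f \<in> poly_fun q"
    and "\<And>r. r \<in> poly_fun q \<Longrightarrow> ip \<mu> X (L2_proj \<mu> q X f) r = ip \<mu> X f r"
proof -
  obtain B where B: "onb \<mu> q X B" using onb_exists[OF ci] by blast
  define p where "p x = (\<Sum>e\<in>B. ip \<mu> X f e * e x)" for x
  have Bq: "e \<in> poly_fun q" if "e \<in> B" for e using B that by (auto simp: onb_def)
  have p: "p \<in> poly_fun q" unfolding p_def by (intro poly_fun_sum poly_fun_cmul Bq)
  have int: "set_integrable \<mu> X (\<lambda>x. f x * g x)" if "f \<in> poly_fun q" "g \<in> poly_fun q" for f g
    by (intro cont_set_integrable[OF ci] continuous_intros poly_fun_continuous[OF that(1)] poly_fun_continuous[OF that(2)])
  have "ip \<mu> X p r = ip \<mu> X f r" if r: "r \<in> poly_fun q" for r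
  proof -
    define r' where "r' x = (\<Sum>e\<in>B. ip \<mu> X r e * e x)" for x
    have r': "r' \<in> poly_fun q" unfolding r'_def by (intro poly_fun_sum poly_fun_cmul Bq)
    have nr: "null_on \<mu> X (\<lambda>x. r x - r' x)" using B r unfolding onb_def r'_def by blast
    have "ip \<mu> X f r = ip \<mu> X f r'"
      unfolding ip_def using f[OF r'] by (intro set_integrable_cong_null(2)[OF nr f[OF r]]) (auto simp: set_integrable_def set_borel_measurable_def)
    also have "\<dots> = ip \<mu> X r' f" by (rule ip_commute)
    also have "\<dots> = (\<Sum>e\<in>B. ip \<mu> X r e * ip \<mu> X e f)"
    proof -
      have "set_integrable \<mu> X (\<lambda>x. (ip \<mu> X r e * e x) * f x)" if "e \<in> B" for e
        using set_integrable_mult_right[OF f[OF Bq[OF that]], of "ip \<mu> X r e"] by (simp add: mult_ac)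
      then show ?thesis unfolding r'_def by (subst ip_sum_left[OF ci]) (auto simp: ip_cmul_left[OF ci])
    qed
    also have "\<dots> = (\<Sum>e\<in>B. ip \<mu> X f e * ip \<mu> X e r)"
      by (simp add: ip_commute[of \<mu> X r] ip_commute[of \<mu> X f] mult.commute)
    also have "\<dots> = ip \<mu> X p r"
    proof -
      have "set_integrable \<mu> X (\<lambda>x. (ip \<mu> X f e * e x) * r x)" if "e \<in> B" for e
        using set_integrable_mult_right[OF int[OF Bq[OF that] r], of "ip \<mu> X f e"] by (simp add: mult_ac)
      then show ?thesis unfolding p_def by (subst ip_sum_left[OF ci]) (auto simp: ip_cmul_left[OF ci])
    qed
    finally show ?thesis by simp
  qed
  then have ex: "\<exists>p. p \<in> poly_fun q \<and> (\<forall>r\<in>poly_fun q. (LINT x:X|\<mu>. p x * r x) = (LINT x:X|\<mu>. f x * r x))"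
    using p by (auto simp: ip_def)
  show "L2_proj \<mu> q X f \<in> poly_fun q" "\<And>r. r \<in> poly_fun q \<Longrightarrow> ip \<mu> X (L2_proj \<mu> q X f) r = ip \<mu> X f r"
    using someI_ex[OF ex] unfolding L2_proj_def ip_def by auto
qed

lemma poly_fun_null_eqI:
  fixes \<mu> :: "(real^'n) measure"
  assumes ci: "cont_integrable \<mu> X" and p: "p \<in> poly_fun q" and z: "\<And>r. r \<in> poly_fun q \<Longrightarrow> ip \<mu> X p r = 0"
  shows "null_on \<mu> X p"
  using ip_self_zero[OF ci poly_fun_continuous[OF p] z[OF p]] .

section \<open>Continuous representatives of Lipschitz Sobolev functions\<close>

text \<open>Of class C^1 with a Lipschitz gradient, which suffices because the weak gradient is
  tested against functions of class C^1.\<close>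

definition bump :: "'a::euclidean_space \<Rightarrow> real" where
  "bump z = (max 0 (1 - z \<bullet> z))\<^sup>2"

definition bump_grad :: "'a::euclidean_space \<Rightarrow> 'a" where
  "bump_grad z = (- 4 * max 0 (1 - z \<bullet> z)) *\<^sub>R z"

lemma DERIV_quadratic_remainder:
  fixes h :: "real \<Rightarrow> real"
  assumes d: "\<delta> > 0" and L: "\<And>s. \<bar>s\<bar> \<le> \<delta> \<Longrightarrow> \<bar>h (t + s) - h t - s * D\<bar> \<le> L * s\<^sup>2"
  shows "(h has_real_derivative D) (at t)"
  unfolding DERIV_def
proof (rule Lim_transform_within[where d=\<delta>])
  show "(\<lambda>s. D + (if s = 0 then 0 else (h (t + s) - h t - s * D) / s)) \<midarrow>0\<rightarrow> D"
  proof -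
    have "((\<lambda>s. if s = 0 then 0 else (h (t + s) - h t - s * D) / s) \<longlongrightarrow> 0) (at 0)"
    proof (rule Lim_null_comparison)
      show "\<forall>\<^sub>F s in at 0. norm (if s = 0 then 0 else (h (t + s) - h t - s * D) / s) \<le> L * \<bar>s\<bar>"
        unfolding eventually_at
      proof (intro exI[of _ \<delta>] conjI ballI impI d)
        fix s :: real assume "s \<noteq> 0 \<and> dist s 0 < \<delta>"
        then show "norm (if s = 0 then 0 else (h (t + s) - h t - s * D) / s) \<le> L * \<bar>s\<bar>"
          using L[of s] by (simp add: divide_le_eq power2_eq_square mult.assoc)
      qed
      show "((\<lambda>s. L * \<bar>s\<bar>) \<longlongrightarrow> 0) (at 0)" by (intro tendsto_eq_intros) auto
    qed
    from tendsto_add[OF tendsto_const[of D] this] show ?thesis by simp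
  qed
  show "D + (if s = 0 then 0 else (h (t + s) - h t - s * D) / s) = (h (t + s) - h t) / s"
    if "0 < dist s 0" "dist s 0 < \<delta>" for s :: real
    using that by (simp add: field_simps)
qed (rule d)

text \<open>The derivative \<open>2 * max 0 s\<close> of the squared positive part is Lipschitz with
  constant 2, hence a Taylor remainder of at most the square of \<open>h\<close>.\<close>

lemma square_pos_part_remainder: "\<bar>(max 0 (s + h))\<^sup>2 - (max 0 s)\<^sup>2 - 2 * max 0 s * h\<bar> \<le> (h::real)\<^sup>2"
proof (cases "s \<ge> 0"; cases "s + h \<ge> 0")
  assume "s \<ge> 0" "\<not> s + h \<ge> 0"
  then have "s\<^sup>2 + 2 * s * h \<le> 0" using mult_nonneg_nonpos[of s "s + 2 * h"] by (simp add: power2_eq_square algebra_simps)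
  moreover have "0 \<le> (s + h)\<^sup>2" by simp
  ultimately show ?thesis using \<open>s \<ge> 0\<close> \<open>\<not> s + h \<ge> 0\<close> by (simp add: max_def power2_eq_square algebra_simps abs_le_iff)
next
  assume "\<not> s \<ge> 0" "s + h \<ge> 0"
  then have "(s + h)\<^sup>2 \<le> h\<^sup>2" by (intro power_mono) auto
  then show ?thesis using \<open>\<not> s \<ge> 0\<close> \<open>s + h \<ge> 0\<close> by (simp add: max_def)
qed (auto simp: max_def power2_eq_square algebra_simps)

lemma bump_remainder:
  assumes z: "norm z \<le> R" and w: "norm w \<le> 1"
  shows "\<bar>bump (z + w) - bump z - bump_grad z \<bullet> w\<bar> \<le> ((2 * R + 1)\<^sup>2 + 2) * (norm w)\<^sup>2"
proof -
  define s where "s = 1 - z \<bullet> z"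
  define h where "h = - 2 * (z \<bullet> w) - w \<bullet> w"
  have sh: "1 - (z + w) \<bullet> (z + w) = s + h" by (simp add: s_def h_def inner_add_left inner_add_right inner_commute)
  have R: "R \<ge> 0" using z norm_ge_zero order_trans by blast
  have "\<bar>z \<bullet> w\<bar> \<le> R * norm w"
    using Cauchy_Schwarz_ineq2[of z w] z mult_right_mono[OF z norm_ge_zero[of w]] by linarith
  moreover have "w \<bullet> w \<le> norm w" "w \<bullet> w \<ge> 0"
    using w mult_left_mono[OF w norm_ge_zero[of w]] by (simp_all add: power2_norm_eq_inner[symmetric] power2_eq_square)
  ultimately have "\<bar>h\<bar> \<le> (2 * R + 1) * norm w"
    unfolding h_def using inner_ge_zero[of w] unfolding distrib_right by linarith
  then have h2: "h\<^sup>2 \<le> (2 * R + 1)\<^sup>2 * (norm w)\<^sup>2"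
    by (metis abs_ge_zero power2_abs power_mono power_mult_distrib)
  have "bump (z + w) - bump z - bump_grad z \<bullet> w = ((max 0 (s + h))\<^sup>2 - (max 0 s)\<^sup>2 - 2 * max 0 s * h) - 2 * max 0 s * (w \<bullet> w)"
    unfolding bump_def bump_grad_def sh s_def[symmetric] by (simp add: h_def algebra_simps)
  moreover have "\<bar>2 * max 0 s * (w \<bullet> w)\<bar> \<le> 2 * (norm w)\<^sup>2"
  proof -
    have "max 0 s \<le> 1" by (simp add: s_def)
    then have "max 0 s * (w \<bullet> w) \<le> 1 * (w \<bullet> w)" by (rule mult_right_mono) simp
    then show ?thesis by (simp add: power2_norm_eq_inner abs_mult)
  qed
  ultimately show ?thesis using square_pos_part_remainder[of s h] h2 unfolding distrib_right by linarith
qed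

lemma has_derivative_quadratic_remainder:
  fixes f :: "'a::euclidean_space \<Rightarrow> real"
  assumes L: "\<And>w. norm w \<le> 1 \<Longrightarrow> \<bar>f (z + w) - f z - g \<bullet> w\<bar> \<le> L * (norm w)\<^sup>2"
  shows "(f has_derivative (\<lambda>h. g \<bullet> h)) (at z)"
  unfolding has_derivative_at
proof (intro conjI bounded_linear_inner_right)
  show "(\<lambda>h. norm (f (z + h) - f z - g \<bullet> h) / norm h) \<midarrow>0\<rightarrow> 0"
  proof (rule Lim_null_comparison)
    show "\<forall>\<^sub>F h in at 0. norm (norm (f (z + h) - f z - g \<bullet> h) / norm h) \<le> L * norm h"
      unfolding eventually_at
    proof (intro exI[of _ 1] conjI ballI impI)
      fix h :: 'a assume "h \<noteq> 0 \<and> dist h 0 < 1"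
      then show "norm (norm (f (z + h) - f z - g \<bullet> h) / norm h) \<le> L * norm h"
        using L[of h] by (simp add: divide_le_eq power2_eq_square mult.assoc)
    qed simp
    show "((\<lambda>h::'a. L * norm h) \<longlongrightarrow> 0) (at 0)" by (intro tendsto_eq_intros) auto
  qed
qed

text \<open>The last clause replaces the derivative by a Taylor estimate, uniform for bounded
  \<open>z\<close>. It yields both the differentiability of the kernel and differentiation of the
  convolution under the integral. Evenness allows moving a mollification onto the test
  function.\<close>

definition mollifier :: "real \<Rightarrow> ('a::euclidean_space \<Rightarrow> real) \<Rightarrow> ('a \<Rightarrow> 'a) \<Rightarrow> bool" where
  "mollifier \<delta> \<kappa> \<kappa>' \<longleftrightarrow> continuous_on UNIV \<kappa> \<and> continuous_on UNIV \<kappa>' \<and>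
     (\<forall>z. 0 \<le> \<kappa> z) \<and> (\<forall>z. norm z \<ge> \<delta> \<longrightarrow> \<kappa> z = 0) \<and> (\<forall>z. \<kappa> (- z) = \<kappa> z) \<and>
     integrable lborel \<kappa> \<and> (\<integral>z. \<kappa> z \<partial>lborel) = 1 \<and>
     (\<forall>R. \<exists>L. \<forall>z w. norm z \<le> R \<longrightarrow> norm w \<le> 1 \<longrightarrow> \<bar>\<kappa> (z + w) - \<kappa> z - \<kappa>' z \<bullet> w\<bar> \<le> L * (norm w)\<^sup>2)"

lemma mollifier_exists:
  assumes \<delta>: "\<delta> > 0" "\<delta> \<le> 1"
  shows "\<exists>(\<kappa> :: 'a::euclidean_space \<Rightarrow> real) \<kappa>'. mollifier \<delta> \<kappa> \<kappa>'"
proof -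
  define b where "b z = bump (z /\<^sub>R \<delta>)" for z :: 'a
  have contb: "continuous_on UNIV b" unfolding b_def bump_def by (intro continuous_intros)
  have b0: "b z = 0" if "norm z \<ge> \<delta>" for z
  proof -
    have "1 \<le> norm (z /\<^sub>R \<delta>)" using that \<delta> by (simp add: field_simps)
    then have "1 \<le> (norm (z /\<^sub>R \<delta>))\<^sup>2" by simp
    then have "1 \<le> (z /\<^sub>R \<delta>) \<bullet> (z /\<^sub>R \<delta>)" by (simp only: power2_norm_eq_inner)
    then have "max 0 (1 - (z /\<^sub>R \<delta>) \<bullet> (z /\<^sub>R \<delta>)) = 0" by linarith
    then show ?thesis unfolding b_def bump_def by simp
  qed
  have bnn: "b z \<ge> 0" for z by (simp add: b_def bump_def)
  have "integrable lborel (\<lambda>z. indicator (cball 0 \<delta>) z *\<^sub>R b z)"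
    using contb by (intro borel_integrable_compact) (auto intro: continuous_on_subset)
  moreover have "(\<lambda>z. indicator (cball 0 \<delta>) z *\<^sub>R b z) = b" using b0 by (auto simp: fun_eq_iff indicator_def)
  ultimately have intb: "integrable lborel b" by simp
  define c where "c = (\<integral>z. b z \<partial>lborel)"
  have c: "c > 0"
  proof -
    have half: "b z \<ge> 1/2" if "z \<in> ball 0 (\<delta>/2)" for z
    proof -
      have "norm (z /\<^sub>R \<delta>) \<le> 1/2" using that \<delta> by (simp add: field_simps)
      then have "(norm (z /\<^sub>R \<delta>))\<^sup>2 \<le> (1/2)\<^sup>2" by (intro power_mono) auto
      then have "(z /\<^sub>R \<delta>) \<bullet> (z /\<^sub>R \<delta>) \<le> 1/4" unfolding power2_norm_eq_inner by (simp add: power2_eq_square del: inner_scaleR_left inner_scaleR_right)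
      then have "3/4 \<le> max 0 (1 - (z /\<^sub>R \<delta>) \<bullet> (z /\<^sub>R \<delta>))" by linarith
      from power_mono[OF this, of 2] have "(3/4)\<^sup>2 \<le> b z" unfolding b_def bump_def by linarith
      then show ?thesis by (simp add: power2_eq_square)
    qed
    have fin: "emeasure lborel (ball (0::'a) (\<delta>/2)) < \<infinity>" by (rule emeasure_bounded_finite) simp
    have "0 < 1/2 * measure lborel (ball (0::'a) (\<delta>/2))" using \<delta> content_ball_pos[of "\<delta>/2" "0::'a"] by simp
    also have "\<dots> = (\<integral>z. 1/2 * indicator (ball (0::'a) (\<delta>/2)) z \<partial>lborel)" by simp
    also have "\<dots> \<le> c" unfolding c_def
      by (intro integral_mono integrable_mult_right integrable_real_indicator intb fin)
         (use half bnn in \<open>auto simp: indicator_def\<close>)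
    finally show ?thesis .
  qed
  define \<kappa> where "\<kappa> z = b z / c" for z
  define \<kappa>' where "\<kappa>' z = (1 / (c * \<delta>)) *\<^sub>R bump_grad (z /\<^sub>R \<delta>)" for z :: 'a
  have "mollifier \<delta> \<kappa> \<kappa>'"
    unfolding mollifier_def
  proof (intro conjI allI impI)
    show "continuous_on UNIV \<kappa>" unfolding \<kappa>_def using c contb by (intro continuous_intros) auto
    show "continuous_on UNIV \<kappa>'" unfolding \<kappa>'_def bump_grad_def by (intro continuous_intros)
    show "integrable lborel \<kappa>" unfolding \<kappa>_def using intb by simp
    show "(\<integral>z. \<kappa> z \<partial>lborel) = 1" unfolding \<kappa>_def using c by (simp add: c_def[symmetric])
    show "\<kappa> (- z) = \<kappa> z" for z by (simp add: \<kappa>_def b_def bump_def)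
    fix R
    show "\<exists>L. \<forall>z w. norm z \<le> R \<longrightarrow> norm w \<le> 1 \<longrightarrow> \<bar>\<kappa> (z + w) - \<kappa> z - \<kappa>' z \<bullet> w\<bar> \<le> L * (norm w)\<^sup>2"
    proof -
      define L where "L = max ((2 * (R / \<delta>) + 1)\<^sup>2 + 2) 0 / \<delta>\<^sup>2 / c"
      obtain B where B: "B \<ge> 0" "\<And>z. norm (\<kappa>' z) \<le> B" "\<And>z. \<kappa> z \<le> B"
      proof -
        have n1: "norm (bump_grad z) \<le> 4" for z :: 'a
        proof (cases "norm z \<le> 1")
          case True
          have "\<bar>max 0 (1 - z \<bullet> z)\<bar> \<le> 1" by simp
          then have "\<bar>max 0 (1 - z \<bullet> z)\<bar> * norm z \<le> 1 * 1" using True by (intro mult_mono) auto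
          then show ?thesis by (simp add: bump_grad_def abs_mult mult.assoc)
        next
          case False
          then have "1 \<le> z \<bullet> z" using power_mono[of 1 "norm z" 2] by (simp add: power2_norm_eq_inner)
          then show ?thesis by (simp add: bump_grad_def)
        qed
        have n2: "bump z \<le> 1" for z :: 'a by (simp add: bump_def power_le_one)
        have "norm (\<kappa>' z) \<le> 1 / (c * \<delta>) * 4" for z
          unfolding \<kappa>'_def norm_scaleR using c \<delta> by (intro mult_mono n1) auto
        moreover have "\<kappa> z \<le> 1 / c" for z using n2 c by (simp add: \<kappa>_def b_def divide_right_mono)
        ultimately show ?thesis using c \<delta>
          by (intro that[of "max (1 / (c * \<delta>) * 4) (1 / c)"]) (auto intro: le_max_iff_disj[THEN iffD2])
      qed
      \<comment> \<open>For \<open>norm w \<le> \<delta>\<close> the scaled estimate for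
        \<open>bump\<close> applies. For larger \<open>w\<close> each of the three terms is at most
        \<open>B\<close> in modulus, and dividing by \<open>\<delta>\<^sup>2\<close> turns this into
        a quadratic bound.\<close>
      define L' where "L' = max L (3 * B / \<delta>\<^sup>2)"
      have "\<bar>\<kappa> (z + w) - \<kappa> z - \<kappa>' z \<bullet> w\<bar> \<le> L' * (norm w)\<^sup>2" if zw: "norm z \<le> R" "norm w \<le> 1" for z w
      proof (cases "norm w \<le> \<delta>")
        case True
        have "\<kappa> (z + w) - \<kappa> z - \<kappa>' z \<bullet> w =
            (bump (z /\<^sub>R \<delta> + w /\<^sub>R \<delta>) - bump (z /\<^sub>R \<delta>) - bump_grad (z /\<^sub>R \<delta>) \<bullet> (w /\<^sub>R \<delta>)) / c"
          using c \<delta> by (simp add: \<kappa>_def \<kappa>'_def b_def scaleR_add_right field_simps)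
        also have "\<bar>\<dots>\<bar> \<le> ((2 * (R / \<delta>) + 1)\<^sup>2 + 2) * (norm (w /\<^sub>R \<delta>))\<^sup>2 / c"
          unfolding abs_divide using c \<delta> zw True
            bump_remainder[of "z /\<^sub>R \<delta>" "R / \<delta>" "w /\<^sub>R \<delta>"]
          by (simp add: divide_right_mono field_simps)
        also have "\<dots> = ((2 * (R / \<delta>) + 1)\<^sup>2 + 2) / \<delta>\<^sup>2 / c * (norm w)\<^sup>2"
          using \<delta> by (simp add: power_mult_distrib field_simps)
        also have "\<dots> \<le> L' * (norm w)\<^sup>2"
          unfolding L'_def L_def using c by (intro mult_right_mono) (auto intro!: le_max_iff_disj[THEN iffD2] divide_right_mono)
        finally show ?thesis .
      next
        case False
        have knn: "\<kappa> u \<ge> 0" for u using bnn c by (simp add: \<kappa>_def)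
        have "\<bar>\<kappa>' z \<bullet> w\<bar> \<le> B"
          using Cauchy_Schwarz_ineq2[of "\<kappa>' z" w] mult_mono[OF B(2)[of z] zw(2) B(1) norm_ge_zero] by simp
        then have "\<bar>\<kappa> (z + w) - \<kappa> z - \<kappa>' z \<bullet> w\<bar> \<le> 3 * B" using B(3)[of z] B(3)[of "z+w"] knn[of z] knn[of "z+w"] by linarith
        also have "\<dots> = 3 * B / \<delta>\<^sup>2 * \<delta>\<^sup>2" using \<delta> by simp
        also have "\<dots> \<le> L' * (norm w)\<^sup>2"
          unfolding L'_def using False \<delta> B(1) by (intro mult_mono power_mono) (auto intro: max.coboundedI2)
        finally show ?thesis .
      qed
      then show ?thesis by blast
    qed
  qed (use b0 bnn c in \<open>auto simp: \<kappa>_def\<close>)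
  then show ?thesis by blast
qed

section \<open>Mollification of functions with bounded weak gradient\<close>

lemma lborel_integral_translate:
  fixes G :: "'a::euclidean_space \<Rightarrow> real"
  assumes "integrable lborel G"
  shows "integrable lborel (\<lambda>x. G (c + x))" "(\<integral>x. G (c + x) \<partial>lborel) = (\<integral>x. G x \<partial>lborel)"
proof -
  have [measurable]: "G \<in> borel_measurable borel" using assms by simp
  have "integrable (distr lborel borel ((+) c)) G" using assms by (simp add: lborel_distr_plus)
  then show "integrable lborel (\<lambda>x. G (c + x))" by (subst (asm) integrable_distr_eq) auto
  show "(\<integral>x. G (c + x) \<partial>lborel) = (\<integral>x. G x \<partial>lborel)"
    by (subst (2) lborel_distr_plus[of c, symmetric]) (simp add: integral_distr)
qed

lemma DERIV_imp_lipschitz_bound: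
  fixes h :: "real \<Rightarrow> real"
  assumes "\<And>t. 0 \<le> t \<Longrightarrow> t \<le> 1 \<Longrightarrow> (h has_real_derivative D t) (at t)" "\<And>t. 0 \<le> t \<Longrightarrow> t \<le> 1 \<Longrightarrow> \<bar>D t\<bar> \<le> C"
  shows "\<bar>h 1 - h 0\<bar> \<le> C"
proof -
  obtain z where "0 < z" "z < 1" "h 1 - h 0 = (1 - 0) * D z"
    using MVT2[of 0 1 h D] assms(1) by auto
  then show ?thesis using assms(2)[of z] by simp
qed

lemma mollifier_translate:
  assumes "mollifier \<delta> \<kappa> \<kappa>'"
  shows "integrable lborel (\<lambda>y. \<kappa> (p - y))" "(\<integral>y. \<kappa> (p - y) \<partial>lborel) = 1"
proof -
  have "\<kappa> (p - y) = \<kappa> (- p + y)" for y using assms unfolding mollifier_def by (metis minus_diff_eq uminus_add_conv_diff)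
  then show "integrable lborel (\<lambda>y. \<kappa> (p - y))" "(\<integral>y. \<kappa> (p - y) \<partial>lborel) = 1"
    using lborel_integral_translate[of \<kappa> "- p"] assms by (auto simp: mollifier_def)
qed

text \<open>\<open>F\<close> is a Borel version of \<open>f\<close>, bounded everywhere and zero off
  \<open>U\<close>. Convolutions and Fubini are carried out for \<open>lborel\<close>, where a
  function that is only Lebesgue measurable may fail to be measurable.\<close>

locale bounded_weak_derivative =
  fixes U :: "'a::euclidean_space set" and f :: "'a \<Rightarrow> real" and g :: "'a \<Rightarrow> 'a" and F :: "'a \<Rightarrow> real" and B C :: real
  assumes U: "open U" "bounded U"
    and weak: "weak_gradient U f g" and fm: "set_borel_measurable lebesgue U f"
    and g: "set_borel_measurable lebesgue U g" "AE x in lebesgue. x \<in> U \<longrightarrow> norm (g x) \<le> C"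
    and F [measurable]: "F \<in> borel_measurable borel" and FB: "\<And>x. \<bar>F x\<bar> \<le> B"
    and F0: "\<And>x. x \<notin> U \<Longrightarrow> F x = 0" and Ff: "AE x in lebesgue. x \<in> U \<longrightarrow> f x = F x"
    and C: "C \<ge> 0"
begin

definition conv :: "('a \<Rightarrow> real) \<Rightarrow> 'a \<Rightarrow> real" where
  "conv \<kappa> x = (\<integral>y. F y * \<kappa> (x - y) \<partial>lborel)"

lemma B: "B \<ge> 0" using FB[of undefined] by linarith

lemma U_borel [measurable]: "U \<in> sets borel" using U by simp

lemma integrable_times_bounded:
  fixes q :: "'a \<Rightarrow> 'b::{banach, second_countable_topology}"
  assumes [measurable]: "q \<in> borel_measurable borel" and Q: "\<And>y. y \<in> U \<Longrightarrow> norm (q y) \<le> Q"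
  shows "integrable lborel (\<lambda>y. F y *\<^sub>R q y)"
proof (rule Bochner_Integration.integrable_bound)
  show "integrable lborel (\<lambda>y. (B * \<bar>Q\<bar>) * indicator U y)"
    using U emeasure_bounded_finite by (intro integrable_mult_right integrable_real_indicator) auto
  show "AE y in lborel. norm (F y *\<^sub>R q y) \<le> norm ((B * \<bar>Q\<bar>) * indicator U y)"
  proof (rule AE_I2)
    fix y show "norm (F y *\<^sub>R q y) \<le> norm ((B * \<bar>Q\<bar>) * indicator U y)"
    proof (cases "y \<in> U")
      case True
      then have "\<bar>F y\<bar> * norm (q y) \<le> B * \<bar>Q\<bar>"
        using FB[of y] Q[of y] by (intro mult_mono) auto
      then show ?thesis using True B by (simp add: abs_mult)
    qed (simp add: F0)
  qed
qed measurable

lemma integrable_F: "integrable lborel F"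
  using integrable_times_bounded[of "\<lambda>_. 1 :: real" 1] by simp

lemma continuous_bounded_on_U:
  fixes q :: "'a \<Rightarrow> 'b::real_normed_vector"
  assumes "continuous_on UNIV q"
  shows "\<exists>Q. \<forall>y\<in>U. norm (q y) \<le> Q"
proof -
  have "compact (closure U)" using U by simp
  then have "bounded (q ` closure U)"
    using assms by (intro compact_imp_bounded compact_continuous_image) (auto intro: continuous_on_subset)
  then show ?thesis using closure_subset[of U] by (auto simp: bounded_iff)
qed

lemma integrable_F_cont:
  fixes q :: "'a \<Rightarrow> 'b::{banach, second_countable_topology}"
  assumes "continuous_on UNIV q"
  shows "integrable lborel (\<lambda>y. F y *\<^sub>R q y)"
  using continuous_bounded_on_U[OF assms] assms
  by (auto intro!: integrable_times_bounded borel_measurable_continuous_onI)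

lemma weak_F:
  assumes "C1_test U \<psi> d"
  shows "(\<integral>y. F y *\<^sub>R d y \<partial>lborel) = - (LINT x:U|lebesgue. \<psi> x *\<^sub>R g x)"
proof -
  have d: "continuous_on UNIV d" using assms by (simp add: C1_test_def)
  have [measurable]: "d \<in> borel_measurable borel" using d by (rule borel_measurable_continuous_onI)
  have "(LINT x:U|lebesgue. f x *\<^sub>R d x) = (\<integral>x. F x *\<^sub>R d x \<partial>lebesgue)"
    unfolding set_lebesgue_integral_def
  proof (rule integral_cong_AE)
    have *: "AE x in lebesgue. indicator U x *\<^sub>R f x *\<^sub>R d x = F x *\<^sub>R d x"
      using Ff by eventually_elim (auto simp: indicator_def F0)
    show "(\<lambda>x. F x *\<^sub>R d x) \<in> borel_measurable lebesgue"
      by (intro measurable_completion) measurable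
    have "(\<lambda>x. (indicator U x *\<^sub>R f x) *\<^sub>R d x) \<in> borel_measurable lebesgue"
      using fm unfolding set_borel_measurable_def
      by (rule borel_measurable_scaleR) (rule measurable_completion, measurable)
    then show "(\<lambda>x. indicator U x *\<^sub>R f x *\<^sub>R d x) \<in> borel_measurable lebesgue" by simp
    show "AE x in lebesgue. indicator U x *\<^sub>R f x *\<^sub>R d x = F x *\<^sub>R d x" by (rule *)
  qed
  also have "\<dots> = (\<integral>x. F x *\<^sub>R d x \<partial>lborel)" by (rule integral_completion) measurable
  finally show ?thesis using weak assms unfolding weak_gradient_def by auto
qed

text \<open>Along the segment, the derivative of the mollification is an integral of
  \<open>F\<close> against \<open>\<kappa>'\<close>. Since the translated kernel is supported in
  \<open>U\<close>, the weak gradient turns this into an average of \<open>g\<close>, of size at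
  most \<open>C\<close>, and the mean value theorem concludes.\<close>

lemma conv_lipschitz:
  assumes m: "mollifier \<delta> \<kappa> \<kappa>'" and seg: "\<And>p. p \<in> closed_segment x x' \<Longrightarrow> cball p \<delta> \<subseteq> U"
  shows "\<bar>conv \<kappa> x' - conv \<kappa> x\<bar> \<le> C * norm (x' - x)"
proof -
  have int1: "integrable lborel (\<lambda>y. \<kappa> (p - y))" and int2: "(\<integral>y. \<kappa> (p - y) \<partial>lborel) = 1" for p
    using mollifier_translate[OF m] by auto
  define v where "v = x' - x"
  define h where "h t = conv \<kappa> (x + t *\<^sub>R v)" for t
  define D where "D t = (\<integral>y. F y *\<^sub>R \<kappa>' (x + t *\<^sub>R v - y) \<partial>lborel) \<bullet> v" for t
  have \<kappa>: "continuous_on UNIV \<kappa>" "continuous_on UNIV \<kappa>'" "\<And>z. 0 \<le> \<kappa> z" "\<And>z. norm z \<ge> \<delta> \<Longrightarrow> \<kappa> z = 0"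
     "\<And>z. \<kappa> (- z) = \<kappa> z" "integrable lborel \<kappa>" "(\<integral>z. \<kappa> z \<partial>lborel) = 1"
     and rem: "\<And>R. \<exists>L. \<forall>z w. norm z \<le> R \<longrightarrow> norm w \<le> 1 \<longrightarrow> \<bar>\<kappa> (z + w) - \<kappa> z - \<kappa>' z \<bullet> w\<bar> \<le> L * (norm w)\<^sup>2"
    using m by (auto simp: mollifier_def)
  have cont: "continuous_on UNIV (\<lambda>y. \<kappa> (p - y))" "continuous_on UNIV (\<lambda>y. \<kappa>' (p - y))" for p
    using \<kappa>(1,2) by (auto intro!: continuous_on_compose2[of UNIV _ UNIV "\<lambda>y. p - y"] continuous_intros)
  have int\<kappa>: "integrable lborel (\<lambda>y. F y * \<kappa> (p - y))" for p
    using integrable_F_cont[OF cont(1)[of p]] by simp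
  have int\<kappa>': "integrable lborel (\<lambda>y. F y *\<^sub>R \<kappa>' (p - y))" for p
    by (rule integrable_F_cont[OF cont(2)])
  have der: "(h has_real_derivative D t) (at t)" if t: "0 \<le> t" "t \<le> 1" for t
  proof (cases "v = 0")
    case True
    then show ?thesis by (simp add: h_def[abs_def] D_def)
  next
    case False
    \<comment> \<open>Only differences \<open>x + t *\<^sub>R v - y\<close> with \<open>y\<close> in
      the bounded set \<open>U\<close> matter, so one remainder constant serves the whole
      integral.\<close>
    obtain RU where RU: "\<And>y. y \<in> U \<Longrightarrow> norm y \<le> RU" using U by (auto simp: bounded_iff)
    obtain L0 where L0: "\<And>z w. norm z \<le> norm (x + t *\<^sub>R v) + RU \<Longrightarrow> norm w \<le> 1 \<Longrightarrow>
       \<bar>\<kappa> (z + w) - \<kappa> z - \<kappa>' z \<bullet> w\<bar> \<le> L0 * (norm w)\<^sup>2" using rem by blast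
    define L where "L = \<bar>L0\<bar>"
    have Lnn: "L \<ge> 0" by (simp add: L_def)
    have L: "\<bar>\<kappa> (z + w) - \<kappa> z - \<kappa>' z \<bullet> w\<bar> \<le> L * (norm w)\<^sup>2"
      if "norm z \<le> norm (x + t *\<^sub>R v) + RU" "norm w \<le> 1" for z w
      using L0[OF that] mult_right_mono[OF abs_ge_self[of L0], of "(norm w)\<^sup>2"] by (simp add: L_def)
    define p where "p = x + t *\<^sub>R v"
    show ?thesis
    proof (rule DERIV_quadratic_remainder[where \<delta>="1 / norm v" and L="(\<integral>y. \<bar>F y\<bar> \<partial>lborel) * L * (norm v)\<^sup>2"])
      fix s assume s: "\<bar>s\<bar> \<le> 1 / norm v"
      then have sv: "norm (s *\<^sub>R v) \<le> 1" using False by (simp add: field_simps)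
      have "h (t + s) - h t - s * D t = (\<integral>y. F y * \<kappa> (p + s *\<^sub>R v - y) \<partial>lborel) - (\<integral>y. F y * \<kappa> (p - y) \<partial>lborel)
          - (\<integral>y. F y *\<^sub>R \<kappa>' (p - y) \<partial>lborel) \<bullet> (s *\<^sub>R v)"
        by (simp add: h_def D_def conv_def p_def algebra_simps)
      also have "(\<integral>y. F y *\<^sub>R \<kappa>' (p - y) \<partial>lborel) \<bullet> (s *\<^sub>R v) = (\<integral>y. F y * (\<kappa>' (p - y) \<bullet> (s *\<^sub>R v)) \<partial>lborel)"
        using integral_inner_left[OF int\<kappa>'[of p], of "s *\<^sub>R v"] by (simp only: inner_scaleR_left)
      also have "(\<integral>y. F y * \<kappa> (p + s *\<^sub>R v - y) \<partial>lborel) - (\<integral>y. F y * \<kappa> (p - y) \<partial>lborel) - \<dots>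
        = (\<integral>y. F y * (\<kappa> ((p - y) + s *\<^sub>R v) - \<kappa> (p - y) - \<kappa>' (p - y) \<bullet> (s *\<^sub>R v)) \<partial>lborel)"
      proof -
        have "integrable lborel (\<lambda>y. F y * (\<kappa>' (p - y) \<bullet> (s *\<^sub>R v)))"
          using integrable_inner_left[OF int\<kappa>'[of p], of "s *\<^sub>R v"] by (simp only: inner_scaleR_left)
        then show ?thesis using int\<kappa>[of p] int\<kappa>[of "p + s *\<^sub>R v"]
          by (simp add: right_diff_distrib add_diff_eq diff_add_eq)
      qed
      also have "\<bar>\<dots>\<bar> \<le> (\<integral>y. \<bar>F y\<bar> * (L * (norm (s *\<^sub>R v))\<^sup>2) \<partial>lborel)"
      proof (rule integral_abs_bound[THEN order_trans], rule integral_mono_AE')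
        show "integrable lborel (\<lambda>y. \<bar>F y\<bar> * (L * (norm (s *\<^sub>R v))\<^sup>2))" using integrable_F by simp
        show "AE y in lborel. \<bar>F y * (\<kappa> ((p - y) + s *\<^sub>R v) - \<kappa> (p - y) - \<kappa>' (p - y) \<bullet> (s *\<^sub>R v))\<bar> \<le> \<bar>F y\<bar> * (L * (norm (s *\<^sub>R v))\<^sup>2)"
        proof (rule AE_I2)
          fix y
          show "\<bar>F y * (\<kappa> ((p - y) + s *\<^sub>R v) - \<kappa> (p - y) - \<kappa>' (p - y) \<bullet> (s *\<^sub>R v))\<bar> \<le> \<bar>F y\<bar> * (L * (norm (s *\<^sub>R v))\<^sup>2)"
          proof (cases "y \<in> U")
            case True
            have "norm (p - y) \<le> norm p + RU" using norm_triangle_ineq4[of p y] RU[OF True] by linarith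
            then show ?thesis unfolding abs_mult using L[of "p - y" "s *\<^sub>R v"] sv
              by (intro mult_left_mono) (auto simp: p_def)
          qed (simp add: F0)
        qed
      qed (use Lnn in auto)
      also have "\<dots> = (\<integral>y. \<bar>F y\<bar> \<partial>lborel) * L * (norm v)\<^sup>2 * s\<^sup>2"
        by (simp add: power_mult_distrib mult_ac)
      finally show "\<bar>h (t + s) - h t - s * D t\<bar> \<le> (\<integral>y. \<bar>F y\<bar> \<partial>lborel) * L * (norm v)\<^sup>2 * s\<^sup>2" .
    qed (use False in auto)
  qed
  have bound: "\<bar>D t\<bar> \<le> C * norm v" if t: "0 \<le> t" "t \<le> 1" for t
  proof -
    define p where "p = x + t *\<^sub>R v"
    have "p = (1 - t) *\<^sub>R x + t *\<^sub>R x'" by (simp add: p_def v_def algebra_simps)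
    then have pU: "cball p \<delta> \<subseteq> U" using t by (intro seg) (auto simp: closed_segment_def)
    have "C1_test U (\<lambda>y. \<kappa> (p - y)) (\<lambda>y. - \<kappa>' (p - y))"
      unfolding C1_test_def
    proof (intro conjI allI exI[of _ "cball p \<delta>"] impI)
      show "continuous_on UNIV (\<lambda>y. - \<kappa>' (p - y))" using cont(2) by (intro continuous_intros)
      fix y
      obtain L where L: "\<And>z w. norm z \<le> norm (p - y) \<Longrightarrow> norm w \<le> 1 \<Longrightarrow>
         \<bar>\<kappa> (z + w) - \<kappa> z - \<kappa>' z \<bullet> w\<bar> \<le> L * (norm w)\<^sup>2" using rem by blast
      show "((\<lambda>y. \<kappa> (p - y)) has_derivative (\<lambda>h. - \<kappa>' (p - y) \<bullet> h)) (at y)"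
      proof (rule has_derivative_quadratic_remainder)
        fix w :: 'a assume "norm w \<le> 1"
        then show "\<bar>\<kappa> (p - (y + w)) - \<kappa> (p - y) - (- \<kappa>' (p - y)) \<bullet> w\<bar> \<le> L * (norm w)\<^sup>2"
          using L[of "p - y" "- w"] by (simp add: algebra_simps)
      qed
      show "\<kappa> (p - y) = 0" if "y \<notin> cball p \<delta>" using that by (intro \<kappa>(4)) (auto simp: dist_norm)
    qed (use pU in auto)
    from weak_F[OF this] have "(\<integral>y. F y *\<^sub>R \<kappa>' (p - y) \<partial>lborel) = (LINT y:U|lebesgue. \<kappa> (p - y) *\<^sub>R g y)"
      by simp
    then have "D t = (LINT y:U|lebesgue. \<kappa> (p - y) *\<^sub>R g y) \<bullet> v" by (simp add: D_def p_def)
    then have "\<bar>D t\<bar> \<le> norm (LINT y:U|lebesgue. \<kappa> (p - y) *\<^sub>R g y) * norm v"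
      using Cauchy_Schwarz_ineq2 by metis
    also have "norm (LINT y:U|lebesgue. \<kappa> (p - y) *\<^sub>R g y) \<le> (\<integral>y. C * \<kappa> (p - y) \<partial>lebesgue)"
      unfolding set_lebesgue_integral_def
    proof (rule order_trans[OF integral_norm_bound], rule integral_mono_AE')
      show "integrable lebesgue (\<lambda>y. C * \<kappa> (p - y))" using int1 by (simp add: integrable_completion)
      show "AE y in lebesgue. norm (indicator U y *\<^sub>R \<kappa> (p - y) *\<^sub>R g y) \<le> C * \<kappa> (p - y)"
        using g(2)
      proof eventually_elim
        case (elim y)
        then show ?case using \<kappa>(3)[of "p - y"] C mult_right_mono[of "norm (g y)" C "\<kappa> (p - y)"]
          by (auto simp: indicator_def mult.commute)
      qed
      show "AE y in lebesgue. 0 \<le> C * \<kappa> (p - y)" using C \<kappa>(3) by simp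
    qed
    also have "(\<integral>y. C * \<kappa> (p - y) \<partial>lebesgue) = C"
      using int1 int2 by (subst integral_completion) auto
    finally show ?thesis by (simp add: mult_right_mono)
  qed
  have "\<bar>h 1 - h 0\<bar> \<le> C * norm v" using der bound by (rule DERIV_imp_lipschitz_bound)
  then show ?thesis by (simp add: h_def v_def)
qed

lemma conv_measurable [measurable]:
  assumes "mollifier \<delta> \<kappa> \<kappa>'"
  shows "conv \<kappa> \<in> borel_measurable borel"
proof -
  have "continuous_on UNIV \<kappa>" using assms by (simp add: mollifier_def)
  then have [measurable]: "\<kappa> \<in> borel_measurable borel" by (rule borel_measurable_continuous_onI)
  show ?thesis unfolding conv_def[abs_def] by measurable
qed

lemma conv_bound:
  assumes m: "mollifier \<delta> \<kappa> \<kappa>'"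
  shows "\<bar>conv \<kappa> x\<bar> \<le> B"
proof -
  have nn: "\<And>z. 0 \<le> \<kappa> z" using m by (auto simp: mollifier_def)
  have "\<bar>conv \<kappa> x\<bar> \<le> (\<integral>y. B * \<kappa> (x - y) \<partial>lborel)"
    unfolding conv_def
  proof (rule order_trans[OF integral_abs_bound], rule integral_mono_AE')
    show "integrable lborel (\<lambda>y. B * \<kappa> (x - y))" using mollifier_translate[OF m] by simp
  qed (use nn FB B in \<open>auto simp: abs_mult intro!: mult_right_mono\<close>)
  also have "\<dots> = B" using mollifier_translate[OF m] by simp
  finally show ?thesis .
qed

text \<open>Both sides are the double mollification of \<open>F\<close>; the convolution of the two
  kernels is symmetric by the substitution of \<open>x - y - z\<close> for \<open>z\<close>.\<close>

lemma conv_commute: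
  assumes m1: "mollifier \<delta>1 \<kappa>1 \<kappa>1'" and m2: "mollifier \<delta>2 \<kappa>2 \<kappa>2'"
  shows "(\<integral>z. conv \<kappa>1 (x - z) * \<kappa>2 z \<partial>lborel) = (\<integral>z. conv \<kappa>2 (x - z) * \<kappa>1 z \<partial>lborel)"
proof -
  have main: "(\<integral>z. conv \<kappa>1 (x - z) * \<kappa>2 z \<partial>lborel) = (\<integral>y. F y * (\<integral>z. \<kappa>1 (x - z - y) * \<kappa>2 z \<partial>lborel) \<partial>lborel)"
    if m1: "mollifier \<delta>1 \<kappa>1 \<kappa>1'" and m2: "mollifier \<delta>2 \<kappa>2 \<kappa>2'" for \<kappa>1 \<kappa>2 \<delta>1 \<delta>2 \<kappa>1' \<kappa>2'
  proof -
    have c: "continuous_on UNIV \<kappa>1" "continuous_on UNIV \<kappa>2" "integrable lborel \<kappa>2" "\<And>z. \<delta>1 \<le> norm z \<Longrightarrow> \<kappa>1 z = 0"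
      using m1 m2 by (auto simp: mollifier_def)
    then have [measurable]: "\<kappa>1 \<in> borel_measurable borel" "\<kappa>2 \<in> borel_measurable borel"
      by (auto intro: borel_measurable_continuous_onI)
    obtain Q where Q: "\<And>z. \<bar>\<kappa>1 z\<bar> \<le> Q"
    proof -
      have "bounded (\<kappa>1 ` cball 0 \<delta>1)" using c(1)
        by (intro compact_imp_bounded compact_continuous_image) (auto intro: continuous_on_subset)
      then obtain Q where "\<forall>z\<in>cball 0 \<delta>1. \<bar>\<kappa>1 z\<bar> \<le> Q" by (auto simp: bounded_iff)
      then have "norm z \<le> \<delta>1 \<Longrightarrow> \<bar>\<kappa>1 z\<bar> \<le> Q" for z by simp
      then have "\<bar>\<kappa>1 z\<bar> \<le> \<bar>Q\<bar>" for z using c(4)[of z] by (cases "norm z \<le> \<delta>1") force+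
      then show ?thesis using that by blast
    qed
    have int: "integrable (lborel \<Otimes>\<^sub>M lborel) (\<lambda>(z, y). F y * \<kappa>1 (x - z - y) * \<kappa>2 z)"
    proof (rule Bochner_Integration.integrable_bound)
      show "integrable (lborel \<Otimes>\<^sub>M lborel) (\<lambda>(z, y). (Q * \<kappa>2 z) * F y)"
      proof (rule lborel_pair.Fubini_integrable)
        show "integrable lborel (\<lambda>z. \<integral>y. norm (case (z, y) of (z, y) \<Rightarrow> (Q * \<kappa>2 z) * F y) \<partial>lborel)"
          using c(3) by (simp add: abs_mult)
      qed (use integrable_F in auto)
      show "AE p in lborel \<Otimes>\<^sub>M lborel. norm (case p of (z, y) \<Rightarrow> F y * \<kappa>1 (x - z - y) * \<kappa>2 z) \<le> norm (case p of (z, y) \<Rightarrow> (Q * \<kappa>2 z) * F y)"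
      proof (rule AE_I2)
        fix p :: "'a \<times> 'a"
        obtain z y where p: "p = (z, y)" by force
        have "\<bar>\<kappa>1 (x - z - y)\<bar> * (\<bar>F y\<bar> * \<bar>\<kappa>2 z\<bar>) \<le> \<bar>Q\<bar> * (\<bar>F y\<bar> * \<bar>\<kappa>2 z\<bar>)"
          using Q[of "x - z - y"] by (intro mult_right_mono) auto
        then show "norm (case p of (z, y) \<Rightarrow> F y * \<kappa>1 (x - z - y) * \<kappa>2 z) \<le> norm (case p of (z, y) \<Rightarrow> (Q * \<kappa>2 z) * F y)"
          by (simp add: p abs_mult mult_ac)
      qed
    qed measurable
    have "(\<integral>z. conv \<kappa>1 (x - z) * \<kappa>2 z \<partial>lborel) = (\<integral>z. \<integral>y. F y * \<kappa>1 (x - z - y) * \<kappa>2 z \<partial>lborel \<partial>lborel)"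
      by (simp add: conv_def)
    also have "\<dots> = (\<integral>y. \<integral>z. F y * \<kappa>1 (x - z - y) * \<kappa>2 z \<partial>lborel \<partial>lborel)"
      using lborel_pair.Fubini_integral[OF int] by simp
    also have "\<dots> = (\<integral>y. F y * (\<integral>z. \<kappa>1 (x - z - y) * \<kappa>2 z \<partial>lborel) \<partial>lborel)"
      by (simp add: mult.assoc)
    finally show ?thesis .
  qed
  have "(\<integral>z. \<kappa>1 (x - z - y) * \<kappa>2 z \<partial>lborel) = (\<integral>z. \<kappa>2 (x - z - y) * \<kappa>1 z \<partial>lborel)" for y
  proof -
    define q where "q z = \<kappa>1 (x - z - y) * \<kappa>2 z" for z
    have c: "continuous_on UNIV \<kappa>1" "continuous_on UNIV \<kappa>2" using m1 m2 by (auto simp: mollifier_def)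
    then have [measurable]: "\<kappa>1 \<in> borel_measurable borel" "\<kappa>2 \<in> borel_measurable borel"
      by (auto intro: borel_measurable_continuous_onI)
    have [measurable]: "q \<in> borel_measurable borel" unfolding q_def by measurable
    have "(\<integral>z. q z \<partial>lborel) = (\<integral>z. q ((x - y) + (-1) *\<^sub>R z) \<partial>lborel)"
      by (subst lborel_affine[of "-1" "x - y"]) (simp_all add: density_1 integral_distr)
    also have "\<dots> = (\<integral>z. \<kappa>2 (x - z - y) * \<kappa>1 z \<partial>lborel)" by (simp add: q_def algebra_simps)
    finally show ?thesis by (simp add: q_def)
  qed
  then show ?thesis using main[OF m1 m2] main[OF m2 m1] by simp
qed

text \<open>Each single mollification is close to the double one, by its own Lipschitz bound and the
  radius of the other kernel, and the double one is common to both. This compares two scales without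
  knowing the limit.\<close>

lemma conv_difference:
  assumes m1: "mollifier \<delta>1 \<kappa>1 \<kappa>1'" and m2: "mollifier \<delta>2 \<kappa>2 \<kappa>2'" and sub: "cball x (\<delta>1 + \<delta>2) \<subseteq> U"
    and d: "\<delta>1 > 0" "\<delta>2 > 0"
  shows "\<bar>conv \<kappa>1 x - conv \<kappa>2 x\<bar> \<le> C * (\<delta>1 + \<delta>2)"
proof -
  have main: "\<bar>conv \<kappa>1 x - (\<integral>z. conv \<kappa>1 (x - z) * \<kappa>2 z \<partial>lborel)\<bar> \<le> C * \<delta>2"
    if m1: "mollifier \<delta>1 \<kappa>1 \<kappa>1'" and m2: "mollifier \<delta>2 \<kappa>2 \<kappa>2'" and sub: "cball x (\<delta>1 + \<delta>2) \<subseteq> U"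
      and d: "\<delta>1 > 0" "\<delta>2 > 0" for \<kappa>1 \<kappa>2 \<delta>1 \<delta>2 \<kappa>1' \<kappa>2'
  proof -
    note [measurable] = conv_measurable[OF m1]
    have k: "\<And>z. 0 \<le> \<kappa>2 z" "\<And>z. \<delta>2 \<le> norm z \<Longrightarrow> \<kappa>2 z = 0" "integrable lborel \<kappa>2" "(\<integral>z. \<kappa>2 z \<partial>lborel) = 1"
      using m2 by (auto simp: mollifier_def)
    have [measurable]: "\<kappa>2 \<in> borel_measurable borel" using k(3) by simp
    have int: "integrable lborel (\<lambda>z. conv \<kappa>1 (x - z) * \<kappa>2 z)"
    proof (rule Bochner_Integration.integrable_bound)
      show "integrable lborel (\<lambda>z. B * \<kappa>2 z)" using k by simp
      show "AE z in lborel. norm (conv \<kappa>1 (x - z) * \<kappa>2 z) \<le> norm (B * \<kappa>2 z)"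
        using conv_bound[OF m1] B k(1) by (auto simp: abs_mult intro!: mult_right_mono)
    qed measurable
    have "conv \<kappa>1 x - (\<integral>z. conv \<kappa>1 (x - z) * \<kappa>2 z \<partial>lborel) = (\<integral>z. (conv \<kappa>1 x - conv \<kappa>1 (x - z)) * \<kappa>2 z \<partial>lborel)"
      using k int by (simp add: left_diff_distrib)
    also have "\<bar>\<dots>\<bar> \<le> (\<integral>z. (C * \<delta>2) * \<kappa>2 z \<partial>lborel)"
    proof (rule order_trans[OF integral_abs_bound], rule integral_mono_AE')
      show "integrable lborel (\<lambda>z. (C * \<delta>2) * \<kappa>2 z)" using k by simp
      have "\<bar>(conv \<kappa>1 x - conv \<kappa>1 (x - z)) * \<kappa>2 z\<bar> \<le> (C * \<delta>2) * \<kappa>2 z" for z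
      proof (cases "norm z \<le> \<delta>2")
        case True
        have "cball p \<delta>1 \<subseteq> U" if p: "p \<in> closed_segment (x - z) x" for p
        proof -
          have "dist p x \<le> norm z" using segment_bound(2)[OF p] by (simp add: dist_norm norm_minus_commute)
          then have "cball p \<delta>1 \<subseteq> cball x (\<delta>1 + \<delta>2)" using True by (auto simp: cball_subset_cball_iff)
          then show ?thesis using sub by blast
        qed
        then have "\<bar>conv \<kappa>1 x - conv \<kappa>1 (x - z)\<bar> \<le> C * norm (x - (x - z))" by (intro conv_lipschitz[OF m1])
        then have "\<bar>conv \<kappa>1 x - conv \<kappa>1 (x - z)\<bar> \<le> C * norm z" by simp
        also have "\<dots> \<le> C * \<delta>2" using True C by (intro mult_left_mono)
        finally show ?thesis unfolding abs_mult using k(1)[of z] by (simp add: mult_right_mono)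
      qed (use k(2)[of z] in simp)
      then show "AE z in lborel. \<bar>(conv \<kappa>1 x - conv \<kappa>1 (x - z)) * \<kappa>2 z\<bar> \<le> (C * \<delta>2) * \<kappa>2 z" by simp
      show "AE z in lborel. 0 \<le> (C * \<delta>2) * \<kappa>2 z" using C d k(1) by simp
    qed
    also have "\<dots> = C * \<delta>2" using k by simp
    finally show ?thesis .
  qed
  have "cball x (\<delta>2 + \<delta>1) \<subseteq> U" using sub by (simp add: add.commute)
  then show ?thesis using main[OF m1 m2 sub d] main[OF m2 m1 _ d(2,1)] conv_commute[OF m1 m2, of x]
    by (simp add: distrib_left abs_le_iff)
qed

text \<open>Fubini and the evenness of the kernels move the mollification from \<open>F\<close> onto
  \<open>P\<close>, the test function cut off to a ball. There it converges pointwise except on the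
  bounding sphere, which is null, and a multiple of \<open>\<bar>F y\<bar>\<close>
  dominates.\<close>

lemma conv_weak_limit:
  fixes \<kappa> :: "nat \<Rightarrow> 'a \<Rightarrow> real"
  assumes m: "\<And>n. mollifier (1 / real (Suc n)) (\<kappa> n) (\<kappa>' n)"
    and \<psi>: "continuous_on UNIV \<psi>" "\<And>x. \<bar>\<psi> x\<bar> \<le> Q" and W: "W = ball x0 r"
  shows "(\<lambda>n. \<integral>x. indicator W x * \<psi> x * conv (\<kappa> n) x \<partial>lborel) \<longlonglongrightarrow> (\<integral>x. indicator W x * \<psi> x * F x \<partial>lborel)"
proof -
  have [measurable]: "W \<in> sets borel" "\<psi> \<in> borel_measurable borel"
    using W \<psi>(1) by (auto intro: borel_measurable_continuous_onI)
  define P where "P x = indicator W x * \<psi> x" for x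
  have [measurable]: "P \<in> borel_measurable borel" unfolding P_def by measurable
  have Q0: "Q \<ge> 0" using \<psi>(2)[of undefined] by linarith
  have PQ: "\<bar>P x\<bar> \<le> Q" for x using \<psi>(2)[of x] Q0 by (auto simp: P_def indicator_def)
  have finW: "emeasure lborel W < \<infinity>" unfolding W by (rule emeasure_bounded_finite) simp
  have intP: "integrable lborel P"
  proof (rule Bochner_Integration.integrable_bound)
    show "integrable lborel (\<lambda>x. Q * indicator W x)" using finW by simp
    show "AE x in lborel. norm (P x) \<le> norm (Q * indicator W x)"
      using \<psi>(2) Q0 by (auto simp: P_def indicator_def)
  qed measurable
  have k: "\<And>n z. 0 \<le> \<kappa> n z" "\<And>n z. 1 / real (Suc n) \<le> norm z \<Longrightarrow> \<kappa> n z = 0" "\<And>n. continuous_on UNIV (\<kappa> n)"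
     "\<And>n z. \<kappa> n (- z) = \<kappa> n z" "\<And>n. integrable lborel (\<kappa> n)"
    using m unfolding mollifier_def by blast+
  have [measurable]: "\<kappa> n \<in> borel_measurable borel" for n using k(5)[of n] by simp
  define p where "p n y = (\<integral>x. P x * \<kappa> n (y - x) \<partial>lborel)" for n y
  have ix: "integrable lborel (\<lambda>x. P x * \<kappa> n (y - x))" for n y
  proof (rule Bochner_Integration.integrable_bound)
    show "integrable lborel (\<lambda>x. Q * \<kappa> n (y - x))" using mollifier_translate[OF m] by simp
    show "AE x in lborel. norm (P x * \<kappa> n (y - x)) \<le> norm (Q * \<kappa> n (y - x))"
      using PQ k(1) Q0 by (auto simp: abs_mult intro!: mult_right_mono)
  qed measurable
  have pQ: "\<bar>p n y\<bar> \<le> Q" for n y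
  proof -
    have "\<bar>p n y\<bar> \<le> (\<integral>x. Q * \<kappa> n (y - x) \<partial>lborel)" unfolding p_def
    proof (rule order_trans[OF integral_abs_bound], rule integral_mono_AE')
      show "integrable lborel (\<lambda>x. Q * \<kappa> n (y - x))" using mollifier_translate[OF m] by simp
    qed (use PQ k(1) Q0 in \<open>auto simp: abs_mult intro!: mult_right_mono\<close>)
    then show ?thesis using mollifier_translate(2)[OF m] by simp
  qed
  have [measurable]: "p n \<in> borel_measurable borel" for n unfolding p_def[abs_def] by measurable
  have swap: "(\<integral>x. P x * conv (\<kappa> n) x \<partial>lborel) = (\<integral>y. F y * p n y \<partial>lborel)" for n
  proof -
    have int: "integrable (lborel \<Otimes>\<^sub>M lborel) (\<lambda>(x, y). P x * (F y * \<kappa> n (x - y)))"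
    proof (rule lborel_pair.Fubini_integrable)
      have "integrable lborel (\<lambda>y. F y * \<kappa> n (x - y))" for x
      proof -
        have "continuous_on UNIV (\<lambda>y. \<kappa> n (x - y))"
          using k(3)[of n] by (auto intro!: continuous_on_compose2[of UNIV _ UNIV "\<lambda>y. x - y"] continuous_intros)
        then show ?thesis using integrable_F_cont[of "\<lambda>y. \<kappa> n (x - y)"] by simp
      qed
      then show "AE x in lborel. integrable lborel (\<lambda>y. case (x, y) of (x, y) \<Rightarrow> P x * (F y * \<kappa> n (x - y)))" by simp
      show "integrable lborel (\<lambda>x. \<integral>y. norm (case (x, y) of (x, y) \<Rightarrow> P x * (F y * \<kappa> n (x - y))) \<partial>lborel)"
      proof (rule Bochner_Integration.integrable_bound)
        show "integrable lborel (\<lambda>x. B * P x)" using intP by simp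
        have "(\<integral>y. \<bar>F y\<bar> * \<kappa> n (x - y) \<partial>lborel) \<le> B" for x
        proof -
          have "(\<integral>y. \<bar>F y\<bar> * \<kappa> n (x - y) \<partial>lborel) \<le> (\<integral>y. B * \<kappa> n (x - y) \<partial>lborel)"
            by (rule integral_mono_AE') (use mollifier_translate[OF m] FB B k(1) in \<open>auto intro!: mult_right_mono\<close>)
          then show ?thesis using mollifier_translate(2)[OF m] by simp
        qed
        moreover have "(\<integral>y. \<bar>F y\<bar> * \<kappa> n (x - y) \<partial>lborel) \<ge> 0" for x using k(1) by simp
        ultimately have "\<bar>P x\<bar> * (\<integral>y. \<bar>F y\<bar> * \<kappa> n (x - y) \<partial>lborel) \<le> \<bar>P x\<bar> * B" for x by (intro mult_left_mono) auto
        then show "AE x in lborel. norm (\<integral>y. norm (case (x, y) of (x, y) \<Rightarrow> P x * (F y * \<kappa> n (x - y))) \<partial>lborel) \<le> norm (B * P x)"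
          using k(1) B by (simp add: abs_mult mult.commute)
      qed measurable
    qed measurable
    have "(\<integral>x. P x * conv (\<kappa> n) x \<partial>lborel) = (\<integral>x. \<integral>y. P x * (F y * \<kappa> n (x - y)) \<partial>lborel \<partial>lborel)"
      by (simp add: conv_def)
    also have "\<dots> = (\<integral>y. \<integral>x. P x * (F y * \<kappa> n (x - y)) \<partial>lborel \<partial>lborel)"
      using lborel_pair.Fubini_integral[OF int] by simp
    also have "\<dots> = (\<integral>y. F y * p n y \<partial>lborel)"
    proof (rule Bochner_Integration.integral_cong[OF refl])
      fix y
      have "(\<lambda>x. P x * (F y * \<kappa> n (x - y))) = (\<lambda>x. F y * (P x * \<kappa> n (y - x)))"
        using k(4)[of n] by (auto simp: fun_eq_iff) (metis minus_diff_eq)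
      then show "(\<integral>x. P x * (F y * \<kappa> n (x - y)) \<partial>lborel) = F y * p n y" by (simp add: p_def)
    qed
    finally show ?thesis .
  qed
  have contP: "isCont P y" if y: "y \<notin> sphere x0 r" for y
  proof (cases "y \<in> W")
    case True
    have "\<forall>\<^sub>F x in nhds y. P x = \<psi> x"
      using True W eventually_nhds_in_open[of W y] by (auto simp: P_def elim!: eventually_mono)
    moreover have "isCont \<psi> y" using \<psi>(1) by (simp add: continuous_on_eq_continuous_at)
    ultimately show ?thesis by (simp add: isCont_cong)
  next
    case False
    then have "y \<in> - cball x0 r" using y W by (auto simp: sphere_def)
    then have "\<forall>\<^sub>F x in nhds y. x \<in> - cball x0 r" by (intro eventually_nhds_in_open) auto
    then have "\<forall>\<^sub>F x in nhds y. P x = 0" by eventually_elim (auto simp: P_def W)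
    then show ?thesis by (simp add: isCont_cong)
  qed
  have plim: "(\<lambda>n. p n y) \<longlonglongrightarrow> P y" if y: "y \<notin> sphere x0 r" for y
  proof (rule LIMSEQ_I)
    fix \<epsilon> :: real assume e: "\<epsilon> > 0"
    obtain d where d: "d > 0" "\<And>x. dist x y < d \<Longrightarrow> \<bar>P x - P y\<bar> < \<epsilon> / 2"
      using contP[OF y] e unfolding continuous_at_eps_delta by (metis dist_real_def half_gt_zero)
    obtain N where N: "1 / real (Suc N) < d" using nat_approx_posE[OF d(1)] .
    have "norm (p n y - P y) < \<epsilon>" if n: "n \<ge> N" for n
    proof -
      have nd: "1 / real (Suc n) < d" using n N by (smt (verit) frac_le of_nat_0_less_iff of_nat_mono Suc_le_mono zero_less_Suc)
      have "p n y - P y = (\<integral>x. (P x - P y) * \<kappa> n (y - x) \<partial>lborel)"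
        using ix[of n y] mollifier_translate[OF m, of n y] by (simp add: p_def left_diff_distrib)
      also have "\<bar>\<dots>\<bar> \<le> (\<integral>x. \<epsilon> / 2 * \<kappa> n (y - x) \<partial>lborel)"
      proof (rule order_trans[OF integral_abs_bound], rule integral_mono_AE')
        show "integrable lborel (\<lambda>x. \<epsilon> / 2 * \<kappa> n (y - x))" using mollifier_translate[OF m] by simp
        have "\<bar>(P x - P y) * \<kappa> n (y - x)\<bar> \<le> \<epsilon> / 2 * \<kappa> n (y - x)" for x
        proof (cases "dist x y < d")
          case True
          then have "\<bar>P x - P y\<bar> * \<kappa> n (y - x) \<le> \<epsilon> / 2 * \<kappa> n (y - x)"
            using d(2)[OF True] k(1) by (intro mult_right_mono) auto
          then show ?thesis using k(1)[of n "y - x"] by (simp add: abs_mult)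
        next
          case False
          then have "\<kappa> n (y - x) = 0" using nd by (intro k(2)) (simp add: dist_norm norm_minus_commute)
          then show ?thesis by simp
        qed
        then show "AE x in lborel. \<bar>(P x - P y) * \<kappa> n (y - x)\<bar> \<le> \<epsilon> / 2 * \<kappa> n (y - x)" by simp
        show "AE x in lborel. 0 \<le> \<epsilon> / 2 * \<kappa> n (y - x)" using e k(1) by simp
      qed
      also have "\<dots> = \<epsilon> / 2" using mollifier_translate(2)[OF m] by simp
      finally show ?thesis using e by simp
    qed
    then show "\<exists>N. \<forall>n\<ge>N. norm (p n y - P y) < \<epsilon>" by blast
  qed
  have "(\<lambda>n. \<integral>y. F y * p n y \<partial>lborel) \<longlonglongrightarrow> (\<integral>y. F y * P y \<partial>lborel)"
  proof (rule integral_dominated_convergence[where w="\<lambda>y. Q * \<bar>F y\<bar>"])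
    show "integrable lborel (\<lambda>y. Q * \<bar>F y\<bar>)" using integrable_F by simp
    have "AE y in lborel. y \<notin> sphere x0 r"
    proof -
      have "sphere x0 r \<in> null_sets lebesgue"
        using negligible_sphere by (simp add: negligible_iff_null_sets)
      then have "sphere x0 r \<in> null_sets lborel" by (auto simp: null_sets_def)
      then show ?thesis by (rule AE_not_in)
    qed
    then show "AE y in lborel. (\<lambda>n. F y * p n y) \<longlonglongrightarrow> F y * P y"
      by eventually_elim (intro tendsto_mult_left plim)
    show "AE y in lborel. norm (F y * p n y) \<le> Q * \<bar>F y\<bar>" for n
    proof (rule AE_I2)
      fix y show "norm (F y * p n y) \<le> Q * \<bar>F y\<bar>"
        using mult_left_mono[OF pQ[of n y] abs_ge_zero[of "F y"]] by (simp add: abs_mult mult.commute)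
    qed
  qed measurable
  moreover have "(\<integral>y. F y * P y \<partial>lborel) = (\<integral>x. indicator W x * \<psi> x * F x \<partial>lborel)"
    by (simp add: P_def mult_ac)
  ultimately show ?thesis unfolding swap[symmetric] by (simp add: P_def)
qed

text \<open>The mollifications are Cauchy at every point of \<open>U\<close>, so the limit
  \<open>h\<close> is defined everywhere there and inherits the bound along segments. That it agrees
  with \<open>f\<close> almost everywhere is obtained weakly: the difference \<open>q\<close>, cut
  off to a ball, is orthogonal to all bounded continuous functions, and approximating
  \<open>q\<close> by such functions makes the integral of its square zero.\<close>

lemma lipschitz_representative:
  "\<exists>h. (\<forall>x y. closed_segment x y \<subseteq> U \<longrightarrow> \<bar>h y - h x\<bar> \<le> C * norm (y - x)) \<and>
     (AE x in lebesgue. x \<in> U \<longrightarrow> h x = f x)"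
proof -
  have "\<forall>n. \<exists>\<kappa> \<kappa>'. mollifier (1 / real (Suc n)) (\<kappa> :: 'a \<Rightarrow> real) \<kappa>'"
    by (intro allI mollifier_exists) auto
  then obtain \<kappa> \<kappa>' where m: "\<And>n. mollifier (1 / real (Suc n)) (\<kappa> n :: 'a \<Rightarrow> real) (\<kappa>' n)" by metis
  define G where "G n = conv (\<kappa> n)" for n
  have diff: "\<bar>G n x - G k x\<bar> \<le> C * (1 / real (Suc n) + 1 / real (Suc k))"
    if "cball x (1 / real (Suc n) + 1 / real (Suc k)) \<subseteq> U" for n k x
    unfolding G_def by (rule conv_difference[OF m m that]) auto
  define h where "h x = lim (\<lambda>n. G n x)" for x
  have small: "\<exists>N. \<forall>n\<ge>N. 1 / real (Suc n) < d" if d: "d > 0" for d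
  proof -
    obtain N where N: "1 / real (Suc N) < d" using nat_approx_posE[OF d] .
    have "1 / real (Suc n) < d" if "n \<ge> N" for n
      using that N by (smt (verit) frac_le of_nat_0_less_iff of_nat_mono Suc_le_mono zero_less_Suc)
    then show ?thesis by blast
  qed
  have lim: "(\<lambda>n. G n x) \<longlonglongrightarrow> h x" if x: "x \<in> U" for x
  proof -
    obtain r where r: "r > 0" "cball x r \<subseteq> U" using U(1) x open_contains_cball by blast
    have "Cauchy (\<lambda>n. G n x)"
    proof (rule CauchyI)
      fix e :: real assume e: "e > 0"
      \<comment> \<open>The bound by \<open>r / 2\<close> keeps the balls inside \<open>U\<close>;
        the denominator uses \<open>C + 1\<close> because \<open>C\<close> may be zero.\<close>
      define d where "d = min (r / 2) (e / (2 * (C + 1)))"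
      have "d > 0" using r e C by (simp add: d_def)
      then obtain N where N: "\<And>n. n \<ge> N \<Longrightarrow> 1 / real (Suc n) < d" using small by blast
      have "norm (G n x - G k x) < e" if nk: "n \<ge> N" "k \<ge> N" for n k
      proof -
        have s: "1 / real (Suc n) + 1 / real (Suc k) < 2 * d" using N[OF nk(1)] N[OF nk(2)] by linarith
        also have "2 * d \<le> r" by (simp add: d_def)
        finally have "cball x (1 / real (Suc n) + 1 / real (Suc k)) \<subseteq> U" using r(2) by (meson less_imp_le order_trans subset_cball)
        from diff[OF this] have "norm (G n x - G k x) \<le> C * (1 / real (Suc n) + 1 / real (Suc k))" by simp
        also have "\<dots> \<le> C * (2 * d)" using s C by (intro mult_left_mono) auto
        also have "\<dots> \<le> C * (2 * (e / (2 * (C + 1))))" using C by (intro mult_left_mono) (auto simp: d_def)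
        also have "\<dots> < e" using C e by (simp add: field_simps)
        finally show ?thesis .
      qed
      then show "\<exists>M. \<forall>m\<ge>M. \<forall>n\<ge>M. norm (G m x - G n x) < e" by blast
    qed
    then show ?thesis unfolding h_def by (simp add: Cauchy_convergent_iff convergent_LIMSEQ_iff)
  qed
  have lip: "\<bar>h y - h x\<bar> \<le> C * norm (y - x)" if seg: "closed_segment x y \<subseteq> U" for x y
  proof -
    obtain \<epsilon> where \<epsilon>: "\<epsilon> > 0" "(\<Union>p\<in>closed_segment x y. cball p \<epsilon>) \<subseteq> U"
      using compact_subset_open_imp_cball_epsilon_subset[OF compact_segment U(1) seg] by blast
    obtain N where N: "\<And>n. n \<ge> N \<Longrightarrow> 1 / real (Suc n) < \<epsilon>" using small[OF \<epsilon>(1)] by blast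
    have ev: "\<bar>G n y - G n x\<bar> \<le> C * norm (y - x)" if "n \<ge> N" for n
      unfolding G_def
    proof (rule conv_lipschitz[OF m])
      fix p assume "p \<in> closed_segment x y"
      then have "cball p \<epsilon> \<subseteq> U" using \<epsilon>(2) by blast
      then show "cball p (1 / real (Suc n)) \<subseteq> U" using N[OF that] by (meson less_imp_le order_trans subset_cball)
    qed
    have xy: "x \<in> U" "y \<in> U" using seg by auto
    have "(\<lambda>n. \<bar>G n y - G n x\<bar>) \<longlonglongrightarrow> \<bar>h y - h x\<bar>" by (intro tendsto_intros lim xy)
    then show ?thesis by (rule LIMSEQ_le_const2) (use ev in blast)
  qed
  have ae: "\<exists>r>0. negligible (ball x0 r \<inter> {x. h x \<noteq> F x})" if x0: "x0 \<in> U" for x0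
  proof -
    obtain r where r: "r > 0" "cball x0 (2 * r) \<subseteq> U"
      using U(1) x0 open_contains_cball by (metis field_sum_of_halves half_gt_zero mult_2)
    define W where "W = ball x0 r"
    have WU: "cball x r \<subseteq> U" if "x \<in> W" for x
    proof -
      have "cball x r \<subseteq> cball x0 (2 * r)" using that by (auto simp: W_def cball_subset_cball_iff dist_commute)
      then show ?thesis using r by blast
    qed
    have inU: "x \<in> U" if "x \<in> W" for x using WU[OF that] r(1) by auto
    have unif: "\<bar>G n x - h x\<bar> \<le> C * (2 / real (Suc n))" if x: "x \<in> W" and n: "1 / real (Suc n) < r / 2" for n x
    proof -
      have ev: "\<bar>G n x - G k x\<bar> \<le> C * (2 / real (Suc n))" if "k \<ge> n" for k
      proof -
        have k: "1 / real (Suc k) \<le> 1 / real (Suc n)" using that by (simp add: frac_le)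
        then have "1 / real (Suc n) + 1 / real (Suc k) \<le> r" using n by linarith
        then have "cball x (1 / real (Suc n) + 1 / real (Suc k)) \<subseteq> U" using WU[OF x] by (meson order_trans subset_cball)
        from diff[OF this] have "\<bar>G n x - G k x\<bar> \<le> C * (1 / real (Suc n) + 1 / real (Suc k))" .
        also have "\<dots> \<le> C * (2 / real (Suc n))" using k C by (intro mult_left_mono) auto
        finally show ?thesis .
      qed
      have "(\<lambda>k. \<bar>G n x - G k x\<bar>) \<longlonglongrightarrow> \<bar>G n x - h x\<bar>" by (intro tendsto_intros lim inU x)
      then show ?thesis by (rule LIMSEQ_le_const2) (use ev in blast)
    qed
    have Gb: "\<bar>G n x\<bar> \<le> B" for n x unfolding G_def by (rule conv_bound[OF m])
    have hb: "\<bar>h x\<bar> \<le> B" if "x \<in> W" for x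
      using lim[OF inU[OF that]] by (intro LIMSEQ_le_const2[OF tendsto_rabs]) (use Gb in auto)
    have [measurable]: "G n \<in> borel_measurable borel" for n unfolding G_def by (rule conv_measurable[OF m])
    have [measurable]: "W \<in> sets borel" by (simp add: W_def)
    define q where "q x = indicator W x * (h x - F x)" for x
    have qlim: "(\<lambda>n. indicator W x * (G n x - F x)) \<longlonglongrightarrow> q x" for x
      unfolding q_def using lim[OF inU] by (cases "x \<in> W") (auto intro!: tendsto_intros)
    have [measurable]: "q \<in> borel_measurable borel"
      by (rule borel_measurable_LIMSEQ_real[OF qlim]) measurable
    have qb: "\<bar>q x\<bar> \<le> 2 * B" for x
      using hb[of x] FB[of x] B by (auto simp: q_def indicator_def abs_le_iff)
    have finW: "emeasure lborel W < \<infinity>" unfolding W_def by (rule emeasure_bounded_finite) simp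
    have orth: "(\<integral>x. q x * \<psi> x \<partial>lborel) = 0" if \<psi>: "continuous_on UNIV \<psi>" "\<And>x. \<bar>\<psi> x\<bar> \<le> Q" for \<psi> Q
    proof -
      have [measurable]: "\<psi> \<in> borel_measurable borel" using \<psi>(1) by (rule borel_measurable_continuous_onI)
      have Q0: "Q \<ge> 0" using \<psi>(2)[of undefined] by linarith
      have i: "integrable lborel (\<lambda>x. indicator W x * \<psi> x * u x)"
        if [measurable]: "u \<in> borel_measurable borel" and ub: "\<And>x. \<bar>u x\<bar> \<le> B" for u
      proof (rule Bochner_Integration.integrable_bound)
        show "integrable lborel (\<lambda>x. (Q * B) * indicator W x)" using finW by simp
        show "AE x in lborel. norm (indicator W x * \<psi> x * u x) \<le> norm ((Q * B) * indicator W x)"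
          using \<psi>(2) ub Q0 B by (auto simp: indicator_def abs_mult intro!: mult_mono)
      qed measurable
      have "(\<lambda>n. \<integral>x. indicator W x * \<psi> x * G n x \<partial>lborel) \<longlonglongrightarrow> (\<integral>x. indicator W x * \<psi> x * F x \<partial>lborel)"
        unfolding G_def by (rule conv_weak_limit[OF m \<psi> W_def])
      then have "(\<lambda>n. (\<integral>x. indicator W x * \<psi> x * G n x \<partial>lborel) - (\<integral>x. indicator W x * \<psi> x * F x \<partial>lborel)) \<longlonglongrightarrow> 0"
        by (simp add: LIM_zero)
      moreover have "(\<integral>x. indicator W x * \<psi> x * G n x \<partial>lborel) - (\<integral>x. indicator W x * \<psi> x * F x \<partial>lborel)
          = (\<integral>x. (indicator W x * (G n x - F x)) * \<psi> x \<partial>lborel)" for n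
        using i[of "G n"] i[of F] Gb FB
        by (subst Bochner_Integration.integral_diff[symmetric]) (auto simp: algebra_simps)
      moreover have "(\<lambda>n. \<integral>x. (indicator W x * (G n x - F x)) * \<psi> x \<partial>lborel) \<longlonglongrightarrow> (\<integral>x. q x * \<psi> x \<partial>lborel)"
      proof (rule integral_dominated_convergence[where w="\<lambda>x. (2 * B * Q) * indicator W x"])
        show "integrable lborel (\<lambda>x. (2 * B * Q) * indicator W x)" using finW by simp
        show "AE x in lborel. (\<lambda>n. (indicator W x * (G n x - F x)) * \<psi> x) \<longlonglongrightarrow> q x * \<psi> x"
          by (intro AE_I2 tendsto_mult_right qlim)
        show "AE x in lborel. norm ((indicator W x * (G n x - F x)) * \<psi> x) \<le> (2 * B * Q) * indicator W x" for n
        proof (rule AE_I2)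
          fix x
          have "\<bar>G n x - F x\<bar> * \<bar>\<psi> x\<bar> \<le> (2 * B) * Q"
            using Gb[of n x] FB[of x] \<psi>(2)[of x] B by (intro mult_mono) auto
          then show "norm ((indicator W x * (G n x - F x)) * \<psi> x) \<le> (2 * B * Q) * indicator W x"
            by (auto simp: indicator_def abs_mult)
        qed
      qed measurable
      ultimately show ?thesis by (simp add: LIMSEQ_unique)
    qed
    have "q \<in> borel_measurable lebesgue" by (rule measurable_completion) simp
    then have "q measurable_on UNIV" using lebesgue_measurable_imp_measurable_on_real[of q UNIV] by simp
    then obtain N g where N: "negligible N" "\<And>n. continuous_on UNIV (g n)" "\<And>x. x \<notin> N \<Longrightarrow> (\<lambda>n. g n x) \<longlonglongrightarrow> q x"
      unfolding measurable_on_def by auto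
    \<comment> \<open>Truncation at \<open>2 * B\<close>, which bounds \<open>q\<close>, leaves the
      limit unchanged and makes the approximations admissible in \<open>orth\<close> and
      dominated.\<close>
    define \<psi> where "\<psi> n x = max (- (2 * B)) (min (2 * B) (g n x))" for n :: nat and x
    have c\<psi>: "continuous_on UNIV (\<psi> n)" for n unfolding \<psi>_def using N(2) by (intro continuous_intros)
    have b\<psi>: "\<bar>\<psi> n x\<bar> \<le> 2 * B" for n x unfolding \<psi>_def using B by auto
    have l\<psi>: "(\<lambda>n. \<psi> n x) \<longlonglongrightarrow> q x" if "x \<notin> N" for x
    proof -
      have "(\<lambda>n. \<psi> n x) \<longlonglongrightarrow> max (- (2 * B)) (min (2 * B) (q x))"
        unfolding \<psi>_def by (intro tendsto_intros N(3) that)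
      then show ?thesis using qb[of x] by (simp add: abs_le_iff)
    qed
    have "(\<lambda>n. \<integral>x. q x * \<psi> n x \<partial>lebesgue) \<longlonglongrightarrow> (\<integral>x. q x * q x \<partial>lebesgue)"
    proof (rule integral_dominated_convergence[where w="\<lambda>x. (2 * B * (2 * B)) * indicator W x"])
      have "integrable lborel (\<lambda>x. (2 * B * (2 * B)) * indicator W x)" using finW by simp
      then show "integrable lebesgue (\<lambda>x. (2 * B * (2 * B)) * indicator W x)" by (simp add: integrable_completion)
      have "AE x in lebesgue. x \<notin> N" using N(1) by (simp add: negligible_iff_null_sets AE_not_in)
      then show "AE x in lebesgue. (\<lambda>n. q x * \<psi> n x) \<longlonglongrightarrow> q x * q x"
        by eventually_elim (intro tendsto_mult_left l\<psi>)
      show "AE x in lebesgue. norm (q x * \<psi> n x) \<le> (2 * B * (2 * B)) * indicator W x" for n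
      proof (rule AE_I2)
        fix x
        have "\<bar>q x\<bar> * \<bar>\<psi> n x\<bar> \<le> (2 * B) * (2 * B)" using qb b\<psi> B by (intro mult_mono) auto
        then show "norm (q x * \<psi> n x) \<le> (2 * B * (2 * B)) * indicator W x"
          by (auto simp: indicator_def q_def abs_mult)
      qed
      have [measurable]: "\<psi> n \<in> borel_measurable borel" for n using c\<psi> by (rule borel_measurable_continuous_onI)
      show "(\<lambda>x. q x * \<psi> n x) \<in> borel_measurable lebesgue" for n by (rule measurable_completion) measurable
      show "(\<lambda>x. q x * q x) \<in> borel_measurable lebesgue" by (rule measurable_completion) measurable
    qed
    moreover have "(\<integral>x. q x * \<psi> n x \<partial>lebesgue) = 0" for n
    proof -
      have [measurable]: "\<psi> n \<in> borel_measurable borel" using c\<psi> by (rule borel_measurable_continuous_onI)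
      show ?thesis using orth[OF c\<psi> b\<psi>, of n] by (subst integral_completion) auto
    qed
    ultimately have "(\<integral>x. q x * q x \<partial>lebesgue) = 0" by (simp add: LIMSEQ_const_iff)
    then have I0: "(\<integral>x. q x * q x \<partial>lborel) = 0" by (subst (asm) integral_completion) auto
    have iq: "integrable lborel (\<lambda>x. q x * q x)"
    proof (rule Bochner_Integration.integrable_bound)
      show "integrable lborel (\<lambda>x. (2 * B * (2 * B)) * indicator W x)" using finW by simp
      have "\<bar>q x\<bar> * \<bar>q x\<bar> \<le> (2 * B) * (2 * B)" for x using qb[of x] B by (intro mult_mono) auto
      then have qq: "\<bar>q x * q x\<bar> \<le> 2 * B * (2 * B)" for x by (simp add: abs_mult)
      have "norm (q x * q x) \<le> norm ((2 * B * (2 * B)) * indicator W x)" for x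
      proof (cases "x \<in> W")
        case True
        then show ?thesis using qq[of x] B by simp
      qed (simp add: q_def)
      then show "AE x in lborel. norm (q x * q x) \<le> norm ((2 * B * (2 * B)) * indicator W x)" by simp
    qed measurable
    have "AE x in lborel. q x * q x = 0"
      using integral_nonneg_eq_0_iff_AE[OF iq] I0 by simp
    then have "AE x in lebesgue. q x = 0" by (auto intro!: AE_completion elim!: eventually_mono)
    moreover have "{x. q x \<noteq> 0} \<in> sets lebesgue"
      using measurable_sets[OF \<open>q \<in> borel_measurable lebesgue\<close>, of "- {0}"] by (simp add: vimage_def)
    ultimately have "{x. q x \<noteq> 0} \<in> null_sets lebesgue" by (simp add: AE_iff_null_sets)
    moreover have "ball x0 r \<inter> {x. h x \<noteq> F x} \<subseteq> {x. q x \<noteq> 0}" by (auto simp: q_def W_def)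
    ultimately have "negligible (ball x0 r \<inter> {x. h x \<noteq> F x})"
      using negligible_subset negligible_iff_null_sets by blast
    then show ?thesis using r(1) by blast
  qed
  have "negligible (U \<inter> {x. h x \<noteq> F x})"
    unfolding locally_negligible_alt[of "U \<inter> {x. h x \<noteq> F x}"]
  proof
    fix x assume x: "x \<in> U \<inter> {x. h x \<noteq> F x}"
    then obtain r where r: "r > 0" "negligible (ball x r \<inter> {x. h x \<noteq> F x})" using ae by blast
    have "openin (top_of_set (U \<inter> {x. h x \<noteq> F x})) ((U \<inter> {x. h x \<noteq> F x}) \<inter> ball x r)" by (simp add: openin_open_Int)
    moreover have "negligible ((U \<inter> {x. h x \<noteq> F x}) \<inter> ball x r)" using r(2) negligible_subset by (metis inf.cobounded2 inf_assoc inf_commute)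
    ultimately show "\<exists>T. openin (top_of_set (U \<inter> {x. h x \<noteq> F x})) T \<and> x \<in> T \<and> negligible T"
      using x r(1) by (intro exI[of _ "(U \<inter> {x. h x \<noteq> F x}) \<inter> ball x r"]) auto
  qed
  then have "AE x in lebesgue. x \<notin> U \<inter> {x. h x \<noteq> F x}" unfolding negligible_iff_null_sets by (rule AE_not_in)
  with Ff have "AE x in lebesgue. x \<in> U \<longrightarrow> h x = f x" by eventually_elim auto
  with lip show ?thesis by blast
qed

end

text \<open>The segment between two points of \<open>U\<close> near the boundary may leave
  \<open>U\<close>. It is replaced by a detour inside the epigraph: up by \<open>s\<close> along
  \<open>e\<close>, across, and down again. The detour has length
  \<open>(2 * L + 3) * norm (z - y)\<close>.\<close>

lemma local_lipschitz_at_boundary: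
  fixes U :: "'a::euclidean_space set" and h :: "'a \<Rightarrow> real"
  assumes U: "open U" "lipschitz_boundary_in UNIV U" and C: "C \<ge> 0"
    and h: "\<And>x y. closed_segment x y \<subseteq> U \<Longrightarrow> \<bar>h y - h x\<bar> \<le> C * norm (y - x)"
    and x0: "x0 \<in> closure U"
  shows "\<exists>r>0. \<exists>C'\<ge>0. \<forall>y\<in>U \<inter> ball x0 r. \<forall>z\<in>U \<inter> ball x0 r. \<bar>h z - h y\<bar> \<le> C' * norm (z - y)"
proof (cases "x0 \<in> U")
  case True
  then obtain r where r: "r > 0" "ball x0 r \<subseteq> U" using U(1) open_contains_ball by blast
  have "\<bar>h z - h y\<bar> \<le> C * norm (z - y)" if "y \<in> ball x0 r" "z \<in> ball x0 r" for y z
    using that r(2) convex_contains_segment[of "ball x0 r"] convex_ball[of x0 r] by (intro h) blast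
  then show ?thesis using r(1) C by blast
next
  case False
  then have "x0 \<in> top_of_set UNIV frontier_of U"
    using x0 U(1) by (auto simp: euclidean_frontier_of frontier_def interior_open)
  then obtain e g L r where e: "norm e = 1" and g: "L-lipschitz_on (UNIV :: 'a set) g" and r: "r > 0"
    and epi: "\<And>y. y \<in> ball x0 r \<Longrightarrow> y \<in> U \<longleftrightarrow> g (y - (y \<bullet> e) *\<^sub>R e) < y \<bullet> e"
    using U(2) unfolding lipschitz_boundary_in_def by (metis IntI UNIV_I)
  have ee: "e \<bullet> e = 1" using e by (simp add: norm_eq_1)
  have L: "L \<ge> 0" using g by (rule lipschitz_on_nonneg)
  \<comment> \<open>Small enough for the whole detour to stay in the chart: its points are at
    distance less than \<open>r' + 2 * (L + 1) * r'\<close> from \<open>x0\<close>, which is below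
    \<open>r\<close>.\<close>
  define r' where "r' = r / (2 * L + 4)"
  have r': "r' > 0" "r' * (2 * L + 3) < r" using r L by (auto simp: r'_def field_simps)
  have proj: "norm (v - (v \<bullet> e) *\<^sub>R e) \<le> norm v" for v
  proof -
    have "(norm (v - (v \<bullet> e) *\<^sub>R e))\<^sup>2 = (norm v)\<^sup>2 - (v \<bullet> e)\<^sup>2"
      unfolding power2_norm_eq_inner by (simp add: inner_diff_left inner_diff_right inner_commute ee power2_eq_square)
    then show ?thesis by (intro power2_le_imp_le[OF _ norm_ge_zero]) simp
  qed
  have main: "\<bar>h z - h y\<bar> \<le> C * (2 * L + 3) * norm (z - y)" if yz: "y \<in> U \<inter> ball x0 r'" "z \<in> U \<inter> ball x0 r'" for y z
  proof -
    \<comment> \<open>Along the segment the graph rises by at most \<open>L * norm (z - y)\<close>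
      and the height drops by at most \<open>norm (z - y)\<close>; lifting by the sum of both keeps
      the segment above the graph.\<close>
    define s where "s = (L + 1) * norm (z - y)"
    have s0: "s \<ge> 0" using L by (simp add: s_def)
    have "norm (z - y) < 2 * r'"
    proof -
      have "dist z y < 2 * r'" using yz dist_triangle[of z y x0] by (auto simp: dist_commute)
      then show ?thesis by (simp add: dist_norm)
    qed
    then have "s \<le> (L + 1) * (2 * r')" unfolding s_def using L by (intro mult_left_mono) auto
    then have sr: "r' + s < r" using r'(2) by (simp add: algebra_simps)
    have inb: "p + \<tau> *\<^sub>R e \<in> ball x0 r" if "p \<in> ball x0 r'" "0 \<le> \<tau>" "\<tau> \<le> s" for p \<tau>
    proof -
      have "dist x0 (p + \<tau> *\<^sub>R e) \<le> dist x0 p + \<tau>"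
        using dist_triangle[of x0 "p + \<tau> *\<^sub>R e" p] e that by (simp add: dist_norm)
      then show ?thesis using that sr by simp
    qed
    have vert: "closed_segment p (p + s *\<^sub>R e) \<subseteq> U" if p: "p \<in> U \<inter> ball x0 r'" for p
    proof
      fix w assume "w \<in> closed_segment p (p + s *\<^sub>R e)"
      then obtain u where u: "0 \<le> u" "u \<le> 1" "w = (1 - u) *\<^sub>R p + u *\<^sub>R (p + s *\<^sub>R e)" by (auto simp: closed_segment_def)
      then have w: "w = p + (u * s) *\<^sub>R e" by (simp add: algebra_simps)
      have us: "0 \<le> u * s" "u * s \<le> s" using u s0 by (auto simp: mult_left_le_one_le)
      have wb: "w \<in> ball x0 r" unfolding w by (rule inb) (use p us in auto)
      have "p \<in> ball x0 r" using inb[of p 0] p s0 by simp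
      then have "g (p - (p \<bullet> e) *\<^sub>R e) < p \<bullet> e" using epi p by blast
      moreover have "w - (w \<bullet> e) *\<^sub>R e = p - (p \<bullet> e) *\<^sub>R e" unfolding w by (simp add: inner_add_left ee algebra_simps)
      moreover have "w \<bullet> e = p \<bullet> e + u * s" unfolding w by (simp add: inner_add_left ee)
      ultimately have "g (w - (w \<bullet> e) *\<^sub>R e) < w \<bullet> e" using us by simp
      then show "w \<in> U" using epi[OF wb] by simp
    qed
    have horiz: "closed_segment (y + s *\<^sub>R e) (z + s *\<^sub>R e) \<subseteq> U"
    proof
      fix w assume "w \<in> closed_segment (y + s *\<^sub>R e) (z + s *\<^sub>R e)"
      then obtain u where u: "0 \<le> u" "u \<le> 1" "w = (1 - u) *\<^sub>R (y + s *\<^sub>R e) + u *\<^sub>R (z + s *\<^sub>R e)" by (auto simp: closed_segment_def)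
      define p where "p = (1 - u) *\<^sub>R y + u *\<^sub>R z"
      have w: "w = p + s *\<^sub>R e" using u(3) by (simp add: p_def algebra_simps)
      have "p \<in> closed_segment y z" using u by (auto simp: closed_segment_def p_def)
      then have pb: "p \<in> ball x0 r'" using yz convex_contains_segment[of "ball x0 r'"] convex_ball[of x0 r'] by blast
      have wb: "w \<in> ball x0 r" unfolding w by (rule inb) (use pb s0 in auto)
      have py: "p - y = u *\<^sub>R (z - y)" by (simp add: p_def algebra_simps)
      then have npy: "norm (p - y) \<le> norm (z - y)" using u by (simp add: mult_left_le_one_le)
      have "y \<in> ball x0 r" using inb[of y 0] yz s0 by simp
      then have gy: "g (y - (y \<bullet> e) *\<^sub>R e) < y \<bullet> e" using epi yz by blast
      have weq: "w - (w \<bullet> e) *\<^sub>R e = p - (p \<bullet> e) *\<^sub>R e" unfolding w by (simp add: inner_add_left ee algebra_simps)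
      have "dist (g (p - (p \<bullet> e) *\<^sub>R e)) (g (y - (y \<bullet> e) *\<^sub>R e)) \<le> L * dist (p - (p \<bullet> e) *\<^sub>R e) (y - (y \<bullet> e) *\<^sub>R e)"
        by (rule lipschitz_onD[OF g]) auto
      also have "dist (p - (p \<bullet> e) *\<^sub>R e) (y - (y \<bullet> e) *\<^sub>R e) = norm ((p - y) - ((p - y) \<bullet> e) *\<^sub>R e)"
        by (simp add: dist_norm inner_diff_left algebra_simps)
      also have "L * \<dots> \<le> L * norm (z - y)" using proj[of "p - y"] npy L by (intro mult_left_mono) auto
      finally have "g (p - (p \<bullet> e) *\<^sub>R e) \<le> g (y - (y \<bullet> e) *\<^sub>R e) + L * norm (z - y)" by (simp add: dist_real_def abs_le_iff)
      moreover have "p \<bullet> e \<ge> y \<bullet> e - norm (z - y)"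
        using Cauchy_Schwarz_ineq2[of "p - y" e] e npy by (simp add: inner_diff_left abs_le_iff)
      moreover have "w \<bullet> e = p \<bullet> e + s" unfolding w by (simp add: inner_add_left ee)
      ultimately have "g (w - (w \<bullet> e) *\<^sub>R e) < w \<bullet> e" unfolding weq using gy by (simp add: s_def algebra_simps)
      then show "w \<in> U" using epi[OF wb] by simp
    qed
    have 1: "\<bar>h (y + s *\<^sub>R e) - h y\<bar> \<le> C * s" using h[OF vert[OF yz(1)]] e s0 by simp
    have 2: "\<bar>h (z + s *\<^sub>R e) - h z\<bar> \<le> C * s" using h[OF vert[OF yz(2)]] e s0 by simp
    have 3: "\<bar>h (z + s *\<^sub>R e) - h (y + s *\<^sub>R e)\<bar> \<le> C * norm (z - y)" using h[OF horiz] by simp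
    have "\<bar>h z - h y\<bar> \<le> C * s + C * s + C * norm (z - y)" using 1 2 3 by linarith
    then show ?thesis by (simp add: s_def algebra_simps)
  qed
  have "C * (2 * L + 3) \<ge> 0" using C L by simp
  then show ?thesis using main r'(1) by blast
qed

text \<open>Two sequences violating uniform continuity have a common limit point in the compact
  closure, and the local Lipschitz bound around that point contradicts their choice.\<close>

lemma continuous_extension_lipschitz_boundary:
  fixes U :: "'a::euclidean_space set" and h :: "'a \<Rightarrow> real"
  assumes U: "open U" "bounded U" "lipschitz_boundary_in UNIV U" and C: "C \<ge> 0"
    and h: "\<And>x y. closed_segment x y \<subseteq> U \<Longrightarrow> \<bar>h y - h x\<bar> \<le> C * norm (y - x)"
  shows "\<exists>h'. continuous_on (closure U) h' \<and> (\<forall>x\<in>U. h' x = h x)"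
proof -
  have "uniformly_continuous_on U h"
  proof (rule ccontr)
    assume "\<not> ?thesis"
    then obtain \<epsilon> where \<epsilon>: "\<epsilon> > 0" "\<And>d. d > 0 \<Longrightarrow> \<exists>x\<in>U. \<exists>y\<in>U. dist y x < d \<and> \<not> dist (h y) (h x) < \<epsilon>"
      unfolding uniformly_continuous_on_def by blast
    have "\<forall>n. \<exists>x y. x \<in> U \<and> y \<in> U \<and> dist y x < 1 / real (Suc n) \<and> \<not> dist (h y) (h x) < \<epsilon>"
      using \<epsilon>(2)[of "1 / real (Suc _)"] by (meson divide_pos_pos of_nat_0_less_iff zero_less_Suc zero_less_one)
    then obtain X Y where XY: "\<And>n. X n \<in> U" "\<And>n. Y n \<in> U" "\<And>n. dist (Y n) (X n) < 1 / real (Suc n)"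
       "\<And>n. \<not> dist (h (Y n)) (h (X n)) < \<epsilon>" by metis
    have "compact (closure U)" using U(2) by simp
    then obtain x0 s where s: "x0 \<in> closure U" "strict_mono (s::nat \<Rightarrow> nat)" "(X \<circ> s) \<longlonglongrightarrow> x0"
      using XY(1) closure_subset[of U] unfolding compact_def by (metis subsetD)
    have z: "(\<lambda>n. 1 / real (Suc (s n))) \<longlonglongrightarrow> 0"
      using LIMSEQ_subseq_LIMSEQ[OF LIMSEQ_Suc[OF lim_const_over_n[of "1::real"]] s(2)] by (simp add: o_def)
    have d0: "(\<lambda>n. dist (Y (s n)) (X (s n))) \<longlonglongrightarrow> 0"
      by (rule tendsto_sandwich[OF _ _ tendsto_const z]) (use XY(3) in \<open>auto intro: less_imp_le always_eventually\<close>)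
    have Xl: "(\<lambda>n. X (s n)) \<longlonglongrightarrow> x0" using s(3) by (simp add: o_def)
    have "(\<lambda>n. Y (s n) - X (s n)) \<longlonglongrightarrow> 0" using d0 by (simp add: dist_norm tendsto_norm_zero_iff)
    from tendsto_add[OF this Xl] have Yl: "(\<lambda>n. Y (s n)) \<longlonglongrightarrow> x0" by simp
    obtain r C' where r: "r > 0" "C' \<ge> 0" "\<And>y z. y \<in> U \<inter> ball x0 r \<Longrightarrow> z \<in> U \<inter> ball x0 r \<Longrightarrow> \<bar>h z - h y\<bar> \<le> C' * norm (z - y)"
      using local_lipschitz_at_boundary[OF U(1,3) C h s(1)] by blast
    have "\<forall>\<^sub>F n in sequentially. X (s n) \<in> ball x0 r" "\<forall>\<^sub>F n in sequentially. Y (s n) \<in> ball x0 r"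
      using tendstoD[OF Xl r(1)] tendstoD[OF Yl r(1)] by (simp_all add: dist_commute)
    then have "\<forall>\<^sub>F n in sequentially. \<epsilon> \<le> C' * dist (Y (s n)) (X (s n))"
    proof eventually_elim
      case (elim n)
      then show ?case using r(3)[of "X (s n)" "Y (s n)"] XY(1,2,4)[of "s n"] by (simp add: dist_norm dist_real_def)
    qed
    moreover have "(\<lambda>n. C' * dist (Y (s n)) (X (s n))) \<longlonglongrightarrow> C' * 0" by (intro tendsto_mult_left d0)
    ultimately have "\<epsilon> \<le> C' * 0" by (intro tendsto_lowerbound[of _ _ sequentially]) auto
    then show False using \<epsilon>(1) by simp
  qed
  from uniformly_continuous_on_extension_on_closure[OF this] show ?thesis
    using uniformly_continuous_imp_continuous by metis
qed

lemma W1_infty_continuous_representative: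
  fixes U :: "'a::euclidean_space set" and f :: "'a \<Rightarrow> real"
  assumes dom: "open U" "bounded U" "lipschitz_boundary_in UNIV U" and f: "W1_infty U f"
  shows "\<exists>h. continuous_on (closure U) h \<and> (AE x in lebesgue. x \<in> U \<longrightarrow> h x = f x)"
proof -
  obtain g where fL: "L_infty U f" and gL: "L_infty U g" and weak: "weak_gradient U f g"
    using f by (auto simp: W1_infty_def)
  obtain B0 where B0: "AE x in lebesgue. x \<in> U \<longrightarrow> norm (f x) \<le> B0" and fm: "set_borel_measurable lebesgue U f"
    using fL by (auto simp: L_infty_def)
  obtain C0 where C0: "AE x in lebesgue. x \<in> U \<longrightarrow> norm (g x) \<le> C0" and gm: "set_borel_measurable lebesgue U g"
    using gL by (auto simp: L_infty_def)
  obtain f' where f' [measurable]: "f' \<in> borel_measurable lborel" and ff': "AE x in lborel. indicator U x *\<^sub>R f x = f' x"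
    using completion_ex_borel_measurable_real[of "\<lambda>x. indicator U x *\<^sub>R f x" lborel] fm
    unfolding set_borel_measurable_def by auto
  \<comment> \<open>Clamping a Borel version at the essential bound makes it bounded everywhere and
    changes it only on a null set.\<close>
  define B where "B = \<bar>B0\<bar>"
  define F where "F x = (if x \<in> U then max (- B) (min B (f' x)) else 0)" for x
  interpret bounded_weak_derivative U f g F B "\<bar>C0\<bar>"
  proof
    have [measurable]: "U \<in> sets borel" using dom by simp
    have [measurable]: "f' \<in> borel_measurable borel" using f' by simp
    show "F \<in> borel_measurable borel" unfolding F_def by measurable
    have ff'': "AE x in lebesgue. indicator U x *\<^sub>R f x = f' x" using ff' by (rule AE_completion)
    from B0 ff'' show "AE x in lebesgue. x \<in> U \<longrightarrow> f x = F x"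
    proof eventually_elim
      case (elim x)
      then show ?case by (auto simp: F_def B_def)
    qed
    show "AE x in lebesgue. x \<in> U \<longrightarrow> norm (g x) \<le> \<bar>C0\<bar>" using C0 by eventually_elim auto
  qed (use dom weak fm gm in \<open>auto simp: F_def B_def\<close>)
  obtain h where h: "\<And>x y. closed_segment x y \<subseteq> U \<Longrightarrow> \<bar>h y - h x\<bar> \<le> \<bar>C0\<bar> * norm (y - x)"
    "AE x in lebesgue. x \<in> U \<longrightarrow> h x = f x" using lipschitz_representative by blast
  obtain h' where h': "continuous_on (closure U) h'" "\<And>x. x \<in> U \<Longrightarrow> h' x = h x"
    using continuous_extension_lipschitz_boundary[OF dom C h(1)] by blast
  from h(2) have "AE x in lebesgue. x \<in> U \<longrightarrow> h' x = f x" by eventually_elim (simp add: h'(2))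
  then show ?thesis using h'(1) by blast
qed

lemma boundary_trace_real:
  fixes U :: "'a::euclidean_space set" and f :: "'a \<Rightarrow> real"
  assumes "open U" "bounded U" "lipschitz_boundary_in UNIV U" "W1_infty U f"
  shows "continuous_on (closure U) (boundary_trace U f)" "AE x in lebesgue. x \<in> U \<longrightarrow> boundary_trace U f x = f x"
  using someI_ex[OF W1_infty_continuous_representative[OF assms]] unfolding boundary_trace_def by auto

lemma boundary_trace_matrix:
  fixes U :: "(real^'n) set" and f :: "real^'n \<Rightarrow> real^'n^'n"
  assumes "open U" "bounded U" "lipschitz_boundary_in UNIV U" "\<And>i j. W1_infty U (\<lambda>x. f x $ i $ j)"
  shows "continuous_on (closure U) (boundary_trace U f)" "AE x in lebesgue. x \<in> U \<longrightarrow> boundary_trace U f x = f x"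
proof -
  define h where "h i j = boundary_trace U (\<lambda>x. f x $ i $ j)" for i j
  have h: "\<And>i j. continuous_on (closure U) (h i j)"
    "\<And>i j. AE x in lebesgue. x \<in> U \<longrightarrow> h i j x = f x $ i $ j"
    unfolding h_def by (rule boundary_trace_real[OF assms])+
  have "\<forall>i j. AE x in lebesgue. x \<in> U \<longrightarrow> h i j x = f x $ i $ j" by (intro allI h(2))
  then have "AE x in lebesgue. \<forall>i. \<forall>j. x \<in> U \<longrightarrow> h i j x = f x $ i $ j" by (simp only: AE_all_countable simp_thms)
  then have "AE x in lebesgue. x \<in> U \<longrightarrow> (\<chi> i j. h i j x) = f x" by eventually_elim (auto simp: vec_eq_iff)
  moreover have "continuous_on (closure U) (\<lambda>x. \<chi> i j. h i j x)" by (intro continuous_on_vec_lambda h)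
  ultimately have ex: "\<exists>g. continuous_on (closure U) g \<and> (AE x in lebesgue. x \<in> U \<longrightarrow> g x = f x)" by blast
  show "continuous_on (closure U) (boundary_trace U f)" "AE x in lebesgue. x \<in> U \<longrightarrow> boundary_trace U f x = f x"
    using someI_ex[OF ex] unfolding boundary_trace_def by auto
qed

section \<open>The discrete gradient\<close>

lemma set_integrable_compact_lebesgue:
  fixes f :: "'a::euclidean_space \<Rightarrow> real"
  assumes "bounded K" "K \<in> sets borel" "continuous_on (closure K) f"
  shows "set_integrable lebesgue K f"
proof -
  have "integrable lborel (\<lambda>x. indicator (closure K) x *\<^sub>R f x)"
    using assms by (intro borel_integrable_compact) auto
  then have "set_integrable lborel (closure K) f" by (simp only: set_integrable_def)
  moreover have "K \<in> sets lborel" using assms(2) by simp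
  ultimately have "set_integrable lborel K f" using closure_subset by (rule set_integrable_subset)
  then have i: "integrable lborel (\<lambda>x. indicator K x *\<^sub>R f x)" by (simp only: set_integrable_def)
  then show ?thesis unfolding set_integrable_def by (subst integrable_completion[OF borel_measurable_integrable[OF i]])
qed

text \<open>The set where a polynomial is nonzero is open, so on a cell vanishing almost everywhere
  already means being the zero polynomial. On a face there is no such conclusion.\<close>

lemma poly_fun_AE_zero:
  fixes K :: "(real^'n) set"
  assumes K: "open K" "K \<noteq> {}" and p: "p \<in> poly_fun q" and z: "null_on lebesgue K p"
  shows "p = (\<lambda>x. 0)"
proof -
  have "p x = 0" if x: "x \<in> K" for x
  proof (rule ccontr)
    assume nz: "p x \<noteq> 0"
    define V where "V = K \<inter> p -` (- {0})"
    have "open V" unfolding V_def using K(1) poly_fun_continuous[OF p]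
      by (intro open_Int open_vimage) auto
    moreover have "V \<noteq> {}" using x nz by (auto simp: V_def)
    moreover have "negligible V"
    proof -
      have "AE x in lebesgue. x \<notin> V" using z unfolding null_on_def by eventually_elim (auto simp: V_def)
      then have "V \<in> null_sets lebesgue" using \<open>open V\<close> by (simp add: AE_iff_null_sets)
      then show ?thesis by (simp add: negligible_iff_null_sets)
    qed
    ultimately show False using open_not_negligible by blast
  qed
  then show ?thesis using poly_fun_zero_on_open[OF p K] by blast
qed

text \<open>Pointwise convergence with a uniform bound: what dominated convergence asks for on a set
  of finite measure, and a property preserved by all the operations that build the exponential
  weights.\<close>

definition bconv :: "'a set \<Rightarrow> (nat \<Rightarrow> 'a \<Rightarrow> real) \<Rightarrow> ('a \<Rightarrow> real) \<Rightarrow> bool" where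
  "bconv X f g \<longleftrightarrow> (\<forall>x\<in>X. (\<lambda>n. f n x) \<longlonglongrightarrow> g x) \<and> (\<exists>D. \<forall>n. \<forall>x\<in>X. \<bar>f n x\<bar> \<le> D)"

lemma bconvI:
  assumes "\<And>x. x \<in> X \<Longrightarrow> (\<lambda>n. f n x) \<longlonglongrightarrow> g x" "\<And>n x. x \<in> X \<Longrightarrow> \<bar>f n x\<bar> \<le> D"
  shows "bconv X f g"
  using assms unfolding bconv_def by (intro conjI ballI exI[of _ D] allI)

lemma bconvE:
  assumes "bconv X f g"
  obtains D where "\<forall>x\<in>X. (\<lambda>n. f n x) \<longlonglongrightarrow> g x" "\<forall>n. \<forall>x\<in>X. \<bar>f n x\<bar> \<le> D"
  using assms unfolding bconv_def by (elim conjE exE) (rule that)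

lemma bconv_add:
  assumes "bconv X f g" "bconv X f' g'"
  shows "bconv X (\<lambda>n x. f n x + f' n x) (\<lambda>x. g x + g' x)"
proof -
  obtain D where D': "\<forall>x\<in>X. (\<lambda>n. f n x) \<longlonglongrightarrow> g x" "\<forall>n. \<forall>x\<in>X. \<bar>f n x\<bar> \<le> D"
    using assms(1) by (rule bconvE)
  note D = D'[rule_format]
  obtain D2 where D2: "\<forall>x\<in>X. (\<lambda>n. f' n x) \<longlonglongrightarrow> g' x" "\<forall>n. \<forall>x\<in>X. \<bar>f' n x\<bar> \<le> D2"
    using assms(2) by (rule bconvE)
  note D' = D2[rule_format]
  show ?thesis
  proof (rule bconvI)
    fix x n assume x: "x \<in> X"
    show "(\<lambda>n. f n x + f' n x) \<longlonglongrightarrow> g x + g' x" by (intro tendsto_add D(1) D'(1) x)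
    show "\<bar>f n x + f' n x\<bar> \<le> D + D2" using D(2)[OF x, of n] D'(2)[OF x, of n] by linarith
  qed
qed

lemma bconv_cmul:
  assumes "bconv X f g" and q: "\<And>x. x \<in> X \<Longrightarrow> \<bar>q x\<bar> \<le> B"
  shows "bconv X (\<lambda>n x. f n x * q x) (\<lambda>x. g x * q x)"
proof -
  obtain D where D': "\<forall>x\<in>X. (\<lambda>n. f n x) \<longlonglongrightarrow> g x" "\<forall>n. \<forall>x\<in>X. \<bar>f n x\<bar> \<le> D"
    using assms(1) by (rule bconvE)
  note D = D'[rule_format]
  show ?thesis
  proof (rule bconvI)
    fix x n assume x: "x \<in> X"
    show "(\<lambda>n. f n x * q x) \<longlonglongrightarrow> g x * q x" by (intro tendsto_mult_right D(1) x)
    show "\<bar>f n x * q x\<bar> \<le> \<bar>D\<bar> * \<bar>B\<bar>"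
      unfolding abs_mult using D(2)[OF x, of n] q[OF x] by (intro mult_mono) auto
  qed
qed

lemma bconv_exp:
  assumes "bconv X f g"
  shows "bconv X (\<lambda>n x. exp (f n x)) (\<lambda>x. exp (g x))"
proof -
  obtain D where D': "\<forall>x\<in>X. (\<lambda>n. f n x) \<longlonglongrightarrow> g x" "\<forall>n. \<forall>x\<in>X. \<bar>f n x\<bar> \<le> D"
    using assms(1) by (rule bconvE)
  note D = D'[rule_format]
  show ?thesis
  proof (rule bconvI)
    fix x n assume x: "x \<in> X"
    show "(\<lambda>n. exp (f n x)) \<longlonglongrightarrow> exp (g x)" by (intro tendsto_exp D(1) x)
    show "\<bar>exp (f n x)\<bar> \<le> exp D" using D(2)[OF x, of n] by simp
  qed
qed

lemma bconv_lincomb: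
  assumes "finite I" "\<And>n i. i \<in> I \<Longrightarrow> \<bar>c n i\<bar> \<le> R" "\<And>i. i \<in> I \<Longrightarrow> (\<lambda>n. c n i) \<longlonglongrightarrow> d i"
    and "\<And>i. i \<in> I \<Longrightarrow> \<exists>B. \<forall>x\<in>X. \<bar>q i x\<bar> \<le> B"
  shows "bconv X (\<lambda>n x. \<Sum>i\<in>I. c n i * q i x) (\<lambda>x. \<Sum>i\<in>I. d i * q i x)"
  using assms
proof (induction I rule: finite_induct)
  case empty
  show ?case by (auto simp: bconv_def intro: exI[of _ 0])
next
  case (insert a I)
  obtain B where B: "\<And>x. x \<in> X \<Longrightarrow> \<bar>q a x\<bar> \<le> B" using insert.prems(3)[of a] by blast
  have "bconv X (\<lambda>n x. c n a) (\<lambda>x. d a)" using insert.prems(1,2)[of a] unfolding bconv_def by blast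
  then have "bconv X (\<lambda>n x. c n a * q a x) (\<lambda>x. d a * q a x)" using B by (rule bconv_cmul)
  moreover have "bconv X (\<lambda>n x. \<Sum>i\<in>I. c n i * q i x) (\<lambda>x. \<Sum>i\<in>I. d i * q i x)"
    by (rule insert.IH) (use insert.prems in auto)
  ultimately show ?case using insert.hyps bconv_add by fastforce
qed

lemma bconv_integral:
  assumes "bconv X f g" "\<And>n. set_borel_measurable \<mu> X (f n)" "set_borel_measurable \<mu> X g"
    and "emeasure \<mu> X < \<infinity>" "X \<in> sets \<mu>"
  shows "(\<lambda>n. LINT x:X|\<mu>. f n x) \<longlonglongrightarrow> (LINT x:X|\<mu>. g x)"
proof -
  obtain D where D': "\<forall>x\<in>X. (\<lambda>n. f n x) \<longlonglongrightarrow> g x" "\<forall>n. \<forall>x\<in>X. \<bar>f n x\<bar> \<le> D"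
    using assms(1) by (rule bconvE)
  note l = D'(1)[rule_format] and D = D'(2)[rule_format]
  show ?thesis unfolding set_lebesgue_integral_def
  proof (rule integral_dominated_convergence[where w="\<lambda>x. D * indicator X x"])
    show "integrable \<mu> (\<lambda>x. D * indicator X x)" using assms(4,5) by simp
    show "AE x in \<mu>. (\<lambda>n. indicator X x *\<^sub>R f n x) \<longlonglongrightarrow> indicator X x *\<^sub>R g x"
      using l by (intro AE_I2) (auto simp: indicator_def)
    show "AE x in \<mu>. norm (indicator X x *\<^sub>R f n x) \<le> D * indicator X x" for n
      using D by (intro AE_I2) (auto simp: indicator_def)
  qed (use assms(2,3) in \<open>auto simp: set_borel_measurable_def\<close>)
qed

text \<open>The bound on the dimension ensures that a face, being open in a hyperplane, is not a
  single point. Its diameter is then positive, and the jump coefficients do not collapse to zero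
  through division by zero.\<close>

locale hho =
  fixes \<Omega> :: "(real^'n) set" and \<Lambda> :: "real^'n \<Rightarrow> real^'n^'n" and M E :: "(real^'n) set set"
    and EK :: "(real^'n) set \<Rightarrow> (real^'n) set set" and k :: nat
  assumes dim: "2 \<le> CARD('n)"
    and domain: "open \<Omega>" "bounded \<Omega>" "connected \<Omega>"
    and Lambda_elliptic: "\<exists>c>0. AE x in lebesgue. x \<in> \<Omega> \<longrightarrow> (\<forall>\<xi>. (\<Lambda> x *v \<xi>) \<bullet> \<xi> \<ge> c * (norm \<xi>)\<^sup>2)"
    and mesh: "discretisation \<Omega> M E EK"
    and Lambda_cells: "\<And>K i j. K \<in> M \<Longrightarrow> W1_infty K (\<lambda>x. \<Lambda> x $ i $ j)"
begin

section \<open>Integrability on cells and faces\<close>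

lemmas D = discretisationD[OF mesh]

abbreviation nrm :: "(real^'n) set \<Rightarrow> (real^'n) set \<Rightarrow> real^'n" where "nrm \<equiv> outer_normal"

lemma finite_EK: "K \<in> M \<Longrightarrow> finite (EK K)"
  using D(4,10) finite_subset by blast

lemma EK_E: "K \<in> M \<Longrightarrow> \<sigma> \<in> EK K \<Longrightarrow> \<sigma> \<in> E" using D(10) by blast

lemma cell_bounded: "K \<in> M \<Longrightarrow> bounded K" using D(7) domain(2) bounded_subset by blast

lemma cell_borel: "K \<in> M \<Longrightarrow> K \<in> sets borel" using D(6) by simp

lemma cell_ci: "K \<in> M \<Longrightarrow> cont_integrable lebesgue K"
  unfolding cont_integrable_def
  by (auto intro!: set_integrable_compact_lebesgue cell_bounded cell_borel intro: continuous_on_subset)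

lemma cell_finite: "K \<in> M \<Longrightarrow> emeasure lebesgue K < \<infinity>"
  using emeasure_bounded_finite[OF cell_bounded] cell_borel by simp

definition off :: "(real^'n) set \<Rightarrow> (real^'n) set \<Rightarrow> real" where
  "off K \<sigma> = (SOME b. cell_face K \<sigma> (nrm K \<sigma>) b)"

lemma face_cf: "K \<in> M \<Longrightarrow> \<sigma> \<in> EK K \<Longrightarrow> cell_face K \<sigma> (nrm K \<sigma>) (off K \<sigma>)"
  unfolding off_def by (rule someI_ex) (rule discretisation_cell_face[OF mesh])

lemma nrm_norm: "K \<in> M \<Longrightarrow> \<sigma> \<in> EK K \<Longrightarrow> norm (nrm K \<sigma>) = 1"
  using face_cf by (auto simp: cell_face_def)

lemma face_closure: "K \<in> M \<Longrightarrow> \<sigma> \<in> EK K \<Longrightarrow> closure \<sigma> \<subseteq> closure K"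
  using D(11)[of K] by (auto simp: frontier_def)

lemma face_bounded: "K \<in> M \<Longrightarrow> \<sigma> \<in> EK K \<Longrightarrow> bounded \<sigma>"
  using face_closure closure_subset cell_bounded bounded_closure bounded_subset by metis

lemma face_measure_eq: "K \<in> M \<Longrightarrow> \<sigma> \<in> EK K \<Longrightarrow> face_measure \<sigma> = affine_lborel {x. nrm K \<sigma> \<bullet> x = off K \<sigma>}"
  using face_measure_hyperplane[OF face_cf D(13)[OF EK_E]] .

lemma sets_face_measure [simp]: "sets (face_measure \<sigma>) = sets borel" by (simp add: face_measure_def)

lemma face_borel: "K \<in> M \<Longrightarrow> \<sigma> \<in> EK K \<Longrightarrow> \<sigma> \<in> sets borel" by (rule cell_face_borel[OF face_cf])

lemma face_finite: "K \<in> M \<Longrightarrow> \<sigma> \<in> EK K \<Longrightarrow> emeasure (face_measure \<sigma>) \<sigma> < \<infinity>"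
  using face_measure_eq emeasure_affine_lborel_bounded[OF nrm_norm face_bounded] by simp

lemma continuous_bounded_on:
  fixes f :: "real^'n \<Rightarrow> real"
  assumes "bounded X" "continuous_on (closure X) f"
  shows "\<exists>B. \<forall>x\<in>X. \<bar>f x\<bar> \<le> B"
proof -
  have "bounded (f ` closure X)"
    using assms by (intro compact_imp_bounded compact_continuous_image) auto
  then show ?thesis using closure_subset[of X] by (auto simp: bounded_iff)
qed

lemma face_set_integrable:
  fixes f :: "real^'n \<Rightarrow> real"
  assumes K: "K \<in> M" "\<sigma> \<in> EK K" and f: "continuous_on (closure \<sigma>) f"
  shows "set_integrable (face_measure \<sigma>) \<sigma> f"
proof -
  obtain B where B: "\<And>x. x \<in> \<sigma> \<Longrightarrow> \<bar>f x\<bar> \<le> B" using continuous_bounded_on[OF face_bounded[OF K] f] by blast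
  have "set_borel_measurable borel \<sigma> f"
    using f closure_subset continuous_on_subset by (intro borel_measurable_continuous_on_indicator[unfolded set_borel_measurable_def[symmetric]] face_borel[OF K]) blast
  then have [measurable]: "(\<lambda>x. indicator \<sigma> x *\<^sub>R f x) \<in> borel_measurable (face_measure \<sigma>)"
    by (simp add: set_borel_measurable_def measurable_cong_sets[OF sets_face_measure refl])
  show ?thesis unfolding set_integrable_def
  proof (rule Bochner_Integration.integrable_bound)
    show "integrable (face_measure \<sigma>) (\<lambda>x. B * indicator \<sigma> x)"
      using face_finite[OF K] face_borel[OF K] by (intro integrable_mult_right integrable_real_indicator) simp_all
    show "AE x in face_measure \<sigma>. norm (indicator \<sigma> x *\<^sub>R f x) \<le> norm (B * indicator \<sigma> x)"
      using B by (intro AE_I2) (force simp: indicator_def)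
  qed measurable
qed

lemma face_ci: "K \<in> M \<Longrightarrow> \<sigma> \<in> EK K \<Longrightarrow> cont_integrable (face_measure \<sigma>) \<sigma>"
  unfolding cont_integrable_def by (auto intro!: face_set_integrable intro: continuous_on_subset)

lemma cell_divergence:
  assumes K: "K \<in> M" and f: "\<And>x. (f has_derivative (\<lambda>h. g x \<bullet> h)) (at x)" and g: "continuous_on UNIV g"
  shows "(LINT x:K|lebesgue. g x \<bullet> e) = (\<Sum>\<sigma>\<in>EK K. (e \<bullet> nrm K \<sigma>) * (LINT y:\<sigma>|face_measure \<sigma>. f y))"
proof (rule divergence_directional[OF D(6)[OF K] cell_bounded[OF K] finite_EK[OF K] _ D(11)[OF K] _ _ _ f g])
  show "pairwise disjnt (EK K)" using D(5) D(10)[OF K] pairwise_subset by blast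
  show "\<And>\<sigma>. \<sigma> \<in> EK K \<Longrightarrow> cell_face K \<sigma> (nrm K \<sigma>) (off K \<sigma>)" using face_cf K by blast
  show "\<And>\<sigma>. \<sigma> \<in> EK K \<Longrightarrow> \<sigma> \<noteq> {}" "\<And>\<sigma>. \<sigma> \<in> EK K \<Longrightarrow> codim2 (closure \<sigma> - \<sigma>)" using D(13,15) EK_E[OF K] by auto
qed

section \<open>Divergence and integration by parts\<close>

lemma poly_vec_derivative:
  assumes "\<tau> \<in> poly_vec q"
  shows "\<exists>g. (\<forall>i. continuous_on UNIV (g i)) \<and> (\<forall>i x. ((\<lambda>x. \<tau> x $ i) has_derivative (\<lambda>h. g i x \<bullet> h)) (at x)) \<and>
    (\<forall>x. divergence \<tau> x = (\<Sum>i\<in>UNIV. g i x $ i)) \<and> (\<forall>x. \<tau> differentiable (at x))"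
proof -
  have "\<forall>i. \<exists>g. g \<in> poly_vec q \<and> (\<forall>x. ((\<lambda>x. \<tau> x $ i) has_derivative (\<lambda>h. g x \<bullet> h)) (at x))"
    using assms poly_fun_gradient[OF poly_fun_Suc] unfolding poly_vec_def by blast
  then obtain g where g: "\<And>i. g i \<in> poly_vec q" "\<And>i x. ((\<lambda>x. \<tau> x $ i) has_derivative (\<lambda>h. g i x \<bullet> h)) (at x)" by metis
  have *: "divergence \<tau> x = (\<Sum>i\<in>UNIV. g i x $ i) \<and> \<tau> differentiable (at x)" for x
  proof -
    have d: "(\<tau> has_derivative (\<lambda>h. \<chi> i. g i x \<bullet> h)) (at x)"
      by (subst has_derivative_componentwise_within) (auto simp: Basis_vec_def inner_axis intro: g(2))
    then have "frechet_derivative \<tau> (at x) = (\<lambda>h. \<chi> i. g i x \<bullet> h)" by (rule frechet_derivative_at[symmetric])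
    then show ?thesis using d by (auto simp: divergence_def inner_axis differentiable_def)
  qed
  have c: "continuous_on UNIV (g i)" for i by (rule poly_vec_continuous[OF g(1)])
  show ?thesis by (intro exI[of _ g] conjI allI c g(2) conjunct1[OF *] conjunct2[OF *])
qed

lemma poly_vec_differentiable: "\<tau> \<in> poly_vec q \<Longrightarrow> \<tau> differentiable (at x)"
  using poly_vec_derivative by blast

lemma divergence_continuous:
  assumes "\<tau> \<in> poly_vec q"
  shows "continuous_on UNIV (divergence \<tau>)"
proof -
  obtain g where g': "(\<forall>i. continuous_on UNIV (g i)) \<and> (\<forall>i x. ((\<lambda>x. \<tau> x $ i) has_derivative (\<lambda>h. g i x \<bullet> h)) (at x)) \<and>
    (\<forall>x. divergence \<tau> x = (\<Sum>i\<in>UNIV. g i x $ i)) \<and> (\<forall>x. \<tau> differentiable (at x))"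
    using poly_vec_derivative[OF assms] ..
  have g: "\<And>i. continuous_on UNIV (g i)" "\<And>x. divergence \<tau> x = (\<Sum>i\<in>UNIV. g i x $ i)" using g' by simp_all
  have "divergence \<tau> = (\<lambda>x. \<Sum>i\<in>UNIV. g i x $ i)" using g(2) by (rule ext)
  then show ?thesis using g(1) by (simp add: continuous_on_sum continuous_on_component)
qed

lemma divergence_add:
  assumes "\<tau> \<in> poly_vec q" "\<rho> \<in> poly_vec q"
  shows "divergence (\<lambda>x. \<tau> x + \<rho> x) x = divergence \<tau> x + divergence \<rho> x"
proof -
  have "frechet_derivative (\<lambda>x. \<tau> x + \<rho> x) (at x) = (\<lambda>h. frechet_derivative \<tau> (at x) h + frechet_derivative \<rho> (at x) h)"
    by (intro frechet_derivative_at[symmetric] has_derivative_add) (simp_all add: frechet_derivative_works[symmetric] poly_vec_differentiable[OF assms(1)] poly_vec_differentiable[OF assms(2)])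
  then show ?thesis by (simp add: divergence_def sum.distrib)
qed

lemma divergence_scaleR:
  assumes "\<tau> \<in> poly_vec q"
  shows "divergence (\<lambda>x. a *\<^sub>R \<tau> x) x = a * divergence \<tau> x"
proof -
  have "frechet_derivative (\<lambda>x. a *\<^sub>R \<tau> x) (at x) = (\<lambda>h. a *\<^sub>R frechet_derivative \<tau> (at x) h)"
    by (intro frechet_derivative_at[symmetric] has_derivative_scaleR_right) (simp_all add: frechet_derivative_works[symmetric] poly_vec_differentiable[OF assms])
  then show ?thesis by (simp add: divergence_def sum_distrib_left)
qed

text \<open>The divergence theorem is applied to the product of \<open>p\<close> with the component
  \<open>i\<close> of \<open>\<tau>\<close>, in the direction of axis \<open>i\<close>, and summed
  over \<open>i\<close>.\<close>

lemma integration_by_parts: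
  assumes K: "K \<in> M" and p: "\<And>x. (p has_derivative (\<lambda>h. g x \<bullet> h)) (at x)" and g: "continuous_on UNIV g"
    and \<tau>: "\<tau> \<in> poly_vec q"
  shows "(LINT x:K|lebesgue. g x \<bullet> \<tau> x) = - (LINT x:K|lebesgue. p x * divergence \<tau> x) +
     (\<Sum>\<sigma>\<in>EK K. LINT x:\<sigma>|face_measure \<sigma>. p x * (\<tau> x \<bullet> nrm K \<sigma>))"
proof -
  obtain G where G': "(\<forall>i. continuous_on UNIV (G i)) \<and> (\<forall>i x. ((\<lambda>x. \<tau> x $ i) has_derivative (\<lambda>h. G i x \<bullet> h)) (at x)) \<and>
    (\<forall>x. divergence \<tau> x = (\<Sum>i\<in>UNIV. G i x $ i)) \<and> (\<forall>x. \<tau> differentiable (at x))"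
    using poly_vec_derivative[OF \<tau>] ..
  have G: "\<And>i. continuous_on UNIV (G i)" "\<And>i x. ((\<lambda>x. \<tau> x $ i) has_derivative (\<lambda>h. G i x \<bullet> h)) (at x)"
    "\<And>x. divergence \<tau> x = (\<Sum>i\<in>UNIV. G i x $ i)" using G' by simp_all
  have cp: "continuous_on UNIV p" using p by (meson continuous_at_imp_continuous_on has_derivative_continuous)
  have c\<tau>: "continuous_on UNIV \<tau>" by (rule poly_vec_continuous[OF \<tau>])
  have c\<tau>i: "continuous_on UNIV (\<lambda>x. \<tau> x $ i)" for i using c\<tau> by (rule continuous_on_component)
  note int = cont_set_integrable[OF cell_ci[OF K]]
  have i1: "(LINT x:K|lebesgue. g x $ i * \<tau> x $ i) + (LINT x:K|lebesgue. p x * G i x $ i)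
      = (\<Sum>\<sigma>\<in>EK K. nrm K \<sigma> $ i * (LINT y:\<sigma>|face_measure \<sigma>. p y * \<tau> y $ i))" for i
  proof -
    have "((\<lambda>x. p x * \<tau> x $ i) has_derivative (\<lambda>h. (\<tau> x $ i *\<^sub>R g x + p x *\<^sub>R G i x) \<bullet> h)) (at x)" for x
      using has_derivative_mult[OF p[of x] G(2)[of i x]] by (simp add: inner_add_left algebra_simps)
    from cell_divergence[OF K this, of "axis i 1"]
    have "(LINT x:K|lebesgue. g x $ i * \<tau> x $ i + p x * G i x $ i)
      = (\<Sum>\<sigma>\<in>EK K. nrm K \<sigma> $ i * (LINT y:\<sigma>|face_measure \<sigma>. p y * \<tau> y $ i))"
      using cp c\<tau>i g G(1) by (simp add: inner_axis inner_axis' mult.commute continuous_intros)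
    moreover have "set_integrable lebesgue K (\<lambda>x. g x $ i * \<tau> x $ i)" "set_integrable lebesgue K (\<lambda>x. p x * G i x $ i)"
      by (intro int continuous_on_mult cp c\<tau>i continuous_on_component g G(1))+
    ultimately show ?thesis by simp
  qed
  have "(LINT x:K|lebesgue. g x \<bullet> \<tau> x) = (\<Sum>i\<in>UNIV. LINT x:K|lebesgue. g x $ i * \<tau> x $ i)"
    unfolding inner_vec_def inner_real_def set_lebesgue_integral_def scaleR_sum_right
    by (intro Bochner_Integration.integral_sum int[unfolded set_integrable_def] continuous_on_mult c\<tau>i continuous_on_component g)
  moreover have "(LINT x:K|lebesgue. p x * divergence \<tau> x) = (\<Sum>i\<in>UNIV. LINT x:K|lebesgue. p x * G i x $ i)"
    unfolding G(3) sum_distrib_left set_lebesgue_integral_def scaleR_sum_right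
    by (intro Bochner_Integration.integral_sum int[unfolded set_integrable_def] continuous_on_mult cp continuous_on_component G(1))
  moreover have "(LINT x:\<sigma>|face_measure \<sigma>. p x * (\<tau> x \<bullet> nrm K \<sigma>))
     = (\<Sum>i\<in>UNIV. nrm K \<sigma> $ i * (LINT y:\<sigma>|face_measure \<sigma>. p y * \<tau> y $ i))" if \<sigma>: "\<sigma> \<in> EK K" for \<sigma>
  proof -
    have "(LINT x:\<sigma>|face_measure \<sigma>. p x * (\<tau> x \<bullet> nrm K \<sigma>)) = (LINT x:\<sigma>|face_measure \<sigma>. \<Sum>i\<in>UNIV. nrm K \<sigma> $ i * (p x * \<tau> x $ i))"
      by (simp add: inner_vec_def sum_distrib_left mult_ac)
    also have "\<dots> = (\<Sum>i\<in>UNIV. LINT x:\<sigma>|face_measure \<sigma>. nrm K \<sigma> $ i * (p x * \<tau> x $ i))"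
      unfolding set_lebesgue_integral_def scaleR_sum_right
      by (intro Bochner_Integration.integral_sum cont_set_integrable[OF face_ci[OF K \<sigma>], unfolded set_integrable_def]
          continuous_on_mult continuous_on_const cp c\<tau>i)
    finally show ?thesis by simp
  qed
  moreover have "(\<Sum>i\<in>UNIV. \<Sum>\<sigma>\<in>EK K. nrm K \<sigma> $ i * (LINT y:\<sigma>|face_measure \<sigma>. p y * \<tau> y $ i))
     = (\<Sum>\<sigma>\<in>EK K. \<Sum>i\<in>UNIV. nrm K \<sigma> $ i * (LINT y:\<sigma>|face_measure \<sigma>. p y * \<tau> y $ i))" by (rule sum.swap)
  moreover have "(\<Sum>i\<in>UNIV. LINT x:K|lebesgue. g x $ i * \<tau> x $ i) + (\<Sum>i\<in>UNIV. LINT x:K|lebesgue. p x * G i x $ i)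
     = (\<Sum>i\<in>UNIV. \<Sum>\<sigma>\<in>EK K. nrm K \<sigma> $ i * (LINT y:\<sigma>|face_measure \<sigma>. p y * \<tau> y $ i))"
    unfolding sum.distrib[symmetric] i1 ..
  ultimately show ?thesis by simp
qed

text \<open>Constrains only faces that bound some cell, the only ones that enter the forms.\<close>

definition adm :: "'n hybrid \<Rightarrow> bool" where
  "adm v \<longleftrightarrow> (\<forall>K\<in>M. fst v K \<in> poly_fun (k + 1)) \<and> (\<forall>K\<in>M. \<forall>\<sigma>\<in>EK K. snd v \<sigma> \<in> poly_fun k)"

text \<open>A face polynomial is determined only on its face, hence the comparison up to null sets.\<close>

definition eqv :: "'n hybrid \<Rightarrow> 'n hybrid \<Rightarrow> bool" where
  "eqv v w \<longleftrightarrow> (\<forall>K\<in>M. fst v K = fst w K) \<and>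
     (\<forall>K\<in>M. \<forall>\<sigma>\<in>EK K. null_on (face_measure \<sigma>) \<sigma> (\<lambda>x. snd v \<sigma> x - snd w \<sigma> x))"

section \<open>Linear combinations and existence of the discrete gradient\<close>

definition hcomb :: "'i set \<Rightarrow> ('i \<Rightarrow> real) \<Rightarrow> ('i \<Rightarrow> 'n hybrid) \<Rightarrow> 'n hybrid" where
  "hcomb I c v = (\<lambda>K x. \<Sum>i\<in>I. c i * fst (v i) K x, \<lambda>\<sigma> x. \<Sum>i\<in>I. c i * snd (v i) \<sigma> x)"

lemma adm_hcomb: "(\<And>i. i \<in> I \<Longrightarrow> adm (v i)) \<Longrightarrow> adm (hcomb I c v)"
  unfolding adm_def hcomb_def by (auto intro!: poly_fun_sum poly_fun_cmul)

definition grad_rhs :: "(real^'n) set \<Rightarrow> 'n hybrid \<Rightarrow> (real^'n \<Rightarrow> real^'n) \<Rightarrow> real" where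
  "grad_rhs K v \<tau> = - (LINT x:K|lebesgue. fst v K x * divergence \<tau> x) +
     (\<Sum>\<sigma>\<in>EK K. LINT x:\<sigma>|face_measure \<sigma>. snd v \<sigma> x * (\<tau> x \<bullet> nrm K \<sigma>))"

lemma adm_cont:
  assumes "adm v" "K \<in> M"
  shows "continuous_on UNIV (fst v K)" "\<sigma> \<in> EK K \<Longrightarrow> continuous_on UNIV (snd v \<sigma>)"
  using assms poly_fun_continuous unfolding adm_def by blast+

lemma grad_rhs_add:
  assumes v: "adm v" and K: "K \<in> M" and \<tau>: "\<tau> \<in> poly_vec q" and \<rho>: "\<rho> \<in> poly_vec q"
  shows "grad_rhs K v (\<lambda>x. \<tau> x + \<rho> x) = grad_rhs K v \<tau> + grad_rhs K v \<rho>"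
proof -
  have "(LINT x:K|lebesgue. fst v K x * divergence (\<lambda>x. \<tau> x + \<rho> x) x)
      = (LINT x:K|lebesgue. fst v K x * divergence \<tau> x) + (LINT x:K|lebesgue. fst v K x * divergence \<rho> x)"
    unfolding divergence_add[OF \<tau> \<rho>] distrib_left
    by (intro set_integral_add(2) cont_set_integrable[OF cell_ci[OF K]] continuous_on_mult adm_cont(1)[OF v K]
        divergence_continuous[OF \<tau>] divergence_continuous[OF \<rho>])
  moreover have "(LINT x:\<sigma>|face_measure \<sigma>. snd v \<sigma> x * ((\<tau> x + \<rho> x) \<bullet> nrm K \<sigma>))
     = (LINT x:\<sigma>|face_measure \<sigma>. snd v \<sigma> x * (\<tau> x \<bullet> nrm K \<sigma>)) + (LINT x:\<sigma>|face_measure \<sigma>. snd v \<sigma> x * (\<rho> x \<bullet> nrm K \<sigma>))"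
    if \<sigma>: "\<sigma> \<in> EK K" for \<sigma>
    unfolding inner_add_left distrib_left
    by (intro set_integral_add(2) cont_set_integrable[OF face_ci[OF K \<sigma>]] continuous_on_mult adm_cont(2)[OF v K \<sigma>]
        continuous_on_inner continuous_on_const poly_vec_continuous[OF \<tau>] poly_vec_continuous[OF \<rho>])
  ultimately show ?thesis unfolding grad_rhs_def by (simp add: sum.distrib)
qed

lemma grad_rhs_scaleR:
  assumes \<tau>: "\<tau> \<in> poly_vec q"
  shows "grad_rhs K v (\<lambda>x. a *\<^sub>R \<tau> x) = a * grad_rhs K v \<tau>"
proof -
  have "(LINT x:K|lebesgue. fst v K x * divergence (\<lambda>x. a *\<^sub>R \<tau> x) x) = a * (LINT x:K|lebesgue. fst v K x * divergence \<tau> x)"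
    unfolding divergence_scaleR[OF \<tau>] by (subst set_integral_mult_right[symmetric]) (simp add: mult_ac)
  moreover have "(LINT x:\<sigma>|face_measure \<sigma>. snd v \<sigma> x * ((a *\<^sub>R \<tau> x) \<bullet> nrm K \<sigma>))
     = a * (LINT x:\<sigma>|face_measure \<sigma>. snd v \<sigma> x * (\<tau> x \<bullet> nrm K \<sigma>))" for \<sigma>
    by (subst set_integral_mult_right[symmetric]) (simp add: mult_ac)
  ultimately show ?thesis unfolding grad_rhs_def by (simp add: sum_distrib_left algebra_simps)
qed

lemma grad_rhs_hcomb:
  assumes v: "\<And>i. i \<in> I \<Longrightarrow> adm (v i)" and K: "K \<in> M" and \<tau>: "\<tau> \<in> poly_vec q"
  shows "grad_rhs K (hcomb I c v) \<tau> = (\<Sum>i\<in>I. c i * grad_rhs K (v i) \<tau>)"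
proof -
  have "(LINT x:K|lebesgue. (\<Sum>i\<in>I. c i * fst (v i) K x) * divergence \<tau> x)
      = (\<Sum>i\<in>I. LINT x:K|lebesgue. (c i * fst (v i) K x) * divergence \<tau> x)"
    unfolding sum_distrib_right set_lebesgue_integral_def scaleR_sum_right
    by (intro Bochner_Integration.integral_sum cont_set_integrable[OF cell_ci[OF K], unfolded set_integrable_def]
        continuous_on_mult continuous_on_const adm_cont(1)[OF v K] divergence_continuous[OF \<tau>])
  then have 1: "(LINT x:K|lebesgue. (\<Sum>i\<in>I. c i * fst (v i) K x) * divergence \<tau> x)
      = (\<Sum>i\<in>I. c i * (LINT x:K|lebesgue. fst (v i) K x * divergence \<tau> x))" by (simp add: mult.assoc)
  have "(LINT x:\<sigma>|face_measure \<sigma>. (\<Sum>i\<in>I. c i * snd (v i) \<sigma> x) * (\<tau> x \<bullet> nrm K \<sigma>))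
     = (\<Sum>i\<in>I. LINT x:\<sigma>|face_measure \<sigma>. (c i * snd (v i) \<sigma> x) * (\<tau> x \<bullet> nrm K \<sigma>))" if \<sigma>: "\<sigma> \<in> EK K" for \<sigma>
    unfolding sum_distrib_right set_lebesgue_integral_def scaleR_sum_right
    by (intro Bochner_Integration.integral_sum cont_set_integrable[OF face_ci[OF K \<sigma>], unfolded set_integrable_def]
        continuous_on_mult continuous_on_inner continuous_on_const adm_cont(2)[OF v K \<sigma>] poly_vec_continuous[OF \<tau>])
  then have "(\<Sum>\<sigma>\<in>EK K. LINT x:\<sigma>|face_measure \<sigma>. (\<Sum>i\<in>I. c i * snd (v i) \<sigma> x) * (\<tau> x \<bullet> nrm K \<sigma>))
    = (\<Sum>i\<in>I. c i * (\<Sum>\<sigma>\<in>EK K. LINT x:\<sigma>|face_measure \<sigma>. snd (v i) \<sigma> x * (\<tau> x \<bullet> nrm K \<sigma>)))"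
    by (simp add: mult.assoc sum_distrib_left) (rule sum.swap)
  then show ?thesis unfolding grad_rhs_def hcomb_def using 1
    by (simp add: sum_negf[symmetric] sum.distrib[symmetric] algebra_simps)
qed

lemma poly_vec_sum: "(\<And>i. i \<in> I \<Longrightarrow> \<tau> i \<in> poly_vec q) \<Longrightarrow> (\<lambda>x. \<Sum>i\<in>I. \<tau> i x) \<in> poly_vec q"
  unfolding poly_vec_def by (auto intro!: poly_fun_sum)

lemma grad_rhs_sum:
  assumes v: "adm v" and K: "K \<in> M"
  shows "finite I \<Longrightarrow> (\<And>i. i \<in> I \<Longrightarrow> \<tau> i \<in> poly_vec q) \<Longrightarrow> grad_rhs K v (\<lambda>x. \<Sum>i\<in>I. \<tau> i x) = (\<Sum>i\<in>I. grad_rhs K v (\<tau> i))"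
proof (induction I rule: finite_induct)
  case empty
  have "(\<lambda>x. 0) \<in> poly_vec q" by (simp add: poly_vec_def poly_fun_zero)
  from grad_rhs_scaleR[OF this, of K v 0] show ?case by simp
next
  case (insert i I)
  then have "grad_rhs K v (\<lambda>x. \<tau> i x + (\<Sum>i\<in>I. \<tau> i x)) = grad_rhs K v (\<tau> i) + grad_rhs K v (\<lambda>x. \<Sum>i\<in>I. \<tau> i x)"
    by (intro grad_rhs_add[OF v K] poly_vec_sum) auto
  then show ?case using insert by simp
qed

lemma poly_vec_ext:
  assumes K: "K \<in> M" and G: "G \<in> poly_vec q" "G' \<in> poly_vec q"
    and eq: "\<And>\<tau>. \<tau> \<in> poly_vec q \<Longrightarrow> (LINT x:K|lebesgue. G x \<bullet> \<tau> x) = (LINT x:K|lebesgue. G' x \<bullet> \<tau> x)"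
  shows "G = G'"
proof -
  have "(\<lambda>x. G x $ i - G' x $ i) = (\<lambda>x. 0)" for i
  proof -
    have p: "(\<lambda>x. G x $ i - G' x $ i) \<in> poly_fun q" using G by (auto simp: poly_vec_def intro!: poly_fun_diff)
    have "null_on lebesgue K (\<lambda>x. G x $ i - G' x $ i)"
    proof (rule poly_fun_null_eqI[OF cell_ci[OF K] p])
      fix r :: "real^'n \<Rightarrow> real" assume r: "r \<in> poly_fun q"
      have int: "set_integrable lebesgue K (\<lambda>x. G x $ i * r x)" "set_integrable lebesgue K (\<lambda>x. G' x $ i * r x)"
        by (intro cont_set_integrable[OF cell_ci[OF K]] continuous_on_mult continuous_on_component
            poly_vec_continuous[OF G(1)] poly_vec_continuous[OF G(2)] poly_fun_continuous[OF r])+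
      have "(LINT x:K|lebesgue. G x $ i * r x) = (LINT x:K|lebesgue. G' x $ i * r x)"
        using eq[OF poly_vec_axis[OF r, of i]] by (simp add: inner_axis mult.commute)
      then show "ip lebesgue K (\<lambda>x. G x $ i - G' x $ i) r = 0"
        unfolding ip_def left_diff_distrib set_integral_diff(2)[OF int] by simp
    qed
    then show ?thesis by (rule poly_fun_AE_zero[OF D(6)[OF K] D(9)[OF K] p])
  qed
  then show ?thesis by (auto simp: vec_eq_iff fun_eq_iff)
qed

text \<open>Justifies the definite description in \<open>grad_K\<close>. For existence, component
  \<open>i\<close> of \<open>G\<close> has as coefficients the values of \<open>grad_rhs\<close> on
  the orthonormal polynomials times axis \<open>i\<close>; expanding \<open>\<tau>\<close> in the
  same family gives the identity. Uniqueness is \<open>poly_vec_ext\<close>.\<close>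

lemma grad_K_props:
  assumes v: "adm v" and K: "K \<in> M"
  shows "grad_K k EK K v \<in> poly_vec k"
    and "\<And>\<tau>. \<tau> \<in> poly_vec k \<Longrightarrow> (LINT x:K|lebesgue. grad_K k EK K v x \<bullet> \<tau> x) = grad_rhs K v \<tau>"
proof -
  obtain B where B: "onb lebesgue k K B" using onb_exists[OF cell_ci[OF K]] by blast
  have fB: "finite B" and BP: "\<And>e. e \<in> B \<Longrightarrow> e \<in> poly_fun k" using B by (auto simp: onb_def)
  define G where "G x = (\<chi> i. \<Sum>e\<in>B. grad_rhs K v (\<lambda>x. e x *\<^sub>R axis i 1) * e x)" for x
  have G: "G \<in> poly_vec k" unfolding poly_vec_def G_def by (simp add: poly_fun_sum poly_fun_cmul BP)
  have "(LINT x:K|lebesgue. G x \<bullet> \<tau> x) = grad_rhs K v \<tau>" if \<tau>: "\<tau> \<in> poly_vec k" for \<tau>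
  proof -
    have \<tau>i: "(\<lambda>x. \<tau> x $ i) \<in> poly_fun k" for i using \<tau> by (simp add: poly_vec_def)
    have exp: "\<tau> x $ i = (\<Sum>e\<in>B. ip lebesgue K (\<lambda>x. \<tau> x $ i) e * e x)" for i x
    proof -
      have "null_on lebesgue K (\<lambda>x. \<tau> x $ i - (\<Sum>e\<in>B. ip lebesgue K (\<lambda>x. \<tau> x $ i) e * e x))"
        using B unfolding onb_def by (elim conjE) (erule bspec, rule \<tau>i)
      moreover have "(\<lambda>x. \<tau> x $ i - (\<Sum>e\<in>B. ip lebesgue K (\<lambda>x. \<tau> x $ i) e * e x)) \<in> poly_fun k"
        by (intro poly_fun_diff \<tau>i poly_fun_sum poly_fun_cmul BP)
      ultimately have "(\<lambda>x. \<tau> x $ i - (\<Sum>e\<in>B. ip lebesgue K (\<lambda>x. \<tau> x $ i) e * e x)) = (\<lambda>x. 0)"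
        by (intro poly_fun_AE_zero[OF D(6)[OF K] D(9)[OF K]])
      from fun_cong[OF this, of x] show ?thesis by simp
    qed
    have \<tau>eq: "\<tau> = (\<lambda>x. \<Sum>i\<in>UNIV. \<Sum>e\<in>B. ip lebesgue K (\<lambda>x. \<tau> x $ i) e *\<^sub>R (e x *\<^sub>R axis i 1))"
    proof
      fix x
      have "(\<Sum>i\<in>UNIV. \<Sum>e\<in>B. ip lebesgue K (\<lambda>x. \<tau> x $ i) e *\<^sub>R (e x *\<^sub>R axis i (1::real)))
        = (\<Sum>i\<in>UNIV. (\<tau> x $ i) *\<^sub>R axis i 1)"
        by (subst exp) (simp add: scaleR_sum_left)
      also have "\<dots> = \<tau> x" by (simp add: vec_eq_iff axis_def if_distrib sum.delta cong: if_cong)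
      finally show "\<tau> x = (\<Sum>i\<in>UNIV. \<Sum>e\<in>B. ip lebesgue K (\<lambda>x. \<tau> x $ i) e *\<^sub>R (e x *\<^sub>R axis i 1))" by simp
    qed
    have mem: "(\<lambda>x. ip lebesgue K (\<lambda>x. \<tau> x $ i) e *\<^sub>R (e x *\<^sub>R axis i 1)) \<in> poly_vec k" if "e \<in> B" for e i
      by (intro poly_vec_scaleR poly_vec_axis BP that)
    have "grad_rhs K v \<tau> = (\<Sum>i\<in>UNIV. \<Sum>e\<in>B. ip lebesgue K (\<lambda>x. \<tau> x $ i) e * grad_rhs K v (\<lambda>x. e x *\<^sub>R axis i 1))"
    proof -
      have "grad_rhs K v \<tau> = grad_rhs K v (\<lambda>x. \<Sum>i\<in>UNIV. \<Sum>e\<in>B. ip lebesgue K (\<lambda>x. \<tau> x $ i) e *\<^sub>R (e x *\<^sub>R axis i 1))"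
        by (rule arg_cong[OF \<tau>eq])
      also have "\<dots> = (\<Sum>i\<in>UNIV. grad_rhs K v (\<lambda>x. \<Sum>e\<in>B. ip lebesgue K (\<lambda>x. \<tau> x $ i) e *\<^sub>R (e x *\<^sub>R axis i 1)))"
        by (rule grad_rhs_sum[OF v K finite_class.finite_UNIV, where q=k]) (intro poly_vec_sum mem)
      also have "\<dots> = (\<Sum>i\<in>UNIV. \<Sum>e\<in>B. grad_rhs K v (\<lambda>x. ip lebesgue K (\<lambda>x. \<tau> x $ i) e *\<^sub>R (e x *\<^sub>R axis i 1)))"
        by (intro sum.cong[OF refl] grad_rhs_sum[OF v K fB, where q=k] mem)
      also have "\<dots> = (\<Sum>i\<in>UNIV. \<Sum>e\<in>B. ip lebesgue K (\<lambda>x. \<tau> x $ i) e * grad_rhs K v (\<lambda>x. e x *\<^sub>R axis i 1))"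
        by (intro sum.cong[OF refl] grad_rhs_scaleR[where q=k] poly_vec_axis BP)
      finally show ?thesis .
    qed
    also have "\<dots> = (\<Sum>i\<in>UNIV. ip lebesgue K (\<lambda>x. G x $ i) (\<lambda>x. \<tau> x $ i))"
    proof (rule sum.cong[OF refl])
      fix i
      have "ip lebesgue K (\<lambda>x. G x $ i) (\<lambda>x. \<tau> x $ i)
         = (\<Sum>e\<in>B. ip lebesgue K (\<lambda>x. grad_rhs K v (\<lambda>x. e x *\<^sub>R axis i 1) * e x) (\<lambda>x. \<tau> x $ i))"
        unfolding G_def vec_lambda_beta
        by (intro ip_sum_left[OF cell_ci[OF K]] cont_set_integrable[OF cell_ci[OF K]] continuous_on_mult continuous_on_const
            poly_fun_continuous[OF BP] poly_fun_continuous[OF \<tau>i])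
      then show "(\<Sum>e\<in>B. ip lebesgue K (\<lambda>x. \<tau> x $ i) e * grad_rhs K v (\<lambda>x. e x *\<^sub>R axis i 1)) = ip lebesgue K (\<lambda>x. G x $ i) (\<lambda>x. \<tau> x $ i)"
        unfolding ip_cmul_left[OF cell_ci[OF K]]
        by (simp only: ip_commute[of lebesgue K "\<lambda>x. \<tau> x $ i"] mult.commute)
    qed
    also have "\<dots> = (LINT x:K|lebesgue. G x \<bullet> \<tau> x)"
      unfolding inner_vec_def inner_real_def set_lebesgue_integral_def scaleR_sum_right ip_def
      by (intro Bochner_Integration.integral_sum[symmetric] cont_set_integrable[OF cell_ci[OF K], unfolded set_integrable_def]
          continuous_on_mult continuous_on_component poly_vec_continuous[OF G] poly_vec_continuous[OF \<tau>])
    finally show ?thesis by simp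
  qed
  then have G2: "G \<in> poly_vec k \<and> (\<forall>\<tau>\<in>poly_vec k. (LINT x:K|lebesgue. G x \<bullet> \<tau> x) = grad_rhs K v \<tau>)" using G by blast
  have "grad_K k EK K v \<in> poly_vec k \<and> (\<forall>\<tau>\<in>poly_vec k. (LINT x:K|lebesgue. grad_K k EK K v x \<bullet> \<tau> x) = grad_rhs K v \<tau>)"
    unfolding grad_K_def grad_rhs_def[symmetric]
  proof (rule theI[where P="\<lambda>G. G \<in> poly_vec k \<and> (\<forall>\<tau>\<in>poly_vec k. (LINT x:K|lebesgue. G x \<bullet> \<tau> x) = grad_rhs K v \<tau>)" and a=G])
    show "G \<in> poly_vec k \<and> (\<forall>\<tau>\<in>poly_vec k. (LINT x:K|lebesgue. G x \<bullet> \<tau> x) = grad_rhs K v \<tau>)" by (rule G2)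
  next
    fix G' assume "G' \<in> poly_vec k \<and> (\<forall>\<tau>\<in>poly_vec k. (LINT x:K|lebesgue. G' x \<bullet> \<tau> x) = grad_rhs K v \<tau>)"
    then show "G' = G" using G2 by (intro poly_vec_ext[OF K]) auto
  qed
  then show "grad_K k EK K v \<in> poly_vec k"
    "\<And>\<tau>. \<tau> \<in> poly_vec k \<Longrightarrow> (LINT x:K|lebesgue. grad_K k EK K v x \<bullet> \<tau> x) = grad_rhs K v \<tau>" by auto
qed

end

section \<open>The discrete forms\<close>

lemma continuous_on_matrix_vector:
  fixes A :: "'a::topological_space \<Rightarrow> real^'n^'n"
  assumes "continuous_on S A" "continuous_on S g"
  shows "continuous_on S (\<lambda>x. A x *v g x)"
  unfolding matrix_vector_mult_def
  by (intro continuous_on_vec_lambda continuous_on_sum continuous_on_mult continuous_on_component assms)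

text \<open>Completeness of Lebesgue measure. It is needed because \<open>\<Lambda>\<close> and its
  continuous trace agree only almost everywhere on a cell.\<close>

lemma borel_measurable_lebesgue_cong_AE:
  fixes f g :: "'a::euclidean_space \<Rightarrow> real"
  assumes f: "f \<in> borel_measurable lebesgue" and ae: "AE x in lebesgue. f x = g x"
  shows "g \<in> borel_measurable lebesgue"
proof (rule measurableI)
  fix A :: "real set" assume A: "A \<in> sets borel"
  obtain N where N: "N \<in> null_sets lebesgue" "{x. f x \<noteq> g x} \<subseteq> N"
    using ae by (auto simp: eventually_ae_filter)
  have fA: "f -` A \<in> sets lebesgue" using measurable_sets[OF f A] by simp
  have sub: "N \<inter> g -` A \<in> sets lebesgue"
    using N(1) completion.complete2[of "N \<inter> g -` A" N] by (auto simp: null_sets_def)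
  have "f x = g x" if "x \<notin> N" for x using N(2) that by blast
  then have eq: "(f -` A - N) \<union> (N \<inter> g -` A) = g -` A" by auto
  have "f -` A - N \<in> sets lebesgue" using fA N(1) by (intro sets.Diff) auto
  from sets.Un[OF this sub] show "g -` A \<inter> space lebesgue \<in> sets lebesgue" by (simp add: eq)
qed simp

context hho
begin

text \<open>Linearity comes from uniqueness: the combination of the gradients has the same integrals
  against \<open>poly_vec k\<close> as the gradient of the combination.\<close>

lemma grad_K_hcomb:
  assumes v: "\<And>i. i \<in> I \<Longrightarrow> adm (v i)" and K: "K \<in> M"
  shows "grad_K k EK K (hcomb I c v) x = (\<Sum>i\<in>I. c i *\<^sub>R grad_K k EK K (v i) x)"
proof -
  define G where "G x = (\<Sum>i\<in>I. c i *\<^sub>R grad_K k EK K (v i) x)" for x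
  have G: "G \<in> poly_vec k" unfolding G_def by (intro poly_vec_sum poly_vec_scaleR grad_K_props(1)[OF v K])
  have a: "adm (hcomb I c v)" by (rule adm_hcomb) (rule v)
  have "grad_K k EK K (hcomb I c v) = G"
  proof (rule poly_vec_ext[OF K grad_K_props(1)[OF a K] G])
    fix \<tau> :: "real^'n \<Rightarrow> real^'n" assume \<tau>: "\<tau> \<in> poly_vec k"
    have "(LINT x:K|lebesgue. grad_K k EK K (hcomb I c v) x \<bullet> \<tau> x) = (\<Sum>i\<in>I. c i * grad_rhs K (v i) \<tau>)"
      unfolding grad_K_props(2)[OF a K \<tau>] by (rule grad_rhs_hcomb[OF v K \<tau>])
    also have "\<dots> = (\<Sum>i\<in>I. LINT x:K|lebesgue. c i * (grad_K k EK K (v i) x \<bullet> \<tau> x))"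
      by (intro sum.cong[OF refl]) (simp add: grad_K_props(2)[OF v K \<tau>])
    also have "\<dots> = (LINT x:K|lebesgue. \<Sum>i\<in>I. c i * (grad_K k EK K (v i) x \<bullet> \<tau> x))"
      unfolding set_lebesgue_integral_def scaleR_sum_right
      by (intro Bochner_Integration.integral_sum[symmetric] cont_set_integrable[OF cell_ci[OF K], unfolded set_integrable_def]
          continuous_on_mult continuous_on_const continuous_on_inner poly_vec_continuous[OF grad_K_props(1)[OF v K]]
          poly_vec_continuous[OF \<tau>])
    also have "\<dots> = (LINT x:K|lebesgue. G x \<bullet> \<tau> x)" by (simp add: G_def inner_sum_left)
    finally show "(LINT x:K|lebesgue. grad_K k EK K (hcomb I c v) x \<bullet> \<tau> x) = (LINT x:K|lebesgue. G x \<bullet> \<tau> x)" .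
  qed
  then show ?thesis by (simp add: G_def)
qed

section \<open>Projections and jumps modulo null sets\<close>

lemma null_integral_cong:
  assumes K: "K \<in> M" "\<sigma> \<in> EK K" and n: "null_on (face_measure \<sigma>) \<sigma> (\<lambda>x. f x - g x)"
    and c: "continuous_on UNIV f" "continuous_on UNIV g"
  shows "(LINT x:\<sigma>|face_measure \<sigma>. f x) = (LINT x:\<sigma>|face_measure \<sigma>. (g x :: real))"
  unfolding set_lebesgue_integral_def
proof (rule integral_cong_AE)
  show "AE x in face_measure \<sigma>. indicator \<sigma> x *\<^sub>R f x = indicator \<sigma> x *\<^sub>R g x"
    using n unfolding null_on_def by eventually_elim (auto simp: indicator_def)
qed (use cont_set_integrable[OF face_ci[OF K] c(1)] cont_set_integrable[OF face_ci[OF K] c(2)] in \<open>auto simp: set_integrable_def\<close>)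

lemma null_on_diff_ip:
  assumes K: "K \<in> M" "\<sigma> \<in> EK K" and p: "p \<in> poly_fun q" "p' \<in> poly_fun q"
    and eq: "\<And>r. r \<in> poly_fun q \<Longrightarrow> ip (face_measure \<sigma>) \<sigma> p r = ip (face_measure \<sigma>) \<sigma> p' r"
  shows "null_on (face_measure \<sigma>) \<sigma> (\<lambda>x. p x - p' x)"
proof (rule poly_fun_null_eqI[OF face_ci[OF K] poly_fun_diff[OF p]])
  fix r :: "real^'n \<Rightarrow> real" assume r: "r \<in> poly_fun q"
  have int: "set_integrable (face_measure \<sigma>) \<sigma> (\<lambda>x. p x * r x)" "set_integrable (face_measure \<sigma>) \<sigma> (\<lambda>x. p' x * r x)"
    by (intro cont_set_integrable[OF face_ci[OF K]] continuous_on_mult poly_fun_continuous[OF p(1)]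
        poly_fun_continuous[OF p(2)] poly_fun_continuous[OF r])+
  show "ip (face_measure \<sigma>) \<sigma> (\<lambda>x. p x - p' x) r = 0"
    using eq[OF r] unfolding ip_def left_diff_distrib set_integral_diff(2)[OF int] by simp
qed

lemma face_proj_props:
  assumes K: "K \<in> M" "\<sigma> \<in> EK K" and f: "continuous_on UNIV f"
  shows "face_proj k \<sigma> f \<in> poly_fun k"
    and "\<And>r. r \<in> poly_fun k \<Longrightarrow> ip (face_measure \<sigma>) \<sigma> (face_proj k \<sigma> f) r = ip (face_measure \<sigma>) \<sigma> f r"
proof -
  have "set_integrable (face_measure \<sigma>) \<sigma> (\<lambda>x. f x * r x)" if "r \<in> poly_fun k" for r
    by (intro cont_set_integrable[OF face_ci[OF K]] continuous_on_mult f poly_fun_continuous[OF that])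
  from L2_proj_poly_fun[OF face_ci[OF K] this]
  show "face_proj k \<sigma> f \<in> poly_fun k"
    "\<And>r. r \<in> poly_fun k \<Longrightarrow> ip (face_measure \<sigma>) \<sigma> (face_proj k \<sigma> f) r = ip (face_measure \<sigma>) \<sigma> f r" by auto
qed

lemma ip_face_lincomb:
  assumes K: "K \<in> M" "\<sigma> \<in> EK K" and f: "\<And>i. i \<in> I \<Longrightarrow> continuous_on UNIV (f i)" and r: "continuous_on UNIV r"
  shows "ip (face_measure \<sigma>) \<sigma> (\<lambda>x. \<Sum>i\<in>I. c i * f i x) r = (\<Sum>i\<in>I. c i * ip (face_measure \<sigma>) \<sigma> (f i) r)"
proof -
  have "ip (face_measure \<sigma>) \<sigma> (\<lambda>x. \<Sum>i\<in>I. c i * f i x) r = (\<Sum>i\<in>I. ip (face_measure \<sigma>) \<sigma> (\<lambda>x. c i * f i x) r)"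
    by (intro ip_sum_left[OF face_ci[OF K]] cont_set_integrable[OF face_ci[OF K]] continuous_on_mult continuous_on_const f r)
  then show ?thesis by (simp add: ip_cmul_left[OF face_ci[OF K]])
qed

text \<open>Both sides have the same inner products with polynomials on the face. Equality off the
  face cannot be expected, since every projection is a separate choice among polynomials that agree
  on it.\<close>

lemma face_proj_lincomb:
  assumes K: "K \<in> M" "\<sigma> \<in> EK K" and f: "\<And>i. i \<in> I \<Longrightarrow> continuous_on UNIV (f i)"
  shows "null_on (face_measure \<sigma>) \<sigma> (\<lambda>x. face_proj k \<sigma> (\<lambda>x. \<Sum>i\<in>I. c i * f i x) x - (\<Sum>i\<in>I. c i * face_proj k \<sigma> (f i) x))"
proof (rule null_on_diff_ip[OF K])
  have cs: "continuous_on UNIV (\<lambda>x. \<Sum>i\<in>I. c i * f i x)" by (intro continuous_on_sum continuous_on_mult continuous_on_const f)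
  show "face_proj k \<sigma> (\<lambda>x. \<Sum>i\<in>I. c i * f i x) \<in> poly_fun k" by (rule face_proj_props[OF K cs])
  show "(\<lambda>x. \<Sum>i\<in>I. c i * face_proj k \<sigma> (f i) x) \<in> poly_fun k" by (intro poly_fun_sum poly_fun_cmul face_proj_props(1)[OF K f])
  fix r :: "real^'n \<Rightarrow> real" assume r: "r \<in> poly_fun k"
  note cr = poly_fun_continuous[OF r]
  have cp: "continuous_on UNIV (face_proj k \<sigma> (f i))" if "i \<in> I" for i
    by (rule poly_fun_continuous[OF face_proj_props(1)[OF K f[OF that]]])
  show "ip (face_measure \<sigma>) \<sigma> (face_proj k \<sigma> (\<lambda>x. \<Sum>i\<in>I. c i * f i x)) r = ip (face_measure \<sigma>) \<sigma> (\<lambda>x. \<Sum>i\<in>I. c i * face_proj k \<sigma> (f i) x) r"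
  proof -
    have "ip (face_measure \<sigma>) \<sigma> (\<lambda>x. \<Sum>i\<in>I. c i * f i x) r = (\<Sum>i\<in>I. c i * ip (face_measure \<sigma>) \<sigma> (f i) r)"
      by (rule ip_face_lincomb[OF K f cr])
    moreover have "ip (face_measure \<sigma>) \<sigma> (\<lambda>x. \<Sum>i\<in>I. c i * face_proj k \<sigma> (f i) x) r
        = (\<Sum>i\<in>I. c i * ip (face_measure \<sigma>) \<sigma> (face_proj k \<sigma> (f i)) r)"
      by (rule ip_face_lincomb[OF K cp cr])
    ultimately show ?thesis by (simp add: face_proj_props(2)[OF K cs r] face_proj_props(2)[OF K f r])
  qed
qed

lemma jump_poly: "adm v \<Longrightarrow> K \<in> M \<Longrightarrow> \<sigma> \<in> EK K \<Longrightarrow> jump k K \<sigma> v \<in> poly_fun k"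
  unfolding jump_def[abs_def] by (intro poly_fun_diff face_proj_props(1) adm_cont(1)) (auto simp: adm_def)

lemma jump_cont: "adm v \<Longrightarrow> K \<in> M \<Longrightarrow> \<sigma> \<in> EK K \<Longrightarrow> continuous_on UNIV (jump k K \<sigma> v)"
  using jump_poly poly_fun_continuous by blast

lemma jump_hcomb:
  assumes v: "\<And>i. i \<in> I \<Longrightarrow> adm (v i)" and K: "K \<in> M" "\<sigma> \<in> EK K"
  shows "null_on (face_measure \<sigma>) \<sigma> (\<lambda>x. jump k K \<sigma> (hcomb I c v) x - (\<Sum>i\<in>I. c i * jump k K \<sigma> (v i) x))"
proof -
  have "null_on (face_measure \<sigma>) \<sigma> (\<lambda>x. face_proj k \<sigma> (\<lambda>x. \<Sum>i\<in>I. c i * fst (v i) K x) x - (\<Sum>i\<in>I. c i * face_proj k \<sigma> (fst (v i) K) x))"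
    by (rule face_proj_lincomb[OF K adm_cont(1)[OF v K(1)]])
  then show ?thesis
    unfolding null_on_def jump_def hcomb_def by (elim eventually_mono) (simp add: algebra_simps sum_subtractf)
qed

lemma grad_K_eqv:
  assumes "adm v" "adm w" "eqv v w" and K: "K \<in> M"
  shows "grad_K k EK K v = grad_K k EK K w"
proof (rule poly_vec_ext[OF K grad_K_props(1)[OF assms(1) K] grad_K_props(1)[OF assms(2) K]])
  fix \<tau> :: "real^'n \<Rightarrow> real^'n" assume \<tau>: "\<tau> \<in> poly_vec k"
  have "(LINT x:\<sigma>|face_measure \<sigma>. snd v \<sigma> x * (\<tau> x \<bullet> nrm K \<sigma>)) = (LINT x:\<sigma>|face_measure \<sigma>. snd w \<sigma> x * (\<tau> x \<bullet> nrm K \<sigma>))"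
    if \<sigma>: "\<sigma> \<in> EK K" for \<sigma>
  proof (rule null_integral_cong[OF K \<sigma>])
    have "null_on (face_measure \<sigma>) \<sigma> (\<lambda>x. snd v \<sigma> x - snd w \<sigma> x)" using assms(3) K \<sigma> by (auto simp: eqv_def)
    then show "null_on (face_measure \<sigma>) \<sigma> (\<lambda>x. snd v \<sigma> x * (\<tau> x \<bullet> nrm K \<sigma>) - snd w \<sigma> x * (\<tau> x \<bullet> nrm K \<sigma>))"
      unfolding null_on_def by eventually_elim auto
  qed (intro continuous_on_mult continuous_on_inner continuous_on_const poly_vec_continuous[OF \<tau>]
        adm_cont(2)[OF assms(1) K \<sigma>] adm_cont(2)[OF assms(2) K \<sigma>])+
  then have "grad_rhs K v \<tau> = grad_rhs K w \<tau>" using assms(3) K by (simp add: grad_rhs_def eqv_def)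
  then show "(LINT x:K|lebesgue. grad_K k EK K v x \<bullet> \<tau> x) = (LINT x:K|lebesgue. grad_K k EK K w x \<bullet> \<tau> x)"
    by (simp only: grad_K_props(2)[OF assms(1) K \<tau>] grad_K_props(2)[OF assms(2) K \<tau>])
qed

lemma jump_eqv:
  assumes "eqv v w" "K \<in> M" "\<sigma> \<in> EK K"
  shows "null_on (face_measure \<sigma>) \<sigma> (\<lambda>x. jump k K \<sigma> v x - jump k K \<sigma> w x)"
proof -
  have "null_on (face_measure \<sigma>) \<sigma> (\<lambda>x. snd v \<sigma> x - snd w \<sigma> x)" "fst v K = fst w K" using assms by (auto simp: eqv_def)
  then show ?thesis unfolding null_on_def jump_def by (elim eventually_mono) auto
qed

section \<open>Ellipticity up to the boundary of a cell\<close>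

lemma Lambda_trace:
  assumes "K \<in> M"
  shows "continuous_on (closure K) (boundary_trace K \<Lambda>)" "AE x in lebesgue. x \<in> K \<longrightarrow> boundary_trace K \<Lambda> x = \<Lambda> x"
  using boundary_trace_matrix[OF D(6)[OF assms] cell_bounded[OF assms] D(8)[OF assms] Lambda_cells[OF assms]] by auto

text \<open>A violation at a point of a cell would persist on a nonempty open set, against the
  almost everywhere bound; continuity of the trace extends the bound to the closure.\<close>

lemma Lambda_trace_elliptic:
  "\<exists>c>0. \<forall>K\<in>M. \<forall>x\<in>closure K. \<forall>\<xi>. (boundary_trace K \<Lambda> x *v \<xi>) \<bullet> \<xi> \<ge> c * (norm \<xi>)\<^sup>2"
proof -
  obtain c where c: "c > 0" "AE x in lebesgue. x \<in> \<Omega> \<longrightarrow> (\<forall>\<xi>. (\<Lambda> x *v \<xi>) \<bullet> \<xi> \<ge> c * (norm \<xi>)\<^sup>2)"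
    using Lambda_elliptic by blast
  have "(boundary_trace K \<Lambda> x *v \<xi>) \<bullet> \<xi> \<ge> c * (norm \<xi>)\<^sup>2" if K: "K \<in> M" and x: "x \<in> closure K" for K x \<xi>
  proof -
    define f where "f y = (boundary_trace K \<Lambda> y *v \<xi>) \<bullet> \<xi> - c * (norm \<xi>)\<^sup>2" for y
    have cf: "continuous_on (closure K) f"
      unfolding f_def by (intro continuous_on_diff continuous_on_inner continuous_on_const continuous_on_matrix_vector Lambda_trace(1)[OF K])
    have "f y \<ge> 0" if y: "y \<in> K" for y
    proof (rule ccontr)
      assume neg: "\<not> f y \<ge> 0"
      define V where "V = K \<inter> f -` {..<0}"
      have "continuous_on K f" using cf closure_subset continuous_on_subset by blast
      then have "open V" unfolding V_def by (intro continuous_open_preimage D(6)[OF K]) auto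
      moreover have "V \<noteq> {}" using y neg by (auto simp: V_def)
      moreover have "AE z in lebesgue. z \<notin> V"
        using c(2) Lambda_trace(2)[OF K]
      proof eventually_elim
        case (elim z)
        show ?case
        proof
          assume "z \<in> V"
          then have "z \<in> K" "f z < 0" by (auto simp: V_def)
          then have "boundary_trace K \<Lambda> z = \<Lambda> z" "c * (norm \<xi>)\<^sup>2 \<le> (\<Lambda> z *v \<xi>) \<bullet> \<xi>" using elim D(7)[OF K] by blast+
          then show False using \<open>f z < 0\<close> by (simp add: f_def)
        qed
      qed
      then have "negligible V" using \<open>open V\<close> by (simp add: AE_iff_null_sets negligible_iff_null_sets)
      ultimately show False using open_not_negligible by blast
    qed
    then have "f ` K \<subseteq> {0..}" by auto
    moreover have "f ` closure K \<subseteq> closure (f ` K)" using cf by (rule image_closure_subset[OF _ closed_closure closure_subset])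
    ultimately have "f x \<ge> 0" using x closure_minimal[of "f ` K" "{0..}"] by auto
    then show ?thesis by (simp add: f_def)
  qed
  then show ?thesis using c(1) by blast
qed

text \<open>The normal component of the trace is at least the ellipticity constant on all of the
  face, which has positive measure, so no smaller essential bound exists. Continuity of the trace
  makes the set of bounds nonempty, so that its infimum is meaningful.\<close>

lemma Lambda_face_pos:
  assumes K: "K \<in> M" "\<sigma> \<in> EK K"
  shows "Lambda_face \<Lambda> K \<sigma> > 0"
proof -
  obtain c where c: "c > 0" "\<And>K x \<xi>. K \<in> M \<Longrightarrow> x \<in> closure K \<Longrightarrow> (boundary_trace K \<Lambda> x *v \<xi>) \<bullet> \<xi> \<ge> c * (norm \<xi>)\<^sup>2"
    using Lambda_trace_elliptic by blast
  define f where "f x = (boundary_trace K \<Lambda> x *v nrm K \<sigma>) \<bullet> nrm K \<sigma>" for x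
  have sub: "closure \<sigma> \<subseteq> closure K" using face_closure[OF K] .
  have lo: "c \<le> \<bar>f x\<bar>" if "x \<in> \<sigma>" for x
    using c(2)[OF K(1), of x "nrm K \<sigma>"] sub closure_subset that nrm_norm[OF K] by (force simp: f_def)
  have "continuous_on (closure \<sigma>) f"
    unfolding f_def
    by (intro continuous_on_inner continuous_on_const continuous_on_matrix_vector continuous_on_subset[OF Lambda_trace(1)[OF K(1)] sub])
  then obtain B where B: "\<And>x. x \<in> \<sigma> \<Longrightarrow> \<bar>f x\<bar> \<le> B" using continuous_bounded_on[OF face_bounded[OF K]] by blast
  have "c \<le> Inf {C. 0 \<le> C \<and> (AE x in face_measure \<sigma>. x \<in> \<sigma> \<longrightarrow> \<bar>f x\<bar> \<le> C)}"
  proof (rule cInf_greatest)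
    have "\<bar>B\<bar> \<in> {C. 0 \<le> C \<and> (AE x in face_measure \<sigma>. x \<in> \<sigma> \<longrightarrow> \<bar>f x\<bar> \<le> C)}" using B by force
    then show "{C. 0 \<le> C \<and> (AE x in face_measure \<sigma>. x \<in> \<sigma> \<longrightarrow> \<bar>f x\<bar> \<le> C)} \<noteq> {}" by blast
    fix C assume "C \<in> {C. 0 \<le> C \<and> (AE x in face_measure \<sigma>. x \<in> \<sigma> \<longrightarrow> \<bar>f x\<bar> \<le> C)}"
    then have ae: "AE x in face_measure \<sigma>. x \<in> \<sigma> \<longrightarrow> \<bar>f x\<bar> \<le> C" by simp
    show "c \<le> C"
    proof (rule ccontr)
      assume less: "\<not> c \<le> C"
      have "AE x in face_measure \<sigma>. x \<notin> \<sigma>" using ae by (rule eventually_mono) (use lo less in force)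
      then have "emeasure (face_measure \<sigma>) \<sigma> = 0"
        using face_borel[OF K] AE_iff_null_sets[of \<sigma> "face_measure \<sigma>"] by auto
      then show False using D(12)[OF EK_E[OF K]] by simp
    qed
  qed
  then show ?thesis using c(1) by (simp add: Lambda_face_def Linf_norm_def f_def[abs_def])
qed

lemma diameter_pos: "bounded X \<Longrightarrow> x \<in> X \<Longrightarrow> y \<in> X \<Longrightarrow> x \<noteq> y \<Longrightarrow> diameter (X :: (real^'n) set) > 0"
  using diameter_bounded_bound[of X x y] by (metis dist_pos_lt less_le_trans)

lemma cell_diameter_pos: assumes K: "K \<in> M" shows "diameter K > 0"
proof -
  obtain x r where r: "r > 0" "ball x r \<subseteq> K" using D(6,9)[OF K] open_contains_ball by blast
  obtain b :: "real^'n" where b: "b \<in> Basis" using nonempty_Basis by blast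
  have "x + (r/2) *\<^sub>R b \<in> ball x r" using r(1) b by (simp add: dist_norm)
  then have "x + (r/2) *\<^sub>R b \<in> K" "x \<in> K" using r by auto
  moreover have "x \<noteq> x + (r/2) *\<^sub>R b" using r(1) b nonzero_Basis by simp
  ultimately show ?thesis using diameter_pos[OF cell_bounded[OF K]] by blast
qed

lemma face_diameter_pos: assumes K: "K \<in> M" "\<sigma> \<in> EK K" shows "diameter \<sigma> > 0"
proof -
  define n where "n = nrm K \<sigma>"
  obtain x where x: "x \<in> \<sigma>" using D(13)[OF EK_E[OF K]] by blast
  have op: "openin (top_of_set {x. n \<bullet> x = off K \<sigma>}) \<sigma>" using face_cf[OF K] by (simp add: cell_face_def n_def)
  then obtain r where r: "r > 0" "ball x r \<inter> {x. n \<bullet> x = off K \<sigma>} \<subseteq> \<sigma>" using x unfolding openin_contains_ball by blast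
  have nx: "n \<bullet> x = off K \<sigma>" using openin_imp_subset[OF op] x by auto
  have "dim {x. n \<bullet> x = 0} = DIM(real^'n) - 1" using nrm_norm[OF K] by (intro dim_hyperplane) (auto simp: n_def)
  then have "dim {x. n \<bullet> x = 0} \<noteq> 0" using dim by simp
  then obtain w where w: "n \<bullet> w = 0" "w \<noteq> 0" by (auto simp: dim_eq_0)
  define y where "y = x + (r / (2 * norm w)) *\<^sub>R w"
  have "y \<in> ball x r" using r(1) w(2) by (simp add: y_def dist_norm)
  moreover have "n \<bullet> y = off K \<sigma>" using nx w by (simp add: y_def inner_add_right)
  ultimately have "y \<in> \<sigma>" using r(2) by auto
  moreover have "x \<noteq> y" using r(1) w(2) by (simp add: y_def)
  ultimately show ?thesis using x by (intro diameter_pos[OF face_bounded[OF K]])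
qed

section \<open>Weighted bilinear forms\<close>

abbreviation cell_form :: "(real^'n) set \<Rightarrow> (real^'n \<Rightarrow> real) \<Rightarrow> 'n hybrid \<Rightarrow> 'n hybrid \<Rightarrow> real" where
  "cell_form K W w v \<equiv> LINT x:K|lebesgue. W x * ((\<Lambda> x *v grad_K k EK K w x) \<bullet> grad_K k EK K v x)"

abbreviation face_form ::
  "(real^'n) set \<Rightarrow> (real^'n) set \<Rightarrow> (real^'n \<Rightarrow> real) \<Rightarrow> 'n hybrid \<Rightarrow> 'n hybrid \<Rightarrow> real" where
  "face_form K \<sigma> W w v \<equiv> LINT x:\<sigma>|face_measure \<sigma>. W x * (jump k K \<sigma> w x * jump k K \<sigma> v x)"

text \<open>One form for both parts of the scheme: exponential weights give the nonlinear term,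
  weights equal to one give \<open>a_K\<close>.\<close>

definition wform :: "(real^'n) set \<Rightarrow> (real^'n \<Rightarrow> real) \<Rightarrow> ((real^'n) set \<Rightarrow> real^'n \<Rightarrow> real) \<Rightarrow> 'n hybrid \<Rightarrow> 'n hybrid \<Rightarrow> real" where
  "wform K W Wf w v = cell_form K W w v +
     (\<Sum>\<sigma>\<in>EK K. Lambda_face \<Lambda> K \<sigma> / diameter \<sigma> *
        face_form K \<sigma> (Wf \<sigma>) w v)"

lemma a_K_wform: "a_K k \<Lambda> EK K w v = wform K (\<lambda>_. 1) (\<lambda>_ _. 1) w v"
  by (simp add: a_K_def wform_def)

definition Lt :: "(real^'n) set \<Rightarrow> real^'n \<Rightarrow> real^'n^'n" where "Lt K = boundary_trace K \<Lambda>"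

text \<open>Replacing \<open>\<Lambda>\<close> by its trace, which is continuous on the compact
  closure, yields integrability and pointwise bounds without changing the integral.\<close>

lemma cell_form_trace:
  assumes K: "K \<in> M" and W: "continuous_on UNIV W" and g: "g \<in> poly_vec k" "h \<in> poly_vec k"
  shows "(LINT x:K|lebesgue. W x * ((\<Lambda> x *v g x) \<bullet> h x)) = (LINT x:K|lebesgue. W x * ((Lt K x *v g x) \<bullet> h x))"
    and "continuous_on (closure K) (\<lambda>x. (Lt K x *v g x) \<bullet> h x)"
    and "set_integrable lebesgue K (\<lambda>x. W x * ((Lt K x *v g x) \<bullet> h x))"
proof -
  have sub: "continuous_on (closure K) f" if "continuous_on UNIV f" for f :: "real^'n \<Rightarrow> 'b::topological_space"
    using that continuous_on_subset by blast
  show c: "continuous_on (closure K) (\<lambda>x. (Lt K x *v g x) \<bullet> h x)"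
    unfolding Lt_def
    by (intro continuous_on_inner sub[OF poly_vec_continuous[OF g(2)]]
        continuous_on_matrix_vector Lambda_trace(1)[OF K] sub[OF poly_vec_continuous[OF g(1)]])
  show i: "set_integrable lebesgue K (\<lambda>x. W x * ((Lt K x *v g x) \<bullet> h x))"
    by (intro set_integrable_compact_lebesgue[OF cell_bounded[OF K] cell_borel[OF K]] continuous_on_mult sub[OF W] c)
  have ae: "AE x in lebesgue. indicator K x *\<^sub>R (W x * ((Lt K x *v g x) \<bullet> h x)) = indicator K x *\<^sub>R (W x * ((\<Lambda> x *v g x) \<bullet> h x))"
    using Lambda_trace(2)[OF K] unfolding Lt_def by eventually_elim (auto simp: indicator_def)
  have m: "(\<lambda>x. indicator K x *\<^sub>R (W x * ((Lt K x *v g x) \<bullet> h x))) \<in> borel_measurable lebesgue"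
    using i by (simp add: set_integrable_def)
  show "(LINT x:K|lebesgue. W x * ((\<Lambda> x *v g x) \<bullet> h x)) = (LINT x:K|lebesgue. W x * ((Lt K x *v g x) \<bullet> h x))"
    unfolding set_lebesgue_integral_def
    by (rule integral_cong_AE[OF borel_measurable_lebesgue_cong_AE[OF m ae] m]) (use ae in \<open>auto elim: eventually_mono\<close>)
qed

lemma cell_form_hcomb:
  assumes v: "\<And>i. i \<in> I \<Longrightarrow> adm (v i)" and w: "adm w" and K: "K \<in> M" and W: "continuous_on UNIV W"
  shows "cell_form K W w (hcomb I c v)
      = (\<Sum>i\<in>I. c i * cell_form K W w (v i))"
    and "cell_form K W (hcomb I c v) w
      = (\<Sum>i\<in>I. c i * cell_form K W (v i) w)"
proof -
  note gw = grad_K_props(1)[OF w K]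
  have gv: "grad_K k EK K (v i) \<in> poly_vec k" if "i \<in> I" for i by (rule grad_K_props(1)[OF v[OF that] K])
  have gc: "grad_K k EK K (hcomb I c v) \<in> poly_vec k" by (rule grad_K_props(1)[OF adm_hcomb K]) (rule v)
  have "(LINT x:K|lebesgue. W x * ((Lt K x *v grad_K k EK K w x) \<bullet> grad_K k EK K (hcomb I c v) x))
     = (LINT x:K|lebesgue. \<Sum>i\<in>I. c i * (W x * ((Lt K x *v grad_K k EK K w x) \<bullet> grad_K k EK K (v i) x)))"
    by (simp add: grad_K_hcomb[OF v K] inner_sum_right sum_distrib_left mult_ac)
  also have "\<dots> = (\<Sum>i\<in>I. LINT x:K|lebesgue. c i * (W x * ((Lt K x *v grad_K k EK K w x) \<bullet> grad_K k EK K (v i) x)))"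
    unfolding set_lebesgue_integral_def scaleR_sum_right
    by (intro Bochner_Integration.integral_sum set_integrable_mult_right[unfolded set_integrable_def]
        cell_form_trace(3)[OF K W gw gv, unfolded set_integrable_def])
  finally show "cell_form K W w (hcomb I c v)
      = (\<Sum>i\<in>I. c i * cell_form K W w (v i))"
    by (simp add: cell_form_trace(1)[OF K W gw gc] cell_form_trace(1)[OF K W gw gv])
  have "(LINT x:K|lebesgue. W x * ((Lt K x *v grad_K k EK K (hcomb I c v) x) \<bullet> grad_K k EK K w x))
     = (LINT x:K|lebesgue. \<Sum>i\<in>I. c i * (W x * ((Lt K x *v grad_K k EK K (v i) x) \<bullet> grad_K k EK K w x)))"
    by (simp add: grad_K_hcomb[OF v K] linear_sum[OF matrix_vector_mul_linear] matrix_vector_mult_scaleR inner_sum_left sum_distrib_left mult_ac)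
  also have "\<dots> = (\<Sum>i\<in>I. LINT x:K|lebesgue. c i * (W x * ((Lt K x *v grad_K k EK K (v i) x) \<bullet> grad_K k EK K w x)))"
    unfolding set_lebesgue_integral_def scaleR_sum_right
    by (intro Bochner_Integration.integral_sum set_integrable_mult_right[unfolded set_integrable_def]
        cell_form_trace(3)[OF K W gv gw, unfolded set_integrable_def])
  finally show "cell_form K W (hcomb I c v) w
      = (\<Sum>i\<in>I. c i * cell_form K W (v i) w)"
    by (simp add: cell_form_trace(1)[OF K W gc gw] cell_form_trace(1)[OF K W gv gw])
qed

lemma face_form_commute:
  "face_form K \<sigma> Wf w v = face_form K \<sigma> Wf v w"
  by (simp add: mult.commute)

lemma face_form_hcomb:
  assumes v: "\<And>i. i \<in> I \<Longrightarrow> adm (v i)" and w: "adm w" and K: "K \<in> M" "\<sigma> \<in> EK K" and W: "continuous_on UNIV Wf"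
  shows "face_form K \<sigma> Wf w (hcomb I c v)
    = (\<Sum>i\<in>I. c i * face_form K \<sigma> Wf w (v i))"
proof -
  have jc: "continuous_on UNIV (jump k K \<sigma> (hcomb I c v))" by (rule jump_cont[OF adm_hcomb K]) (rule v)
  have jv: "continuous_on UNIV (jump k K \<sigma> (v i))" if "i \<in> I" for i by (rule jump_cont[OF v[OF that] K])
  note jw = jump_cont[OF w K]
  have "null_on (face_measure \<sigma>) \<sigma> (\<lambda>x. jump k K \<sigma> (hcomb I c v) x - (\<Sum>i\<in>I. c i * jump k K \<sigma> (v i) x))"
    by (rule jump_hcomb[OF v K])
  then have "null_on (face_measure \<sigma>) \<sigma> (\<lambda>x. Wf x * (jump k K \<sigma> w x * jump k K \<sigma> (hcomb I c v) x) - Wf x * (jump k K \<sigma> w x * (\<Sum>i\<in>I. c i * jump k K \<sigma> (v i) x)))"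
    unfolding null_on_def by (elim eventually_mono) auto
  then have "face_form K \<sigma> Wf w (hcomb I c v)
    = (LINT x:\<sigma>|face_measure \<sigma>. Wf x * (jump k K \<sigma> w x * (\<Sum>i\<in>I. c i * jump k K \<sigma> (v i) x)))"
    by (rule null_integral_cong[OF K]) (intro continuous_on_mult continuous_on_sum continuous_on_const W jc jv jw)+
  also have "\<dots> = (LINT x:\<sigma>|face_measure \<sigma>. \<Sum>i\<in>I. c i * (Wf x * (jump k K \<sigma> w x * jump k K \<sigma> (v i) x)))"
    by (simp add: sum_distrib_left mult_ac)
  also have "\<dots> = (\<Sum>i\<in>I. LINT x:\<sigma>|face_measure \<sigma>. c i * (Wf x * (jump k K \<sigma> w x * jump k K \<sigma> (v i) x)))"
    unfolding set_lebesgue_integral_def scaleR_sum_right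
    by (intro Bochner_Integration.integral_sum cont_set_integrable[OF face_ci[OF K], unfolded set_integrable_def]
        continuous_on_mult continuous_on_const W jv jw)
  finally show ?thesis by simp
qed

lemma wform_hcomb_right:
  assumes v: "\<And>i. i \<in> I \<Longrightarrow> adm (v i)" and w: "adm w" and K: "K \<in> M" and W: "continuous_on UNIV W"
    and Wf: "\<And>\<sigma>. \<sigma> \<in> EK K \<Longrightarrow> continuous_on UNIV (Wf \<sigma>)"
  shows "wform K W Wf w (hcomb I c v) = (\<Sum>i\<in>I. c i * wform K W Wf w (v i))"
proof -
  have "(\<Sum>\<sigma>\<in>EK K. Lambda_face \<Lambda> K \<sigma> / diameter \<sigma> * face_form K \<sigma> (Wf \<sigma>) w (hcomb I c v))
    = (\<Sum>\<sigma>\<in>EK K. \<Sum>i\<in>I. c i * (Lambda_face \<Lambda> K \<sigma> / diameter \<sigma> * face_form K \<sigma> (Wf \<sigma>) w (v i)))"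
  proof (rule sum.cong[OF refl])
    fix \<sigma> assume \<sigma>: "\<sigma> \<in> EK K"
    have "face_form K \<sigma> (Wf \<sigma>) w (hcomb I c v)
      = (\<Sum>i\<in>I. c i * face_form K \<sigma> (Wf \<sigma>) w (v i))"
      by (rule face_form_hcomb[OF v w K \<sigma> Wf[OF \<sigma>]])
    then show "Lambda_face \<Lambda> K \<sigma> / diameter \<sigma> * face_form K \<sigma> (Wf \<sigma>) w (hcomb I c v)
      = (\<Sum>i\<in>I. c i * (Lambda_face \<Lambda> K \<sigma> / diameter \<sigma> * face_form K \<sigma> (Wf \<sigma>) w (v i)))"
      by (simp only: sum_distrib_left mult.left_commute)
  qed
  also have "\<dots> = (\<Sum>i\<in>I. c i * (\<Sum>\<sigma>\<in>EK K. Lambda_face \<Lambda> K \<sigma> / diameter \<sigma> * face_form K \<sigma> (Wf \<sigma>) w (v i)))"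
    unfolding sum_distrib_left by (rule sum.swap)
  finally have 1: "(\<Sum>\<sigma>\<in>EK K. Lambda_face \<Lambda> K \<sigma> / diameter \<sigma> * face_form K \<sigma> (Wf \<sigma>) w (hcomb I c v))
    = (\<Sum>i\<in>I. c i * (\<Sum>\<sigma>\<in>EK K. Lambda_face \<Lambda> K \<sigma> / diameter \<sigma> * face_form K \<sigma> (Wf \<sigma>) w (v i)))" .
  have 2: "cell_form K W w (hcomb I c v)
      = (\<Sum>i\<in>I. c i * cell_form K W w (v i))"
    by (rule cell_form_hcomb(1)[OF v w K W])
  show ?thesis unfolding wform_def 1 2 by (simp add: distrib_left sum.distrib)
qed

lemma wform_hcomb_left:
  assumes v: "\<And>i. i \<in> I \<Longrightarrow> adm (v i)" and w: "adm w" and K: "K \<in> M" and W: "continuous_on UNIV W"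
    and Wf: "\<And>\<sigma>. \<sigma> \<in> EK K \<Longrightarrow> continuous_on UNIV (Wf \<sigma>)"
  shows "wform K W Wf (hcomb I c v) w = (\<Sum>i\<in>I. c i * wform K W Wf (v i) w)"
proof -
  have "(\<Sum>\<sigma>\<in>EK K. Lambda_face \<Lambda> K \<sigma> / diameter \<sigma> * face_form K \<sigma> (Wf \<sigma>) (hcomb I c v) w)
    = (\<Sum>\<sigma>\<in>EK K. \<Sum>i\<in>I. c i * (Lambda_face \<Lambda> K \<sigma> / diameter \<sigma> * face_form K \<sigma> (Wf \<sigma>) (v i) w))"
  proof (rule sum.cong[OF refl])
    fix \<sigma> assume \<sigma>: "\<sigma> \<in> EK K"
    have "face_form K \<sigma> (Wf \<sigma>) w (hcomb I c v)
      = (\<Sum>i\<in>I. c i * face_form K \<sigma> (Wf \<sigma>) w (v i))"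
      by (rule face_form_hcomb[OF v w K \<sigma> Wf[OF \<sigma>]])
    then show "Lambda_face \<Lambda> K \<sigma> / diameter \<sigma> * face_form K \<sigma> (Wf \<sigma>) (hcomb I c v) w
      = (\<Sum>i\<in>I. c i * (Lambda_face \<Lambda> K \<sigma> / diameter \<sigma> * face_form K \<sigma> (Wf \<sigma>) (v i) w))"
      unfolding face_form_commute[of \<sigma> "Wf \<sigma>" K _ w] by (simp only: sum_distrib_left mult.left_commute)
  qed
  also have "\<dots> = (\<Sum>i\<in>I. c i * (\<Sum>\<sigma>\<in>EK K. Lambda_face \<Lambda> K \<sigma> / diameter \<sigma> * face_form K \<sigma> (Wf \<sigma>) (v i) w))"
    unfolding sum_distrib_left by (rule sum.swap)
  finally have 1: "(\<Sum>\<sigma>\<in>EK K. Lambda_face \<Lambda> K \<sigma> / diameter \<sigma> * face_form K \<sigma> (Wf \<sigma>) (hcomb I c v) w)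
    = (\<Sum>i\<in>I. c i * (\<Sum>\<sigma>\<in>EK K. Lambda_face \<Lambda> K \<sigma> / diameter \<sigma> * face_form K \<sigma> (Wf \<sigma>) (v i) w))" .
  have 2: "cell_form K W (hcomb I c v) w
      = (\<Sum>i\<in>I. c i * cell_form K W (v i) w)"
    by (rule cell_form_hcomb(2)[OF v w K W])
  show ?thesis unfolding wform_def 1 2 by (simp add: distrib_left sum.distrib)
qed

lemma wform_eqv:
  assumes a: "adm w" "adm w'" "adm v" "adm v'" and e: "eqv w w'" "eqv v v'" and K: "K \<in> M"
    and Wf: "\<And>\<sigma>. \<sigma> \<in> EK K \<Longrightarrow> continuous_on UNIV (Wf \<sigma>)"
  shows "wform K W Wf w v = wform K W Wf w' v'"
proof -
  have "face_form K \<sigma> (Wf \<sigma>) w v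
      = face_form K \<sigma> (Wf \<sigma>) w' v'" if \<sigma>: "\<sigma> \<in> EK K" for \<sigma>
  proof (rule null_integral_cong[OF K \<sigma>])
    show "null_on (face_measure \<sigma>) \<sigma> (\<lambda>x. Wf \<sigma> x * (jump k K \<sigma> w x * jump k K \<sigma> v x) - Wf \<sigma> x * (jump k K \<sigma> w' x * jump k K \<sigma> v' x))"
      using jump_eqv[OF e(1) K \<sigma>] jump_eqv[OF e(2) K \<sigma>] unfolding null_on_def by eventually_elim auto
  qed (intro continuous_on_mult Wf \<sigma> jump_cont[OF _ K \<sigma>] a)+
  then show ?thesis unfolding wform_def grad_K_eqv[OF a(1,2) e(1) K] grad_K_eqv[OF a(3,4) e(2) K] by simp
qed

lemma face_coeff_pos: "K \<in> M \<Longrightarrow> \<sigma> \<in> EK K \<Longrightarrow> Lambda_face \<Lambda> K \<sigma> / diameter \<sigma> > 0"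
  using Lambda_face_pos face_diameter_pos by simp

lemma cell_form_nonneg:
  assumes K: "K \<in> M" and W: "continuous_on UNIV W" "\<And>x. W x \<ge> 0" and g: "g \<in> poly_vec k"
  shows "(LINT x:K|lebesgue. W x * ((\<Lambda> x *v g x) \<bullet> g x)) \<ge> 0"
proof -
  obtain c where c: "c > 0" "\<forall>K\<in>M. \<forall>x\<in>closure K. \<forall>\<xi>. (boundary_trace K \<Lambda> x *v \<xi>) \<bullet> \<xi> \<ge> c * (norm \<xi>)\<^sup>2"
    using Lambda_trace_elliptic by blast
  have "(Lt K x *v g x) \<bullet> g x \<ge> 0" if "x \<in> K" for x
  proof -
    have "x \<in> closure K" using that closure_subset by blast
    then have "(Lt K x *v g x) \<bullet> g x \<ge> c * (norm (g x))\<^sup>2" using c(2) K by (simp add: Lt_def)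
    moreover have "c * (norm (g x))\<^sup>2 \<ge> 0" using c(1) by simp
    ultimately show ?thesis by linarith
  qed
  then show ?thesis unfolding cell_form_trace(1)[OF K W(1) g g]
    unfolding set_lebesgue_integral_def
    using W(2) by (intro integral_nonneg_AE AE_I2) (simp add: indicator_def)
qed

lemma face_form_nonneg:
  "(\<And>x. Wf x \<ge> 0) \<Longrightarrow> face_form K \<sigma> Wf w w \<ge> 0"
  unfolding set_lebesgue_integral_def by (intro integral_nonneg_AE AE_I2) (simp add: indicator_def)

lemma wform_nonneg:
  assumes w: "adm w" and K: "K \<in> M" and W: "continuous_on UNIV W" "\<And>x. W x \<ge> 0" and Wf: "\<And>\<sigma> x. Wf \<sigma> x \<ge> 0"
  shows "wform K W Wf w w \<ge> 0"
  unfolding wform_def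
  by (intro add_nonneg_nonneg cell_form_nonneg[OF K W] grad_K_props(1)[OF w K] sum_nonneg mult_nonneg_nonneg
      face_form_nonneg Wf less_imp_le[OF face_coeff_pos[OF K]])

text \<open>All contributions are nonnegative and the face coefficients are positive, so each
  integral vanishes. Ellipticity bounds the cell term from below by a multiple of the squared norm
  of the gradient, and a null polynomial on a cell is zero; on a face only \<open>null_on\<close>
  follows.\<close>

lemma wform_zeroD:
  assumes w: "adm w" and K: "K \<in> M" and z: "wform K (\<lambda>_. 1) (\<lambda>_ _. 1) w w = 0"
  shows "grad_K k EK K w = (\<lambda>x. 0)" and "\<And>\<sigma>. \<sigma> \<in> EK K \<Longrightarrow> null_on (face_measure \<sigma>) \<sigma> (jump k K \<sigma> w)"
proof -
  define g where "g = grad_K k EK K w"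
  have g: "g \<in> poly_vec k" unfolding g_def by (rule grad_K_props(1)[OF w K])
  have c1: "continuous_on UNIV (\<lambda>_::real^'n. 1::real)" by simp
  have i1: "(LINT x:K|lebesgue. 1 * ((\<Lambda> x *v g x) \<bullet> g x)) \<ge> 0" by (rule cell_form_nonneg[OF K c1 _ g]) simp
  have i2: "Lambda_face \<Lambda> K \<sigma> / diameter \<sigma> * face_form K \<sigma> (\<lambda>_. 1) w w \<ge> 0" if "\<sigma> \<in> EK K" for \<sigma>
    by (intro mult_nonneg_nonneg less_imp_le[OF face_coeff_pos[OF K that]] face_form_nonneg) simp
  have i3: "(\<Sum>\<sigma>\<in>EK K. Lambda_face \<Lambda> K \<sigma> / diameter \<sigma> * face_form K \<sigma> (\<lambda>_. 1) w w) \<ge> 0"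
    by (intro sum_nonneg i2)
  note z' = z[unfolded wform_def, folded g_def]
  have z1: "(LINT x:K|lebesgue. 1 * ((\<Lambda> x *v g x) \<bullet> g x)) = 0"
    and z2: "(\<Sum>\<sigma>\<in>EK K. Lambda_face \<Lambda> K \<sigma> / diameter \<sigma> * face_form K \<sigma> (\<lambda>_. 1) w w) = 0"
    using z' i1 i3 by linarith+
  show "null_on (face_measure \<sigma>) \<sigma> (jump k K \<sigma> w)" if \<sigma>: "\<sigma> \<in> EK K" for \<sigma>
  proof (rule ip_self_zero[OF face_ci[OF K \<sigma>] jump_cont[OF w K \<sigma>]])
    have "Lambda_face \<Lambda> K \<sigma> / diameter \<sigma> * face_form K \<sigma> (\<lambda>_. 1) w w = 0"
      using z2 sum_nonneg_eq_0_iff[OF finite_EK[OF K] i2] \<sigma> by simp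
    then show "ip (face_measure \<sigma>) \<sigma> (jump k K \<sigma> w) (jump k K \<sigma> w) = 0"
      using face_coeff_pos[OF K \<sigma>] by (auto simp: ip_def)
  qed
  obtain c where c: "c > 0" "\<forall>K\<in>M. \<forall>x\<in>closure K. \<forall>\<xi>. (boundary_trace K \<Lambda> x *v \<xi>) \<bullet> \<xi> \<ge> c * (norm \<xi>)\<^sup>2"
    using Lambda_trace_elliptic by blast
  have ell: "(Lt K x *v g x) \<bullet> g x \<ge> c * (g x \<bullet> g x)" if "x \<in> K" for x
  proof -
    have "x \<in> closure K" using that closure_subset by blast
    then show ?thesis using c(2) K by (simp add: Lt_def power2_norm_eq_inner)
  qed
  have "(LINT x:K|lebesgue. c * (g x \<bullet> g x)) \<le> (LINT x:K|lebesgue. 1 * ((Lt K x *v g x) \<bullet> g x))"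
    using ell by (intro set_integral_mono cell_form_trace(3)[OF K c1 g g] cont_set_integrable[OF cell_ci[OF K]]
        continuous_on_mult continuous_on_const continuous_on_inner poly_vec_continuous[OF g]) auto
  then have "c * (LINT x:K|lebesgue. g x \<bullet> g x) \<le> 0" using z1 by (simp add: cell_form_trace(1)[OF K c1 g g, simplified])
  then have le: "(LINT x:K|lebesgue. g x \<bullet> g x) \<le> 0" using c(1) by (simp add: mult_le_0_iff)
  have gi: "(\<lambda>x. g x $ i) \<in> poly_fun k" for i using g by (simp add: poly_vec_def)
  have "(LINT x:K|lebesgue. g x \<bullet> g x) = (\<Sum>i\<in>UNIV. ip lebesgue K (\<lambda>x. g x $ i) (\<lambda>x. g x $ i))"
    unfolding inner_vec_def inner_real_def set_lebesgue_integral_def scaleR_sum_right ip_def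
    by (intro Bochner_Integration.integral_sum cont_set_integrable[OF cell_ci[OF K], unfolded set_integrable_def]
        continuous_on_mult poly_fun_continuous[OF gi])
  with le have "(\<Sum>i\<in>UNIV. ip lebesgue K (\<lambda>x. g x $ i) (\<lambda>x. g x $ i)) = 0"
    using sum_nonneg[of UNIV "\<lambda>i. ip lebesgue K (\<lambda>x. g x $ i) (\<lambda>x. g x $ i)"] ip_self_nonneg[OF cell_ci[OF K]] by fastforce
  then have "ip lebesgue K (\<lambda>x. g x $ i) (\<lambda>x. g x $ i) = 0" for i
    using sum_nonneg_eq_0_iff[of UNIV "\<lambda>i. ip lebesgue K (\<lambda>x. g x $ i) (\<lambda>x. g x $ i)"] ip_self_nonneg[OF cell_ci[OF K]] by simp
  then have "null_on lebesgue K (\<lambda>x. g x $ i)" for i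
    by (intro ip_self_zero[OF cell_ci[OF K]] poly_fun_continuous[OF gi])
  then have "(\<lambda>x. g x $ i) = (\<lambda>x. 0)" for i by (rule poly_fun_AE_zero[OF D(6)[OF K] D(9)[OF K] gi])
  then show "grad_K k EK K w = (\<lambda>x. 0)" unfolding g_def[symmetric] by (auto simp: vec_eq_iff fun_eq_iff)
qed

lemma wform_tendsto:
  assumes w: "adm w" and v: "adm v" and K: "K \<in> M"
    and W: "\<And>n. continuous_on UNIV (Wn n)" "continuous_on UNIV W" "bconv K Wn W"
    and Wf: "\<And>n \<sigma>. \<sigma> \<in> EK K \<Longrightarrow> continuous_on UNIV (Wfn n \<sigma>)" "\<And>\<sigma>. \<sigma> \<in> EK K \<Longrightarrow> continuous_on UNIV (Wf \<sigma>)"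
      "\<And>\<sigma>. \<sigma> \<in> EK K \<Longrightarrow> bconv \<sigma> (\<lambda>n. Wfn n \<sigma>) (Wf \<sigma>)"
  shows "(\<lambda>n. wform K (Wn n) (Wfn n) w v) \<longlonglongrightarrow> wform K W Wf w v"
proof -
  define g where "g = grad_K k EK K w"
  define h where "h = grad_K k EK K v"
  have g: "g \<in> poly_vec k" "h \<in> poly_vec k" unfolding g_def h_def by (rule grad_K_props(1)[OF w K] grad_K_props(1)[OF v K])+
  have meas: "set_borel_measurable \<mu> X f" if "set_integrable \<mu> X f" for \<mu> :: "(real^'n) measure" and X and f :: "real^'n \<Rightarrow> real"
    using that by (auto simp: set_integrable_def set_borel_measurable_def)
  obtain B where B: "\<forall>x\<in>K. \<bar>(Lt K x *v g x) \<bullet> h x\<bar> \<le> B"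
    using continuous_bounded_on[OF cell_bounded[OF K] cell_form_trace(2)[OF K W(2) g]] by blast
  have 1: "(\<lambda>n. LINT x:K|lebesgue. Wn n x * ((\<Lambda> x *v g x) \<bullet> h x)) \<longlonglongrightarrow> (LINT x:K|lebesgue. W x * ((\<Lambda> x *v g x) \<bullet> h x))"
    unfolding cell_form_trace(1)[OF K W(1) g] cell_form_trace(1)[OF K W(2) g]
    by (rule bconv_integral[OF bconv_cmul[OF W(3)] meas[OF cell_form_trace(3)[OF K W(1) g]] meas[OF cell_form_trace(3)[OF K W(2) g]] cell_finite[OF K]])
       (use B cell_borel[OF K] in auto)
  have 2: "(\<lambda>n. LINT x:\<sigma>|face_measure \<sigma>. Wfn n \<sigma> x * (jump k K \<sigma> w x * jump k K \<sigma> v x)) \<longlonglongrightarrow>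
      face_form K \<sigma> (Wf \<sigma>) w v" if \<sigma>: "\<sigma> \<in> EK K" for \<sigma>
  proof -
    note jc = jump_cont[OF w K \<sigma>] jump_cont[OF v K \<sigma>]
    have cc: "continuous_on UNIV (\<lambda>x. jump k K \<sigma> w x * jump k K \<sigma> v x)" by (intro continuous_on_mult jc)
    then obtain B where B: "\<forall>x\<in>\<sigma>. \<bar>jump k K \<sigma> w x * jump k K \<sigma> v x\<bar> \<le> B"
      using continuous_bounded_on[OF face_bounded[OF K \<sigma>] continuous_on_subset] by blast
    show ?thesis
      by (rule bconv_integral[OF bconv_cmul[OF Wf(3)[OF \<sigma>]] meas[OF cont_set_integrable[OF face_ci[OF K \<sigma>] continuous_on_mult[OF Wf(1)[OF \<sigma>] cc]]]
          meas[OF cont_set_integrable[OF face_ci[OF K \<sigma>] continuous_on_mult[OF Wf(2)[OF \<sigma>] cc]]] face_finite[OF K \<sigma>]])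
        (use B face_borel[OF K \<sigma>] in auto)
  qed
  show ?thesis unfolding wform_def g_def[symmetric] h_def[symmetric]
    by (intro tendsto_add tendsto_sum tendsto_mult_left 1 2)
qed

end

section \<open>Basis and kernel\<close>

lemma onb_independent:
  fixes \<mu> :: "(real^'n) measure"
  assumes ci: "cont_integrable \<mu> X" and B: "onb \<mu> q X B" and z: "null_on \<mu> X (\<lambda>x. \<Sum>e\<in>B. c e * e x)" and b: "b \<in> B"
  shows "c b = 0"
proof -
  have fB: "finite B" and cB: "\<And>e. e \<in> B \<Longrightarrow> continuous_on UNIV e"
    and o: "\<And>e e'. e \<in> B \<Longrightarrow> e' \<in> B \<Longrightarrow> ip \<mu> X e e' = (if e = e' then 1 else 0)"
    using B poly_fun_continuous unfolding onb_def by blast+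
  have "ip \<mu> X (\<lambda>x. \<Sum>e\<in>B. c e * e x) b = (\<Sum>e\<in>B. ip \<mu> X (\<lambda>x. c e * e x) b)"
    by (intro ip_sum_left[OF ci] cont_set_integrable[OF ci] continuous_on_mult continuous_on_const cB b)
  also have "\<dots> = (\<Sum>e\<in>B. c e * (if e = b then 1 else 0))"
    by (intro sum.cong[OF refl]) (simp add: ip_cmul_left[OF ci] o b)
  also have "\<dots> = c b" using fB b by (simp add: if_distrib sum.delta cong: if_cong)
  finally have 1: "ip \<mu> X (\<lambda>x. \<Sum>e\<in>B. c e * e x) b = c b" .
  have "ip \<mu> X (\<lambda>x. \<Sum>e\<in>B. c e * e x) b = ip \<mu> X (\<lambda>x. 0) b"
    using z by (intro ip_cong_null cont_set_integrable[OF ci] continuous_on_mult continuous_on_sum continuous_on_const cB b) simp_all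
  also have "\<dots> = 0" by (simp add: ip_def)
  finally show ?thesis using 1 by simp
qed

context hho
begin

lemma hybrid_space_adm: "v \<in> hybrid_space k M E \<Longrightarrow> adm v"
  using EK_E by (auto simp: hybrid_space_def adm_def)

text \<open>Each basis element lives on a single cell or a single face, and its index carries that
  set, so that a polynomial occurring on several of them is counted separately. Spanning and
  independence are understood modulo \<open>eqv\<close>.\<close>

lemma hybrid_basis:
  "\<exists>(I :: (((real^'n) set \<times> (real^'n \<Rightarrow> real)) + ((real^'n) set \<times> (real^'n \<Rightarrow> real))) set) bas.
     finite I \<and> (\<forall>i\<in>I. bas i \<in> hybrid_space k M E) \<and> (\<forall>v. adm v \<longrightarrow> (\<exists>c. eqv v (hcomb I c bas))) \<and>
     (\<forall>c. eqv (hcomb I c bas) (\<lambda>_ _. 0, \<lambda>_ _. 0) \<longrightarrow> (\<forall>i\<in>I. c i = 0))"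
proof -
  have "\<forall>K\<in>M. \<exists>B. onb lebesgue (k + 1) K B" using onb_exists[OF cell_ci] by blast
  from bchoice[OF this] obtain Bc where Bc: "\<forall>K\<in>M. onb lebesgue (k + 1) K (Bc K)" ..
  \<comment> \<open>Faces of \<open>E\<close> that bound no cell are left out: \<open>eqv\<close>
    does not see them, so elements supported on them would destroy independence.\<close>
  define F where "F = (\<Union>K\<in>M. EK K)"
  have "\<forall>\<sigma>\<in>F. \<exists>B. onb (face_measure \<sigma>) k \<sigma> B" using onb_exists[OF face_ci] unfolding F_def by blast
  from bchoice[OF this] obtain Bf where Bf: "\<forall>\<sigma>\<in>F. onb (face_measure \<sigma>) k \<sigma> (Bf \<sigma>)" ..
  have fF: "finite F" unfolding F_def using D(1) finite_EK by blast
  have FI: "\<sigma> \<in> F" if "K \<in> M" "\<sigma> \<in> EK K" for K \<sigma> using that by (auto simp: F_def)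
  have fin: "finite (Sigma M Bc)" "finite (Sigma F Bf)" using D(1) fF Bc Bf by (auto simp: onb_def)
  define I where "I = Sigma M Bc <+> Sigma F Bf"
  define bas :: "(((real^'n) set \<times> (real^'n \<Rightarrow> real)) + ((real^'n) set \<times> (real^'n \<Rightarrow> real))) \<Rightarrow> 'n hybrid" where
    "bas i = (case i of Inl (K, e) \<Rightarrow> (\<lambda>K' x. if K' = K then e x else 0, \<lambda>_ _. 0)
      | Inr (\<sigma>, e) \<Rightarrow> (\<lambda>_ _. 0, \<lambda>\<sigma>' x. if \<sigma>' = \<sigma> then e x else 0))" for i
  have cell: "fst (hcomb I c bas) K x = (\<Sum>e\<in>Bc K. c (Inl (K, e)) * e x)" if K: "K \<in> M" for c K x
  proof -
    have "fst (hcomb I c bas) K x = (\<Sum>(K',e)\<in>Sigma M Bc. c (Inl (K', e)) * (if K = K' then e x else 0))"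
      unfolding hcomb_def I_def by (simp add: sum.Plus[OF fin] o_def bas_def case_prod_beta sum.neutral)
    also have "\<dots> = (\<Sum>K'\<in>M. \<Sum>e\<in>Bc K'. c (Inl (K', e)) * (if K = K' then e x else 0))"
      using D(1) Bc by (intro sum.Sigma[symmetric]) (auto simp: onb_def)
    also have "\<dots> = (\<Sum>K'\<in>M. if K = K' then (\<Sum>e\<in>Bc K'. c (Inl (K', e)) * e x) else 0)"
      by (intro sum.cong[OF refl]) auto
    finally show ?thesis using K D(1) by simp
  qed
  have face: "snd (hcomb I c bas) \<sigma> x = (\<Sum>e\<in>Bf \<sigma>. c (Inr (\<sigma>, e)) * e x)" if \<sigma>: "\<sigma> \<in> F" for c \<sigma> x
  proof -
    have "snd (hcomb I c bas) \<sigma> x = (\<Sum>(\<sigma>',e)\<in>Sigma F Bf. c (Inr (\<sigma>', e)) * (if \<sigma> = \<sigma>' then e x else 0))"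
      unfolding hcomb_def I_def by (simp add: sum.Plus[OF fin] o_def bas_def case_prod_beta sum.neutral)
    also have "\<dots> = (\<Sum>\<sigma>'\<in>F. \<Sum>e\<in>Bf \<sigma>'. c (Inr (\<sigma>', e)) * (if \<sigma> = \<sigma>' then e x else 0))"
      using fF Bf by (intro sum.Sigma[symmetric]) (auto simp: onb_def)
    also have "\<dots> = (\<Sum>\<sigma>'\<in>F. if \<sigma> = \<sigma>' then (\<Sum>e\<in>Bf \<sigma>'. c (Inr (\<sigma>', e)) * e x) else 0)"
      by (intro sum.cong[OF refl]) auto
    finally show ?thesis using \<sigma> fF by simp
  qed
  have "bas i \<in> hybrid_space k M E" if "i \<in> I" for i
  proof -
    have "e \<in> poly_fun (k + 1)" if "K \<in> M" "e \<in> Bc K" for K e using that Bc by (auto simp: onb_def)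
    moreover have "e \<in> poly_fun k" if "\<sigma> \<in> F" "e \<in> Bf \<sigma>" for \<sigma> e using that Bf by (auto simp: onb_def)
    moreover have "(\<lambda>x. if P then b x else 0) \<in> poly_fun q" if "b \<in> poly_fun q" for P q and b :: "real^'n \<Rightarrow> real"
      using that by (cases P) (simp_all add: poly_fun_zero)
    ultimately show ?thesis using \<open>i \<in> I\<close>
      by (auto simp: I_def bas_def hybrid_space_def poly_fun_zero)
  qed
  moreover have "\<exists>c. eqv v (hcomb I c bas)" if v: "adm v" for v
  proof -
    define c where "c i = (case i of Inl (K, e) \<Rightarrow> ip lebesgue K (fst v K) e | Inr (\<sigma>, e) \<Rightarrow> ip (face_measure \<sigma>) \<sigma> (snd v \<sigma>) e)" for i
    have "fst v K x = fst (hcomb I c bas) K x" if K: "K \<in> M" for K x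
    proof -
      have p: "fst v K \<in> poly_fun (k + 1)" and B: "onb lebesgue (k + 1) K (Bc K)" using v K Bc by (auto simp: adm_def)
      have "null_on lebesgue K (\<lambda>x. fst v K x - (\<Sum>e\<in>Bc K. ip lebesgue K (fst v K) e * e x))"
        using B p unfolding onb_def by blast
      moreover have "(\<lambda>x. fst v K x - (\<Sum>e\<in>Bc K. ip lebesgue K (fst v K) e * e x)) \<in> poly_fun (k + 1)"
        using B by (intro poly_fun_diff p poly_fun_sum poly_fun_cmul) (auto simp: onb_def)
      ultimately have "(\<lambda>x. fst v K x - (\<Sum>e\<in>Bc K. ip lebesgue K (fst v K) e * e x)) = (\<lambda>x. 0)"
        by (intro poly_fun_AE_zero[OF D(6)[OF K] D(9)[OF K]])
      from fun_cong[OF this, of x] show ?thesis unfolding cell[OF K] by (simp add: c_def)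
    qed
    moreover have "null_on (face_measure \<sigma>) \<sigma> (\<lambda>x. snd v \<sigma> x - snd (hcomb I c bas) \<sigma> x)" if K: "K \<in> M" "\<sigma> \<in> EK K" for K \<sigma>
    proof -
      have p: "snd v \<sigma> \<in> poly_fun k" and B: "onb (face_measure \<sigma>) k \<sigma> (Bf \<sigma>)" using v K Bf FI by (auto simp: adm_def)
      show ?thesis unfolding face[OF FI[OF K]] using B p unfolding onb_def by (simp add: c_def)
    qed
    ultimately have "eqv v (hcomb I c bas)" unfolding eqv_def by (auto simp: fun_eq_iff)
    then show ?thesis by (rule exI[of _ c])
  qed
  moreover have "c i = 0" if z: "eqv (hcomb I c bas) (\<lambda>_ _. 0, \<lambda>_ _. 0)" and i: "i \<in> I" for c i
  proof -
    have "c (Inl (K, e)) = 0" if K: "K \<in> M" and e: "e \<in> Bc K" for K e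
    proof (rule onb_independent[OF cell_ci[OF K] Bc[rule_format, OF K] _ e, where c="\<lambda>e. c (Inl (K, e))"])
      have "fst (hcomb I c bas) K = (\<lambda>x. 0)" using z K by (simp add: eqv_def)
      then show "null_on lebesgue K (\<lambda>x. \<Sum>e\<in>Bc K. c (Inl (K, e)) * e x)"
        using cell[OF K, of c] by (simp add: null_on_def fun_eq_iff)
    qed
    moreover have "c (Inr (\<sigma>, e)) = 0" if \<sigma>: "\<sigma> \<in> F" and e: "e \<in> Bf \<sigma>" for \<sigma> e
    proof -
      obtain K where K: "K \<in> M" "\<sigma> \<in> EK K" using \<sigma> by (auto simp: F_def)
      have "null_on (face_measure \<sigma>) \<sigma> (\<lambda>x. snd (hcomb I c bas) \<sigma> x - 0)" using z K by (simp add: eqv_def)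
      then have "null_on (face_measure \<sigma>) \<sigma> (\<lambda>x. \<Sum>e\<in>Bf \<sigma>. c (Inr (\<sigma>, e)) * e x)" unfolding face[OF \<sigma>] by simp
      from onb_independent[OF face_ci[OF K] Bf[rule_format, OF \<sigma>] this e] show ?thesis .
    qed
    ultimately show ?thesis using i by (auto simp: I_def)
  qed
  moreover have "finite I" unfolding I_def using fin by simp
  ultimately have "finite I \<and> (\<forall>i\<in>I. bas i \<in> hybrid_space k M E) \<and> (\<forall>v. adm v \<longrightarrow> (\<exists>c. eqv v (hcomb I c bas))) \<and>
     (\<forall>c. eqv (hcomb I c bas) (\<lambda>_ _. 0, \<lambda>_ _. 0) \<longrightarrow> (\<forall>i\<in>I. c i = 0))" by simp
  then show ?thesis by (intro exI)
qed

text \<open>Vanishing jumps allow replacing the face unknown by the trace of the cell unknown in the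
  definition of the discrete gradient: the jump controls only the projection, but
  \<open>\<tau> x \<bullet> nrm K \<sigma>\<close> has degree \<open>k\<close> and does not see the
  difference. By integration by parts, the true gradient of the cell unknown then equals the
  discrete one, which is zero; both have degree \<open>k\<close> because cell unknowns have degree
  \<open>k + 1\<close>. The resulting constants agree across a common face, since it has positive
  measure, and the mesh is connected through such faces.\<close>

lemma wform_kernel:
  assumes w: "adm w" and z: "\<And>K. K \<in> M \<Longrightarrow> wform K (\<lambda>_. 1) (\<lambda>_ _. 1) w w = 0"
  shows "\<exists>c. eqv w (\<lambda>_ _. c, \<lambda>_ _. c)"
proof -
  note g0 = wform_zeroD(1)[OF w _ z] and j0 = wform_zeroD(2)[OF w _ z]
  have const: "\<exists>c. fst w K = (\<lambda>x. c)" if K: "K \<in> M" for K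
  proof -
    have p: "fst w K \<in> poly_fun (k + 1)" using w K by (simp add: adm_def)
    obtain g where g: "g \<in> poly_vec k" "\<forall>x. (fst w K has_derivative (\<lambda>h. g x \<bullet> h)) (at x)"
      using poly_fun_gradient[OF p] ..
    have "g = (\<lambda>x. 0)"
    proof (rule poly_vec_ext[OF K g(1)])
      show "(\<lambda>x. 0) \<in> poly_vec k" by (simp add: poly_vec_def poly_fun_zero)
      fix \<tau> :: "real^'n \<Rightarrow> real^'n" assume \<tau>: "\<tau> \<in> poly_vec k"
      have f: "(LINT x:\<sigma>|face_measure \<sigma>. fst w K x * (\<tau> x \<bullet> nrm K \<sigma>)) = (LINT x:\<sigma>|face_measure \<sigma>. snd w \<sigma> x * (\<tau> x \<bullet> nrm K \<sigma>))"
        if \<sigma>: "\<sigma> \<in> EK K" for \<sigma>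
      proof -
        have r: "(\<lambda>x. \<tau> x \<bullet> nrm K \<sigma>) \<in> poly_fun k" by (rule poly_vec_inner[OF \<tau>])
        note fp = face_proj_props[OF K \<sigma> adm_cont(1)[OF w K]]
        have "(LINT x:\<sigma>|face_measure \<sigma>. face_proj k \<sigma> (fst w K) x * (\<tau> x \<bullet> nrm K \<sigma>)) = (LINT x:\<sigma>|face_measure \<sigma>. snd w \<sigma> x * (\<tau> x \<bullet> nrm K \<sigma>))"
        proof (rule null_integral_cong[OF K \<sigma>])
          show "null_on (face_measure \<sigma>) \<sigma> (\<lambda>x. face_proj k \<sigma> (fst w K) x * (\<tau> x \<bullet> nrm K \<sigma>) - snd w \<sigma> x * (\<tau> x \<bullet> nrm K \<sigma>))"
            using j0[OF K K \<sigma>] unfolding null_on_def jump_def by (elim eventually_mono) auto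
        qed (intro continuous_on_mult poly_fun_continuous[OF fp(1)] poly_fun_continuous[OF r] adm_cont(2)[OF w K \<sigma>])+
        then show ?thesis using fp(2)[OF r] by (simp add: ip_def)
      qed
      have "(LINT x:K|lebesgue. g x \<bullet> \<tau> x) = grad_rhs K w \<tau>"
        unfolding grad_rhs_def integration_by_parts[OF K g(2)[rule_format] poly_vec_continuous[OF g(1)] \<tau>]
        by (simp add: f)
      also have "\<dots> = (LINT x:K|lebesgue. 0 \<bullet> \<tau> x)"
        unfolding grad_K_props(2)[OF w K \<tau>, symmetric] by (simp add: g0[OF K K])
      finally show "(LINT x:K|lebesgue. g x \<bullet> \<tau> x) = (LINT x:K|lebesgue. 0 \<bullet> \<tau> x)" .
    qed
    then have "(fst w K has_derivative (\<lambda>h. 0)) (at x within UNIV)" for x using g(2) by simp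
    then have "\<exists>c. \<forall>x\<in>UNIV. fst w K x = c" by (intro has_derivative_zero_constant convex_UNIV)
    then show ?thesis by (auto simp: fun_eq_iff)
  qed
  then have "\<forall>K\<in>M. \<exists>c. fst w K = (\<lambda>x. c)" by blast
  from bchoice[OF this] obtain c where c: "\<forall>K\<in>M. fst w K = (\<lambda>x. c K)" ..
  have f: "null_on (face_measure \<sigma>) \<sigma> (\<lambda>x. snd w \<sigma> x - c K)" if K: "K \<in> M" "\<sigma> \<in> EK K" for K \<sigma>
  proof -
    have cc: "continuous_on UNIV (\<lambda>x::real^'n. c K)" by simp
    have n: "null_on (face_measure \<sigma>) \<sigma> (\<lambda>x. face_proj k \<sigma> (\<lambda>x. c K) x - c K)"
      by (rule null_on_diff_ip[OF K face_proj_props(1)[OF K cc] poly_fun_const face_proj_props(2)[OF K cc]])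
    have "fst w K = (\<lambda>x. c K)" using c K(1) by blast
    then have "null_on (face_measure \<sigma>) \<sigma> (\<lambda>x. face_proj k \<sigma> (\<lambda>x. c K) x - snd w \<sigma> x)"
      using j0[OF K(1) K] by (simp add: jump_def[abs_def])
    with n show ?thesis unfolding null_on_def by eventually_elim auto
  qed
  have eq: "c K = c K'" if K: "K \<in> M" "K' \<in> M" and \<sigma>: "\<sigma> \<in> EK K" "\<sigma> \<in> EK K'" for K K' \<sigma>
  proof (rule ccontr)
    assume neq: "c K \<noteq> c K'"
    have "AE x in face_measure \<sigma>. x \<notin> \<sigma>"
      using f[OF K(1) \<sigma>(1)] f[OF K(2) \<sigma>(2)] unfolding null_on_def by eventually_elim (use neq in auto)
    then have "emeasure (face_measure \<sigma>) \<sigma> = 0"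
      using face_borel[OF K(1) \<sigma>(1)] AE_iff_null_sets[of \<sigma> "face_measure \<sigma>"] by auto
    then show False using D(12)[OF EK_E[OF K(1) \<sigma>(1)]] by simp
  qed
  have "c K = c K'" if "K \<in> M" "K' \<in> M" for K K' by (rule mesh_connected[OF mesh domain(1,3) eq that])
  then have "\<exists>a. \<forall>K\<in>M. c K = a" by (cases "M = {}") blast+
  then obtain a where "\<forall>K\<in>M. c K = a" ..
  then have "eqv w (\<lambda>_ _. a, \<lambda>_ _. a)" using c f by (fastforce simp: eqv_def)
  then show ?thesis ..
qed

text \<open>A face may lie on the boundary of \<open>\<Omega>\<close>, so the trace of the potential
  must be continuous on the closure for its projection to exist.\<close>

lemma hybrid_potential_adm:
  assumes lip: "lipschitz_boundary_in UNIV \<Omega>" and phi: "W1_infty \<Omega> \<phi>"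
  shows "adm (hybrid_potential k \<Omega> \<phi>)"
proof -
  have "set_integrable lebesgue K (\<lambda>x. \<phi> x * r x)" if K: "K \<in> M" and r: "r \<in> poly_fun (k + 1)" for K r
  proof -
    obtain C where m: "(\<lambda>x. indicator \<Omega> x *\<^sub>R \<phi> x) \<in> borel_measurable lebesgue" and C: "AE x in lebesgue. x \<in> \<Omega> \<longrightarrow> norm (\<phi> x) \<le> C"
      using phi unfolding W1_infty_def L_infty_def set_borel_measurable_def by blast
    have ri: "integrable lebesgue (\<lambda>x. indicator K x *\<^sub>R r x)"
      using cont_set_integrable[OF cell_ci[OF K] poly_fun_continuous[OF r]] by (simp add: set_integrable_def)
    have eq: "indicator K x *\<^sub>R (\<phi> x * r x) = (indicator \<Omega> x *\<^sub>R \<phi> x) * (indicator K x *\<^sub>R r x)" for x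
      using D(7)[OF K] by (auto simp: indicator_def)
    show ?thesis unfolding set_integrable_def
    proof (rule Bochner_Integration.integrable_bound)
      show "integrable lebesgue (\<lambda>x. C * (indicator K x *\<^sub>R r x))" using ri by (rule integrable_mult_right)
      show "(\<lambda>x. indicator K x *\<^sub>R (\<phi> x * r x)) \<in> borel_measurable lebesgue"
        unfolding eq using ri by (intro borel_measurable_times m) auto
      show "AE x in lebesgue. norm (indicator K x *\<^sub>R (\<phi> x * r x)) \<le> norm (C * (indicator K x *\<^sub>R r x))"
        using C
      proof eventually_elim
        case (elim x)
        show ?case
        proof (cases "x \<in> K")
          case True
          then have "\<bar>\<phi> x\<bar> \<le> \<bar>C\<bar>" using elim D(7)[OF K] by force
          then show ?thesis using True by (simp add: abs_mult mult_right_mono)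
        qed simp
      qed
    qed
  qed
  then have 1: "cell_proj (k + 1) K \<phi> \<in> poly_fun (k + 1)" if "K \<in> M" for K
    using that by (intro L2_proj_poly_fun(1)[OF cell_ci])
  have tr: "continuous_on (closure \<Omega>) (boundary_trace \<Omega> \<phi>)"
    using boundary_trace_real[OF domain(1,2) lip phi] by simp
  have 2: "face_proj k \<sigma> (boundary_trace \<Omega> \<phi>) \<in> poly_fun k" if K: "K \<in> M" "\<sigma> \<in> EK K" for K \<sigma>
  proof (rule L2_proj_poly_fun(1)[OF face_ci[OF K]])
    fix r :: "real^'n \<Rightarrow> real" assume r: "r \<in> poly_fun k"
    have "closure \<sigma> \<subseteq> closure \<Omega>" using D(14)[OF EK_E[OF K]] by (simp add: closure_minimal)
    then show "set_integrable (face_measure \<sigma>) \<sigma> (\<lambda>x. boundary_trace \<Omega> \<phi> x * r x)"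
      by (intro face_set_integrable[OF K] continuous_on_mult continuous_on_subset[OF tr] continuous_on_subset[OF poly_fun_continuous[OF r]]) auto
  qed
  show ?thesis unfolding adm_def hybrid_potential_def using 1 2 by auto
qed

text \<open>
  A projection onto a face is unique only almost everywhere on the face. Combining the projections
  of the basis functions makes the face weight pointwise continuous in the coefficients.
\<close>

definition step_form :: "real \<Rightarrow> 'i set \<Rightarrow> ('i \<Rightarrow> 'n hybrid) \<Rightarrow> ('i \<Rightarrow> real) \<Rightarrow> 'n hybrid \<Rightarrow> 'n hybrid \<Rightarrow> real" where
  "step_form \<epsilon> I bas c w v = (\<Sum>K\<in>M. wform K (\<lambda>x. exp (\<Sum>i\<in>I. c i * fst (bas i) K x))
      (\<lambda>\<sigma> x. (exp (\<Sum>i\<in>I. c i * face_proj k \<sigma> (fst (bas i) K) x) + exp (\<Sum>i\<in>I. c i * snd (bas i) \<sigma> x)) / 2) w v +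
      \<epsilon> * diameter K ^ (k + 2) * wform K (\<lambda>_. 1) (\<lambda>_ _. 1) w v)"

lemma T_D_step_form:
  assumes b: "\<And>i. i \<in> I \<Longrightarrow> adm (bas i)" and w: "adm w" and v: "adm v"
  shows "T_D k \<epsilon> \<Lambda> M EK (hcomb I c bas) w v = step_form \<epsilon> I bas c w v"
proof -
  have "(LINT x:\<sigma>|face_measure \<sigma>. (exp (face_proj k \<sigma> (fst (hcomb I c bas) K) x) + exp (snd (hcomb I c bas) \<sigma> x)) / 2 * (jump k K \<sigma> w x * jump k K \<sigma> v x))
     = (LINT x:\<sigma>|face_measure \<sigma>. (exp (\<Sum>i\<in>I. c i * face_proj k \<sigma> (fst (bas i) K) x) + exp (\<Sum>i\<in>I. c i * snd (bas i) \<sigma> x)) / 2 * (jump k K \<sigma> w x * jump k K \<sigma> v x))"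
    if K: "K \<in> M" "\<sigma> \<in> EK K" for K \<sigma>
  proof (rule null_integral_cong[OF K])
    have cb: "continuous_on UNIV (fst (bas i) K)" if "i \<in> I" for i by (rule adm_cont(1)[OF b[OF that] K(1)])
    have cs: "continuous_on UNIV (snd (bas i) \<sigma>)" if "i \<in> I" for i by (rule adm_cont(2)[OF b[OF that] K(1) K(2)])
    have ch: "continuous_on UNIV (fst (hcomb I c bas) K)" "continuous_on UNIV (snd (hcomb I c bas) \<sigma>)"
      unfolding hcomb_def fst_conv snd_conv by (intro continuous_on_sum continuous_on_mult continuous_on_const cb cs; assumption)+
    have "null_on (face_measure \<sigma>) \<sigma> (\<lambda>x. face_proj k \<sigma> (\<lambda>x. \<Sum>i\<in>I. c i * fst (bas i) K x) x - (\<Sum>i\<in>I. c i * face_proj k \<sigma> (fst (bas i) K) x))"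
      by (rule face_proj_lincomb[OF K cb])
    then show "null_on (face_measure \<sigma>) \<sigma> (\<lambda>x. (exp (face_proj k \<sigma> (fst (hcomb I c bas) K) x) + exp (snd (hcomb I c bas) \<sigma> x)) / 2 * (jump k K \<sigma> w x * jump k K \<sigma> v x)
       - (exp (\<Sum>i\<in>I. c i * face_proj k \<sigma> (fst (bas i) K) x) + exp (\<Sum>i\<in>I. c i * snd (bas i) \<sigma> x)) / 2 * (jump k K \<sigma> w x * jump k K \<sigma> v x))"
      unfolding null_on_def hcomb_def by (elim eventually_mono) simp
    have cp: "continuous_on UNIV (face_proj k \<sigma> (fst (bas i) K))" if "i \<in> I" for i
      by (rule poly_fun_continuous[OF face_proj_props(1)[OF K cb[OF that]]])
    note jc = jump_cont[OF w K] jump_cont[OF v K]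
    have two: "continuous_on UNIV (\<lambda>x. (exp (f x) + exp (g x)) / 2 * (jump k K \<sigma> w x * jump k K \<sigma> v x))"
      if "continuous_on UNIV f" "continuous_on UNIV g" for f g :: "real^'n \<Rightarrow> real"
      using that jc by (intro continuous_intros) auto
    show "continuous_on UNIV (\<lambda>x. (exp (face_proj k \<sigma> (fst (hcomb I c bas) K) x) + exp (snd (hcomb I c bas) \<sigma> x)) / 2 * (jump k K \<sigma> w x * jump k K \<sigma> v x))"
      by (rule two[OF poly_fun_continuous[OF face_proj_props(1)[OF K ch(1)]] ch(2)])
    show "continuous_on UNIV (\<lambda>x. (exp (\<Sum>i\<in>I. c i * face_proj k \<sigma> (fst (bas i) K) x) + exp (\<Sum>i\<in>I. c i * snd (bas i) \<sigma> x)) / 2 * (jump k K \<sigma> w x * jump k K \<sigma> v x))"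
      by (rule two) (intro continuous_on_sum continuous_on_mult continuous_on_const cp cs; assumption)+
  qed
  then show ?thesis unfolding T_D_def step_form_def a_K_wform by (simp add: wform_def hcomb_def)
qed

end

section \<open>A variational inequality on a cube\<close>

lemma finite_convergent_subseq:
  fixes X :: "nat \<Rightarrow> 'i \<Rightarrow> real"
  assumes "finite I" "\<And>n i. i \<in> I \<Longrightarrow> \<bar>X n i\<bar> \<le> R"
  shows "\<exists>r x. strict_mono (r::nat \<Rightarrow> nat) \<and> (\<forall>i\<in>I. (\<lambda>n. X (r n) i) \<longlonglongrightarrow> x i)"
  using assms
proof (induction I rule: finite_induct)
  case empty
  show ?case by (auto intro: exI[of _ id] simp: strict_mono_def)
next
  case (insert a I)
  then obtain r x where r: "strict_mono (r::nat \<Rightarrow> nat)" "\<forall>i\<in>I. (\<lambda>n. X (r n) i) \<longlonglongrightarrow> x i"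
    by (metis insert_iff)
  have "bounded (range (\<lambda>n. X (r n) a))"
    using insert.prems by (intro boundedI[of _ R]) auto
  then obtain s y where s: "strict_mono (s::nat \<Rightarrow> nat)" "((\<lambda>n. X (r n) a) \<circ> s) \<longlonglongrightarrow> y"
    using bounded_imp_convergent_subsequence by blast
  have "strict_mono (r \<circ> s)" using r(1) s(1) by (rule strict_mono_o)
  moreover have "\<forall>i\<in>insert a I. (\<lambda>n. X ((r \<circ> s) n) i) \<longlonglongrightarrow> (x(a := y)) i"
  proof
    fix i assume i: "i \<in> insert a I"
    show "(\<lambda>n. X ((r \<circ> s) n) i) \<longlonglongrightarrow> (x(a := y)) i"
    proof (cases "i = a")
      case True then show ?thesis using s(2) by (simp add: o_def)
    next
      case False
      then have "(\<lambda>n. X (r n) i) \<longlonglongrightarrow> x i" using r(2) i by auto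
      from LIMSEQ_subseq_LIMSEQ[OF this s(1)] False show ?thesis by (simp add: o_def)
    qed
  qed
  ultimately show ?case by blast
qed

text \<open>Continuity in the coordinates indexed by \<open>I\<close> only; values elsewhere are
  arbitrary. Sequences are used because dominated convergence provides exactly this form.\<close>

definition seq_cont_on_cube :: "'i set \<Rightarrow> real \<Rightarrow> (('i \<Rightarrow> real) \<Rightarrow> real) \<Rightarrow> bool" where
  "seq_cont_on_cube I R f \<longleftrightarrow>
     (\<forall>X x. (\<forall>n. \<forall>i\<in>I. \<bar>X n i\<bar> \<le> R) \<longrightarrow> (\<forall>i\<in>I. (\<lambda>n. X n i) \<longlonglongrightarrow> x i) \<longrightarrow>
        (\<lambda>n. f (X n)) \<longlonglongrightarrow> f x)"

lemma seq_cont_on_cubeD: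
  assumes "seq_cont_on_cube I R f" "\<And>n i. i \<in> I \<Longrightarrow> \<bar>X n i\<bar> \<le> R" "\<And>i. i \<in> I \<Longrightarrow> (\<lambda>n. X n i) \<longlonglongrightarrow> x i"
  shows "(\<lambda>n. f (X n)) \<longlonglongrightarrow> f x"
  using assms by (auto simp: seq_cont_on_cube_def)

text \<open>Kuhn's labelling lemma, the combinatorial core of Brouwer's theorem, is applied to grids
  of width \<open>2 * R / real (Suc p)\<close>. \<open>Q\<close> is the displacement when a step
  along \<open>- P\<close> is followed by clamping onto the cube. In a small grid cube every
  component of \<open>Q\<close> takes both signs, so \<open>Q\<close> vanishes at a limit of such
  cubes.\<close>

lemma cube_variational_inequality_nat:
  fixes P :: "(nat \<Rightarrow> real) \<Rightarrow> nat \<Rightarrow> real"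
  assumes R: "R > 0" and cont: "\<And>i. i < N \<Longrightarrow> seq_cont_on_cube {..<N} R (\<lambda>x. P x i)"
  shows "\<exists>x. (\<forall>i<N. \<bar>x i\<bar> \<le> R) \<and> (\<forall>i<N. \<forall>y. \<bar>y\<bar> \<le> R \<longrightarrow> P x i * (y - x i) \<ge> 0)"
proof -
  define Q where "Q x i = max (- R) (min R (x i - P x i)) - x i" for x i
  define pt where "pt p q = (\<lambda>i. 2 * R * real (q i) / real (Suc p) - R)" for p :: nat and q :: "nat \<Rightarrow> nat"
  have pt_bd: "\<bar>pt p q i\<bar> \<le> R" if "q i \<le> Suc p" for p q i
  proof -
    have "0 \<le> real (q i) / real (Suc p)" "real (q i) / real (Suc p) \<le> 1"
      using that by (auto simp: divide_simps)
    then have "0 \<le> 2 * R * (real (q i) / real (Suc p))" "2 * R * (real (q i) / real (Suc p)) \<le> 2 * R * 1"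
      using R mult_left_mono[of "real (q i) / real (Suc p)" 1 "2 * R"] by auto
    then show ?thesis by (auto simp: pt_def abs_le_iff)
  qed
  \<comment> \<open>On opposite sides of the cube the lemma prescribes the labels 0 and 1. This
    agrees with the sign of \<open>Q\<close>: clamping maps into the cube, so the displacement at
    its boundary cannot point outwards.\<close>
  define label where "label p q i = (if q i = Suc p then (1::nat) else if q i = 0 then 0
     else if Q (pt p q) i \<ge> 0 then 0 else 1)" for p q i
  have lab0: "Q (pt p q) i \<ge> 0" if "label p q i = 0" for p q i
    using that R by (auto simp: label_def Q_def pt_def split: if_splits)
  have lab1: "Q (pt p q) i \<le> 0" if "label p q i \<noteq> 0" for p q i
    using that R by (auto simp: label_def Q_def pt_def split: if_splits simp del: of_nat_Suc)
  define Prs where "Prs p q i r s \<longleftrightarrow> (\<forall>j<N. q j \<le> r j \<and> r j \<le> q j + 1) \<and>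
      (\<forall>j<N. q j \<le> s j \<and> s j \<le> q j + 1) \<and> label p r i = 0 \<and> label p s i \<noteq> 0" for p q i r s
  have "\<exists>q. (\<forall>i<N. q i < Suc p) \<and> (\<forall>i<N. \<exists>r s. Prs p q i r s)" for p
  proof -
    obtain q where q: "\<forall>i<N. q i < Suc p"
      "\<forall>i<N. \<exists>r s. (\<forall>j<N. q j \<le> r j \<and> r j \<le> q j + 1) \<and>
      (\<forall>j<N. q j \<le> s j \<and> s j \<le> q j + 1) \<and> label p r i \<noteq> label p s i"
    proof (rule kuhn_lemma[of "Suc p" N "label p"])
      show "\<forall>x. (\<forall>i<N. x i \<le> Suc p) \<longrightarrow> (\<forall>i<N. label p x i = 0 \<or> label p x i = 1)"
        by (auto simp: label_def)
    qed (auto simp: label_def)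
    have "\<exists>r s. (\<forall>j<N. q j \<le> r j \<and> r j \<le> q j + 1) \<and>
      (\<forall>j<N. q j \<le> s j \<and> s j \<le> q j + 1) \<and> label p r i = 0 \<and> label p s i \<noteq> 0" if "i < N" for i
    proof -
      obtain r s where rs: "\<forall>j<N. q j \<le> r j \<and> r j \<le> q j + 1"
        "\<forall>j<N. q j \<le> s j \<and> s j \<le> q j + 1" "label p r i \<noteq> label p s i"
        using q(2) \<open>i < N\<close> by blast
      show ?thesis
      proof (cases "label p r i = 0")
        case True then show ?thesis using rs by metis
      next
        case False
        then have "label p s i = 0" using rs(3) by (auto simp: label_def split: if_splits)
        then show ?thesis using rs False by metis
      qed
    qed
    then show ?thesis using q(1) unfolding Prs_def by blast
  qed
  then obtain q where q: "\<And>p i. i < N \<Longrightarrow> q p i < Suc p"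
    and ex: "\<And>p i. i < N \<Longrightarrow> \<exists>r s. Prs p (q p) i r s"
    by metis
  have "\<forall>p i. \<exists>r s. i < N \<longrightarrow> Prs p (q p) i r s" using ex by blast
  then obtain r s where Prs: "\<And>p i. i < N \<Longrightarrow> Prs p (q p) i (r p i) (s p i)"
    by metis
  have rs: "\<And>p i j. i < N \<Longrightarrow> j < N \<Longrightarrow> q p j \<le> r p i j \<and> r p i j \<le> q p j + 1"
     "\<And>p i j. i < N \<Longrightarrow> j < N \<Longrightarrow> q p j \<le> s p i j \<and> s p i j \<le> q p j + 1"
     "\<And>p i. i < N \<Longrightarrow> label p (r p i) i = 0"
     "\<And>p i. i < N \<Longrightarrow> label p (s p i) i \<noteq> 0"
    using Prs unfolding Prs_def by blast+
  have "\<exists>\<theta> x. strict_mono (\<theta>::nat \<Rightarrow> nat) \<and> (\<forall>i\<in>{..<N}. (\<lambda>n. pt (\<theta> n) (q (\<theta> n)) i) \<longlonglongrightarrow> x i)"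
    by (intro finite_convergent_subseq[where R=R and X="\<lambda>n. pt n (q n)"]) (use q in \<open>auto intro!: pt_bd intro: order.strict_implies_order\<close>)
  then obtain \<theta> x where th: "strict_mono (\<theta>::nat \<Rightarrow> nat)"
    and x: "\<And>i. i < N \<Longrightarrow> (\<lambda>n. pt (\<theta> n) (q (\<theta> n)) i) \<longlonglongrightarrow> x i" by auto
  have near: "(\<lambda>n. pt (\<theta> n) (t (\<theta> n)) j) \<longlonglongrightarrow> x j"
    if t: "\<And>p j. j < N \<Longrightarrow> q p j \<le> t p j \<and> t p j \<le> q p j + 1" and j: "j < N" for t j
  proof -
    have z: "(\<lambda>n. 2 * R / real (Suc (\<theta> n))) \<longlonglongrightarrow> 0"
      using LIMSEQ_subseq_LIMSEQ[OF LIMSEQ_Suc[OF lim_const_over_n[of "2*R"]] th] by (simp add: o_def)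
    have "(\<lambda>n. pt (\<theta> n) (t (\<theta> n)) j - pt (\<theta> n) (q (\<theta> n)) j) \<longlonglongrightarrow> 0"
    proof (rule Lim_null_comparison[OF _ z], rule always_eventually, rule allI)
      fix n
      have "pt (\<theta> n) (t (\<theta> n)) j - pt (\<theta> n) (q (\<theta> n)) j
          = 2 * R * (real (t (\<theta> n) j) - real (q (\<theta> n) j)) / real (Suc (\<theta> n))"
        by (simp add: pt_def field_simps del: of_nat_Suc)
      moreover have "\<bar>real (t (\<theta> n) j) - real (q (\<theta> n) j)\<bar> \<le> 1" using t[OF j, of "\<theta> n"] by linarith
      ultimately show "norm (pt (\<theta> n) (t (\<theta> n)) j - pt (\<theta> n) (q (\<theta> n)) j) \<le> 2 * R / real (Suc (\<theta> n))"
        using R by (simp add: abs_mult mult_left_le divide_right_mono del: of_nat_Suc)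
    qed
    from tendsto_add[OF this x[OF j]] show ?thesis by simp
  qed
  have Qlim: "(\<lambda>n. Q (pt (\<theta> n) (t (\<theta> n))) i) \<longlonglongrightarrow> Q x i"
    if t: "\<And>p j. j < N \<Longrightarrow> q p j \<le> t p j \<and> t p j \<le> q p j + 1" and i: "i < N" for t i
  proof -
    have b: "\<bar>pt (\<theta> n) (t (\<theta> n)) j\<bar> \<le> R" if "j < N" for n j
      using t[OF that, of "\<theta> n"] q[OF that, of "\<theta> n"] by (intro pt_bd) linarith
    have "(\<lambda>n. P (pt (\<theta> n) (t (\<theta> n))) i) \<longlonglongrightarrow> P x i"
      by (rule seq_cont_on_cubeD[OF cont[OF i]]) (use b near[OF t] in auto)
    with near[OF t i] show ?thesis
      unfolding Q_def by (intro tendsto_intros)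
  qed
  have bx: "\<bar>x i\<bar> \<le> R" if "i < N" for i
    using x[OF that] by (rule LIMSEQ_le_const2[OF tendsto_rabs]) (use q that pt_bd less_imp_le in blast)
  have Q0: "Q x i = 0" if i: "i < N" for i
  proof (rule antisym)
    show "Q x i \<le> 0"
      by (rule LIMSEQ_le_const2[OF Qlim[of "\<lambda>p. s p i", OF _ i]]) (use rs i lab1 in auto)
    show "Q x i \<ge> 0"
      by (rule LIMSEQ_le_const[OF Qlim[of "\<lambda>p. r p i", OF _ i]]) (use rs i lab0 in auto)
  qed
  \<comment> \<open>A fixed point of the clamped step has \<open>P x i = 0\<close> if
    \<open>x i\<close> is interior, \<open>P x i \<le> 0\<close> if it is \<open>R\<close>, and
    \<open>P x i \<ge> 0\<close> if it is \<open>- R\<close>.\<close>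
  have "P x i * (y - x i) \<ge> 0" if i: "i < N" and y: "\<bar>y\<bar> \<le> R" for i y
    using Q0[OF i] y bx[OF i] R
    by (auto simp: Q_def max_def min_def abs_le_iff zero_le_mult_iff split: if_splits)
  then show ?thesis using bx by blast
qed

lemma cube_variational_inequality:
  fixes P :: "('i \<Rightarrow> real) \<Rightarrow> 'i \<Rightarrow> real"
  assumes I: "finite I" and R: "R > 0" and cont: "\<And>i. i \<in> I \<Longrightarrow> seq_cont_on_cube I R (\<lambda>x. P x i)"
  shows "\<exists>x. (\<forall>i\<in>I. \<bar>x i\<bar> \<le> R) \<and> (\<forall>i\<in>I. \<forall>y. \<bar>y\<bar> \<le> R \<longrightarrow> P x i * (y - x i) \<ge> 0)"
proof -
  obtain h where h: "bij_betw h {..<card I} I"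
    using ex_bij_betw_nat_finite[OF I] by (metis atLeast0LessThan)
  define g where "g = inv_into {..<card I} h"
  have gh: "g (h n) = n" if "n < card I" for n
    using h that by (simp add: g_def bij_betw_def inv_into_f_f)
  have hg: "h (g i) = i" "g i < card I" if "i \<in> I" for i
    using bij_betw_inv_into_right[OF h that] bij_betwE[OF bij_betw_inv_into[OF h]] that by (auto simp: g_def)
  have hI: "h n \<in> I" if "n < card I" for n using bij_betwE[OF h] that by auto
  have "\<exists>x. (\<forall>i<card I. \<bar>x i\<bar> \<le> R) \<and>
      (\<forall>i<card I. \<forall>y. \<bar>y\<bar> \<le> R \<longrightarrow> P (x \<circ> g) (h i) * (y - x i) \<ge> 0)"
  proof (rule cube_variational_inequality_nat[OF R, where P="\<lambda>x i. P (x \<circ> g) (h i)"])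
    fix n assume n: "n < card I"
    show "seq_cont_on_cube {..<card I} R (\<lambda>x. P (x \<circ> g) (h n))"
      unfolding seq_cont_on_cube_def
    proof (intro allI impI)
      fix X x assume X: "\<forall>n. \<forall>i\<in>{..<card I}. \<bar>X n i\<bar> \<le> R"
        and lim: "\<forall>i\<in>{..<card I}. (\<lambda>n. X n i) \<longlonglongrightarrow> (x i :: real)"
      have "\<forall>m. \<forall>i\<in>I. \<bar>(X m \<circ> g) i\<bar> \<le> R" "\<forall>i\<in>I. (\<lambda>m. (X m \<circ> g) i) \<longlonglongrightarrow> (x \<circ> g) i"
        using X lim hg by auto
      then show "(\<lambda>m. P (X m \<circ> g) (h n)) \<longlonglongrightarrow> P (x \<circ> g) (h n)"
        by (intro seq_cont_on_cubeD[OF cont[OF hI[OF n]]]) auto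
    qed
  qed
  then obtain x where x: "\<And>i. i < card I \<Longrightarrow> \<bar>x i\<bar> \<le> R"
      "\<And>i y. i < card I \<Longrightarrow> \<bar>y\<bar> \<le> R \<Longrightarrow> P (x \<circ> g) (h i) * (y - x i) \<ge> 0" by blast
  have "\<bar>(x \<circ> g) i\<bar> \<le> R" if "i \<in> I" for i using x(1) hg that by auto
  moreover have "P (x \<circ> g) i * (y - (x \<circ> g) i) \<ge> 0" if "i \<in> I" "\<bar>y\<bar> \<le> R" for i y
    using x(2)[of "g i" y] hg that by auto
  ultimately show ?thesis by blast
qed

section \<open>The nonlinear system of one time step\<close>

text \<open>Only negative \<open>w\<close> matter, and there \<open>exp w * (- w) \<le> 1\<close>
  because \<open>exp (- w)\<close> exceeds \<open>- w\<close>. This bounds the nonlinear term below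
  without any bound on \<open>w\<close>.\<close>

lemma exp_mult_self_lower:
  fixes w :: real
  assumes "\<bar>p\<bar> \<le> \<Phi>"
  shows "- exp \<Phi> \<le> exp (w - p) * w"
proof (cases "w \<ge> 0")
  case True
  then have "exp (w - p) * w \<ge> 0" by simp
  then show ?thesis using exp_gt_zero[of \<Phi>] by linarith
next
  case False
  have "exp w * (- w) \<le> exp w * exp (- w)"
    using exp_ge_add_one_self[of "- w"] by (intro mult_left_mono) auto
  then have 1: "exp w * (- w) \<le> 1" by (simp add: exp_minus)
  have "exp (w - p) * (- w) = exp (- p) * (exp w * (- w))" by (simp add: exp_diff exp_minus field_simps)
  also have "\<dots> \<le> exp \<Phi> * 1" using 1 False assms by (intro mult_mono) (auto intro: mult_nonneg_nonpos)
  finally show ?thesis by simp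
qed

text \<open>\<open>u\<close> is the density of the previous step. It is assumed only to be
  integrable, nonnegative and of positive total mass, so that the initial datum and later densities
  are treated alike. \<open>c\<phi>\<close> stands for the coordinates of the discrete
  potential.\<close>

locale hho_step = hho \<Omega> \<Lambda> M E EK k
  for \<Omega> :: "(real^'n) set" and \<Lambda> :: "real^'n \<Rightarrow> real^'n^'n" and M E :: "(real^'n) set set"
    and EK :: "(real^'n) set \<Rightarrow> (real^'n) set set" and k :: nat +
  fixes I :: "'i set" and bas :: "'i \<Rightarrow> 'n hybrid" and \<epsilon> \<Delta>t :: real
    and u :: "(real^'n) set \<Rightarrow> real^'n \<Rightarrow> real" and c\<phi> :: "'i \<Rightarrow> real"
  assumes fin: "finite I" and bas: "\<And>i. i \<in> I \<Longrightarrow> adm (bas i)"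
    and indep: "\<And>c i. eqv (hcomb I c bas) (\<lambda>_ _. 0, \<lambda>_ _. 0) \<Longrightarrow> i \<in> I \<Longrightarrow> c i = 0"
    and eps: "\<epsilon> > 0" and dt: "\<Delta>t > 0"
    and u_int: "\<And>K. K \<in> M \<Longrightarrow> set_integrable lebesgue K (u K)"
    and u_nonneg: "\<And>K. K \<in> M \<Longrightarrow> AE x in lebesgue. x \<in> K \<longrightarrow> 0 \<le> u K x"
    and u_pos: "(\<Sum>K\<in>M. LINT x:K|lebesgue. u K x) > 0"
begin

section \<open>The residual of one time step in coordinates\<close>

abbreviation "hyb c \<equiv> hcomb I c bas"

definition bf :: "('i \<Rightarrow> real) \<Rightarrow> (real^'n) set \<Rightarrow> real^'n \<Rightarrow> real" where
  "bf c K x = (\<Sum>i\<in>I. c i * fst (bas i) K x)"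

lemma hyb_adm: "adm (hyb c)" by (rule adm_hcomb) (rule bas)

lemma bas_cont: "i \<in> I \<Longrightarrow> K \<in> M \<Longrightarrow> continuous_on UNIV (fst (bas i) K)"
  by (rule adm_cont(1)[OF bas])

lemma bf_cont: "K \<in> M \<Longrightarrow> continuous_on UNIV (bf c K)"
  unfolding bf_def[abs_def] by (intro continuous_on_sum continuous_on_mult continuous_on_const bas_cont)

lemma bf_fst: "fst (hyb c) K x = bf c K x" by (simp add: hcomb_def bf_def)

lemma bas_bounded: "\<exists>B\<ge>0. \<forall>K\<in>M. \<forall>i\<in>I. \<forall>x\<in>K. \<bar>fst (bas i) K x\<bar> \<le> B"
proof -
  have "\<exists>B. \<forall>x\<in>fst p. \<bar>fst (bas (snd p)) (fst p) x\<bar> \<le> B" if "p \<in> M \<times> I" for p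
    using that by (intro continuous_bounded_on cell_bounded continuous_on_subset[OF bas_cont]) auto
  then have "\<forall>p\<in>M \<times> I. \<exists>B. \<forall>x\<in>fst p. \<bar>fst (bas (snd p)) (fst p) x\<bar> \<le> B" by blast
  from bchoice[OF this] obtain B where B: "\<forall>p\<in>M \<times> I. \<forall>x\<in>fst p. \<bar>fst (bas (snd p)) (fst p) x\<bar> \<le> B p" ..
  have f: "finite (M \<times> I)" using D(1) fin by simp
  have "\<bar>fst (bas i) K x\<bar> \<le> (\<Sum>p\<in>M \<times> I. \<bar>B p\<bar>)" if "K \<in> M" "i \<in> I" "x \<in> K" for K i x
  proof -
    have "\<bar>fst (bas i) K x\<bar> \<le> \<bar>B (K, i)\<bar>" using B that by force
    also have "\<dots> \<le> (\<Sum>p\<in>M \<times> I. \<bar>B p\<bar>)" using that f by (intro member_le_sum) auto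
    finally show ?thesis .
  qed
  then show ?thesis by (intro exI[of _ "\<Sum>p\<in>M \<times> I. \<bar>B p\<bar>"]) (auto simp: sum_nonneg)
qed

lemma bf_bounded: "\<exists>B\<ge>0. \<forall>c. \<forall>K\<in>M. \<forall>x\<in>K. \<bar>bf c K x\<bar> \<le> B * (\<Sum>i\<in>I. \<bar>c i\<bar>)"
proof -
  obtain B where B: "B \<ge> 0" "\<forall>K\<in>M. \<forall>i\<in>I. \<forall>x\<in>K. \<bar>fst (bas i) K x\<bar> \<le> B" using bas_bounded by blast
  have "\<bar>bf c K x\<bar> \<le> B * (\<Sum>i\<in>I. \<bar>c i\<bar>)" if "K \<in> M" "x \<in> K" for c K x
  proof -
    have "\<bar>bf c K x\<bar> \<le> (\<Sum>i\<in>I. \<bar>c i * fst (bas i) K x\<bar>)" unfolding bf_def by (rule sum_abs)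
    also have "\<dots> \<le> (\<Sum>i\<in>I. B * \<bar>c i\<bar>)"
      using B(2) that unfolding abs_mult mult.commute[of B] by (intro sum_mono mult_left_mono) auto
    finally show ?thesis by (simp add: sum_distrib_left)
  qed
  then show ?thesis using B(1) by blast
qed

lemma u_mult_int:
  assumes K: "K \<in> M" and b: "continuous_on UNIV b"
  shows "set_integrable lebesgue K (\<lambda>x. u K x * b x)"
proof -
  obtain B where B: "\<forall>x\<in>K. \<bar>b x\<bar> \<le> B" using continuous_bounded_on[OF cell_bounded[OF K] continuous_on_subset[OF b]] by blast
  have m: "(\<lambda>x. indicator K x *\<^sub>R u K x) \<in> borel_measurable lebesgue" "(\<lambda>x. indicator K x *\<^sub>R b x) \<in> borel_measurable lebesgue"
    using u_int[OF K] cont_set_integrable[OF cell_ci[OF K] b] by (auto simp: set_integrable_def)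
  have eq: "indicator K x *\<^sub>R (u K x * b x) = (indicator K x *\<^sub>R u K x) * (indicator K x *\<^sub>R b x)" for x
    by (simp add: indicator_def)
  show ?thesis unfolding set_integrable_def
  proof (rule Bochner_Integration.integrable_bound)
    show "integrable lebesgue (\<lambda>x. B * (indicator K x *\<^sub>R u K x))"
      using u_int[OF K] unfolding set_integrable_def by (rule integrable_mult_right)
    show "(\<lambda>x. indicator K x *\<^sub>R (u K x * b x)) \<in> borel_measurable lebesgue"
      unfolding eq by (intro borel_measurable_times m)
    show "AE x in lebesgue. norm (indicator K x *\<^sub>R (u K x * b x)) \<le> norm (B * (indicator K x *\<^sub>R u K x))"
    proof (intro AE_I2)
      fix x show "norm (indicator K x *\<^sub>R (u K x * b x)) \<le> norm (B * (indicator K x *\<^sub>R u K x))"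
      proof (cases "x \<in> K")
        case True
        then have "\<bar>b x\<bar> \<le> \<bar>B\<bar>" using B by force
        then show ?thesis using True by (simp add: abs_mult mult.commute[of "\<bar>B\<bar>"] mult_left_mono)
      qed simp
    qed
  qed
qed

lemma exp_mult_int:
  fixes b f :: "real^'n \<Rightarrow> real"
  assumes K: "K \<in> M" and b: "continuous_on UNIV b" "continuous_on UNIV f"
  shows "set_integrable lebesgue K (\<lambda>x. exp (f x) * b x)"
  by (intro cont_set_integrable[OF cell_ci[OF K]] continuous_on_mult continuous_on_exp b)

text \<open>The time derivative term before division by \<open>\<Delta>t\<close>, with the two
  integrals separated because their integrability has different sources.\<close>

definition mass :: "('i \<Rightarrow> real) \<Rightarrow> (real^'n) set \<Rightarrow> (real^'n \<Rightarrow> real) \<Rightarrow> real" where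
  "mass c K b = (LINT x:K|lebesgue. exp (bf c K x) * b x) - (LINT x:K|lebesgue. u K x * b x)"

lemma mass_difference_quotient:
  assumes K: "K \<in> M" and b: "continuous_on UNIV b"
  shows "(LINT x:K|lebesgue. (exp (bf c K x) - u K x) / \<Delta>t * b x) = mass c K b / \<Delta>t"
proof -
  have "(exp (bf c K x) - u K x) / \<Delta>t * b x = inverse \<Delta>t * (exp (bf c K x) * b x - u K x * b x)" for x
    by (simp add: field_simps)
  then show ?thesis unfolding mass_def
    using set_integral_diff(2)[OF exp_mult_int[OF K b bf_cont[OF K]] u_mult_int[OF K b]] by (simp add: field_simps)
qed

lemma mass_bf:
  assumes K: "K \<in> M"
  shows "mass c K (bf d K) = (\<Sum>i\<in>I. d i * mass c K (fst (bas i) K))"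
proof -
  have "(LINT x:K|lebesgue. exp (bf c K x) * bf d K x) = (LINT x:K|lebesgue. \<Sum>i\<in>I. d i * (exp (bf c K x) * fst (bas i) K x))"
    by (simp add: bf_def[of d] sum_distrib_left mult_ac)
  also have "\<dots> = (\<Sum>i\<in>I. LINT x:K|lebesgue. d i * (exp (bf c K x) * fst (bas i) K x))"
    unfolding set_lebesgue_integral_def scaleR_sum_right
    by (intro Bochner_Integration.integral_sum set_integrable_mult_right[unfolded set_integrable_def]
        exp_mult_int[OF K _ bf_cont[OF K], unfolded set_integrable_def] bas_cont K)
  finally have 1: "(LINT x:K|lebesgue. exp (bf c K x) * bf d K x) = (\<Sum>i\<in>I. d i * (LINT x:K|lebesgue. exp (bf c K x) * fst (bas i) K x))" by simp
  have "(LINT x:K|lebesgue. u K x * bf d K x) = (LINT x:K|lebesgue. \<Sum>i\<in>I. d i * (u K x * fst (bas i) K x))"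
    by (simp add: bf_def[of d] sum_distrib_left mult_ac)
  also have "\<dots> = (\<Sum>i\<in>I. LINT x:K|lebesgue. d i * (u K x * fst (bas i) K x))"
    unfolding set_lebesgue_integral_def scaleR_sum_right
    by (intro Bochner_Integration.integral_sum set_integrable_mult_right[unfolded set_integrable_def]
        u_mult_int[OF K, unfolded set_integrable_def] bas_cont K)
  finally have 2: "(LINT x:K|lebesgue. u K x * bf d K x) = (\<Sum>i\<in>I. d i * (LINT x:K|lebesgue. u K x * fst (bas i) K x))" by simp
  show ?thesis unfolding mass_def 1 2 by (simp add: sum_subtractf right_diff_distrib)
qed

lemma face_proj_bas_cont:
  assumes "i \<in> I" "K \<in> M" "\<sigma> \<in> EK K"
  shows "continuous_on UNIV (face_proj k \<sigma> (fst (bas i) K))"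
  by (rule poly_fun_continuous[OF face_proj_props(1)[OF assms(2,3) bas_cont[OF assms(1,2)]]])

lemma weight_cont:
  assumes K: "K \<in> M"
  shows "continuous_on UNIV (\<lambda>x. exp (\<Sum>i\<in>I. c i * fst (bas i) K x))"
    and "\<sigma> \<in> EK K \<Longrightarrow> continuous_on UNIV (\<lambda>x. (exp (\<Sum>i\<in>I. c i * face_proj k \<sigma> (fst (bas i) K) x) + exp (\<Sum>i\<in>I. c i * snd (bas i) \<sigma> x)) / 2)"
proof -
  show "continuous_on UNIV (\<lambda>x. exp (\<Sum>i\<in>I. c i * fst (bas i) K x))"
    by (intro continuous_on_exp continuous_on_sum continuous_on_mult continuous_on_const bas_cont K)
  assume \<sigma>: "\<sigma> \<in> EK K"
  have cs: "continuous_on UNIV (snd (bas i) \<sigma>)" if "i \<in> I" for i by (rule adm_cont(2)[OF bas[OF that] K \<sigma>])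
  show "continuous_on UNIV (\<lambda>x. (exp (\<Sum>i\<in>I. c i * face_proj k \<sigma> (fst (bas i) K) x) + exp (\<Sum>i\<in>I. c i * snd (bas i) \<sigma> x)) / 2)"
    unfolding divide_inverse
    by (intro continuous_on_mult continuous_on_add continuous_on_exp continuous_on_sum continuous_on_const cs face_proj_bas_cont K \<sigma>)
qed

lemma step_form_hcomb_right:
  assumes w: "adm w"
  shows "step_form \<epsilon> I bas c w (hyb d) = (\<Sum>i\<in>I. d i * step_form \<epsilon> I bas c w (bas i))"
proof -
  let ?W = "\<lambda>K x. exp (\<Sum>i\<in>I. c i * fst (bas i) K x)"
  let ?F = "\<lambda>K \<sigma> x. (exp (\<Sum>i\<in>I. c i * face_proj k \<sigma> (fst (bas i) K) x) + exp (\<Sum>i\<in>I. c i * snd (bas i) \<sigma> x)) / 2"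
  have 1: "wform K (?W K) (?F K) w (hyb d) = (\<Sum>i\<in>I. d i * wform K (?W K) (?F K) w (bas i))" if K: "K \<in> M" for K
    by (rule wform_hcomb_right[OF bas w K weight_cont(1)[OF K] weight_cont(2)[OF K]])
  have 2: "wform K (\<lambda>_. 1) (\<lambda>_ _. 1) w (hyb d) = (\<Sum>i\<in>I. d i * wform K (\<lambda>_. 1) (\<lambda>_ _. 1) w (bas i))" if K: "K \<in> M" for K
    by (rule wform_hcomb_right[OF bas w K]) simp_all
  have "step_form \<epsilon> I bas c w (hyb d) = (\<Sum>K\<in>M. \<Sum>i\<in>I. d i * (wform K (?W K) (?F K) w (bas i) + \<epsilon> * diameter K ^ (k + 2) * wform K (\<lambda>_. 1) (\<lambda>_ _. 1) w (bas i)))"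
    unfolding step_form_def by (intro sum.cong[OF refl]) (simp add: 1 2 sum_distrib_left distrib_left sum.distrib mult_ac)
  also have "\<dots> = (\<Sum>i\<in>I. d i * step_form \<epsilon> I bas c w (bas i))"
    unfolding step_form_def sum_distrib_left by (rule sum.swap)
  finally show ?thesis .
qed

lemma step_form_hcomb_left:
  assumes w: "adm w"
  shows "step_form \<epsilon> I bas c (hyb d) w = (\<Sum>i\<in>I. d i * step_form \<epsilon> I bas c (bas i) w)"
proof -
  let ?W = "\<lambda>K x. exp (\<Sum>i\<in>I. c i * fst (bas i) K x)"
  let ?F = "\<lambda>K \<sigma> x. (exp (\<Sum>i\<in>I. c i * face_proj k \<sigma> (fst (bas i) K) x) + exp (\<Sum>i\<in>I. c i * snd (bas i) \<sigma> x)) / 2"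
  have 1: "wform K (?W K) (?F K) (hyb d) w = (\<Sum>i\<in>I. d i * wform K (?W K) (?F K) (bas i) w)" if K: "K \<in> M" for K
    by (rule wform_hcomb_left[OF bas w K weight_cont(1)[OF K] weight_cont(2)[OF K]])
  have 2: "wform K (\<lambda>_. 1) (\<lambda>_ _. 1) (hyb d) w = (\<Sum>i\<in>I. d i * wform K (\<lambda>_. 1) (\<lambda>_ _. 1) (bas i) w)" if K: "K \<in> M" for K
    by (rule wform_hcomb_left[OF bas w K]) simp_all
  have "step_form \<epsilon> I bas c (hyb d) w = (\<Sum>K\<in>M. \<Sum>i\<in>I. d i * (wform K (?W K) (?F K) (bas i) w + \<epsilon> * diameter K ^ (k + 2) * wform K (\<lambda>_. 1) (\<lambda>_ _. 1) (bas i) w))"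
    unfolding step_form_def by (intro sum.cong[OF refl]) (simp add: 1 2 sum_distrib_left distrib_left sum.distrib mult_ac)
  also have "\<dots> = (\<Sum>i\<in>I. d i * step_form \<epsilon> I bas c (bas i) w)"
    unfolding step_form_def sum_distrib_left by (rule sum.swap)
  finally show ?thesis .
qed

lemma step_form_eqv:
  assumes a: "adm w" "adm w'" "adm v" "adm v'" and e: "eqv w w'" "eqv v v'"
  shows "step_form \<epsilon> I bas c w v = step_form \<epsilon> I bas c w' v'"
  unfolding step_form_def
  by (intro sum.cong[OF refl] arg_cong2[where f="(+)"] arg_cong2[where f="(*)"] refl wform_eqv a e weight_cont(2) continuous_on_const)

lemma step_form_tendsto:
  assumes w: "adm w" and v: "adm v" and X: "\<And>n i. i \<in> I \<Longrightarrow> \<bar>X n i\<bar> \<le> R" "\<And>i. i \<in> I \<Longrightarrow> (\<lambda>n. X n i) \<longlonglongrightarrow> x i"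
  shows "(\<lambda>n. step_form \<epsilon> I bas (X n) w v) \<longlonglongrightarrow> step_form \<epsilon> I bas x w v"
proof -
  have b: "bconv Y (\<lambda>n y. exp (\<Sum>i\<in>I. X n i * q i y)) (\<lambda>y. exp (\<Sum>i\<in>I. x i * q i y))"
    if Y: "bounded Y" and q: "\<And>i. i \<in> I \<Longrightarrow> continuous_on UNIV (q i)" for Y :: "(real^'n) set" and q :: "'i \<Rightarrow> real^'n \<Rightarrow> real"
  proof (rule bconv_exp[OF bconv_lincomb[OF fin]])
    show "\<And>n i. i \<in> I \<Longrightarrow> \<bar>X n i\<bar> \<le> R" "\<And>i. i \<in> I \<Longrightarrow> (\<lambda>n. X n i) \<longlonglongrightarrow> x i" by (rule X; assumption)+
    show "\<exists>B. \<forall>y\<in>Y. \<bar>q i y\<bar> \<le> B" if "i \<in> I" for i by (rule continuous_bounded_on[OF Y continuous_on_subset[OF q[OF that]]]) simp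
  qed
  show ?thesis unfolding step_form_def
  proof (intro tendsto_sum tendsto_add tendsto_const wform_tendsto w v weight_cont b cell_bounded bas_cont; (assumption)?)
    fix K \<sigma> assume K: "K \<in> M" and \<sigma>: "\<sigma> \<in> EK K"
    have cs: "continuous_on UNIV (snd (bas i) \<sigma>)" if "i \<in> I" for i by (rule adm_cont(2)[OF bas[OF that] K \<sigma>])
    note fb = face_bounded[OF K \<sigma>]
    show "bconv \<sigma> (\<lambda>n x. (exp (\<Sum>i\<in>I. X n i * face_proj k \<sigma> (fst (bas i) K) x) + exp (\<Sum>i\<in>I. X n i * snd (bas i) \<sigma> x)) / 2)
         (\<lambda>y. (exp (\<Sum>i\<in>I. x i * face_proj k \<sigma> (fst (bas i) K) y) + exp (\<Sum>i\<in>I. x i * snd (bas i) \<sigma> y)) / 2)"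
      unfolding divide_inverse
      by (rule bconv_cmul[OF bconv_add[OF b[OF fb face_proj_bas_cont[OF _ K \<sigma>]] b[OF fb cs]], where B="1"]) simp_all
  qed
qed

lemma mass_tendsto:
  assumes K: "K \<in> M" and f: "continuous_on UNIV f" and X: "\<And>n i. i \<in> I \<Longrightarrow> \<bar>X n i\<bar> \<le> R" "\<And>i. i \<in> I \<Longrightarrow> (\<lambda>n. X n i) \<longlonglongrightarrow> x i"
  shows "(\<lambda>n. mass (X n) K f) \<longlonglongrightarrow> mass x K f"
proof -
  obtain B where B: "\<forall>x\<in>K. \<bar>f x\<bar> \<le> B" using continuous_bounded_on[OF cell_bounded[OF K] continuous_on_subset[OF f]] by blast
  have e: "bconv K (\<lambda>n y. exp (bf (X n) K y)) (\<lambda>y. exp (bf x K y))" unfolding bf_def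
  proof (rule bconv_exp[OF bconv_lincomb[OF fin]])
    show "\<And>n i. i \<in> I \<Longrightarrow> \<bar>X n i\<bar> \<le> R" "\<And>i. i \<in> I \<Longrightarrow> (\<lambda>n. X n i) \<longlonglongrightarrow> x i" by (rule X; assumption)+
    show "\<exists>B. \<forall>y\<in>K. \<bar>fst (bas i) K y\<bar> \<le> B" if "i \<in> I" for i
      by (rule continuous_bounded_on[OF cell_bounded[OF K] continuous_on_subset[OF bas_cont[OF that K]]]) simp
  qed
  have m: "set_borel_measurable lebesgue K (\<lambda>y. exp (bf c K y) * f y)" for c
    using exp_mult_int[OF K f bf_cont[OF K]] by (auto simp: set_integrable_def set_borel_measurable_def)
  have "(\<lambda>n. LINT y:K|lebesgue. exp (bf (X n) K y) * f y) \<longlonglongrightarrow> (LINT y:K|lebesgue. exp (bf x K y) * f y)"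
    by (rule bconv_integral[OF bconv_cmul[OF e] m m cell_finite[OF K]]) (use B cell_borel[OF K] in auto)
  then show ?thesis unfolding mass_def by (intro tendsto_diff tendsto_const)
qed

text \<open>The residual of the scheme tested with \<open>bas j\<close>: \<open>c\<close> are the
  coordinates of the logarithmic unknown, which sets the weights, and \<open>c i + c\<phi> i\<close>
  those of the second argument of the form.\<close>

definition P :: "('i \<Rightarrow> real) \<Rightarrow> 'i \<Rightarrow> real" where
  "P c j = (\<Sum>K\<in>M. mass c K (fst (bas j) K)) / \<Delta>t + (\<Sum>i\<in>I. (c i + c\<phi> i) * step_form \<epsilon> I bas c (bas i) (bas j))"

lemma P_seq_cont:
  assumes j: "j \<in> I"
  shows "seq_cont_on_cube I R (\<lambda>c. P c j)"
  unfolding seq_cont_on_cube_def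
proof (intro allI impI)
  fix X :: "nat \<Rightarrow> 'i \<Rightarrow> real" and x assume "\<forall>n. \<forall>i\<in>I. \<bar>X n i\<bar> \<le> R" "\<forall>i\<in>I. (\<lambda>n. X n i) \<longlonglongrightarrow> x i"
  then have X: "\<And>n i. i \<in> I \<Longrightarrow> \<bar>X n i\<bar> \<le> R" "\<And>i. i \<in> I \<Longrightarrow> (\<lambda>n. X n i) \<longlonglongrightarrow> x i" by auto
  have 1: "(\<lambda>n. mass (X n) K (fst (bas j) K)) \<longlonglongrightarrow> mass x K (fst (bas j) K)" if K: "K \<in> M" for K
    by (rule mass_tendsto[OF K bas_cont[OF j K] X])
  have 2: "(\<lambda>n. step_form \<epsilon> I bas (X n) (bas i) (bas j)) \<longlonglongrightarrow> step_form \<epsilon> I bas x (bas i) (bas j)" if i: "i \<in> I" for i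
    by (rule step_form_tendsto[OF bas[OF i] bas[OF j] X])
  show "(\<lambda>n. P (X n) j) \<longlonglongrightarrow> P x j" unfolding P_def
    using dt by (intro tendsto_add tendsto_divide tendsto_sum tendsto_mult tendsto_const 1 2 X(2)) auto
qed

text \<open>Used twice: for \<open>e\<close> equal to \<open>c\<close> plus \<open>c\<phi>\<close>
  it is the energy identity, and for the coordinates of a test function it is the scheme
  itself.\<close>

lemma sum_P:
  "(\<Sum>j\<in>I. e j * P c j) = (\<Sum>K\<in>M. mass c K (bf e K)) / \<Delta>t + step_form \<epsilon> I bas c (hyb (\<lambda>i. c i + c\<phi> i)) (hyb e)"
proof -
  have "(\<Sum>j\<in>I. e j * P c j) = (\<Sum>j\<in>I. e j * (\<Sum>K\<in>M. mass c K (fst (bas j) K))) / \<Delta>t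
      + (\<Sum>j\<in>I. e j * (\<Sum>i\<in>I. (c i + c\<phi> i) * step_form \<epsilon> I bas c (bas i) (bas j)))"
    by (simp only: P_def distrib_left sum.distrib times_divide_eq_right sum_divide_distrib[symmetric])
  also have "(\<Sum>j\<in>I. e j * (\<Sum>K\<in>M. mass c K (fst (bas j) K))) = (\<Sum>K\<in>M. mass c K (bf e K))"
    unfolding sum_distrib_left by (subst sum.swap) (simp add: mass_bf)
  also have "(\<Sum>j\<in>I. e j * (\<Sum>i\<in>I. (c i + c\<phi> i) * step_form \<epsilon> I bas c (bas i) (bas j)))
      = step_form \<epsilon> I bas c (hyb (\<lambda>i. c i + c\<phi> i)) (hyb e)"
    unfolding step_form_hcomb_right[OF hyb_adm]
    by (intro sum.cong[OF refl] arg_cong2[where f="(*)"] refl step_form_hcomb_left[OF bas, symmetric])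
  finally show ?thesis .
qed

end

section \<open>A priori bound\<close>

context hho_step
begin

abbreviation nrm1 :: "('i \<Rightarrow> real) \<Rightarrow> real" where "nrm1 d \<equiv> \<Sum>i\<in>I. \<bar>d i\<bar>"

text \<open>Here \<open>d\<close> stands for the coordinates of unknown plus potential, so the
  argument of \<open>exp\<close> is the logarithmic unknown. \<open>load\<close> and
  \<open>Q\<close> below use the same \<open>d\<close>.\<close>

definition gain :: "('i \<Rightarrow> real) \<Rightarrow> real" where
  "gain d = (\<Sum>K\<in>M. LINT x:K|lebesgue. exp (bf d K x - bf c\<phi> K x) * bf d K x)"

definition load :: "('i \<Rightarrow> real) \<Rightarrow> real" where
  "load d = (\<Sum>K\<in>M. LINT x:K|lebesgue. u K x * bf d K x)"

definition Q :: "('i \<Rightarrow> real) \<Rightarrow> real" where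
  "Q d = (\<Sum>K\<in>M. diameter K ^ (k + 2) * wform K (\<lambda>_. 1) (\<lambda>_ _. 1) (hyb d) (hyb d))"

lemma gain_int: "K \<in> M \<Longrightarrow> set_integrable lebesgue K (\<lambda>x. exp (bf d K x - bf c\<phi> K x) * bf d K x)"
  by (intro exp_mult_int continuous_on_diff bf_cont)

lemma Q_term_nonneg: "K \<in> M \<Longrightarrow> diameter K ^ (k + 2) * wform K (\<lambda>_. 1) (\<lambda>_ _. 1) (hyb d) (hyb d) \<ge> 0"
  using cell_diameter_pos by (intro mult_nonneg_nonneg wform_nonneg hyb_adm zero_le_power) (auto simp: less_imp_le)

lemma Q_nonneg: "Q d \<ge> 0"
  unfolding Q_def by (intro sum_nonneg Q_term_nonneg)

text \<open>With equal arguments the form with exponential weights is nonnegative and is discarded;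
  the part with factor \<open>\<epsilon>\<close> is kept, since its coefficients do not depend on
  \<open>c\<close>.\<close>

lemma energy_lower:
  "(\<Sum>j\<in>I. (c j + c\<phi> j) * P c j) \<ge> (gain (\<lambda>i. c i + c\<phi> i) - load (\<lambda>i. c i + c\<phi> i)) / \<Delta>t + \<epsilon> * Q (\<lambda>i. c i + c\<phi> i)"
proof -
  define d where "d = (\<lambda>i. c i + c\<phi> i)"
  have bc: "bf c K x = bf d K x - bf c\<phi> K x" for K x by (simp add: bf_def d_def distrib_right sum.distrib)
  have "(\<Sum>K\<in>M. mass c K (bf d K)) = gain d - load d"
    unfolding mass_def gain_def load_def by (simp add: bc sum_subtractf)
  moreover have "step_form \<epsilon> I bas c (hyb d) (hyb d) \<ge> \<epsilon> * Q d"
    unfolding step_form_def Q_def sum_distrib_left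
  proof (rule sum_mono)
    fix K assume K: "K \<in> M"
    have "wform K (\<lambda>x. exp (\<Sum>i\<in>I. c i * fst (bas i) K x))
       (\<lambda>\<sigma> x. (exp (\<Sum>i\<in>I. c i * face_proj k \<sigma> (fst (bas i) K) x) + exp (\<Sum>i\<in>I. c i * snd (bas i) \<sigma> x)) / 2) (hyb d) (hyb d) \<ge> 0"
      by (rule wform_nonneg[OF hyb_adm K weight_cont(1)[OF K]]) (auto intro!: add_nonneg_nonneg)
    then show "\<epsilon> * (diameter K ^ (k + 2) * wform K (\<lambda>_. 1) (\<lambda>_ _. 1) (hyb d) (hyb d)) \<le>
       wform K (\<lambda>x. exp (\<Sum>i\<in>I. c i * fst (bas i) K x))
       (\<lambda>\<sigma> x. (exp (\<Sum>i\<in>I. c i * face_proj k \<sigma> (fst (bas i) K) x) + exp (\<Sum>i\<in>I. c i * snd (bas i) \<sigma> x)) / 2) (hyb d) (hyb d) +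
       \<epsilon> * diameter K ^ (k + 2) * wform K (\<lambda>_. 1) (\<lambda>_ _. 1) (hyb d) (hyb d)" by (simp add: mult.assoc)
  qed
  ultimately show ?thesis unfolding d_def[symmetric] using sum_P[of d c] by (simp add: d_def)
qed

lemma gain_lower: "\<exists>C. \<forall>d. - C \<le> gain d"
proof -
  obtain B where B: "B \<ge> 0" "\<forall>c. \<forall>K\<in>M. \<forall>x\<in>K. \<bar>bf c K x\<bar> \<le> B * nrm1 c" using bf_bounded by blast
  define \<Phi> where "\<Phi> = B * nrm1 c\<phi>"
  have "(\<Sum>K\<in>M. LINT x:K|lebesgue. - exp \<Phi>) \<le> gain d" for d
    unfolding gain_def
  proof (rule sum_mono)
    fix K assume K: "K \<in> M"
    show "(LINT x:K|lebesgue. - exp \<Phi>) \<le> (LINT x:K|lebesgue. exp (bf d K x - bf c\<phi> K x) * bf d K x)"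
    proof (rule set_integral_mono)
      show "set_integrable lebesgue K (\<lambda>x. - exp \<Phi>)" by (intro cont_set_integrable[OF cell_ci[OF K]] continuous_on_const)
      fix x assume "x \<in> K"
      then have "\<bar>bf c\<phi> K x\<bar> \<le> \<Phi>" using B(2) K by (simp add: \<Phi>_def)
      then show "- exp \<Phi> \<le> exp (bf d K x - bf c\<phi> K x) * bf d K x" by (rule exp_mult_self_lower)
    qed (rule gain_int[OF K])
  qed
  then have "\<forall>d. - (- (\<Sum>K\<in>M. LINT x:K|lebesgue. - exp \<Phi>)) \<le> gain d" by simp
  then show ?thesis by (rule exI)
qed

lemma cells_nonempty: "M \<noteq> {}" using u_pos by auto

lemma cell_ip_one_pos: assumes K: "K \<in> M" shows "ip lebesgue K (\<lambda>_. 1) (\<lambda>_. 1) > 0"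
proof -
  have "ip lebesgue K (\<lambda>_. 1) (\<lambda>_. 1) \<noteq> 0"
  proof
    assume "ip lebesgue K (\<lambda>_. 1) (\<lambda>_. 1) = 0"
    then have "null_on lebesgue K (\<lambda>_. 1)" by (intro ip_self_zero[OF cell_ci[OF K]]) simp_all
    from poly_fun_AE_zero[OF D(6)[OF K] D(9)[OF K] poly_fun_const[of 1 0] this] show False by (simp add: fun_eq_iff)
  qed
  then show ?thesis using ip_self_nonneg[OF cell_ci[OF K], of "\<lambda>_. 1"] by linarith
qed

text \<open>For nonnegative \<open>w\<close> the product \<open>exp w * w\<close> increases with
  \<open>w\<close>, and the potential costs at most the factor \<open>exp (- \<Phi>)\<close>. The
  constant \<open>m\<close> is this factor times the volume of the cells.\<close>

lemma gain_exponential: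
  "\<exists>m>0. \<forall>d s. s \<ge> 0 \<longrightarrow> (\<forall>K\<in>M. \<forall>x\<in>K. bf d K x \<ge> s) \<longrightarrow> gain d \<ge> m * (s * exp s)"
proof -
  obtain B where B: "B \<ge> 0" "\<forall>c. \<forall>K\<in>M. \<forall>x\<in>K. \<bar>bf c K x\<bar> \<le> B * nrm1 c" using bf_bounded by blast
  define \<Phi> where "\<Phi> = B * nrm1 c\<phi>"
  define m where "m = (\<Sum>K\<in>M. exp (- \<Phi>) * ip lebesgue K (\<lambda>_. 1) (\<lambda>_. 1))"
  have "m > 0" unfolding m_def using cells_nonempty cell_ip_one_pos D(1) by (intro sum_pos) auto
  moreover have "gain d \<ge> m * (s * exp s)" if s: "s \<ge> 0" and w: "\<forall>K\<in>M. \<forall>x\<in>K. bf d K x \<ge> s" for d s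
    unfolding gain_def m_def sum_distrib_right
  proof (rule sum_mono)
    fix K assume K: "K \<in> M"
    have "exp (- \<Phi>) * ip lebesgue K (\<lambda>_. 1) (\<lambda>_. 1) * (s * exp s) = (LINT x:K|lebesgue. (exp (s - \<Phi>) * s) * (1 * 1))"
      unfolding ip_def set_integral_mult_right by (simp add: exp_diff exp_minus field_simps)
    also have "\<dots> \<le> (LINT x:K|lebesgue. exp (bf d K x - bf c\<phi> K x) * bf d K x)"
    proof (rule set_integral_mono)
      show "set_integrable lebesgue K (\<lambda>x. (exp (s - \<Phi>) * s) * (1 * 1))"
        by (intro cont_set_integrable[OF cell_ci[OF K]] continuous_on_const)
      fix x assume x: "x \<in> K"
      have "\<bar>bf c\<phi> K x\<bar> \<le> \<Phi>" using B(2) K x by (simp add: \<Phi>_def)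
      moreover have "s \<le> bf d K x" using w K x by simp
      ultimately show "(exp (s - \<Phi>) * s) * (1 * 1) \<le> exp (bf d K x - bf c\<phi> K x) * bf d K x"
        using s by (simp add: mult_mono)
    qed (rule gain_int[OF K])
    finally show "exp (- \<Phi>) * ip lebesgue K (\<lambda>_. 1) (\<lambda>_. 1) * (s * exp s) \<le> (LINT x:K|lebesgue. exp (bf d K x - bf c\<phi> K x) * bf d K x)" .
  qed
  ultimately show ?thesis by blast
qed

lemma load_upper: "\<exists>C\<ge>0. \<forall>d. load d \<le> C * nrm1 d"
proof -
  define a where "a K i = (LINT x:K|lebesgue. u K x * fst (bas i) K x)" for K i
  define C where "C = (\<Sum>K\<in>M. \<Sum>i\<in>I. \<bar>a K i\<bar>)"
  have "load d \<le> C * nrm1 d" for d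
    unfolding load_def C_def sum_distrib_right
  proof (rule sum_mono)
    fix K assume K: "K \<in> M"
    have "(LINT x:K|lebesgue. u K x * bf d K x) = (LINT x:K|lebesgue. \<Sum>i\<in>I. d i * (u K x * fst (bas i) K x))"
      by (simp add: bf_def[of d] sum_distrib_left mult_ac)
    also have "\<dots> = (\<Sum>i\<in>I. LINT x:K|lebesgue. d i * (u K x * fst (bas i) K x))"
      unfolding set_lebesgue_integral_def scaleR_sum_right
      by (intro Bochner_Integration.integral_sum set_integrable_mult_right[unfolded set_integrable_def]
          u_mult_int[OF K, unfolded set_integrable_def] bas_cont K)
    also have "\<dots> = (\<Sum>i\<in>I. d i * a K i)" by (simp add: a_def)
    also have "\<dots> \<le> (\<Sum>i\<in>I. \<bar>a K i\<bar> * nrm1 d)"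
    proof (rule sum_mono)
      fix i assume i: "i \<in> I"
      have "d i * a K i \<le> \<bar>a K i\<bar> * \<bar>d i\<bar>" by (metis abs_ge_self abs_mult mult.commute)
      also have "\<dots> \<le> \<bar>a K i\<bar> * nrm1 d" using fin i by (intro mult_left_mono member_le_sum) auto
      finally show "d i * a K i \<le> \<bar>a K i\<bar> * nrm1 d" .
    qed
    finally show "(LINT x:K|lebesgue. u K x * bf d K x) \<le> (\<Sum>i\<in>I. \<bar>a K i\<bar> * nrm1 d)" .
  qed
  moreover have "C \<ge> 0" by (simp add: C_def sum_nonneg)
  ultimately show ?thesis by blast
qed

lemma load_negative:
  assumes w: "\<forall>K\<in>M. \<forall>x\<in>K. bf d K x \<le> - s"
  shows "load d \<le> - s * (\<Sum>K\<in>M. LINT x:K|lebesgue. u K x)"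
  unfolding load_def sum_distrib_left
proof (rule sum_mono)
  fix K assume K: "K \<in> M"
  have "(LINT x:K|lebesgue. u K x * bf d K x) \<le> (LINT x:K|lebesgue. - s * u K x)"
    unfolding set_lebesgue_integral_def
  proof (rule integral_mono_AE)
    show "integrable lebesgue (\<lambda>x. indicator K x *\<^sub>R (u K x * bf d K x))"
      using u_mult_int[OF K bf_cont[OF K]] by (simp only: set_integrable_def)
    show "integrable lebesgue (\<lambda>x. indicator K x *\<^sub>R (- s * u K x))"
      using set_integrable_mult_right[of "- s", OF u_int[OF K]] by (simp only: set_integrable_def)
    show "AE x in lebesgue. indicator K x *\<^sub>R (u K x * bf d K x) \<le> indicator K x *\<^sub>R (- s * u K x)"
      using u_nonneg[OF K]
    proof eventually_elim
      case (elim x)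
      show ?case
      proof (cases "x \<in> K")
        case True
        then have "u K x * bf d K x \<le> u K x * (- s)" using elim w K by (intro mult_left_mono) auto
        then show ?thesis using True by (simp add: mult.commute)
      qed simp
    qed
  qed
  then show "(LINT x:K|lebesgue. u K x * bf d K x) \<le> - s * (LINT x:K|lebesgue. u K x)" by (simp only: set_integral_mult_right)
qed

lemma Q_quadratic:
  "Q d = (\<Sum>K\<in>M. diameter K ^ (k + 2) * (\<Sum>i\<in>I. d i * (\<Sum>j\<in>I. d j * wform K (\<lambda>_. 1) (\<lambda>_ _. 1) (bas i) (bas j))))"
  unfolding Q_def
proof (intro sum.cong[OF refl] arg_cong2[where f="(*)"] refl)
  fix K assume K: "K \<in> M"
  have "wform K (\<lambda>_. 1) (\<lambda>_ _. 1) (bas i) (hyb d) = (\<Sum>j\<in>I. d j * wform K (\<lambda>_. 1) (\<lambda>_ _. 1) (bas i) (bas j))" if i: "i \<in> I" for i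
    by (rule wform_hcomb_right[OF bas bas[OF i] K]) simp_all
  moreover have "wform K (\<lambda>_. 1) (\<lambda>_ _. 1) (hyb d) (hyb d) = (\<Sum>i\<in>I. d i * wform K (\<lambda>_. 1) (\<lambda>_ _. 1) (bas i) (hyb d))"
    by (rule wform_hcomb_left[OF bas hyb_adm K]) simp_all
  ultimately show "wform K (\<lambda>_. 1) (\<lambda>_ _. 1) (hyb d) (hyb d) = (\<Sum>i\<in>I. d i * (\<Sum>j\<in>I. d j * wform K (\<lambda>_. 1) (\<lambda>_ _. 1) (bas i) (bas j)))"
    by simp
qed

lemma Q_scale:
  assumes "\<And>i. i \<in> I \<Longrightarrow> d i = t * z i"
  shows "Q d = t\<^sup>2 * Q z"
  unfolding Q_quadratic by (simp add: assms sum_distrib_left power2_eq_square mult_ac)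

lemma Q_tendsto:
  assumes "\<And>i. i \<in> I \<Longrightarrow> (\<lambda>n. Z n i) \<longlonglongrightarrow> z i"
  shows "(\<lambda>n. Q (Z n)) \<longlonglongrightarrow> Q z"
  unfolding Q_quadratic by (intro tendsto_sum tendsto_mult tendsto_const assms)

text \<open>All terms of \<open>Q\<close> are nonnegative with positive mesh factors, so every cell
  form vanishes and \<open>wform_kernel\<close> applies. The constant is nonzero because the basis
  is independent modulo \<open>eqv\<close>.\<close>

lemma Q_zeroD:
  assumes z: "Q z = 0" and i: "i \<in> I" "z i \<noteq> 0"
  shows "\<exists>a. a \<noteq> 0 \<and> (\<forall>K\<in>M. \<forall>x. bf z K x = a)"
proof -
  have "wform K (\<lambda>_. 1) (\<lambda>_ _. 1) (hyb z) (hyb z) = 0" if K: "K \<in> M" for K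
  proof -
    have "diameter K ^ (k + 2) * wform K (\<lambda>_. 1) (\<lambda>_ _. 1) (hyb z) (hyb z) = 0"
      using z K D(1) Q_term_nonneg sum_nonneg_eq_0_iff[of M "\<lambda>K. diameter K ^ (k + 2) * wform K (\<lambda>_. 1) (\<lambda>_ _. 1) (hyb z) (hyb z)"]
      by (simp add: Q_def)
    then show ?thesis using cell_diameter_pos[OF K] by simp
  qed
  from wform_kernel[OF hyb_adm this] obtain a where a: "eqv (hyb z) (\<lambda>_ _. a, \<lambda>_ _. a)" ..
  have "a \<noteq> 0" using indep[of z i] a i by auto
  moreover have "bf z K x = a" if K: "K \<in> M" for K x
  proof -
    have "fst (hyb z) K = (\<lambda>_. a)" using a K by (simp add: eqv_def)
    then show ?thesis by (simp add: bf_fst[symmetric])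
  qed
  ultimately show ?thesis by blast
qed

lemma a_priori_bound:
  "\<exists>R>0. \<forall>c. (\<Sum>j\<in>I. (c j + c\<phi> j) * P c j) \<le> 0 \<longrightarrow> (\<forall>i\<in>I. \<bar>c i\<bar> \<le> R)"
proof (rule ccontr)
  assume neg: "\<not> ?thesis"
  \<comment> \<open>The summand 1 makes \<open>real n + 1\<close> positive, as required of
    \<open>R\<close> in the negated claim.\<close>
  have "\<exists>c. (\<Sum>j\<in>I. (c j + c\<phi> j) * P c j) \<le> 0 \<and> (\<exists>i\<in>I. \<bar>c i\<bar> > real n + 1)" for n
  proof (rule ccontr)
    assume "\<nexists>c. (\<Sum>j\<in>I. (c j + c\<phi> j) * P c j) \<le> 0 \<and> (\<exists>i\<in>I. \<bar>c i\<bar> > real n + 1)"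
    then have "\<forall>c. (\<Sum>j\<in>I. (c j + c\<phi> j) * P c j) \<le> 0 \<longrightarrow> (\<forall>i\<in>I. \<bar>c i\<bar> \<le> real n + 1)" by force
    moreover have "real n + 1 > 0" by simp
    ultimately show False using neg by blast
  qed
  then have "\<forall>n. \<exists>c. (\<Sum>j\<in>I. (c j + c\<phi> j) * P c j) \<le> 0 \<and> (\<exists>i\<in>I. \<bar>c i\<bar> > real n + 1)" ..
  from choice[OF this] obtain c where c: "\<forall>n. (\<Sum>j\<in>I. (c n j + c\<phi> j) * P (c n) j) \<le> 0 \<and> (\<exists>i\<in>I. \<bar>c n i\<bar> > real n + 1)" ..
  define d where "d n = (\<lambda>i. c n i + c\<phi> i)" for n
  define t where "t n = nrm1 (d n)" for n
  \<comment> \<open>If \<open>t n = 0\<close> the quotient is zero by convention; \<open>dz\<close>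
    below still holds, because \<open>d n\<close> then vanishes on \<open>I\<close>.\<close>
  define z where "z n i = d n i / t n" for n i
  have t_lower: "t n \<ge> real n - nrm1 c\<phi>" for n
  proof -
    obtain i where i: "i \<in> I" "\<bar>c n i\<bar> > real n + 1" using c by blast
    have "\<bar>d n i\<bar> \<le> t n" "\<bar>c\<phi> i\<bar> \<le> nrm1 c\<phi>" unfolding t_def using i(1) fin by (intro member_le_sum; simp)+
    moreover have "\<bar>c n i\<bar> \<le> \<bar>d n i\<bar> + \<bar>c\<phi> i\<bar>" by (simp add: d_def)
    ultimately show ?thesis using i(2) by linarith
  qed
  have t_nonneg: "t n \<ge> 0" for n by (simp add: t_def sum_nonneg)
  have d_le: "\<bar>d n i\<bar> \<le> t n" if "i \<in> I" for n i unfolding t_def using that fin by (intro member_le_sum) auto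
  have z_le: "\<bar>z n i\<bar> \<le> 1" if "i \<in> I" for n i
    using d_le[OF that, of n] t_nonneg[of n] by (cases "t n = 0") (auto simp: z_def divide_le_eq)
  have dz: "d n i = t n * z n i" if "i \<in> I" for n i
    using d_le[OF that, of n] by (cases "t n = 0") (auto simp: z_def)
  obtain r zl where r: "strict_mono (r :: nat \<Rightarrow> nat)" and zl: "\<forall>i\<in>I. (\<lambda>n. z (r n) i) \<longlonglongrightarrow> zl i"
    using finite_convergent_subseq[of I z 1, OF fin z_le] by blast
  define T where "T n = t (r n)" for n
  have T_inf: "filterlim T at_top sequentially"
  proof (rule filterlim_at_top_mono)
    have "filterlim (\<lambda>n. real n - b) at_top sequentially" for b :: real by real_asymp
    then show "filterlim (\<lambda>n. real n - nrm1 c\<phi>) at_top sequentially" .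
    have "real n - nrm1 c\<phi> \<le> T n" for n using t_lower[of "r n"] seq_suble[OF r, of n] unfolding T_def by linarith
    then show "eventually (\<lambda>n. real n - nrm1 c\<phi> \<le> T n) sequentially" by simp
  qed
  have T_pos: "eventually (\<lambda>n. T n > 0) sequentially" using T_inf by (rule filterlim_at_top_dense[THEN iffD1, rule_format])
  have E: "(gain (d n) - load (d n)) / \<Delta>t + \<epsilon> * Q (d n) \<le> 0" for n
    using energy_lower[of "c n"] c unfolding d_def by (meson order_trans)
  have E': "gain (d n) \<le> load (d n)" for n
  proof -
    have "\<epsilon> * Q (d n) \<ge> 0" using eps Q_nonneg by simp
    with E[of n] have "(gain (d n) - load (d n)) / \<Delta>t \<le> 0" by linarith
    then show ?thesis using dt by (simp add: divide_le_0_iff)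
  qed
  obtain C1 where C1: "\<forall>d. - C1 \<le> gain d" using gain_lower ..
  obtain C2 where C2: "C2 \<ge> 0" "\<forall>d. load d \<le> C2 * nrm1 d" using load_upper by blast
  have "Q zl = 0"
  proof -
    have Qz: "(\<lambda>n. Q (z (r n))) \<longlonglongrightarrow> Q zl" using zl by (intro Q_tendsto) auto
    \<comment> \<open>The energy inequality is divided by the square of \<open>T n\<close>: the gain
      is bounded below, the load grows at most linearly, and \<open>Q\<close> is homogeneous of
      degree 2.\<close>
    have "eventually (\<lambda>n. Q (z (r n)) \<le> (C1 + C2 * T n) / (\<Delta>t * \<epsilon> * (T n)\<^sup>2)) sequentially"
      using T_pos
    proof eventually_elim
      case (elim n)
      have "Q (d (r n)) = (T n)\<^sup>2 * Q (z (r n))" unfolding T_def by (rule Q_scale) (rule dz)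
      moreover have "gain (d (r n)) \<ge> - C1" using C1 by blast
      moreover have "load (d (r n)) \<le> C2 * T n" using C2 unfolding T_def t_def by blast
      ultimately have "- (C1 + C2 * T n) / \<Delta>t + \<epsilon> * ((T n)\<^sup>2 * Q (z (r n))) \<le> 0"
        using E[of "r n"] dt divide_right_mono[of "- (C1 + C2 * T n)" "gain (d (r n)) - load (d (r n))" \<Delta>t] by simp
      then show ?case using dt eps elim by (simp add: field_simps)
    qed
    moreover have "(\<lambda>n. (C1 + C2 * T n) / (\<Delta>t * \<epsilon> * (T n)\<^sup>2)) \<longlonglongrightarrow> 0"
    proof -
      have inv: "((\<lambda>T::real. inverse (T\<^sup>2)) \<longlongrightarrow> 0) at_top" "((\<lambda>T::real. inverse T) \<longlongrightarrow> 0) at_top" by real_asymp+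
      have "((\<lambda>T. C1 / (\<Delta>t * \<epsilon>) * inverse (T\<^sup>2) + C2 / (\<Delta>t * \<epsilon>) * inverse T) \<longlongrightarrow> C1 / (\<Delta>t * \<epsilon>) * 0 + C2 / (\<Delta>t * \<epsilon>) * 0) at_top"
        by (intro tendsto_add tendsto_mult tendsto_const inv)
      moreover have "C1 / (\<Delta>t * \<epsilon>) * inverse (T\<^sup>2) + C2 / (\<Delta>t * \<epsilon>) * inverse T = (C1 + C2 * T) / (\<Delta>t * \<epsilon> * T\<^sup>2)" for T
        using dt eps by (cases "T = 0") (simp_all add: field_simps power2_eq_square)
      ultimately have "((\<lambda>T. (C1 + C2 * T) / (\<Delta>t * \<epsilon> * T\<^sup>2)) \<longlongrightarrow> 0) at_top" by simp
      then show ?thesis using T_inf by (rule filterlim_compose)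
    qed
    ultimately have "(\<lambda>n. Q (z (r n))) \<longlonglongrightarrow> 0"
      by (rule tendsto_sandwich[OF always_eventually[OF allI[OF Q_nonneg]] _ tendsto_const])
    then show ?thesis using Qz LIMSEQ_unique by blast
  qed
  moreover have "\<exists>i\<in>I. zl i \<noteq> 0"
  proof (rule ccontr)
    assume "\<not> (\<exists>i\<in>I. zl i \<noteq> 0)"
    then have "(\<lambda>n. \<Sum>i\<in>I. \<bar>z (r n) i\<bar>) \<longlonglongrightarrow> (\<Sum>i\<in>I. 0)"
      using zl by (intro tendsto_sum tendsto_rabs_zero) auto
    moreover have "eventually (\<lambda>n. (\<Sum>i\<in>I. \<bar>z (r n) i\<bar>) = 1) sequentially"
      using T_pos
    proof eventually_elim
      case (elim n)
      have "(\<Sum>i\<in>I. \<bar>z (r n) i\<bar>) = t (r n) / t (r n)"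
        unfolding z_def abs_divide sum_divide_distrib[symmetric] using t_nonneg by (simp add: t_def[symmetric])
      then show ?case using elim by (simp add: T_def)
    qed
    ultimately have "(\<lambda>n. 1 :: real) \<longlonglongrightarrow> (\<Sum>i\<in>I. 0)" by (rule Lim_transform_eventually)
    from LIMSEQ_unique[OF this tendsto_const] show False by simp
  qed
  ultimately obtain a where a: "a \<noteq> 0" "\<forall>K\<in>M. \<forall>x. bf zl K x = a" using Q_zeroD by blast
  obtain B where B: "B \<ge> 0" "\<forall>c. \<forall>K\<in>M. \<forall>x\<in>K. \<bar>bf c K x\<bar> \<le> B * nrm1 c" using bf_bounded by blast
  have "(\<lambda>n. B * nrm1 (\<lambda>i. z (r n) i - zl i)) \<longlonglongrightarrow> B * (\<Sum>i\<in>I. 0)"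
    using zl by (intro tendsto_mult tendsto_const tendsto_sum tendsto_rabs_zero LIM_zero) auto
  \<comment> \<open>Half of \<open>\<bar>a\<bar>\<close> is the margin that keeps the cell functions
    within half of \<open>T n * a\<close>: they retain the sign of \<open>a\<close> and grow at
    least like \<open>T n * \<bar>a\<bar> / 2\<close>.\<close>
  then have near: "eventually (\<lambda>n. B * nrm1 (\<lambda>i. z (r n) i - zl i) < \<bar>a\<bar> / 2) sequentially"
    using a(1) by (intro order_tendstoD(2)) auto
  have close: "\<bar>bf (d (r n)) K x - T n * a\<bar> \<le> T n * (\<bar>a\<bar> / 2)"
    if n: "B * nrm1 (\<lambda>i. z (r n) i - zl i) < \<bar>a\<bar> / 2" and K: "K \<in> M" "x \<in> K" for n K x
  proof -
    have "bf (d (r n)) K x - T n * a = T n * bf (\<lambda>i. z (r n) i - zl i) K x"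
      unfolding a(2)[rule_format, OF K(1), of x, symmetric] bf_def T_def
      by (simp add: dz sum_distrib_left left_diff_distrib right_diff_distrib sum_subtractf mult.assoc)
    moreover have "\<bar>bf (\<lambda>i. z (r n) i - zl i) K x\<bar> \<le> \<bar>a\<bar> / 2" using B(2) K n by (meson less_imp_le order_trans)
    ultimately show ?thesis using t_nonneg[of "r n"] mult_left_mono by (simp only: abs_mult T_def abs_of_nonneg)
  qed
  show False
  proof (cases "a > 0")
    case True
    obtain m where m: "m > 0" "\<forall>d s. s \<ge> 0 \<longrightarrow> (\<forall>K\<in>M. \<forall>x\<in>K. bf d K x \<ge> s) \<longrightarrow> gain d \<ge> m * (s * exp s)"
      using gain_exponential by blast
    have "eventually (\<lambda>n. m * (a / 2 * T n * exp (a / 2 * T n)) \<le> C2 * T n) sequentially"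
      using near T_pos
    proof eventually_elim
      case (elim n)
      have "bf (d (r n)) K x \<ge> a / 2 * T n" if K: "K \<in> M" "x \<in> K" for K x
        using close[OF elim(1) K] True unfolding abs_le_iff by (simp add: algebra_simps)
      moreover have "a / 2 * T n \<ge> 0" using True elim(2) by simp
      ultimately have "gain (d (r n)) \<ge> m * (a / 2 * T n * exp (a / 2 * T n))" using m(2) by blast
      moreover have "load (d (r n)) \<le> C2 * T n" using C2 unfolding T_def t_def by blast
      ultimately show ?case using E'[of "r n"] by linarith
    qed
    moreover have "eventually (\<lambda>n. m * (a / 2 * T n * exp (a / 2 * T n)) > C2 * T n) sequentially"
    proof -
      have "eventually (\<lambda>T::real. m * (a / 2 * T * exp (a / 2 * T)) > C2 * T) at_top"
        using m(1) True by real_asymp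
      then show ?thesis using T_inf by (rule eventually_compose_filterlim)
    qed
    ultimately have "eventually (\<lambda>n::nat. False) sequentially" by eventually_elim simp
    then show False by simp
  next
    case False
    define U where "U = (\<Sum>K\<in>M. LINT x:K|lebesgue. u K x)"
    have U: "U > 0" unfolding U_def by (rule u_pos)
    have "eventually (\<lambda>n. (- a / 2 * U) * T n \<le> C1) sequentially"
      using near T_pos
    proof eventually_elim
      case (elim n)
      have "bf (d (r n)) K x \<le> - (- a / 2 * T n)" if K: "K \<in> M" "x \<in> K" for K x
        using close[OF elim(1) K] False unfolding abs_le_iff by (simp add: algebra_simps)
      then have "load (d (r n)) \<le> - (- a / 2 * T n) * U" unfolding U_def by (intro load_negative) blast
      moreover have "gain (d (r n)) \<ge> - C1" using C1 by blast
      ultimately show ?case using E'[of "r n"] by (simp add: algebra_simps)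
    qed
    moreover have "eventually (\<lambda>n. (- a / 2 * U) * T n > C1) sequentially"
    proof -
      have "- a / 2 * U > 0" using a(1) False U by (intro mult_pos_pos) auto
      then have "eventually (\<lambda>T::real. (- a / 2 * U) * T > C1) at_top" by real_asymp
      then show ?thesis using T_inf by (rule eventually_compose_filterlim)
    qed
    ultimately have "eventually (\<lambda>n::nat. False) sequentially" by eventually_elim simp
    then show False by simp
  qed
qed

text \<open>Comparing with the point \<open>- c\<phi>\<close>, where unknown plus potential
  vanishes, makes the energy of the solution nonpositive. The a priori bound then places it strictly
  inside the cube, where the inequality holds in both directions.\<close>

lemma P_zero_exists: "\<exists>c. \<forall>j\<in>I. P c j = 0"
proof -
  obtain R0 where R0: "R0 > 0" "\<forall>c. (\<Sum>j\<in>I. (c j + c\<phi> j) * P c j) \<le> 0 \<longrightarrow> (\<forall>i\<in>I. \<bar>c i\<bar> \<le> R0)"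
    using a_priori_bound by blast
  \<comment> \<open>Room for the comparison point \<open>- c\<phi>\<close> and for a unit step in
    either direction from any point that obeys the a priori bound.\<close>
  define R where "R = R0 + 1 + nrm1 c\<phi>"
  have n0: "nrm1 c\<phi> \<ge> 0" by (simp add: sum_nonneg)
  have R: "R > 0" using R0(1) n0 unfolding R_def by linarith
  obtain c where c: "\<forall>i\<in>I. \<bar>c i\<bar> \<le> R" "\<forall>i\<in>I. \<forall>y. \<bar>y\<bar> \<le> R \<longrightarrow> P c i * (y - c i) \<ge> 0"
    using cube_variational_inequality[of I R P, OF fin R P_seq_cont] by blast
  have "(c i + c\<phi> i) * P c i \<le> 0" if i: "i \<in> I" for i
  proof -
    have "\<bar>c\<phi> i\<bar> \<le> nrm1 c\<phi>" using i fin by (intro member_le_sum) auto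
    then have "\<bar>- c\<phi> i\<bar> \<le> R" using R0(1) by (simp add: R_def)
    then have "P c i * (- c\<phi> i - c i) \<ge> 0" using c(2) i by blast
    then show ?thesis by (simp add: algebra_simps)
  qed
  then have "(\<Sum>j\<in>I. (c j + c\<phi> j) * P c j) \<le> 0" by (rule sum_nonpos)
  then have bd: "\<forall>i\<in>I. \<bar>c i\<bar> \<le> R0" using R0(2) by blast
  have "P c i = 0" if i: "i \<in> I" for i
  proof -
    have "\<bar>c i\<bar> \<le> R0" using bd i by blast
    then have "\<bar>c i + 1\<bar> \<le> R" "\<bar>c i - 1\<bar> \<le> R" using n0 unfolding R_def by linarith+
    then have "P c i * (c i + 1 - c i) \<ge> 0" "P c i * (c i - 1 - c i) \<ge> 0" using c(2) i by blast+
    then show ?thesis by simp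
  qed
  then show ?thesis by blast
qed

lemma step_solution:
  assumes pot: "adm pot" "eqv pot (hyb c\<phi>)" and span: "\<And>v. adm v \<Longrightarrow> \<exists>e. eqv v (hyb e)"
  shows "\<exists>c. \<forall>v. adm v \<longrightarrow>
    (\<Sum>K\<in>M. LINT x:K|lebesgue. (exp (fst (hyb c) K x) - u K x) / \<Delta>t * fst v K x) +
      T_D k \<epsilon> \<Lambda> M EK (hyb c) (hybrid_add (hyb c) pot) v = 0"
proof -
  obtain c where c: "\<forall>j\<in>I. P c j = 0" using P_zero_exists ..
  have "(\<Sum>K\<in>M. LINT x:K|lebesgue. (exp (fst (hyb c) K x) - u K x) / \<Delta>t * fst v K x) +
      T_D k \<epsilon> \<Lambda> M EK (hyb c) (hybrid_add (hyb c) pot) v = 0" if v: "adm v" for v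
  proof -
    obtain e where e: "eqv v (hyb e)" using span[OF v] ..
    have "(\<Sum>K\<in>M. LINT x:K|lebesgue. (exp (fst (hyb c) K x) - u K x) / \<Delta>t * fst v K x) = (\<Sum>K\<in>M. mass c K (bf e K) / \<Delta>t)"
    proof (rule sum.cong[OF refl])
      fix K assume K: "K \<in> M"
      have "fst v K = bf e K" using e K by (auto simp: eqv_def bf_fst fun_eq_iff)
      then show "(LINT x:K|lebesgue. (exp (fst (hyb c) K x) - u K x) / \<Delta>t * fst v K x) = mass c K (bf e K) / \<Delta>t"
        unfolding bf_fst by (simp only: mass_difference_quotient[OF K bf_cont[OF K]])
    qed
    moreover have "T_D k \<epsilon> \<Lambda> M EK (hyb c) (hybrid_add (hyb c) pot) v = step_form \<epsilon> I bas c (hyb (\<lambda>i. c i + c\<phi> i)) (hyb e)"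
    proof -
      have a: "adm (hybrid_add (hyb c) pot)" using hyb_adm[of c] pot(1) by (auto simp: adm_def hybrid_add_def intro!: poly_fun_add)
      have q: "eqv (hybrid_add (hyb c) pot) (hyb (\<lambda>i. c i + c\<phi> i))"
        using pot(2) unfolding eqv_def hybrid_add_def hcomb_def
        by (simp add: distrib_right sum.distrib)
      have "T_D k \<epsilon> \<Lambda> M EK (hyb c) (hybrid_add (hyb c) pot) v = step_form \<epsilon> I bas c (hybrid_add (hyb c) pot) v"
        by (rule T_D_step_form[OF bas a v])
      also have "\<dots> = step_form \<epsilon> I bas c (hyb (\<lambda>i. c i + c\<phi> i)) (hyb e)"
        by (rule step_form_eqv[OF a hyb_adm v hyb_adm q e])
      finally show ?thesis .
    qed
    moreover have "(\<Sum>j\<in>I. e j * P c j) = 0" using c by simp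
    ultimately show ?thesis using sum_P[of e c] by (simp add: sum_divide_distrib)
  qed
  then show ?thesis by blast
qed

end

section \<open>Existence of a discrete solution\<close>

context hho
begin

lemma scheme_step:
  fixes \<epsilon> \<Delta>t :: real and u :: "(real^'n) set \<Rightarrow> real^'n \<Rightarrow> real"
  assumes pot: "adm pot" and eps: "\<epsilon> > 0" and dt: "\<Delta>t > 0"
    and u: "\<And>K. K \<in> M \<Longrightarrow> set_integrable lebesgue K (u K)"
      "\<And>K. K \<in> M \<Longrightarrow> AE x in lebesgue. x \<in> K \<longrightarrow> 0 \<le> u K x"
      "(\<Sum>K\<in>M. LINT x:K|lebesgue. u K x) > 0"
  shows "\<exists>l\<in>hybrid_space k M E. \<forall>v\<in>hybrid_space k M E.
    (\<Sum>K\<in>M. LINT x:K|lebesgue. (exp (fst l K x) - u K x) / \<Delta>t * fst v K x) +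
      T_D k \<epsilon> \<Lambda> M EK l (hybrid_add l pot) v = 0"
proof -
  obtain I :: "(((real^'n) set \<times> (real^'n \<Rightarrow> real)) + ((real^'n) set \<times> (real^'n \<Rightarrow> real))) set" and bas
    where B: "finite I \<and> (\<forall>i\<in>I. bas i \<in> hybrid_space k M E) \<and> (\<forall>v. adm v \<longrightarrow> (\<exists>c. eqv v (hcomb I c bas))) \<and>
     (\<forall>c. eqv (hcomb I c bas) (\<lambda>_ _. 0, \<lambda>_ _. 0) \<longrightarrow> (\<forall>i\<in>I. c i = 0))" using hybrid_basis by blast
  obtain c\<phi> where c\<phi>: "eqv pot (hcomb I c\<phi> bas)" using B pot by blast
  interpret step: hho_step \<Omega> \<Lambda> M E EK k I bas \<epsilon> \<Delta>t u c\<phi>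
  proof unfold_locales
    show "finite I" using B by simp
    show "adm (bas i)" if "i \<in> I" for i using B that hybrid_space_adm by blast
    show "c i = 0" if "eqv (hcomb I c bas) (\<lambda>_ _. 0, \<lambda>_ _. 0)" "i \<in> I" for c i using B that by blast
  qed (use eps dt u in auto)
  obtain c where c: "\<forall>v. adm v \<longrightarrow>
    (\<Sum>K\<in>M. LINT x:K|lebesgue. (exp (fst (hcomb I c bas) K x) - u K x) / \<Delta>t * fst v K x) +
      T_D k \<epsilon> \<Lambda> M EK (hcomb I c bas) (hybrid_add (hcomb I c bas) pot) v = 0"
    using step.step_solution[OF pot c\<phi>] B by blast
  have "hcomb I c bas \<in> hybrid_space k M E"
    using B by (auto simp: hybrid_space_def hcomb_def intro!: poly_fun_sum poly_fun_cmul)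
  then show ?thesis using c hybrid_space_adm by blast
qed

text \<open>The cells are disjoint and cover the domain up to a null set, so the cell integrals add
  up to the total mass.\<close>

lemma mesh_integral_pos:
  assumes i: "set_integrable lebesgue \<Omega> u0" and pos: "(LINT x:\<Omega>|lebesgue. u0 x) > (0::real)"
  shows "(\<Sum>K\<in>M. LINT x:K|lebesgue. u0 x) > 0"
proof -
  have iK: "set_integrable lebesgue K u0" if K: "K \<in> M" for K
    using i by (rule set_integrable_subset) (use D(6,7)[OF K] in auto)
  have "(\<Sum>K\<in>M. LINT x:K|lebesgue. u0 x) = (LINT x|lebesgue. (\<Sum>K\<in>M. indicator K x *\<^sub>R u0 x))"
    unfolding set_lebesgue_integral_def using iK
    by (intro Bochner_Integration.integral_sum[symmetric]) (simp only: set_integrable_def)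
  also have "\<dots> = (LINT x:\<Omega>|lebesgue. u0 x)" unfolding set_lebesgue_integral_def
  proof (rule integral_cong_AE)
    show "(\<lambda>x. \<Sum>K\<in>M. indicator K x *\<^sub>R u0 x) \<in> borel_measurable lebesgue"
      using iK by (intro borel_measurable_sum) (auto simp: set_integrable_def)
    show "(\<lambda>x. indicator \<Omega> x *\<^sub>R u0 x) \<in> borel_measurable lebesgue" using i by (auto simp: set_integrable_def)
    show "AE x in lebesgue. (\<Sum>K\<in>M. indicator K x *\<^sub>R u0 x) = indicator \<Omega> x *\<^sub>R u0 x"
      using AE_mesh_covers[OF mesh]
    proof eventually_elim
      case (elim x)
      have "(\<Sum>K\<in>M. indicator K x :: real) = indicator (\<Union>M) x"
        using D(1,2) by (intro indicator_UN_disjoint[symmetric, of M id, simplified])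
           (auto simp: pairwise_def disjoint_family_on_def disjnt_def)
      moreover have "indicator (\<Union>M) x = (indicator \<Omega> x :: real)"
        using elim D(7) by (auto simp: indicator_def)
      ultimately show ?case by (simp add: sum_distrib_right[symmetric])
    qed
  qed
  finally show ?thesis using pos by simp
qed

text \<open>The invariant \<open>good\<close> holds for the initial datum and for the exponential of
  any member of \<open>hybrid_space\<close>, so every step can be followed by another one. The
  sequence is then built by choosing a solution at each step.\<close>

lemma scheme_sequence:
  assumes pot: "adm (hybrid_potential k \<Omega> \<phi>)" and eps: "\<epsilon> > 0" and dt: "\<Delta>t > 0"
    and u0: "set_integrable lebesgue \<Omega> u0" "AE x in lebesgue. x \<in> \<Omega> \<longrightarrow> 0 \<le> u0 x" "(LINT x:\<Omega>|lebesgue. u0 x) > 0"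
  shows "\<exists>l. solves_scheme k \<epsilon> \<Delta>t \<Omega> \<Lambda> \<phi> u0 M E EK l"
proof -
  define good :: "((real^'n) set \<Rightarrow> real^'n \<Rightarrow> real) \<Rightarrow> bool" where
    "good u \<longleftrightarrow> (\<forall>K\<in>M. set_integrable lebesgue K (u K)) \<and> (\<forall>K\<in>M. AE x in lebesgue. x \<in> K \<longrightarrow> 0 \<le> u K x) \<and>
      (\<Sum>K\<in>M. LINT x:K|lebesgue. u K x) > 0" for u
  define sol where "sol u l \<longleftrightarrow> l \<in> hybrid_space k M E \<and> (\<forall>v\<in>hybrid_space k M E.
    (\<Sum>K\<in>M. LINT x:K|lebesgue. (exp (fst l K x) - u K x) / \<Delta>t * fst v K x) +
      T_D k \<epsilon> \<Lambda> M EK l (hybrid_add l (hybrid_potential k \<Omega> \<phi>)) v = 0)" for u l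
  have ex: "\<exists>l. sol u l" if "good u" for u
    using scheme_step[OF pot eps dt, of u] that unfolding good_def sol_def by blast
  have good0: "good (\<lambda>_. u0)"
    unfolding good_def
  proof (intro conjI ballI mesh_integral_pos[OF u0(1,3)])
    fix K assume K: "K \<in> M"
    show "set_integrable lebesgue K u0" using u0(1) by (rule set_integrable_subset) (use D(6,7)[OF K] in auto)
    show "AE x in lebesgue. x \<in> K \<longrightarrow> 0 \<le> u0 x" using u0(2) by eventually_elim (use D(7)[OF K] in auto)
  qed
  have ne: "M \<noteq> {}" using good0 by (auto simp: good_def)
  have good_exp: "good (\<lambda>K x. exp (fst l K x))" if l: "l \<in> hybrid_space k M E" for l
    unfolding good_def
  proof (intro conjI ballI)
    have ci: "continuous_on UNIV (\<lambda>x. exp (fst l K x))" "continuous_on UNIV (\<lambda>x. exp (fst l K x / 2))" if "K \<in> M" for K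
      using adm_cont(1)[OF hybrid_space_adm[OF l] that] by (auto intro!: continuous_intros)
    show "set_integrable lebesgue K (\<lambda>x. exp (fst l K x))" if "K \<in> M" for K
      by (rule cont_set_integrable[OF cell_ci[OF that] ci(1)[OF that]])
    show "AE x in lebesgue. x \<in> K \<longrightarrow> 0 \<le> exp (fst l K x)" for K by simp
    have "(LINT x:K|lebesgue. exp (fst l K x)) > 0" if K: "K \<in> M" for K
    proof -
      \<comment> \<open>Writing the exponential as the square of \<open>exp (fst l K x / 2)\<close>
        turns strict positivity into definiteness of \<open>ip\<close>.\<close>
      have eq: "(LINT x:K|lebesgue. exp (fst l K x)) = ip lebesgue K (\<lambda>x. exp (fst l K x / 2)) (\<lambda>x. exp (fst l K x / 2))"
        by (simp add: ip_def exp_add[symmetric])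
      have "ip lebesgue K (\<lambda>x. exp (fst l K x / 2)) (\<lambda>x. exp (fst l K x / 2)) \<noteq> 0"
      proof
        assume "ip lebesgue K (\<lambda>x. exp (fst l K x / 2)) (\<lambda>x. exp (fst l K x / 2)) = 0"
        then have "null_on lebesgue K (\<lambda>x. exp (fst l K x / 2))" by (intro ip_self_zero[OF cell_ci[OF K]] ci K)
        then have "null_on lebesgue K (\<lambda>x. 1)" by (simp add: null_on_def)
        from poly_fun_AE_zero[OF D(6)[OF K] D(9)[OF K] poly_fun_const[of 1 0] this] show False by (simp add: fun_eq_iff)
      qed
      then show ?thesis unfolding eq using ip_self_nonneg[OF cell_ci[OF K]] by (simp add: less_le)
    qed
    then show "(\<Sum>K\<in>M. LINT x:K|lebesgue. exp (fst l K x)) > 0" using ne D(1) by (intro sum_pos) auto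
  qed
  define step where "step u = (SOME l. sol u l)" for u
  have step: "sol u (step u)" if "good u" for u unfolding step_def by (rule someI_ex[OF ex[OF that]])
  \<comment> \<open>The constant sequence \<open>\<lambda>_. p\<close> supplies the previous unknown
    at index \<open>n\<close>. For \<open>n = 0\<close> the density is \<open>u0\<close> whatever
    \<open>p\<close> is, so the initial value \<open>undefined\<close> has no influence.\<close>
  define l where "l = rec_nat undefined (\<lambda>n p. step (cell_density u0 (\<lambda>_. p) n))"
  have l_Suc: "l (Suc n) = step (cell_density u0 l n)" for n
    by (simp add: l_def cell_density_def[abs_def])
  have "good (cell_density u0 l n) \<and> sol (cell_density u0 l n) (l (Suc n))" for n
  proof (induction n)
    case 0
    have "cell_density u0 l 0 = (\<lambda>_. u0)" by (simp add: cell_density_def[abs_def])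
    then show ?case using good0 step unfolding l_Suc by simp
  next
    case (Suc n)
    have "cell_density u0 l (Suc n) = (\<lambda>K x. exp (fst (l (Suc n)) K x))"
      by (simp add: cell_density_def[abs_def] discrete_density_def)
    then have "good (cell_density u0 l (Suc n))" using good_exp Suc.IH by (simp add: sol_def)
    then show ?case using step unfolding l_Suc[of "Suc n"] by simp
  qed
  then have s: "sol (cell_density u0 l n) (l (Suc n))" for n by blast
  have "l n \<in> hybrid_space k M E" if "n \<ge> 1" for n using s[of "n - 1"] that by (simp add: sol_def)
  moreover have "cell_density u0 l (n + 1) K x = exp (fst (l (Suc n)) K x)" for n K x
    by (simp add: cell_density_def discrete_density_def)
  ultimately have "solves_scheme k \<epsilon> \<Delta>t \<Omega> \<Lambda> \<phi> u0 M E EK l"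
    using s unfolding solves_scheme_def sol_def by simp
  then show ?thesis by (rule exI[of _ l])
qed

end

theorem theorem1:
  fixes \<Omega> :: "(real^'n) set"
    and \<Lambda> :: "real^'n \<Rightarrow> real^'n^'n"
    and \<phi> u0 :: "real^'n \<Rightarrow> real"
    and M E :: "(real^'n) set set"
    and EK :: "(real^'n) set \<Rightarrow> (real^'n) set set"
    and k :: nat
    and \<epsilon> \<Delta>t :: real
  assumes dim: "CARD('n) = 2 \<or> CARD('n) = 3"
    and domain: "open \<Omega>" "bounded \<Omega>" "connected \<Omega>"
      "polytopal_in UNIV \<Omega>" "lipschitz_boundary_in UNIV \<Omega>"
    and Lambda_bounded: "\<And>i j. L_infty \<Omega> (\<lambda>x. \<Lambda> x $ i $ j)"
    and Lambda_elliptic: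
      "\<exists>c>0. AE x in lebesgue. x \<in> \<Omega> \<longrightarrow> (\<forall>\<xi>. (\<Lambda> x *v \<xi>) \<bullet> \<xi> \<ge> c * (norm \<xi>)\<^sup>2)"
    and phi: "W1_infty \<Omega> \<phi>"
    and u0: "set_integrable lebesgue \<Omega> u0"
      "AE x in lebesgue. x \<in> \<Omega> \<longrightarrow> 0 \<le> u0 x"
      "set_integrable lebesgue \<Omega> (\<lambda>x. u0 x * ln (u0 x))"
      "(LINT x:\<Omega>|lebesgue. u0 x) > 0"
    and time_step: "\<Delta>t > 0"
    and mesh: "discretisation \<Omega> M E EK"
    and Lambda_cells: "\<And>K i j. K \<in> M \<Longrightarrow> W1_infty K (\<lambda>x. \<Lambda> x $ i $ j)"
    and stabilisation: "\<epsilon> > 0"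
  shows "\<exists>l. solves_scheme k \<epsilon> \<Delta>t \<Omega> \<Lambda> \<phi> u0 M E EK l \<and>
    (\<forall>n\<ge>1. (\<forall>K\<in>M. \<forall>x\<in>K. fst (discrete_density (l n)) K x > 0) \<and>
            (\<forall>\<sigma>\<in>E. \<forall>x\<in>\<sigma>. snd (discrete_density (l n)) \<sigma> x > 0))"
proof -
  interpret mesh_space: hho \<Omega> \<Lambda> M E EK k
  proof unfold_locales
    show "2 \<le> CARD('n)" using dim by auto
  qed (use domain Lambda_elliptic mesh Lambda_cells in auto)
  obtain l where "solves_scheme k \<epsilon> \<Delta>t \<Omega> \<Lambda> \<phi> u0 M E EK l"
    using mesh_space.scheme_sequence[OF mesh_space.hybrid_potential_adm[OF domain(5) phi] stabilisation time_step u0(1,2,4)] ..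
  then show ?thesis by (intro exI[of _ l]) (simp add: discrete_density_def)
qed

end
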